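(* Suppose the eigengap assumption, the bounded eigenvalue assumption and the sparsity assumption hold, that $\hat\alpha_n,\hat\beta_n$ satisfy the preliminary estimator condition, and that $\hat\Phi_n$ satisfies the inverse Hessian condition (all stated in the context, with a common $\kappa\in[1/2,1]$). Then for any $i\in\{1,\ldots,p\}$: 1. If $(\alpha_0)_i\ne0$, then $n^{1/2}\bigl((\hat x^{db}_{n,i})^2-(x^0_i)^2\bigr)$ converges in distribution to a centered Gaussian random variable with variance $16\sigma_i^2(x_i^0)^2$. 2. If $(\alpha_0)_i=0$, then $n(\hat x^{db}_{n,i})^2$ converges in distribution to a central chi-squared random variable with one degree of freedom and scale parameter $4\sigma_i^2$ (i.e. to $4\sigma_i^2\chi^2_1$). Here $\hat x^{db}_{n,i}$ is the $i$th coordinate of $\hat x^{db}_n$.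
   Context: **Model.** $(X_i,Y_i)_{i=1}^n$ are i.i.d. copies of $(X,Y)$, where $X\in\mathbb{R}^p$, $Y\in\mathbb{R}^q$ are centered sub-Gaussian random vectors (sub-Gaussian norms bounded by a fixed constant); $p,q$ may vary with $n$ and asymptotics are as $n\to\infty$. The joint covariance is $\Sigma=\begin{bmatrix}\Sigma_x&\Sigma_{xy}\\ \Sigma_{yx}&\Sigma_y\end{bmatrix}$. $\Sigma_{xy}$ has fixed rank $r\ge1$ and $\Sigma_{xy}=\Sigma_xU\Lambda V^T\Sigma_y$ with $U=[u_1\ldots u_r]$, $V=[v_1\ldots v_r]$, $U^T\Sigma_xU=V^T\Sigma_yV=I_r$, $\Lambda=\mathrm{diag}(\Lambda_1\ge\cdots\ge\Lambda_r>0)$. Put $\rho_0=\Lambda_1$, $\alpha_0=u_1$, $\beta_0=v_1$, $x^0=\rho_0^{1/2}\alpha_0$, $y^0=\rho_0^{1/2}\beta_0$; $\Lambda_2=0$ if $r=1$. $s_U,s_V$ are the numbers of nonzero rows of $U,V$; $s=s_U+s_V$; $\lambda=(\log(p\vee q)/n)^{1/2}$. $\hat\Sigma_x,\hat\Sigma_y,\hat\Sigma_{xy}=\hat\Sigma_{yx}^T$ are the empirical covariance matrices, e.g. $\hat\Sigma_{xy}=n^{-1}\sum_iX_iY_i^T$. **Assumptions.** *Eigengap:* there is $\epsilon_0\in(0,1)$ with $\rho_0-\Lambda_2>\epsilon_0$ for all $n$. *Bounded eigenvalues:* there is $M>0$ such that all eigenvalues of $\Sigma_x,\Sigma_y$ lie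 in $[M^{-1},M]$. *Sparsity:* $s_U=o(p)$, $s_V=o(q)$, $s^{2\kappa}\lambda^2=o(n^{-1/2})$. *Preliminary estimator condition:* for some $\kappa\in[1/2,1]$, $\inf_{w\in\{\pm1\}}\|w\hat\alpha_n-\alpha_0\|_2+\inf_{w\in\{\pm1\}}\|w\hat\beta_n-\beta_0\|_2=O_p(s^\kappa\lambda)$ and $\inf_{w\in\{\pm1\}}\|w\hat\alpha_n-\alpha_0\|_1+\inf_{w\in\{\pm1\}}\|w\hat\beta_n-\beta_0\|_1=O_p(s^{\kappa+1/2}\lambda)$. *Inverse Hessian condition:* with $\Phi^0=(H^0)^{-1}$, $$H^0=2\rho_0\begin{bmatrix}\Sigma_x+2\Sigma_x\alpha_0\alpha_0^T\Sigma_x & -\Sigma_{xy}/\rho_0\\ -\Sigma_{yx}/\rho_0 & \Sigma_y+2\Sigma_y\beta_0\beta_0^T\Sigma_y\end{bmatrix},$$ the estimator $\hat\Phi_n\in\mathbb{R}^{(p+q)\times(p+q)}$ satisfies $\max_{j}\|(\hat\Phi_n)_j-\Phi^0_j\|_1=O_p(s^{\kappa+1/2}\lambda)$ and $\max_{j}\|(\hat\Phi_n)_j-\Phi^0_j\|_2=O_p(s^{\kappa}\lambda)$, where $A_j$ is the $j$th column of $A$ and $1\le j\le p+q$. **De-biased estimators.** Let $\hat\rho_n=\hat\alpha_n^T\hat\Sigma_{xy}\hat\beta_n/\{(\hat\alpha_n^T\hat\Sigma_x\hat\alpha_n)^{1/2}(\hat\beta_n^T\hat\Sigma_y\hat\beta_n)^{1/2}\}$,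 $\hat x_n=|\hat\rho_n|^{1/2}\hat\alpha_n$, $\hat y_n=|\hat\rho_n|^{1/2}\hat\beta_n$, and $$\begin{bmatrix}\hat x_n^{db}\\ \hat y_n^{db}\end{bmatrix}=\begin{bmatrix}\hat x_n\\ \hat y_n\end{bmatrix}-\hat\Phi_n^T\begin{bmatrix}2(\hat x_n^T\hat\Sigma_x\hat x_n)\hat\Sigma_x\hat x_n-2\hat\Sigma_{xy}\hat y_n\\ 2(\hat y_n^T\hat\Sigma_y\hat y_n)\hat\Sigma_y\hat y_n-2\hat\Sigma_{yx}\hat x_n\end{bmatrix}.$$ **Variances.** Partition the $i$th column of $\Phi^0$ as $\Phi^0_i=(\phi_i^1,\phi_i^2)$, $\phi_i^1\in\mathbb{R}^p$, $\phi_i^2\in\mathbb{R}^q$. Let $$\mathcal Z(i)=[\rho_0(\phi_i^1)^T+\{(\phi_i^1)^T\Sigma_xx^0\}(x^0)^T]XX^Tx^0+[\rho_0(\phi_i^2)^T+\{(\phi_i^2)^T\Sigma_yy^0\}(y^0)^T]YY^Ty^0-(\phi_i^1)^TXY^Ty^0-(x^0)^TXY^T\phi_i^2$$ and $\sigma_i^2=\mathrm{var}(\mathcal Z(i))$.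
   Formalization: Added assumption: the probability that ρ̂_n<0 tends to 0, i.e. α̂_n and β̂_n are correct up to one common sign. Without it the claim fails: α̂_n=α_0, β̂_n=−β_0, Φ̂_n=Φ^0 meets all conditions, yet the de-biased vector tends to (x^0,−y^0)/2. *)

theory Defs
  imports
    "HOL-Probability.Probability"
    "HOL-Library.Landau_Symbols"
    "Jordan_Normal_Form.DL_Rank"
    "Jordan_Normal_Form.Gauss_Jordan_Elimination"
    "Jordan_Normal_Form.Char_Poly"
begin

(* The dimensions p and q change with the sample size n, so vectors and matrices are the
   dimension-as-data "real vec" and "real mat" of Jordan_Normal_Form. Indices start at 0. *)

unbundle no vec_syntax
unbundle no inner_syntax
no_notation fps_nth (infixl \<open>$\<close> 75)

subsection \<open>Vectors\<close>

definition l1_norm :: "real vec \<Rightarrow> real" where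
  "l1_norm v = (\<Sum>j<dim_vec v. \<bar>v $ j\<bar>)"

definition l2_norm :: "real vec \<Rightarrow> real" where
  "l2_norm v = sqrt (\<Sum>j<dim_vec v. (v $ j)\<^sup>2)"

definition outer :: "real vec \<Rightarrow> real vec \<Rightarrow> real mat" where
  "outer a b = mat (dim_vec a) (dim_vec b) (\<lambda>(j, k). a $ j * b $ k)"

definition nonzero_rows :: "real mat \<Rightarrow> nat" where
  "nonzero_rows A = card {j. j < dim_row A \<and> row A j \<noteq> 0\<^sub>v (dim_col A)}"

subsection \<open>Random vectors\<close>

definition borel_vec :: "nat \<Rightarrow> real vec measure" where
  "borel_vec p = vimage_algebra (carrier_vec p) (\<lambda>v. \<lambda>j\<in>{..<p}. v $ j) (\<Pi>\<^sub>M j\<in>{..<p}. borel)"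

lemma measurable_borel_vec_iff:
  "X \<in> measurable M (borel_vec p) \<longleftrightarrow>
     X \<in> space M \<rightarrow> carrier_vec p \<and> (\<forall>j<p. (\<lambda>\<omega>. X \<omega> $ j) \<in> borel_measurable M)"
proof
  assume X: "X \<in> measurable M (borel_vec p)"
  have g: "(\<lambda>v. \<lambda>j\<in>{..<p}. v $ j) \<in> measurable (borel_vec p) (\<Pi>\<^sub>M j\<in>{..<p}. (borel :: real measure))"
    unfolding borel_vec_def by (rule measurable_vimage_algebra1) (auto simp: space_PiM)
  have "(\<lambda>\<omega>. X \<omega> $ j) \<in> borel_measurable M" if "j < p" for j
  proof -
    have "(\<lambda>\<omega>. (\<lambda>j\<in>{..<p}. X \<omega> $ j) j) \<in> borel_measurable M"
      by (rule measurable_compose[OF measurable_compose[OF X g] measurable_component_singleton])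
         (use that in auto)
    then show ?thesis using that by simp
  qed
  moreover have "X \<in> space M \<rightarrow> carrier_vec p"
    using measurable_space[OF X] by (auto simp: borel_vec_def)
  ultimately show "X \<in> space M \<rightarrow> carrier_vec p \<and> (\<forall>j<p. (\<lambda>\<omega>. X \<omega> $ j) \<in> borel_measurable M)"
    by auto
next
  assume "X \<in> space M \<rightarrow> carrier_vec p \<and> (\<forall>j<p. (\<lambda>\<omega>. X \<omega> $ j) \<in> borel_measurable M)"
  then show "X \<in> measurable M (borel_vec p)"
    unfolding borel_vec_def
    by (intro measurable_vimage_algebra2 measurable_restrict) auto
qed

(* inf {t > 0. E exp (Z^2/t^2) \<le> 2}. It is ennreal-valued so that the infimum of the empty
   set is infinite: a variable that is not sub-Gaussian gets norm \<infinity>, not 0. *)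
definition psi2_norm :: "'w measure \<Rightarrow> ('w \<Rightarrow> real) \<Rightarrow> ennreal" where
  "psi2_norm M Z =
     Inf {ennreal t | t. t > 0 \<and> (\<integral>\<^sup>+ \<omega>. ennreal (exp ((Z \<omega>)\<^sup>2 / t\<^sup>2)) \<partial>M) \<le> 2}"

definition psi2_norm_vec :: "'w measure \<Rightarrow> nat \<Rightarrow> ('w \<Rightarrow> real vec) \<Rightarrow> ennreal" where
  "psi2_norm_vec M p X =
     (SUP u \<in> {u \<in> carrier_vec p. l2_norm u = 1}. psi2_norm M (\<lambda>\<omega>. u \<bullet> X \<omega>))"

definition cov_mat :: "'w measure \<Rightarrow> nat \<Rightarrow> nat \<Rightarrow> ('w \<Rightarrow> real vec) \<Rightarrow> ('w \<Rightarrow> real vec) \<Rightarrow> real mat" where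
  "cov_mat M p q X Y = mat p q (\<lambda>(j, k). integral\<^sup>L M (\<lambda>\<omega>.
     (X \<omega> $ j - integral\<^sup>L M (\<lambda>\<omega>. X \<omega> $ j)) * (Y \<omega> $ k - integral\<^sup>L M (\<lambda>\<omega>. Y \<omega> $ k))))"

definition emp_cov :: "nat \<Rightarrow> nat \<Rightarrow> nat \<Rightarrow> (nat \<Rightarrow> real vec) \<Rightarrow> (nat \<Rightarrow> real vec) \<Rightarrow> real mat" where
  "emp_cov n p q x y = mat p q (\<lambda>(j, k). (\<Sum>l<n. x l $ j * y l $ k) / real n)"

subsection \<open>Asymptotics along varying probability spaces\<close>

definition bigO_in_prob :: "(nat \<Rightarrow> 'w measure) \<Rightarrow> (nat \<Rightarrow> 'w \<Rightarrow> real) \<Rightarrow> (nat \<Rightarrow> real) \<Rightarrow> bool" where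
  "bigO_in_prob M Z a \<longleftrightarrow> (\<forall>\<epsilon>>0. \<exists>B>0. \<forall>\<^sub>F n in sequentially.
     measure (M n) {\<omega> \<in> space (M n). \<bar>Z n \<omega>\<bar> > B * a n} \<le> \<epsilon>)"

(* Convergence in distribution to a target that itself depends on n, as the limiting variances
   here do. It is not restricted to targets that stay away from degeneracy. For a target that is
   constant, or weakly convergent, it is the usual weak convergence; see the next two lemmas. *)
definition weakly_merging :: "(nat \<Rightarrow> real measure) \<Rightarrow> (nat \<Rightarrow> real measure) \<Rightarrow> bool" where
  "weakly_merging \<mu> \<nu> \<longleftrightarrow> (\<forall>f :: real \<Rightarrow> real. continuous_on UNIV f \<longrightarrow> bounded (range f) \<longrightarrow>
     (\<lambda>n. integral\<^sup>L (\<mu> n) f - integral\<^sup>L (\<nu> n) f) \<longlonglongrightarrow> 0)"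

lemma weakly_merging_imp_weak_conv_m:
  assumes \<mu>: "\<And>n. real_distribution (\<mu> n)" and \<nu>: "\<And>n. real_distribution (\<nu> n)"
    and L: "real_distribution L"
    and merge: "weakly_merging \<mu> \<nu>" and conv: "weak_conv_m \<nu> L"
  shows "weak_conv_m \<mu> L"
proof (rule integral_bdd_continuous_conv_imp_weak_conv[OF \<mu> L])
  fix f :: "real \<Rightarrow> real"
  assume cont: "\<And>x. isCont f x" and bdd: "\<And>x. \<bar>f x\<bar> \<le> 1"
  have "continuous_on UNIV f"
    using cont by (simp add: continuous_at_imp_continuous_on)
  moreover have "bounded (range f)"
    unfolding bounded_iff using bdd by auto
  ultimately have "(\<lambda>n. integral\<^sup>L (\<mu> n) f - integral\<^sup>L (\<nu> n) f) \<longlonglongrightarrow> 0"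
    using merge unfolding weakly_merging_def by blast
  moreover have "(\<lambda>n. integral\<^sup>L (\<nu> n) f) \<longlonglongrightarrow> integral\<^sup>L L f"
    by (rule weak_conv_imp_integral_bdd_continuous_conv[OF \<nu> L conv, of f 1]) (use cont bdd in auto)
  ultimately have "(\<lambda>n. (integral\<^sup>L (\<mu> n) f - integral\<^sup>L (\<nu> n) f) + integral\<^sup>L (\<nu> n) f)
      \<longlonglongrightarrow> 0 + integral\<^sup>L L f"
    by (rule tendsto_add)
  then show "(\<lambda>n. integral\<^sup>L (\<mu> n) f) \<longlonglongrightarrow> integral\<^sup>L L f"
    by simp
qed

lemma weakly_merging_const_iff:
  assumes \<mu>: "\<And>n. real_distribution (\<mu> n)" and L: "real_distribution L"
  shows "weakly_merging \<mu> (\<lambda>_. L) \<longleftrightarrow> weak_conv_m \<mu> L"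
proof
  assume "weakly_merging \<mu> (\<lambda>_. L)"
  then show "weak_conv_m \<mu> L"
    by (rule weakly_merging_imp_weak_conv_m[OF \<mu> L L])
       (auto simp: weak_conv_m_def weak_conv_def)
next
  assume conv: "weak_conv_m \<mu> L"
  show "weakly_merging \<mu> (\<lambda>_. L)"
    unfolding weakly_merging_def
  proof (intro allI impI)
    fix f :: "real \<Rightarrow> real"
    assume cont: "continuous_on UNIV f" and "bounded (range f)"
    then obtain B where "\<And>x. norm (f x) \<le> B"
      by (auto simp: bounded_iff)
    with cont have "(\<lambda>n. integral\<^sup>L (\<mu> n) f) \<longlonglongrightarrow> integral\<^sup>L L f"
      by (intro weak_conv_imp_integral_bdd_continuous_conv[OF \<mu> L conv, of f B])
         (auto simp: continuous_on_eq_continuous_at)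
    then show "(\<lambda>n. integral\<^sup>L (\<mu> n) f - integral\<^sup>L L f) \<longlonglongrightarrow> 0"
      by (simp add: LIM_zero)
  qed
qed

(* As an image of the standard normal law, and not through normal_density 0 (sqrt v), which
   would be the null measure for v = 0; here v = 0 gives the point mass at 0. *)
definition centered_gaussian :: "real \<Rightarrow> real measure" where
  "centered_gaussian v = distr std_normal_distribution borel (\<lambda>z. sqrt v * z)"

definition chi_squared_1 :: "real measure" where
  "chi_squared_1 = distr std_normal_distribution borel (\<lambda>z. z\<^sup>2)"

definition scaled_chi_squared_1 :: "real \<Rightarrow> real measure" where
  "scaled_chi_squared_1 c = distr chi_squared_1 borel (\<lambda>t. c * t)"

subsection \<open>The model\<close>

(* Everything at one sample size: the probability space, the dimensions p and q, the population
   pair (X, Y), the observations (indexed from 0), and U, V, \<Lambda> with \<Lambda>_(j+1) stored as Lam j. *)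
record 'w cca =
  prob_sp :: "'w measure"
  dim_x :: nat
  dim_y :: nat
  pop_X :: "'w \<Rightarrow> real vec"
  pop_Y :: "'w \<Rightarrow> real vec"
  obs_X :: "nat \<Rightarrow> 'w \<Rightarrow> real vec"
  obs_Y :: "nat \<Rightarrow> 'w \<Rightarrow> real vec"
  mat_U :: "real mat"
  mat_V :: "real mat"
  Lam :: "nat \<Rightarrow> real"

definition Sigma_x :: "'w cca \<Rightarrow> real mat" where
  "Sigma_x C = cov_mat (prob_sp C) (dim_x C) (dim_x C) (pop_X C) (pop_X C)"

definition Sigma_y :: "'w cca \<Rightarrow> real mat" where
  "Sigma_y C = cov_mat (prob_sp C) (dim_y C) (dim_y C) (pop_Y C) (pop_Y C)"

definition Sigma_xy :: "'w cca \<Rightarrow> real mat" where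
  "Sigma_xy C = cov_mat (prob_sp C) (dim_x C) (dim_y C) (pop_X C) (pop_Y C)"

definition rho0 :: "'w cca \<Rightarrow> real" where
  "rho0 C = Lam C 0"

definition Lambda2 :: "nat \<Rightarrow> 'w cca \<Rightarrow> real" where
  "Lambda2 r C = (if r = 1 then 0 else Lam C 1)"

definition alpha0 :: "'w cca \<Rightarrow> real vec" where
  "alpha0 C = col (mat_U C) 0"

definition beta0 :: "'w cca \<Rightarrow> real vec" where
  "beta0 C = col (mat_V C) 0"

definition x0 :: "'w cca \<Rightarrow> real vec" where
  "x0 C = sqrt (rho0 C) \<cdot>\<^sub>v alpha0 C"

definition y0 :: "'w cca \<Rightarrow> real vec" where
  "y0 C = sqrt (rho0 C) \<cdot>\<^sub>v beta0 C"

definition sparsity :: "'w cca \<Rightarrow> nat" where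
  "sparsity C = nonzero_rows (mat_U C) + nonzero_rows (mat_V C)"

definition lambda_rate :: "nat \<Rightarrow> 'w cca \<Rightarrow> real" where
  "lambda_rate n C = sqrt (ln (real (max (dim_x C) (dim_y C))) / real n)"

locale cca_model = prob_space "prob_sp C" for C :: "'w cca" +
  fixes n r :: nat and K :: real
  assumes meas_X: "pop_X C \<in> measurable (prob_sp C) (borel_vec (dim_x C))"
    and meas_Y: "pop_Y C \<in> measurable (prob_sp C) (borel_vec (dim_y C))"
    and centered_X: "\<And>j. j < dim_x C \<Longrightarrow> expectation (\<lambda>\<omega>. pop_X C \<omega> $ j) = 0"
    and centered_Y: "\<And>j. j < dim_y C \<Longrightarrow> expectation (\<lambda>\<omega>. pop_Y C \<omega> $ j) = 0"
    and subgaussian_X: "psi2_norm_vec (prob_sp C) (dim_x C) (pop_X C) \<le> ennreal K"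
    and subgaussian_Y: "psi2_norm_vec (prob_sp C) (dim_y C) (pop_Y C) \<le> ennreal K"
    and indep_obs: "indep_vars (\<lambda>_. borel_vec (dim_x C) \<Otimes>\<^sub>M borel_vec (dim_y C))
          (\<lambda>l \<omega>. (obs_X C l \<omega>, obs_Y C l \<omega>)) {..<n}"
    and ident_obs: "\<And>l. l < n \<Longrightarrow>
          distr (prob_sp C) (borel_vec (dim_x C) \<Otimes>\<^sub>M borel_vec (dim_y C))
            (\<lambda>\<omega>. (obs_X C l \<omega>, obs_Y C l \<omega>)) =
          distr (prob_sp C) (borel_vec (dim_x C) \<Otimes>\<^sub>M borel_vec (dim_y C))
            (\<lambda>\<omega>. (pop_X C \<omega>, pop_Y C \<omega>))"
    and carrier_U: "mat_U C \<in> carrier_mat (dim_x C) r"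
    and carrier_V: "mat_V C \<in> carrier_mat (dim_y C) r"
    and rank_Sigma_xy: "vec_space.rank (dim_x C) (Sigma_xy C) = r"
    and Sigma_xy_decomp: "Sigma_xy C =
          Sigma_x C * mat_U C * mat_diag r (Lam C) * transpose_mat (mat_V C) * Sigma_y C"
    and orthonormal_U: "transpose_mat (mat_U C) * Sigma_x C * mat_U C = 1\<^sub>m r"
    and orthonormal_V: "transpose_mat (mat_V C) * Sigma_y C * mat_V C = 1\<^sub>m r"
    and Lam_decreasing: "\<And>j k. j \<le> k \<Longrightarrow> k < r \<Longrightarrow> Lam C k \<le> Lam C j"
    and Lam_pos: "\<And>j. j < r \<Longrightarrow> Lam C j > 0"

subsection \<open>Hessian and asymptotic variance\<close>

definition H0 :: "'w cca \<Rightarrow> real mat" where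
  "H0 C = (2 * rho0 C) \<cdot>\<^sub>m four_block_mat
     (Sigma_x C + 2 \<cdot>\<^sub>m (Sigma_x C * outer (alpha0 C) (alpha0 C) * Sigma_x C))
     ((- 1 / rho0 C) \<cdot>\<^sub>m Sigma_xy C)
     ((- 1 / rho0 C) \<cdot>\<^sub>m transpose_mat (Sigma_xy C))
     (Sigma_y C + 2 \<cdot>\<^sub>m (Sigma_y C * outer (beta0 C) (beta0 C) * Sigma_y C))"

(* "the" is harmless: the model and the eigengap and eigenvalue assumptions make H0 invertible. *)
definition Phi0 :: "'w cca \<Rightarrow> real mat" where
  "Phi0 C = the (mat_inverse (H0 C))"

definition phi1 :: "'w cca \<Rightarrow> nat \<Rightarrow> real vec" where
  "phi1 C i = vec_first (col (Phi0 C) i) (dim_x C)"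

definition phi2 :: "'w cca \<Rightarrow> nat \<Rightarrow> real vec" where
  "phi2 C i = vec_last (col (Phi0 C) i) (dim_y C)"

definition Z_influence :: "'w cca \<Rightarrow> nat \<Rightarrow> 'w \<Rightarrow> real" where
  "Z_influence C i \<omega> =
     (let X = pop_X C \<omega>; Y = pop_Y C \<omega>; f1 = phi1 C i; f2 = phi2 C i; x = x0 C; y = y0 C in
       (rho0 C \<cdot>\<^sub>v f1 + (f1 \<bullet> (Sigma_x C *\<^sub>v x)) \<cdot>\<^sub>v x) \<bullet> (outer X X *\<^sub>v x)
     + (rho0 C \<cdot>\<^sub>v f2 + (f2 \<bullet> (Sigma_y C *\<^sub>v y)) \<cdot>\<^sub>v y) \<bullet> (outer Y Y *\<^sub>v y)
     - f1 \<bullet> (outer X Y *\<^sub>v y) - x \<bullet> (outer X Y *\<^sub>v f2))"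

definition sigma_sq :: "'w cca \<Rightarrow> nat \<Rightarrow> real" where
  "sigma_sq C i = prob_space.variance (prob_sp C) (Z_influence C i)"

subsection \<open>Estimators\<close>

definition hat_Sigma_x :: "nat \<Rightarrow> 'w cca \<Rightarrow> 'w \<Rightarrow> real mat" where
  "hat_Sigma_x n C \<omega> = emp_cov n (dim_x C) (dim_x C) (\<lambda>l. obs_X C l \<omega>) (\<lambda>l. obs_X C l \<omega>)"

definition hat_Sigma_y :: "nat \<Rightarrow> 'w cca \<Rightarrow> 'w \<Rightarrow> real mat" where
  "hat_Sigma_y n C \<omega> = emp_cov n (dim_y C) (dim_y C) (\<lambda>l. obs_Y C l \<omega>) (\<lambda>l. obs_Y C l \<omega>)"

definition hat_Sigma_xy :: "nat \<Rightarrow> 'w cca \<Rightarrow> 'w \<Rightarrow> real mat" where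
  "hat_Sigma_xy n C \<omega> = emp_cov n (dim_x C) (dim_y C) (\<lambda>l. obs_X C l \<omega>) (\<lambda>l. obs_Y C l \<omega>)"

definition hat_rho :: "nat \<Rightarrow> 'w cca \<Rightarrow> ('w \<Rightarrow> real vec) \<Rightarrow> ('w \<Rightarrow> real vec) \<Rightarrow> 'w \<Rightarrow> real" where
  "hat_rho n C a b \<omega> = (a \<omega> \<bullet> (hat_Sigma_xy n C \<omega> *\<^sub>v b \<omega>)) /
     (sqrt (a \<omega> \<bullet> (hat_Sigma_x n C \<omega> *\<^sub>v a \<omega>)) * sqrt (b \<omega> \<bullet> (hat_Sigma_y n C \<omega> *\<^sub>v b \<omega>)))"

definition debiased :: "nat \<Rightarrow> 'w cca \<Rightarrow> ('w \<Rightarrow> real vec) \<Rightarrow> ('w \<Rightarrow> real vec) \<Rightarrow> ('w \<Rightarrow> real mat)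
    \<Rightarrow> 'w \<Rightarrow> real vec" where
  "debiased n C a b F \<omega> =
     (let Sx = hat_Sigma_x n C \<omega>; Sy = hat_Sigma_y n C \<omega>; Sxy = hat_Sigma_xy n C \<omega>;
          x = sqrt \<bar>hat_rho n C a b \<omega>\<bar> \<cdot>\<^sub>v a \<omega>;
          y = sqrt \<bar>hat_rho n C a b \<omega>\<bar> \<cdot>\<^sub>v b \<omega>
      in (x @\<^sub>v y) - transpose_mat (F \<omega>) *\<^sub>v
           (((2 * (x \<bullet> (Sx *\<^sub>v x))) \<cdot>\<^sub>v (Sx *\<^sub>v x) - 2 \<cdot>\<^sub>v (Sxy *\<^sub>v y)) @\<^sub>v
            ((2 * (y \<bullet> (Sy *\<^sub>v y))) \<cdot>\<^sub>v (Sy *\<^sub>v y) - 2 \<cdot>\<^sub>v (transpose_mat Sxy *\<^sub>v x))))"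

definition x_db :: "nat \<Rightarrow> 'w cca \<Rightarrow> ('w \<Rightarrow> real vec) \<Rightarrow> ('w \<Rightarrow> real vec) \<Rightarrow> ('w \<Rightarrow> real mat)
    \<Rightarrow> 'w \<Rightarrow> real vec" where
  "x_db n C a b F \<omega> = vec_first (debiased n C a b F \<omega>) (dim_x C)"

definition pm_dist :: "(real vec \<Rightarrow> real) \<Rightarrow> real vec \<Rightarrow> real vec \<Rightarrow> real" where
  "pm_dist N a a0 = (INF w \<in> {-1, 1 :: real}. N (w \<cdot>\<^sub>v a - a0))"

definition max_col_dist :: "(real vec \<Rightarrow> real) \<Rightarrow> real mat \<Rightarrow> real mat \<Rightarrow> real" where
  "max_col_dist N A B = Max ((\<lambda>j. N (col A j - col B j)) ` {..<dim_col B})"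

definition random_vectors :: "(nat \<Rightarrow> 'w cca) \<Rightarrow> ('w cca \<Rightarrow> nat) \<Rightarrow> (nat \<Rightarrow> 'w \<Rightarrow> real vec) \<Rightarrow> bool" where
  "random_vectors C d a \<longleftrightarrow> (\<forall>n\<ge>1. a n \<in> measurable (prob_sp (C n)) (borel_vec (d (C n))))"

definition random_square_matrices ::
    "(nat \<Rightarrow> 'w cca) \<Rightarrow> ('w cca \<Rightarrow> nat) \<Rightarrow> (nat \<Rightarrow> 'w \<Rightarrow> real mat) \<Rightarrow> bool" where
  "random_square_matrices C d F \<longleftrightarrow> (\<forall>n\<ge>1.
     (\<forall>\<omega> \<in> space (prob_sp (C n)). F n \<omega> \<in> carrier_mat (d (C n)) (d (C n))) \<and>
     (\<forall>j < d (C n). (\<lambda>\<omega>. col (F n \<omega>) j) \<in> measurable (prob_sp (C n)) (borel_vec (d (C n)))))"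

definition preliminary_estimator_condition ::
    "(nat \<Rightarrow> 'w cca) \<Rightarrow> real \<Rightarrow> (nat \<Rightarrow> 'w \<Rightarrow> real vec) \<Rightarrow> (nat \<Rightarrow> 'w \<Rightarrow> real vec) \<Rightarrow> bool" where
  "preliminary_estimator_condition C \<kappa> a b \<longleftrightarrow>
     bigO_in_prob (\<lambda>n. prob_sp (C n))
       (\<lambda>n \<omega>. pm_dist l2_norm (a n \<omega>) (alpha0 (C n)) + pm_dist l2_norm (b n \<omega>) (beta0 (C n)))
       (\<lambda>n. real (sparsity (C n)) powr \<kappa> * lambda_rate n (C n)) \<and>
     bigO_in_prob (\<lambda>n. prob_sp (C n))
       (\<lambda>n \<omega>. pm_dist l1_norm (a n \<omega>) (alpha0 (C n)) + pm_dist l1_norm (b n \<omega>) (beta0 (C n)))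
       (\<lambda>n. real (sparsity (C n)) powr (\<kappa> + 1/2) * lambda_rate n (C n))"

definition inverse_Hessian_condition ::
    "(nat \<Rightarrow> 'w cca) \<Rightarrow> real \<Rightarrow> (nat \<Rightarrow> 'w \<Rightarrow> real mat) \<Rightarrow> bool" where
  "inverse_Hessian_condition C \<kappa> F \<longleftrightarrow>
     bigO_in_prob (\<lambda>n. prob_sp (C n)) (\<lambda>n \<omega>. max_col_dist l1_norm (F n \<omega>) (Phi0 (C n)))
       (\<lambda>n. real (sparsity (C n)) powr (\<kappa> + 1/2) * lambda_rate n (C n)) \<and>
     bigO_in_prob (\<lambda>n. prob_sp (C n)) (\<lambda>n \<omega>. max_col_dist l2_norm (F n \<omega>) (Phi0 (C n)))
       (\<lambda>n. real (sparsity (C n)) powr \<kappa> * lambda_rate n (C n))"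

(* (\<alpha>0, \<beta>0) is determined up to a common sign only, and the two estimated directions are taken with
   matching signs, i.e. with a nonnegative estimated canonical correlation. The preliminary
   estimator condition minimises over the two signs separately and does not imply this, and
   without it the debiased estimator is inconsistent: for (a, b) = (\<alpha>0, -\<beta>0) and F = Phi0 it
   tends to (x0, -y0) / 2. A common sign flip of (a, b) only changes the sign of the debiased
   vector, hence not the squares of its entries. *)
definition signs_matched ::
    "(nat \<Rightarrow> 'w cca) \<Rightarrow> (nat \<Rightarrow> 'w \<Rightarrow> real vec) \<Rightarrow> (nat \<Rightarrow> 'w \<Rightarrow> real vec) \<Rightarrow> bool" where
  "signs_matched C a b \<longleftrightarrow>
     (\<lambda>n. measure (prob_sp (C n)) {\<omega> \<in> space (prob_sp (C n)). hat_rho n (C n) (a n) (b n) \<omega> < 0})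
       \<longlonglongrightarrow> 0"

end

theory Submission
  imports Defs
begin

text \<open>Write \<open>bil A u v\<close> for \<open>u \<bullet> A v\<close>. All quantities in the de-biased estimator are forms of the empirical
  covariance matrices, so inserting empirical = population + deviation and estimate = truth + error
  expands coordinate \<open>i\<close> into (i) the population part, in which \<open>\<Phi>\<^sup>0\<close> inverts the Hessian and cancels the
  first-order error of the preliminary estimator, (ii) a linear term, which is \<open>- 2\<close> times the centered
  mean of the influence function, and (iii) products of two errors. With \<open>\<lambda>\<close> the entrywise deviation rate and
  \<open>\<tau> = s\<^sup>\<kappa> \<lambda>\<close>, a deviation form tested against a fixed direction and an error costs
  \<open>\<lambda> * s\<^bsup>1/2\<^esup> * \<tau> \<le> \<tau>\<^sup>2\<close> by \<open>l1\<close>-\<open>l\<infinity>\<close> duality, and \<open>\<lambda> * s \<longrightarrow> 0\<close> handles two errors; hence (iii) is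
  \<open>O(\<tau>\<^sup>2) = o(n\<^bsup>-1/2\<^esup>)\<close>. The Hessian is coercive because by Bessel's inequality the eigengap dominates the
  remaining canonical correlations. The linear term obeys a central limit theorem for triangular arrays, proved
  with characteristic functions and bounded third moments so that degenerate limits are allowed, and the squares are
  treated by a Slutsky argument. The random sign of the estimator disappears in the square.\<close>

section \<open>Central limit theorem and Slutsky lemma for weak merging\<close>

text \<open>Nothing has a fixed limit: the dimensions, the laws, \<sigma>_i and the coordinate of
  x^0 all move with n, and the limiting variance may approach 0. Estimates are therefore proved at
  one sample size with constants built from K, \<epsilon>0 and M, and compactness of the bounded
  variances replaces their convergence. In growing dimension the deviation matrices need not be
  small in operator norm. They are controlled only on the finite families \<open>test_x\<close> and
  \<open>test_y\<close> of unit vectors and a few population directions; Bernstein's inequality with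
  a union bound then costs a logarithm of the dimension, which is what \<lambda> pays for. That
  \<open>p\<close> diverges follows from \<open>s_U = o(p)\<close> and \<open>s_U \<ge> 1\<close>.
  Signs are the second obstacle: the estimator condition minimises over four signs separately (two
  vectors, two norms). For each vector the l1 and l2 signs agree once \<open>sqrt s * \<tau>\<close>
  is small; the two vectors are tied together by the sign of the estimated correlation. The
  randomness in the expansion is confined to six exceptional sets; off them it is a deterministic
  statement about one outcome.\<close>

lemma char_centered_gaussian:
  assumes "v \<ge> 0"
  shows "char (centered_gaussian v) t = complex_of_real (exp (- (v * t\<^sup>2) / 2))"
proof -
  have "char (centered_gaussian v) t = char std_normal_distribution (t * sqrt v)"
    unfolding char_def centered_gaussian_def
    by (subst integral_distr) (auto simp: mult.assoc)
  also have "\<dots> = exp (- (v * t\<^sup>2) / 2)"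
    using assms by (simp add: char_std_normal_distribution power_mult_distrib mult.commute)
  finally show ?thesis .
qed

lemma real_distribution_centered_gaussian: "real_distribution (centered_gaussian v)"
proof -
  interpret real_distribution std_normal_distribution by (rule real_dist_normal_dist)
  show ?thesis unfolding centered_gaussian_def
    by (intro real_distribution_distr) auto
qed

text \<open>Levy's continuity theorem needs one limit law, but the variances move. If merging failed
  for some test function, the bad subsequence would have a further subsequence along which the
  bounded variances converge, to \<open>v0\<close> say; along it both laws converge weakly to the
  same Gaussian, possibly the point mass at 0.\<close>

lemma weakly_merging_centered_gaussian:
  assumes \<mu>: "\<And>n. n \<ge> 1 \<Longrightarrow> real_distribution (\<mu> n)"
    and v: "\<And>n. n \<ge> 1 \<Longrightarrow> 0 \<le> v n" "\<And>n. n \<ge> 1 \<Longrightarrow> v n \<le> B"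
    and char: "\<And>t. (\<lambda>n. char (\<mu> n) t - complex_of_real (exp (- (v n * t\<^sup>2) / 2))) \<longlonglongrightarrow> 0"
  shows "weakly_merging \<mu> (\<lambda>n. centered_gaussian (v n))"
  unfolding weakly_merging_def
proof (intro allI impI)
  fix f :: "real \<Rightarrow> real"
  assume f: "continuous_on UNIV f" "bounded (range f)"
  obtain b where b: "\<And>x. norm (f x) \<le> b"
    using f(2) by (auto simp: bounded_iff)
  let ?d = "\<lambda>n. integral\<^sup>L (\<mu> n) f - integral\<^sup>L (centered_gaussian (v n)) f"
  show "?d \<longlonglongrightarrow> 0"
  proof (rule ccontr)
    assume "\<not> ?d \<longlonglongrightarrow> 0"
    then obtain e where e: "e > 0" "\<And>N. \<exists>n\<ge>N. \<bar>?d n\<bar> \<ge> e"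
      unfolding LIMSEQ_iff real_norm_def diff_0_right not_all not_ex not_imp not_less by blast
    then have "infinite {n. \<bar>?d n\<bar> \<ge> e}"
      unfolding infinite_nat_iff_unbounded_le by blast
    from infinite_enumerate[OF this] obtain s :: "nat \<Rightarrow> nat"
      where s: "strict_mono s" "\<And>n. \<bar>?d (s n)\<bar> \<ge> e"
      by blast
    \<comment> \<open>The hypotheses hold only for \<open>n \<ge> 1\<close>; the shift makes every
      selected index positive.\<close>
    define s' where "s' n = s (Suc n)" for n
    have s': "strict_mono s'" "\<And>n. \<bar>?d (s' n)\<bar> \<ge> e"
      using s by (auto simp: s'_def strict_mono_def)
    have s'_ge: "s' n \<ge> 1" for n
      using seq_suble[OF s(1), of "Suc n"] by (simp add: s'_def)
    have "bounded (range (\<lambda>n. v (s' n)))"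
      using v s'_ge unfolding bounded_iff by (intro exI[of _ B]) auto
    then obtain v0 q where q: "strict_mono q" "((\<lambda>n. v (s' n)) \<circ> q) \<longlonglongrightarrow> v0"
      using bounded_imp_convergent_subsequence by blast
    let ?k = "\<lambda>n. s' (q n)"
    have k: "strict_mono ?k" "\<And>n. ?k n \<ge> 1"
      using s'_ge strict_mono_o[OF s'(1) q(1)] by (auto simp: o_def)
    have v0: "(\<lambda>n. v (?k n)) \<longlonglongrightarrow> v0"
      using q by (simp add: o_def)
    have "v0 \<ge> 0"
      by (rule LIMSEQ_le_const[OF v0]) (use v k in auto)
    have c: "(\<lambda>n. complex_of_real (exp (- (v (?k n) * t\<^sup>2) / 2))) \<longlonglongrightarrow> char (centered_gaussian v0) t" for t
      unfolding char_centered_gaussian[OF \<open>v0 \<ge> 0\<close>]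
      by (intro tendsto_intros v0) auto
    have "weak_conv_m (\<lambda>n. \<mu> (?k n)) (centered_gaussian v0)"
    proof (rule levy_continuity)
      fix t
      have "(\<lambda>n. (char (\<mu> (?k n)) t - complex_of_real (exp (- (v (?k n) * t\<^sup>2) / 2)))
            + complex_of_real (exp (- (v (?k n) * t\<^sup>2) / 2))) \<longlonglongrightarrow> 0 + char (centered_gaussian v0) t"
        by (intro tendsto_add c LIMSEQ_subseq_LIMSEQ[OF char k(1), unfolded o_def])
      then show "(\<lambda>n. char (\<mu> (?k n)) t) \<longlonglongrightarrow> char (centered_gaussian v0) t" by simp
    qed (use \<mu> k real_distribution_centered_gaussian in auto)
    moreover have "weak_conv_m (\<lambda>n. centered_gaussian (v (?k n))) (centered_gaussian v0)"
      by (rule levy_continuity)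
        (use c v k in \<open>auto intro: real_distribution_centered_gaussian simp: char_centered_gaussian\<close>)
    ultimately have "(\<lambda>n. ?d (?k n)) \<longlonglongrightarrow> integral\<^sup>L (centered_gaussian v0) f - integral\<^sup>L (centered_gaussian v0) f"
      using f(1) b \<mu> k real_distribution_centered_gaussian
      by (intro tendsto_diff weak_conv_imp_integral_bdd_continuous_conv[where B = b])
         (auto simp: continuous_on_eq_continuous_at)
    then have "(\<lambda>n. \<bar>?d (?k n)\<bar>) \<longlonglongrightarrow> 0"
      by (simp add: tendsto_rabs_zero_iff)
    then have "e \<le> 0"
      by (rule LIMSEQ_le_const) (use s' in auto)
    then show False using e by simp
  qed
qed

section \<open>Central limit theorem for triangular arrays, with explicit error\<close>

lemma abs_exp_minus_linear:
  fixes y :: real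
  assumes "0 \<le> y"
  shows "\<bar>(1 - y) - exp (- y)\<bar> \<le> y\<^sup>2"
proof -
  have "1 - y \<le> exp (- y)"
    using exp_ge_add_one_self[of "- y"] by simp
  moreover have "exp (- y) \<le> 1 / (1 + y)"
    using assms exp_ge_add_one_self[of y] by (auto simp: exp_minus field_simps)
  moreover have "1 / (1 + y) \<le> 1 - y + y\<^sup>2"
    using assms by (simp add: field_simps power2_eq_square)
  ultimately show ?thesis by auto
qed

text \<open>The bound is non-asymptotic and sees the law only through \<open>v\<close> and
  \<open>B\<close>, as a row-dependent array requires. Expanding one factor to second order with a
  third-moment remainder costs order \<open>n^(-3/2)\<close>, and comparing n-th powers multiplies
  this by n.\<close>

lemma (in prob_space) char_normalized_sum_bound:
  fixes \<xi> :: "nat \<Rightarrow> 'a \<Rightarrow> real"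
  assumes n: "n \<ge> 1"
    and indep: "indep_vars (\<lambda>_. borel) \<xi> {..<n}"
    and distr: "\<And>l. l < n \<Longrightarrow> distr M borel (\<xi> l) = \<mu>"
    and \<mu>: "real_distribution \<mu>" "integrable \<mu> (\<lambda>x. \<bar>x\<bar> ^ 3)" "integral\<^sup>L \<mu> (\<lambda>x. x) = 0"
      "integrable \<mu> (\<lambda>x. x)" "integrable \<mu> (\<lambda>x. x\<^sup>2)"
      "integral\<^sup>L \<mu> (\<lambda>x. x\<^sup>2) = v"
    and B: "integral\<^sup>L \<mu> (\<lambda>x. \<bar>x\<bar> ^ 3) \<le> B"
    and t: "v * t\<^sup>2 \<le> 4 * real n"
  shows "cmod (char (distr M borel (\<lambda>\<omega>. (\<Sum>l<n. \<xi> l \<omega>) / sqrt (real n))) t - complex_of_real (exp (- (v * t\<^sup>2) / 2)))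
     \<le> \<bar>t\<bar> ^ 3 * B / (6 * sqrt (real n)) + v\<^sup>2 * t ^ 4 / (4 * real n)"
proof -
  interpret \<mu>: real_distribution \<mu> by fact
  have rv [measurable]: "random_variable borel (\<xi> l)" if "l < n" for l
    using indep that unfolding indep_vars_def2 by simp
  let ?t = "t / sqrt n"
  define \<psi> where "\<psi> = char \<mu> ?t"
  have "char (distr M borel (\<lambda>\<omega>. (\<Sum>l<n. \<xi> l \<omega>) / sqrt (real n))) t
      = char (distr M borel (\<lambda>\<omega>. \<Sum>l<n. \<xi> l \<omega> / sqrt (real n))) t"
    by (simp add: sum_divide_distrib)
  also have "\<dots> = (\<Prod>l<n. char (distr M borel (\<lambda>\<omega>. \<xi> l \<omega> / sqrt (real n))) t)"
    by (rule char_distr_sum, rule indep_vars_compose2[where X = \<xi>, OF indep]) auto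
  also have "\<dots> = (\<Prod>l<n. \<psi>)"
  proof (rule prod.cong, simp)
    fix l assume l: "l \<in> {..<n}"
    show "char (distr M borel (\<lambda>\<omega>. \<xi> l \<omega> / sqrt (real n))) t = \<psi>"
      using l unfolding \<psi>_def distr[OF l[unfolded lessThan_iff], symmetric] char_def
      by (simp add: integral_distr)
  qed
  finally have eq: "char (distr M borel (\<lambda>\<omega>. (\<Sum>l<n. \<xi> l \<omega>) / sqrt (real n))) t = \<psi> ^ n"
    by simp
  define y where "y = v * t\<^sup>2 / (2 * real n)"
  have v0: "v \<ge> 0" using \<mu>(6) by (auto simp flip: \<mu>(6))
  have y: "0 \<le> y" "y \<le> 2"
    using n v0 t by (auto simp: y_def field_simps)
  have "cmod (\<psi> - (1 - ?t\<^sup>2 * v / 2)) \<le> ?t\<^sup>2 / 6 * (LINT x|\<mu>. min (6 * x\<^sup>2) (\<bar>?t\<bar> * \<bar>x\<bar> ^ 3))"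
    unfolding \<psi>_def by (rule \<mu>.char_approx3) (use \<mu> in auto)
  also have "?t\<^sup>2 * v / 2 = y" using n by (simp add: y_def power_divide field_simps)
  \<comment> \<open>Of the two branches of the Taylor remainder the cubic one is kept, since it
    carries the small factor \<open>t / sqrt n\<close>.\<close>
  also have "(LINT x|\<mu>. min (6 * x\<^sup>2) (\<bar>?t\<bar> * \<bar>x\<bar> ^ 3)) \<le> (LINT x|\<mu>. \<bar>?t\<bar> * \<bar>x\<bar> ^ 3)"
    by (intro integral_mono integrable_min integrable_mult_right \<mu>) auto
  also have "\<dots> \<le> \<bar>?t\<bar> * B" using B by (simp add: mult_left_mono divide_right_mono)
  also have "?t\<^sup>2 / 6 * (\<bar>?t\<bar> * B) = \<bar>t\<bar> ^ 3 * B / (6 * sqrt (real n)) / n"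
    using n by (simp add: power_divide power2_eq_square power3_eq_cube abs_mult ac_simps)
  finally have 1: "cmod (\<psi> - (1 - y)) \<le> \<bar>t\<bar> ^ 3 * B / (6 * sqrt (real n)) / n"
    by (simp add: mult_left_mono)
  have "cmod (complex_of_real (1 - y) - exp (- y)) = \<bar>(1 - y) - exp (- y)\<bar>"
    by (metis norm_of_real of_real_diff real_norm_def)
  also have "\<dots> \<le> y\<^sup>2" using abs_exp_minus_linear[OF y(1)] .
  finally have 2: "cmod (complex_of_real (1 - y) - exp (- y)) \<le> y\<^sup>2" .
  have "exp (- (v * t\<^sup>2) / 2) = exp (real n * (- y))"
    using n by (simp add: y_def)
  also have "\<dots> = exp (- y) ^ n" by (simp only: exp_of_nat_mult)
  finally have e: "exp (- (v * t\<^sup>2) / 2) = exp (- y) ^ n" .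
  \<comment> \<open>Both bases lie in the closed unit disc, so their n-th powers differ by at most n
    times the difference of the bases.\<close>
  have "cmod (\<psi> ^ n - complex_of_real (exp (- y)) ^ n) \<le> n * cmod (\<psi> - complex_of_real (exp (- y)))"
    by (intro norm_power_diff) (use y in \<open>auto simp: \<psi>_def \<mu>.cmod_char_le_1\<close>)
  also have "\<dots> \<le> n * (\<bar>t\<bar> ^ 3 * B / (6 * sqrt (real n)) / n + y\<^sup>2)"
    using 1 2 norm_triangle_ineq[of "\<psi> - complex_of_real (1 - y)" "complex_of_real (1 - y) - exp (- y)"]
    by (intro mult_left_mono) auto
  also have "\<dots> = \<bar>t\<bar> ^ 3 * B / (6 * sqrt (real n)) + v\<^sup>2 * t ^ 4 / (4 * real n)"
    using n by (simp add: y_def field_simps power2_eq_square power4_eq_xxxx)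
  finally show ?thesis unfolding eq e by simp
qed

text \<open>For fixed \<open>t\<close> the one-row bound tends to 0 uniformly over all laws with
  moments bounded by \<open>B\<close>. The error is absolute, not relative to the variance, so rows
  of vanishing variance need no separate treatment.\<close>

lemma weakly_merging_normalized_sums:
  fixes P :: "nat \<Rightarrow> 'w measure" and \<xi> :: "nat \<Rightarrow> nat \<Rightarrow> 'w \<Rightarrow> real"
  assumes P: "\<And>n. n \<ge> 1 \<Longrightarrow> prob_space (P n)"
    and indep: "\<And>n. n \<ge> 1 \<Longrightarrow> prob_space.indep_vars (P n) (\<lambda>_. borel) (\<xi> n) {..<n}"
    and distr: "\<And>n l. n \<ge> 1 \<Longrightarrow> l < n \<Longrightarrow> distr (P n) borel (\<xi> n l) = \<mu> n"
    and \<mu>: "\<And>n. n \<ge> 1 \<Longrightarrow> integrable (\<mu> n) (\<lambda>x. \<bar>x\<bar> ^ 3)"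
      "\<And>n. n \<ge> 1 \<Longrightarrow> integral\<^sup>L (\<mu> n) (\<lambda>x. x) = 0"
      "\<And>n. n \<ge> 1 \<Longrightarrow> integrable (\<mu> n) (\<lambda>x. x)" 
      "\<And>n. n \<ge> 1 \<Longrightarrow> integrable (\<mu> n) (\<lambda>x. x\<^sup>2)"
      "\<And>n. n \<ge> 1 \<Longrightarrow> integral\<^sup>L (\<mu> n) (\<lambda>x. x\<^sup>2) = v n"
    and B: "\<And>n. n \<ge> 1 \<Longrightarrow> integral\<^sup>L (\<mu> n) (\<lambda>x. \<bar>x\<bar> ^ 3) \<le> B" "\<And>n. n \<ge> 1 \<Longrightarrow> v n \<le> B"
  shows "weakly_merging (\<lambda>n. distr (P n) borel (\<lambda>\<omega>. (\<Sum>l<n. \<xi> n l \<omega>) / sqrt (real n)))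
           (\<lambda>n. centered_gaussian (v n))"
proof (rule weakly_merging_centered_gaussian)
  have rv: "\<xi> n l \<in> borel_measurable (P n)" if "n \<ge> 1" "l < n" for n l
  proof -
    interpret prob_space "P n" using P that by auto
    show ?thesis using indep[OF that(1)] that unfolding indep_vars_def2 by simp
  qed
  have rd: "real_distribution (\<mu> n)" if "n \<ge> 1" for n
  proof -
    interpret prob_space "P n" using P that by auto
    show ?thesis unfolding distr[OF that, of 0, symmetric] using rv[OF that, of 0] that
      by (subst distr[OF that, of 0, symmetric]) auto
  qed
  show "real_distribution (distr (P n) borel (\<lambda>\<omega>. (\<Sum>l<n. \<xi> n l \<omega>) / sqrt (real n)))" if "n \<ge> 1" for n
  proof -
    interpret prob_space "P n" using P that by auto
    show ?thesis using rv[OF that]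
      by (intro real_distribution_distr borel_measurable_divide borel_measurable_sum) auto
  qed
  show v0: "0 \<le> v n" if "n \<ge> 1" for n
    using \<mu>(5)[OF that, symmetric] by simp
  show "v n \<le> B" if "n \<ge> 1" for n using B that by auto
  fix t :: real
  show "(\<lambda>n. char (distr (P n) borel (\<lambda>\<omega>. (\<Sum>l<n. \<xi> n l \<omega>) / sqrt (real n))) t
          - complex_of_real (exp (- (v n * t\<^sup>2) / 2))) \<longlonglongrightarrow> 0"
  proof (rule Lim_null_comparison)
    show "(\<lambda>n. \<bar>t\<bar> ^ 3 * B / (6 * sqrt (real n)) + B\<^sup>2 * t ^ 4 / (4 * real n)) \<longlonglongrightarrow> 0"
      by real_asymp
    have "\<forall>\<^sub>F n :: nat in sequentially. real n > B * t\<^sup>2"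
      by (rule eventually_sequentiallyI[of "nat \<lceil>B * t\<^sup>2\<rceil> + 1"]) linarith
    then show "\<forall>\<^sub>F n in sequentially.
        norm (char (distr (P n) borel (\<lambda>\<omega>. (\<Sum>l<n. \<xi> n l \<omega>) / sqrt (real n))) t
          - complex_of_real (exp (- (v n * t\<^sup>2) / 2)))
        \<le> \<bar>t\<bar> ^ 3 * B / (6 * sqrt (real n)) + B\<^sup>2 * t ^ 4 / (4 * real n)"
      using eventually_ge_at_top[of 1]
    proof eventually_elim
      case (elim n)
      interpret prob_space "P n" using P elim by auto
      have "v n * t\<^sup>2 \<le> B * t\<^sup>2" by (intro mult_right_mono B) (use elim in auto)
      then have "norm (char (distr (P n) borel (\<lambda>\<omega>. (\<Sum>l<n. \<xi> n l \<omega>) / sqrt (real n))) t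
          - complex_of_real (exp (- (v n * t\<^sup>2) / 2)))
        \<le> \<bar>t\<bar> ^ 3 * B / (6 * sqrt (real n)) + (v n)\<^sup>2 * t ^ 4 / (4 * real n)"
        using elim
        by (intro char_normalized_sum_bound[OF elim(2) indep[OF elim(2)] distr[OF elim(2)] rd[OF elim(2)]
             \<mu>(1)[OF elim(2)] \<mu>(2)[OF elim(2)] \<mu>(3)[OF elim(2)] \<mu>(4)[OF elim(2)] \<mu>(5)[OF elim(2)]
             B(1)[OF elim(2)]]) auto
      also have "(v n)\<^sup>2 \<le> B\<^sup>2" using v0 B elim by (intro power_mono) auto
      finally show ?case by (auto simp: divide_right_mono mult_right_mono)
    qed
  qed
qed

section \<open>Continuous mapping and Slutsky's lemma for moving targets\<close>

lemma weakly_merging_distr: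
  assumes g: "continuous_on UNIV g" and m: "weakly_merging \<mu> \<nu>"
    and s: "\<And>n. n \<ge> 1 \<Longrightarrow> sets (\<mu> n) = sets borel" "\<And>n. n \<ge> 1 \<Longrightarrow> sets (\<nu> n) = sets borel"
  shows "weakly_merging (\<lambda>n. distr (\<mu> n) borel g) (\<lambda>n. distr (\<nu> n) borel g)"
  unfolding weakly_merging_def
proof (intro allI impI)
  fix f :: "real \<Rightarrow> real" assume f: "continuous_on UNIV f" "bounded (range f)"
have "continuous_on UNIV (f \<circ> g)"
    using continuous_on_compose[OF g] continuous_on_subset[OF f(1)] by blast
  moreover have "bounded (range (f \<circ> g))"
    by (rule bounded_subset[OF f(2)]) auto
  ultimately have "(\<lambda>n. integral\<^sup>L (\<mu> n) (f \<circ> g) - integral\<^sup>L (\<nu> n) (f \<circ> g)) \<longlonglongrightarrow> 0"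
    using m unfolding weakly_merging_def by blast
  moreover have "\<forall>\<^sub>F n in sequentially. integral\<^sup>L (\<mu> n) (f \<circ> g) - integral\<^sup>L (\<nu> n) (f \<circ> g)
      = integral\<^sup>L (distr (\<mu> n) borel g) f - integral\<^sup>L (distr (\<nu> n) borel g) f"
    using eventually_ge_at_top[of 1]
  proof eventually_elim
    case (elim n)
    have [measurable]: "f \<in> borel_measurable borel" "g \<in> borel_measurable borel"
      using f g by (auto intro: borel_measurable_continuous_onI)
    have "g \<in> borel_measurable (\<mu> n)" "g \<in> borel_measurable (\<nu> n)"
      using s[OF elim] by (auto simp: measurable_cong_sets[OF s(1)[OF elim]] measurable_cong_sets[OF s(2)[OF elim]])
    then show ?case by (subst (1 2) integral_distr) (auto simp: o_def)
  qed
  ultimately show "(\<lambda>n. integral\<^sup>L (distr (\<mu> n) borel g) f - integral\<^sup>L (distr (\<nu> n) borel g) f) \<longlonglongrightarrow> 0"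
    by (rule Lim_transform_eventually)
qed

text \<open>Only the exceptional set is required to be measurable. The good property may then be any
  predicate, such as an existential statement about signs, and combining properties amounts to a
  union of exceptional sets.\<close>

abbreviation likely :: "'w measure \<Rightarrow> real \<Rightarrow> ('w \<Rightarrow> bool) \<Rightarrow> bool" where
  "likely M e G \<equiv> \<exists>A\<in>sets M. measure M A \<le> e \<and> (\<forall>\<omega>\<in>space M - A. G \<omega>)"

text \<open>A bounded continuous test function is uniformly continuous only on compact sets. Targets
  that move with n offer no limit law from which compactness could be taken, hence tightness of
  \<open>T'\<close> is a hypothesis of its own.\<close>

lemma weakly_merging_slutsky:
  fixes P :: "nat \<Rightarrow> 'w measure" and T T' :: "nat \<Rightarrow> 'w \<Rightarrow> real"
  assumes P: "\<And>n. n \<ge> 1 \<Longrightarrow> prob_space (P n)"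
    and T: "\<And>n. n \<ge> 1 \<Longrightarrow> T n \<in> borel_measurable (P n)"
    and T': "\<And>n. n \<ge> 1 \<Longrightarrow> T' n \<in> borel_measurable (P n)"
    and close: "\<And>\<epsilon> \<delta>. \<epsilon> > 0 \<Longrightarrow> \<delta> > 0 \<Longrightarrow> \<forall>\<^sub>F n in sequentially.
        likely (P n) \<epsilon> (\<lambda>\<omega>. \<bar>T n \<omega> - T' n \<omega>\<bar> \<le> \<delta>)"
    and tight: "\<And>\<epsilon>. \<epsilon> > 0 \<Longrightarrow> \<exists>R. \<forall>\<^sub>F n in sequentially.
        likely (P n) \<epsilon> (\<lambda>\<omega>. \<bar>T' n \<omega>\<bar> \<le> R)"
    and m: "weakly_merging (\<lambda>n. distr (P n) borel (T' n)) \<nu>"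
  shows "weakly_merging (\<lambda>n. distr (P n) borel (T n)) \<nu>"
  unfolding weakly_merging_def
proof (intro allI impI)
  fix f :: "real \<Rightarrow> real" assume f: "continuous_on UNIV f" "bounded (range f)"
  obtain b where b: "b > 0" "\<And>x. \<bar>f x\<bar> \<le> b"
    using f(2) by (auto simp: bounded_pos)
  have [measurable]: "f \<in> borel_measurable borel"
    using f by (auto intro: borel_measurable_continuous_onI)
  let ?I = "\<lambda>T n. integral\<^sup>L (distr (P n) borel (T n)) f"
  have "(\<lambda>n. ?I T n - ?I T' n) \<longlonglongrightarrow> 0"
    unfolding tendsto_iff dist_norm
  proof (intro allI impI)
    fix e :: real assume e: "e > 0"
    \<comment> \<open>Two exceptional sets of this probability cost at most
      \<open>2 * b * (2 * \<epsilon>) = e / 2\<close>, which together with the oscillation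
      \<open>e / 4\<close> stays below \<open>e\<close>.\<close>
    define \<epsilon> where "\<epsilon> = e / (8 * b)"
    have \<epsilon>: "\<epsilon> > 0" using e b by (simp add: \<epsilon>_def)
    obtain R where R: "\<forall>\<^sub>F n in sequentially.
        likely (P n) \<epsilon> (\<lambda>\<omega>. \<bar>T' n \<omega>\<bar> \<le> R)"
      using tight[OF \<epsilon>] by blast
    have "uniformly_continuous_on {- R - 1..R + 1} f"
      by (intro compact_uniformly_continuous continuous_on_subset[OF f(1)]) auto
    then obtain d where d: "d > 0" "\<And>x x'. x \<in> {- R - 1..R + 1} \<Longrightarrow> x' \<in> {- R - 1..R + 1} \<Longrightarrow>
        \<bar>x' - x\<bar> < d \<Longrightarrow> \<bar>f x' - f x\<bar> < e / 4"
      unfolding uniformly_continuous_on_def dist_real_def using e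
      by (elim allE[of _ "e / 4"]) auto
    \<comment> \<open>The cap 1 keeps \<open>T\<close> inside the interval that was enlarged by 1 on
      each side.\<close>
    define \<delta> where "\<delta> = min (d / 2) 1"
    have \<delta>: "\<delta> > 0" "\<delta> < d" "\<delta> \<le> 1" using d by (auto simp: \<delta>_def)
    show "\<forall>\<^sub>F n in sequentially. norm (?I T n - ?I T' n - 0) < e"
      using R close[OF \<epsilon> \<delta>(1)] eventually_ge_at_top[of 1]
    proof eventually_elim
      case (elim n)
      interpret prob_space "P n" using P elim by auto
      note [measurable] = T[OF elim(3)] T'[OF elim(3)]
      obtain A A' where A: "A \<in> events" "prob A \<le> \<epsilon>" "\<And>\<omega>. \<omega> \<in> space (P n) - A \<Longrightarrow> \<bar>T' n \<omega>\<bar> \<le> R"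
        and A': "A' \<in> events" "prob A' \<le> \<epsilon>" "\<And>\<omega>. \<omega> \<in> space (P n) - A' \<Longrightarrow> \<bar>T n \<omega> - T' n \<omega>\<bar> \<le> \<delta>"
        using elim by blast
      have [measurable]: "A \<union> A' \<in> events" using A A' by auto
      have int: "integrable (P n) (\<lambda>\<omega>. f (T n \<omega>))" "integrable (P n) (\<lambda>\<omega>. f (T' n \<omega>))"
        using b by (auto intro!: integrable_const_bound[where B = b])
      have "norm (?I T n - ?I T' n) = \<bar>expectation (\<lambda>\<omega>. f (T n \<omega>) - f (T' n \<omega>))\<bar>"
        using int by (subst (1 2) integral_distr) auto
      also have "\<dots> \<le> expectation (\<lambda>\<omega>. \<bar>f (T n \<omega>) - f (T' n \<omega>)\<bar>)"
        by (rule integral_abs_bound)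
      also have "\<dots> \<le> expectation (\<lambda>\<omega>. e / 4 + 2 * b * indicator (A \<union> A') \<omega>)"
      proof (rule integral_mono)
        show "integrable (P n) (\<lambda>\<omega>. \<bar>f (T n \<omega>) - f (T' n \<omega>)\<bar>)" using int by auto
        show "integrable (P n) (\<lambda>\<omega>. e / 4 + 2 * b * indicator (A \<union> A') \<omega>)"
          by (intro integrable_const_bound[where B = "e / 4 + 2 * b"])
             (use b e in \<open>auto split: split_indicator\<close>)
        fix \<omega> assume \<omega>: "\<omega> \<in> space (P n)"
        show "\<bar>f (T n \<omega>) - f (T' n \<omega>)\<bar> \<le> e / 4 + 2 * b * indicator (A \<union> A') \<omega>"
        proof (cases "\<omega> \<in> A \<union> A'")
          case True
          then show ?thesis using b(2)[of "T n \<omega>"] b(2)[of "T' n \<omega>"] e by auto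
        next
          case False
          then have "\<bar>T' n \<omega>\<bar> \<le> R" "\<bar>T n \<omega> - T' n \<omega>\<bar> \<le> \<delta>" using A A' \<omega> by auto
          then have "\<bar>f (T n \<omega>) - f (T' n \<omega>)\<bar> < e / 4"
            using \<delta> by (intro d) auto
          then show ?thesis using b e by (auto split: split_indicator)
        qed
      qed
      also have "\<dots> = e / 4 + 2 * b * prob (A \<union> A')"
        by (subst Bochner_Integration.integral_add) (auto simp: prob_space emeasure_eq_measure)
      also have "prob (A \<union> A') \<le> 2 * \<epsilon>"
        using A(2) A'(2) measure_Un_le[OF A(1) A'(1)] by linarith
      also have "e / 4 + 2 * b * (2 * \<epsilon>) < e" using b e by (simp add: \<epsilon>_def)
      finally show ?case using b by (simp add: mult_left_mono)
    qed
  qed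
  moreover have "(\<lambda>n. ?I T' n - integral\<^sup>L (\<nu> n) f) \<longlonglongrightarrow> 0"
    using m f unfolding weakly_merging_def by blast
  ultimately have "(\<lambda>n. (?I T n - ?I T' n) + (?I T' n - integral\<^sup>L (\<nu> n) f)) \<longlonglongrightarrow> 0 + 0"
    by (rule tendsto_add)
  then show "(\<lambda>n. ?I T n - integral\<^sup>L (\<nu> n) f) \<longlonglongrightarrow> 0" by simp
qed

section \<open>Concentration of empirical second moments\<close>

text \<open>\<open>c\<close> is on the scale of the squared \<psi>2 norm, so a product of two such
  variables is subexponential with the same \<open>c\<close>. Integrability is demanded separately
  because the Bochner integral of a non-integrable function is 0.\<close>

definition subgaussian :: "'a measure \<Rightarrow> real \<Rightarrow> ('a \<Rightarrow> real) \<Rightarrow> bool" where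
  "subgaussian M c f \<longleftrightarrow> f \<in> borel_measurable M \<and> integrable M (\<lambda>\<omega>. exp ((f \<omega>)\<^sup>2 / c)) \<and>
     integral\<^sup>L M (\<lambda>\<omega>. exp ((f \<omega>)\<^sup>2 / c)) \<le> 2"

section \<open>Exponential moments and Bernstein's inequality\<close>

lemma exp_le_quadratic: "exp x \<le> 1 + x + x\<^sup>2 * exp \<bar>x\<bar> / 2" for x :: real
proof -
  obtain t where t: "\<bar>t\<bar> \<le> \<bar>x\<bar>" "exp x = (\<Sum>m<2. x ^ m / fact m) + exp t / fact 2 * x ^ 2"
    using Maclaurin_exp_le[of x 2] by auto
  have "exp x = 1 + x + x\<^sup>2 * exp t / 2"
    by (subst t(2)) (simp add: lessThan_nat_numeral fact_numeral)
  also have "exp t \<le> exp \<bar>x\<bar>" using t(1) by simp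
  finally show ?thesis by (simp add: mult_left_mono)
qed

text \<open>With \<open>u = \<bar>z\<bar> / (2 * c)\<close>, one factor \<open>exp u\<close> absorbs
  the square of \<open>z\<close> and another one dominates \<open>exp \<bar>s * z\<bar>\<close>;
  together they make \<open>exp (\<bar>z\<bar> / c)\<close>.\<close>

lemma exp_scaled_le_quadratic:
  fixes s z c :: real
  assumes c: "c > 0" and s: "\<bar>s\<bar> \<le> 1 / (2 * c)"
  shows "exp (s * z) \<le> 1 + s * z + 4 * c\<^sup>2 * s\<^sup>2 * exp (\<bar>z\<bar> / c)"
proof -
  define u where "u = \<bar>z\<bar> / (2 * c)"
  have u: "u \<ge> 0" "\<bar>z\<bar> = 2 * c * u" using c by (auto simp: u_def)
  have "\<bar>s * z\<bar> \<le> 1 / (2 * c) * \<bar>z\<bar>"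
    unfolding abs_mult by (intro mult_right_mono s) auto
  then have sz: "\<bar>s * z\<bar> \<le> u" by (simp add: u_def)
  have "u\<^sup>2 \<le> 2 * exp u"
    using exp_lower_Taylor_quadratic[OF u(1)] u(1) by linarith
  then have "z\<^sup>2 \<le> 8 * c\<^sup>2 * exp u"
    using mult_left_mono[of "u\<^sup>2" "2 * exp u" "4 * c\<^sup>2"] u(2) power2_abs[of z]
    by (simp add: power_mult_distrib mult_ac)
  then have "(s * z)\<^sup>2 * exp \<bar>s * z\<bar> \<le> s\<^sup>2 * (8 * c\<^sup>2 * exp u) * exp u"
    using sz by (intro mult_mono) (auto simp: power_mult_distrib intro!: mult_left_mono)
  also have "\<dots> = 8 * c\<^sup>2 * s\<^sup>2 * exp (\<bar>z\<bar> / c)"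
    using c by (simp add: u(2) mult_exp_exp)
  finally show ?thesis using exp_le_quadratic[of "s * z"] by linarith
qed

text \<open>The vanishing mean removes the linear term, and \<open>1 + x \<le> exp x\<close> turns
  what is left into a Gaussian-type bound, valid for small \<open>s\<close>.\<close>

lemma (in prob_space) mgf_le:
  fixes c s D :: real
  assumes c: "c > 0" and s: "\<bar>s\<bar> \<le> 1 / (2 * c)"
    and [measurable]: "random_variable borel \<zeta>"
    and int: "integrable M (\<lambda>\<omega>. exp (\<bar>\<zeta> \<omega>\<bar> / c))" "expectation (\<lambda>\<omega>. exp (\<bar>\<zeta> \<omega>\<bar> / c)) \<le> D"
    and mean: "expectation \<zeta> = 0"
  shows "integrable M (\<lambda>\<omega>. exp (s * \<zeta> \<omega>))"
    and "expectation (\<lambda>\<omega>. exp (s * \<zeta> \<omega>)) \<le> exp (4 * D * c\<^sup>2 * s\<^sup>2)"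
proof -
  have \<zeta>: "integrable M \<zeta>"
  proof (rule Bochner_Integration.integrable_bound[OF integrable_mult_right[OF int(1), of c]])
    have "\<bar>z\<bar> \<le> c * exp (\<bar>z\<bar> / c)" for z :: real
    proof -
      have "\<bar>z\<bar> / c \<le> exp (\<bar>z\<bar> / c)" using exp_ge_add_one_self[of "\<bar>z\<bar> / c"] by linarith
      then show ?thesis using c by (simp add: field_simps)
    qed
    then show "AE x in M. norm (\<zeta> x) \<le> norm (c * exp (\<bar>\<zeta> x\<bar> / c))" using c by (auto simp: abs_mult)
  qed auto
  have bound: "integrable M (\<lambda>\<omega>. 1 + s * \<zeta> \<omega> + 4 * c\<^sup>2 * s\<^sup>2 * exp (\<bar>\<zeta> \<omega>\<bar> / c))"
    using \<zeta> int by auto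
  show 1: "integrable M (\<lambda>\<omega>. exp (s * \<zeta> \<omega>))"
    by (rule Bochner_Integration.integrable_bound[OF bound])
       (use exp_scaled_le_quadratic[OF c s] in \<open>auto intro: order_trans[OF _ abs_ge_self]\<close>)
  have "expectation (\<lambda>\<omega>. exp (s * \<zeta> \<omega>)) \<le> expectation (\<lambda>\<omega>. 1 + s * \<zeta> \<omega> + 4 * c\<^sup>2 * s\<^sup>2 * exp (\<bar>\<zeta> \<omega>\<bar> / c))"
    by (intro integral_mono 1 bound exp_scaled_le_quadratic c s)
  also have "\<dots> = 1 + 4 * c\<^sup>2 * s\<^sup>2 * expectation (\<lambda>\<omega>. exp (\<bar>\<zeta> \<omega>\<bar> / c))"
    using \<zeta> int mean by (simp add: prob_space)
  also have "\<dots> \<le> 1 + 4 * c\<^sup>2 * s\<^sup>2 * D"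
    using int by (simp add: mult_left_mono)
  also have "\<dots> \<le> exp (4 * D * c\<^sup>2 * s\<^sup>2)"
    using exp_ge_add_one_self[of "4 * c\<^sup>2 * s\<^sup>2 * D"] by (simp add: ac_simps)
  finally show "expectation (\<lambda>\<omega>. exp (s * \<zeta> \<omega>)) \<le> exp (4 * D * c\<^sup>2 * s\<^sup>2)" .
qed

text \<open>Chernoff's method: Markov's inequality for the exponential, whose expectation factorises
  by independence. The parameter \<open>s\<close> is left free; it is later set to the rate
  \<lambda> instead of being optimised.\<close>

lemma (in prob_space) bernstein_upper:
  fixes \<zeta> :: "nat \<Rightarrow> 'a \<Rightarrow> real" and c s D t :: real
  assumes c: "c > 0" and s: "0 < s" "s \<le> 1 / (2 * c)"
    and indep: "indep_vars (\<lambda>_. borel) \<zeta> {..<n}"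
    and int: "\<And>l. l < n \<Longrightarrow> integrable M (\<lambda>\<omega>. exp (\<bar>\<zeta> l \<omega>\<bar> / c))"
      "\<And>l. l < n \<Longrightarrow> expectation (\<lambda>\<omega>. exp (\<bar>\<zeta> l \<omega>\<bar> / c)) \<le> D"
    and mean: "\<And>l. l < n \<Longrightarrow> expectation (\<zeta> l) = 0"
  shows "prob {\<omega> \<in> space M. (\<Sum>l<n. \<zeta> l \<omega>) \<ge> real n * t}
    \<le> exp (- s * real n * t + 4 * D * c\<^sup>2 * s\<^sup>2 * real n)"
proof -
  have [measurable]: "random_variable borel (\<zeta> l)" if "l < n" for l
    using indep that unfolding indep_vars_def2 by simp
  have s': "\<bar>s\<bar> \<le> 1 / (2 * c)" using s by simp
  have i: "indep_vars (\<lambda>_. borel) (\<lambda>l \<omega>. exp (s * \<zeta> l \<omega>)) {..<n}"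
    by (rule indep_vars_compose2[where X = \<zeta>, OF indep]) auto
  have mgf: "integrable M (\<lambda>\<omega>. exp (s * \<zeta> l \<omega>))" 
    "expectation (\<lambda>\<omega>. exp (s * \<zeta> l \<omega>)) \<le> exp (4 * D * c\<^sup>2 * s\<^sup>2)" if "l < n" for l
    using mgf_le[OF c s' _ int[OF that] mean[OF that]] that by auto
  let ?u = "\<lambda>\<omega>. \<Prod>l<n. exp (s * \<zeta> l \<omega>)"
  have u: "integrable M ?u"
    by (intro indep_vars_integrable i) (use mgf in auto)
  have "{\<omega> \<in> space M. (\<Sum>l<n. \<zeta> l \<omega>) \<ge> real n * t} = {\<omega> \<in> space M. ?u \<omega> \<ge> exp (s * (real n * t))}"
    using s by (auto simp flip: exp_sum sum_distrib_left)
  then have "prob {\<omega> \<in> space M. (\<Sum>l<n. \<zeta> l \<omega>) \<ge> real n * t} \<le> expectation ?u / exp (s * (real n * t))"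
    using integral_Markov_inequality_measure[OF u, of "{}" "exp (s * (real n * t))"]
    by (auto simp: prod_nonneg)
  also have "expectation ?u = (\<Prod>l<n. expectation (\<lambda>\<omega>. exp (s * \<zeta> l \<omega>)))"
    by (intro indep_vars_lebesgue_integral i) (use mgf in auto)
  also have "\<dots> \<le> (\<Prod>l<n. exp (4 * D * c\<^sup>2 * s\<^sup>2))"
    by (intro prod_mono) (use mgf in \<open>auto intro: integral_nonneg_AE\<close>)
  also have "\<dots> = exp (4 * D * c\<^sup>2 * s\<^sup>2 * real n)"
    by (simp add: exp_of_nat_mult[symmetric] mult.commute)
  finally show ?thesis
    by (simp add: divide_right_mono exp_add exp_minus exp_diff field_simps)
qed

lemma (in prob_space) bernstein:
  fixes \<zeta> :: "nat \<Rightarrow> 'a \<Rightarrow> real" and c s D t :: real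
  assumes n: "n \<ge> 1" and c: "c > 0" and s: "0 < s" "s \<le> 1 / (2 * c)"
    and indep: "indep_vars (\<lambda>_. borel) \<zeta> {..<n}"
    and int: "\<And>l. l < n \<Longrightarrow> integrable M (\<lambda>\<omega>. exp (\<bar>\<zeta> l \<omega>\<bar> / c))"
      "\<And>l. l < n \<Longrightarrow> expectation (\<lambda>\<omega>. exp (\<bar>\<zeta> l \<omega>\<bar> / c)) \<le> D"
    and mean: "\<And>l. l < n \<Longrightarrow> expectation (\<zeta> l) = 0"
  shows "prob {\<omega> \<in> space M. \<bar>(\<Sum>l<n. \<zeta> l \<omega>) / real n\<bar> > t}
    \<le> 2 * exp (- s * real n * t + 4 * D * c\<^sup>2 * s\<^sup>2 * real n)"
proof -
  have [measurable]: "random_variable borel (\<zeta> l)" if "l < n" for l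
    using indep that unfolding indep_vars_def2 by simp
  let ?A = "\<lambda>\<zeta>. {\<omega> \<in> space M. (\<Sum>l<n. \<zeta> l \<omega>) \<ge> real n * t}"
  have "prob {\<omega> \<in> space M. \<bar>(\<Sum>l<n. \<zeta> l \<omega>) / real n\<bar> > t} \<le> prob (?A \<zeta> \<union> ?A (\<lambda>l \<omega>. - \<zeta> l \<omega>))"
    using n by (intro finite_measure_mono) (auto simp: field_simps abs_if sum_negf split: if_splits)
  also have "\<dots> \<le> prob (?A \<zeta>) + prob (?A (\<lambda>l \<omega>. - \<zeta> l \<omega>))"
    by (intro measure_Un_le) auto
  also have "prob (?A \<zeta>) \<le> exp (- s * real n * t + 4 * D * c\<^sup>2 * s\<^sup>2 * real n)"
    by (intro bernstein_upper assms)
  also have "prob (?A (\<lambda>l \<omega>. - \<zeta> l \<omega>)) \<le> exp (- s * real n * t + 4 * D * c\<^sup>2 * s\<^sup>2 * real n)"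
    by (intro bernstein_upper indep_vars_compose2[where X = \<zeta>, OF indep] c s) (use int mean in auto)
  finally show ?thesis by simp
qed

text \<open>The product is at most half the sum of the squares, and the exponential of a mean is at
  most the mean of the exponentials. The expectation of the product is at most \<open>2 * c\<close>
  in modulus, so centering costs a factor \<open>exp 2\<close>.\<close>

lemma subgaussian_product:
  assumes M: "prob_space M" and c: "c > 0" and f: "subgaussian M c f" and g: "subgaussian M c g"
  shows "integrable M (\<lambda>\<omega>. f \<omega> * g \<omega>)" (is ?I)
    and "integrable M (\<lambda>\<omega>. exp (\<bar>f \<omega> * g \<omega> - integral\<^sup>L M (\<lambda>\<omega>. f \<omega> * g \<omega>)\<bar> / c))" (is ?J)
    and "integral\<^sup>L M (\<lambda>\<omega>. exp (\<bar>f \<omega> * g \<omega> - integral\<^sup>L M (\<lambda>\<omega>. f \<omega> * g \<omega>)\<bar> / c)) \<le> 2 * exp 2" (is ?K)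
    and "\<bar>integral\<^sup>L M (\<lambda>\<omega>. f \<omega> * g \<omega>)\<bar> \<le> 2 * c" (is ?L)
proof -
  interpret prob_space M by fact
  have [measurable]: "f \<in> borel_measurable M" "g \<in> borel_measurable M"
    using f g by (auto simp: subgaussian_def)
  let ?h = "\<lambda>\<omega>. (exp ((f \<omega>)\<^sup>2 / c) + exp ((g \<omega>)\<^sup>2 / c)) / 2"
  have h: "integrable M ?h" "expectation ?h \<le> 2"
    using f g by (auto simp: subgaussian_def)
  have le: "exp (\<bar>f \<omega> * g \<omega>\<bar> / c) \<le> ?h \<omega>" for \<omega>
  proof -
    let ?a = "(f \<omega>)\<^sup>2 / c" and ?b = "(g \<omega>)\<^sup>2 / c"
    have "\<bar>f \<omega> * g \<omega>\<bar> \<le> ((f \<omega>)\<^sup>2 + (g \<omega>)\<^sup>2) / 2"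
      using sum_squares_bound[of "\<bar>f \<omega>\<bar>" "\<bar>g \<omega>\<bar>"] by (simp add: abs_mult)
    then have "\<bar>f \<omega> * g \<omega>\<bar> / c \<le> ((f \<omega>)\<^sup>2 + (g \<omega>)\<^sup>2) / 2 / c"
      using c by (intro divide_right_mono) auto
    then have "exp (\<bar>f \<omega> * g \<omega>\<bar> / c) \<le> exp (?a / 2) * exp (?b / 2)"
      by (simp add: mult_exp_exp add_divide_distrib)
    also have "\<dots> \<le> ((exp (?a / 2))\<^sup>2 + (exp (?b / 2))\<^sup>2) / 2"
      using sum_squares_bound[of "exp (?a / 2)" "exp (?b / 2)"] by simp
    finally show ?thesis by (simp flip: exp_double)
  qed
  have e: "integrable M (\<lambda>\<omega>. exp (\<bar>f \<omega> * g \<omega>\<bar> / c))"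
    by (rule Bochner_Integration.integrable_bound[OF h(1)])
       (use le in \<open>auto intro: order_trans[OF _ abs_ge_self]\<close>)
  have e2: "expectation (\<lambda>\<omega>. exp (\<bar>f \<omega> * g \<omega>\<bar> / c)) \<le> 2"
    using integral_mono[OF e h(1) le] h(2) by simp
  have le2: "\<bar>f \<omega> * g \<omega>\<bar> \<le> c * exp (\<bar>f \<omega> * g \<omega>\<bar> / c)" for \<omega>
  proof -
    have "\<bar>f \<omega> * g \<omega>\<bar> / c \<le> exp (\<bar>f \<omega> * g \<omega>\<bar> / c)"
      using exp_ge_add_one_self[of "\<bar>f \<omega> * g \<omega>\<bar> / c"] by linarith
    then show ?thesis using c by (simp add: field_simps)
  qed
  show ?I
    by (rule Bochner_Integration.integrable_bound[OF integrable_mult_right[OF e, of c]])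
       (use le2 c in \<open>auto simp: abs_mult\<close>)
  have "\<bar>expectation (\<lambda>\<omega>. f \<omega> * g \<omega>)\<bar> \<le> expectation (\<lambda>\<omega>. \<bar>f \<omega> * g \<omega>\<bar>)"
    by (rule integral_abs_bound)
  also have "\<dots> \<le> expectation (\<lambda>\<omega>. c * exp (\<bar>f \<omega> * g \<omega>\<bar> / c))"
    using \<open>?I\<close> by (intro integral_mono integrable_mult_right e le2) auto
  also have "\<dots> \<le> 2 * c" using e2 c by simp
  finally show ?L .
  have le3: "exp (\<bar>f \<omega> * g \<omega> - expectation (\<lambda>\<omega>. f \<omega> * g \<omega>)\<bar> / c) \<le> exp 2 * exp (\<bar>f \<omega> * g \<omega>\<bar> / c)" for \<omega>
  proof -
    have "\<bar>f \<omega> * g \<omega> - expectation (\<lambda>\<omega>. f \<omega> * g \<omega>)\<bar> \<le> \<bar>f \<omega> * g \<omega>\<bar> + 2 * c"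
      using \<open>?L\<close> by linarith
    then have "\<bar>f \<omega> * g \<omega> - expectation (\<lambda>\<omega>. f \<omega> * g \<omega>)\<bar> / c \<le> (\<bar>f \<omega> * g \<omega>\<bar> + 2 * c) / c"
      using c by (intro divide_right_mono) auto
    also have "\<dots> = 2 + \<bar>f \<omega> * g \<omega>\<bar> / c" using c by (simp add: add_divide_distrib)
    finally show ?thesis by (simp add: mult_exp_exp)
  qed
  show ?J
    by (rule Bochner_Integration.integrable_bound[OF integrable_mult_right[OF e, of "exp 2"]])
       (use le3 in \<open>auto simp: abs_mult\<close>)
  have "expectation (\<lambda>\<omega>. exp (\<bar>f \<omega> * g \<omega> - expectation (\<lambda>\<omega>. f \<omega> * g \<omega>)\<bar> / c))
      \<le> expectation (\<lambda>\<omega>. exp 2 * exp (\<bar>f \<omega> * g \<omega>\<bar> / c))"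
    by (intro integral_mono \<open>?J\<close> integrable_mult_right e le3)
  also have "\<dots> \<le> 2 * exp 2" using e2 by simp
  finally show ?K .
qed

text \<open>All functionals live on the value space \<open>N\<close> of one observation, so products
  of two x-functionals, two y-functionals or one of each are covered by a single union bound over
  pairs from \<open>J\<close>.\<close>

lemma (in prob_space) empirical_product_concentration:
  fixes c s t :: real and W :: "nat \<Rightarrow> 'a \<Rightarrow> 'b" and W0 :: "'a \<Rightarrow> 'b" and g :: "'j \<Rightarrow> 'b \<Rightarrow> real"
  assumes n: "n \<ge> 1" and c: "c > 0" and s: "0 < s" "s \<le> 1 / (2 * c)"
    and indep: "indep_vars (\<lambda>_. N) W {..<n}"
    and W0 [measurable]: "W0 \<in> measurable M N"
    and ident: "\<And>l. l < n \<Longrightarrow> distr M N (W l) = distr M N W0"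
    and J: "finite J"
    and g [measurable]: "\<And>j. j \<in> J \<Longrightarrow> g j \<in> borel_measurable N"
    and sub: "\<And>j. j \<in> J \<Longrightarrow> subgaussian M c (\<lambda>\<omega>. g j (W0 \<omega>))"
  defines "bad \<equiv> {\<omega> \<in> space M. \<exists>j\<in>J. \<exists>k\<in>J. \<bar>(\<Sum>l<n. g j (W l \<omega>) * g k (W l \<omega>)) / real n
                  - expectation (\<lambda>\<omega>. g j (W0 \<omega>) * g k (W0 \<omega>))\<bar> > t}"
  shows "bad \<in> events" 
    and "prob bad \<le> 2 * (real (card J))\<^sup>2 * exp (- s * real n * t + 64 * c\<^sup>2 * s\<^sup>2 * real n)"
proof -
  have W [measurable]: "W l \<in> measurable M N" if "l < n" for l
    using indep that unfolding indep_vars_def2 by simp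
  define B where "B j k = {\<omega> \<in> space M. \<bar>(\<Sum>l<n. g j (W l \<omega>) * g k (W l \<omega>)) / real n
                  - expectation (\<lambda>\<omega>. g j (W0 \<omega>) * g k (W0 \<omega>))\<bar> > t}" for j k
  have B [measurable]: "B j k \<in> events" if "j \<in> J" "k \<in> J" for j k
    using g[OF that(1)] g[OF that(2)] unfolding B_def by measurable
  have bad: "bad = (\<Union>(j, k)\<in>J \<times> J. B j k)"
    unfolding bad_def B_def by auto
  show "bad \<in> events"
    unfolding bad using J B by (intro sets.finite_UN) auto
  have Bp: "prob (B j k) \<le> 2 * exp (- s * real n * t + 64 * c\<^sup>2 * s\<^sup>2 * real n)" if jk: "j \<in> J" "k \<in> J" for j k
  proof -
    note [measurable] = g[OF jk(1)] g[OF jk(2)]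
    define m where "m = expectation (\<lambda>\<omega>. g j (W0 \<omega>) * g k (W0 \<omega>))"
    let ?\<zeta> = "\<lambda>l \<omega>. g j (W l \<omega>) * g k (W l \<omega>) - m"
    note p = subgaussian_product[OF prob_space_axioms c sub[OF jk(1)] sub[OF jk(2)]]
    have transfer: "integrable M (\<lambda>\<omega>. F (W l \<omega>)) = integrable M (\<lambda>\<omega>. F (W0 \<omega>))"
      "expectation (\<lambda>\<omega>. F (W l \<omega>)) = expectation (\<lambda>\<omega>. F (W0 \<omega>))"
      if l: "l < n" and [measurable]: "F \<in> borel_measurable N" for F :: "'b \<Rightarrow> real" and l
    proof -
      have "integrable (distr M N (W l)) F = integrable (distr M N W0) F"
        "integral\<^sup>L (distr M N (W l)) F = integral\<^sup>L (distr M N W0) F"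
        using ident[OF l] by auto
      then show "integrable M (\<lambda>\<omega>. F (W l \<omega>)) = integrable M (\<lambda>\<omega>. F (W0 \<omega>))"
        "expectation (\<lambda>\<omega>. F (W l \<omega>)) = expectation (\<lambda>\<omega>. F (W0 \<omega>))"
        using W[OF l] by (auto simp: integrable_distr_eq integral_distr)
    qed
    have "prob {\<omega> \<in> space M. \<bar>(\<Sum>l<n. ?\<zeta> l \<omega>) / real n\<bar> > t}
        \<le> 2 * exp (- s * real n * t + 4 * (2 * exp 2) * c\<^sup>2 * s\<^sup>2 * real n)"
    proof (rule bernstein[OF n c s])
      show "indep_vars (\<lambda>_. borel) ?\<zeta> {..<n}"
        by (rule indep_vars_compose2[where X = W, OF indep]) auto
      fix l assume l: "l < n"
      show "integrable M (\<lambda>\<omega>. exp (\<bar>?\<zeta> l \<omega>\<bar> / c))"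
        using transfer(1)[OF l, of "\<lambda>w. exp (\<bar>g j w * g k w - m\<bar> / c)"] p(2) by (simp add: m_def)
      show "expectation (\<lambda>\<omega>. exp (\<bar>?\<zeta> l \<omega>\<bar> / c)) \<le> 2 * exp 2"
        using transfer(2)[OF l, of "\<lambda>w. exp (\<bar>g j w * g k w - m\<bar> / c)"] p(3) by (simp add: m_def)
      have "expectation (?\<zeta> l) = expectation (\<lambda>\<omega>. g j (W0 \<omega>) * g k (W0 \<omega>) - m)"
        using transfer(2)[OF l, of "\<lambda>w. g j w * g k w - m"] by simp
      also have "\<dots> = 0" using p(1) by (simp add: prob_space m_def)
      finally show "expectation (?\<zeta> l) = 0" .
    qed
    also have "{\<omega> \<in> space M. \<bar>(\<Sum>l<n. ?\<zeta> l \<omega>) / real n\<bar> > t} = B j k"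
      using n by (simp add: B_def sum_subtractf diff_divide_distrib flip: m_def)
    \<comment> \<open>With \<open>D = 2 * exp 2\<close> the quadratic coefficient is
      \<open>8 * exp 2\<close>, which is at most 64 because \<open>exp 2\<close> is below the square
      of 2.8.\<close>
    also have "2 * exp (- s * real n * t + 4 * (2 * exp 2) * c\<^sup>2 * s\<^sup>2 * real n)
        \<le> 2 * exp (- s * real n * t + 64 * c\<^sup>2 * s\<^sup>2 * real n)"
    proof -
      have "exp (2 :: real) = (exp 1)\<^sup>2" by (simp flip: exp_double)
      also have "(exp 1 :: real)\<^sup>2 \<le> (2.8)\<^sup>2"
        using e_less_272 by (intro power_mono) auto
      finally have "exp (2 :: real) \<le> 8" by (simp add: power2_eq_square)
      then have "4 * (2 * exp 2) * (c\<^sup>2 * s\<^sup>2 * real n) \<le> 64 * (c\<^sup>2 * s\<^sup>2 * real n)"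
        by (intro mult_right_mono) auto
      then show ?thesis by (simp add: mult.assoc)
    qed
    finally show ?thesis .
  qed
  have "prob bad \<le> (\<Sum>(j, k)\<in>J \<times> J. prob (B j k))"
    unfolding bad case_prod_unfold using J B by (intro finite_measure_subadditive_finite) auto
  also have "\<dots> \<le> (\<Sum>(j, k)\<in>J \<times> J. 2 * exp (- s * real n * t + 64 * c\<^sup>2 * s\<^sup>2 * real n))"
    using Bp by (intro sum_mono) auto
  also have "\<dots> = 2 * (real (card J))\<^sup>2 * exp (- s * real n * t + 64 * c\<^sup>2 * s\<^sup>2 * real n)"
    by (simp add: card_cartesian_product power2_eq_square)
  finally show "prob bad \<le> 2 * (real (card J))\<^sup>2 * exp (- s * real n * t + 64 * c\<^sup>2 * s\<^sup>2 * real n)" .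
qed

section \<open>Bilinear forms and Rayleigh quotients\<close>

definition bil :: "real mat \<Rightarrow> real vec \<Rightarrow> real vec \<Rightarrow> real" where
  "bil A u v = u \<bullet> (A *\<^sub>v v)"

lemma bil_sum:
  assumes "A \<in> carrier_mat p q" "u \<in> carrier_vec p" "v \<in> carrier_vec q"
  shows "bil A u v = (\<Sum>i<p. \<Sum>j<q. u $ i * A $$ (i, j) * v $ j)"
  using assms by (auto simp: bil_def scalar_prod_def sum_distrib_left mult.assoc atLeast0LessThan intro!: sum.cong)

lemma bil_linear:
  assumes "A \<in> carrier_mat p q" "u \<in> carrier_vec p" "u' \<in> carrier_vec p" "v \<in> carrier_vec q" "v' \<in> carrier_vec q"
  shows bil_add_left: "bil A (u + u') v = bil A u v + bil A u' v"
    and bil_add_right: "bil A u (v + v') = bil A u v + bil A u v'"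
    and bil_smult_left: "bil A (k \<cdot>\<^sub>v u) v = k * bil A u v"
    and bil_smult_right: "bil A u (k \<cdot>\<^sub>v v) = k * bil A u v"
proof -
  have Av: "A *\<^sub>v v \<in> carrier_vec p" "A *\<^sub>v v' \<in> carrier_vec p" using assms by auto
  show "bil A (u + u') v = bil A u v + bil A u' v"
    unfolding bil_def by (rule add_scalar_prod_distrib) (use assms Av in auto)
  show "bil A u (v + v') = bil A u v + bil A u v'"
    unfolding bil_def mult_add_distrib_mat_vec[OF assms(1,4,5)]
    by (rule scalar_prod_add_distrib) (use assms Av in auto)
  show "bil A (k \<cdot>\<^sub>v u) v = k * bil A u v"
    unfolding bil_def by (rule smult_scalar_prod_distrib) (use assms Av in auto)
  show "bil A u (k \<cdot>\<^sub>v v) = k * bil A u v"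
    unfolding bil_def mult_mat_vec[OF assms(1,4)]
    by (rule scalar_prod_smult_distrib) (use assms Av in auto)
qed

lemma bil_add_mat:
  assumes "A \<in> carrier_mat p q" "B \<in> carrier_mat p q" "u \<in> carrier_vec p" "v \<in> carrier_vec q"
  shows "bil (A + B) u v = bil A u v + bil B u v"
  using assms by (auto simp: bil_sum[where p = p and q = q] sum.distrib algebra_simps)

lemma bil_smult_mat:
  assumes "A \<in> carrier_mat p q" "u \<in> carrier_vec p" "v \<in> carrier_vec q"
  shows "bil (k \<cdot>\<^sub>m A) u v = k * bil A u v"
  using assms by (auto simp: bil_sum[where p = p and q = q] sum_distrib_left algebra_simps)

lemma bil_one_mat:
  assumes "u \<in> carrier_vec p" "v \<in> carrier_vec p"
  shows "bil (1\<^sub>m p) u v = u \<bullet> v"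
  using assms by (simp add: bil_def)

lemma bil_transpose:
  assumes "A \<in> carrier_mat p q" "u \<in> carrier_vec p" "v \<in> carrier_vec q"
  shows "bil (transpose_mat A) v u = bil A u v"
proof -
  have "bil (transpose_mat A) v u = (\<Sum>j<q. \<Sum>i<p. v $ j * transpose_mat A $$ (j, i) * u $ i)"
    using assms by (intro bil_sum) auto
  also have "\<dots> = (\<Sum>i<p. \<Sum>j<q. v $ j * transpose_mat A $$ (j, i) * u $ i)"
    by (rule sum.swap)
  finally show ?thesis
    unfolding bil_sum[OF assms] using assms by (auto intro!: sum.cong)
qed

lemma bil_mult_right:
  assumes "A \<in> carrier_mat p q" "B \<in> carrier_mat q r" "u \<in> carrier_vec p" "v \<in> carrier_vec r"
  shows "bil (A * B) u v = bil A u (B *\<^sub>v v)"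
  using assms by (simp add: bil_def)

section \<open>Norms, sparsity and l1 duality\<close>

lemma scalar_prod_self: "v \<bullet> v = (\<Sum>j<dim_vec v. (v $ j)\<^sup>2)" for v :: "real vec"
  by (simp add: scalar_prod_def power2_eq_square atLeast0LessThan)

lemma scalar_prod_self_nonneg [simp]: "0 \<le> v \<bullet> v" for v :: "real vec"
  by (simp add: scalar_prod_self sum_nonneg)

lemma l2_norm_alt: "l2_norm v = sqrt (v \<bullet> v)"
  by (simp add: l2_norm_def scalar_prod_self)

lemma l2_norm_sq: "(l2_norm v)\<^sup>2 = v \<bullet> v"
  by (simp add: l2_norm_alt)

lemma l2_norm_nonneg [simp]: "0 \<le> l2_norm v"
  by (simp add: l2_norm_alt)

lemma l1_norm_nonneg [simp]: "0 \<le> l1_norm v"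
  by (simp add: l1_norm_def sum_nonneg)

lemma l2_norm_smult: "l2_norm (k \<cdot>\<^sub>v v) = \<bar>k\<bar> * l2_norm v"
  by (simp add: l2_norm_def power_mult_distrib real_sqrt_mult flip: sum_distrib_left)

lemma l1_norm_smult: "l1_norm (k \<cdot>\<^sub>v v) = \<bar>k\<bar> * l1_norm v"
  by (simp add: l1_norm_def abs_mult sum_distrib_left)

lemma l1_norm_add_le:
  "u \<in> carrier_vec p \<Longrightarrow> v \<in> carrier_vec p \<Longrightarrow> l1_norm (u + v) \<le> l1_norm u + l1_norm v"
  unfolding l1_norm_def using sum_mono[of "{..<p}" "\<lambda>j. \<bar>u $ j + v $ j\<bar>" "\<lambda>j. \<bar>u $ j\<bar> + \<bar>v $ j\<bar>"]
  by (auto simp: sum.distrib)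

lemma l2_norm_add_le:
  assumes "u \<in> carrier_vec p" "v \<in> carrier_vec p"
  shows "l2_norm (u + v) \<le> l2_norm u + l2_norm v"
proof -
  have "l2_norm (u + v) = L2_set (\<lambda>i. u $ i + v $ i) {..<p}"
    using assms by (auto simp: l2_norm_def L2_set_def)
  also have "\<dots> \<le> L2_set (\<lambda>i. u $ i) {..<p} + L2_set (\<lambda>i. v $ i) {..<p}"
    by (rule L2_set_triangle_ineq)
  finally show ?thesis using assms by (simp add: l2_norm_def L2_set_def)
qed

lemma l2_norm_le_l1_norm: "l2_norm v \<le> l1_norm v"
  using L2_set_le_sum_abs[of "\<lambda>i. v $ i" "{..<dim_vec v}"] by (simp add: l2_norm_def l1_norm_def L2_set_def)

lemma abs_index_le_l2_norm:
  assumes "j < dim_vec v"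
  shows "\<bar>v $ j\<bar> \<le> l2_norm v"
proof -
  have "\<bar>v $ j\<bar> = sqrt ((v $ j)\<^sup>2)" by simp
  also have "\<dots> \<le> l2_norm v"
    unfolding l2_norm_def using assms by (intro real_sqrt_le_mono member_le_sum) auto
  finally show ?thesis .
qed

text \<open>Cauchy-Schwarz on the support, against the constant 1.\<close>

lemma l1_norm_sparse_le:
  assumes v: "v \<in> carrier_vec p" and card: "card {j. j < p \<and> v $ j \<noteq> 0} \<le> k"
  shows "l1_norm v \<le> sqrt (real k) * l2_norm v"
proof -
  let ?S = "{j. j < p \<and> v $ j \<noteq> 0}"
  have fin: "finite ?S" by simp
  have "l1_norm v = (\<Sum>j\<in>?S. \<bar>v $ j\<bar>)"
    unfolding l1_norm_def using v by (intro sum.mono_neutral_right) auto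
  also have "\<dots> = (\<Sum>j\<in>?S. \<bar>1\<bar> * \<bar>v $ j\<bar>)" by simp
  also have "\<dots> \<le> L2_set (\<lambda>_. 1) ?S * L2_set (\<lambda>j. v $ j) ?S"
    by (rule L2_set_mult_ineq)
  also have "L2_set (\<lambda>_. 1) ?S = sqrt (real (card ?S))" by (simp add: L2_set_def)
  also have "sqrt (real (card ?S)) * L2_set (\<lambda>j. v $ j) ?S \<le> sqrt (real k) * l2_norm v"
    using card v unfolding l2_norm_def L2_set_def
    by (intro mult_mono real_sqrt_le_mono sum_mono2) (auto simp: sum_nonneg)
  finally show ?thesis .
qed

text \<open>Hoelder's inequality for the pair of the maximum norm and the l1 norm.\<close>

lemma scalar_prod_unit_expand:
  fixes w :: "real vec"
  assumes "w \<in> carrier_vec p" "v \<in> carrier_vec p" "\<And>k. k < p \<Longrightarrow> \<bar>w $ k\<bar> \<le> e"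
  shows "\<bar>w \<bullet> v\<bar> \<le> e * l1_norm v"
proof -
  have "\<bar>w \<bullet> v\<bar> \<le> (\<Sum>k<p. \<bar>w $ k\<bar> * \<bar>v $ k\<bar>)"
    using assms by (auto simp: scalar_prod_def atLeast0LessThan abs_mult[symmetric] intro: sum_abs)
  also have "\<dots> \<le> (\<Sum>k<p. e * \<bar>v $ k\<bar>)"
    using assms by (intro sum_mono mult_right_mono) auto
  finally show ?thesis using assms by (simp add: l1_norm_def sum_distrib_left)
qed

text \<open>The values at unit vectors are the entries of the transpose of \<open>A\<close> applied
  to \<open>u\<close>, so Hoelder's inequality applies. A form that is small only entrywise is
  thereby controlled on arbitrary vectors, at the price of an l1 norm.\<close>

lemma bil_le_l1_right:
  assumes A: "A \<in> carrier_mat p q" and u: "u \<in> carrier_vec p" and v: "v \<in> carrier_vec q"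
    and e: "\<And>k. k < q \<Longrightarrow> \<bar>bil A u (unit_vec q k)\<bar> \<le> e"
  shows "\<bar>bil A u v\<bar> \<le> e * l1_norm v"
proof -
  have eq: "bil A u v' = (transpose_mat A *\<^sub>v u) \<bullet> v'" if "v' \<in> carrier_vec q" for v'
    using bil_transpose[OF A u that] A u that
    by (simp add: bil_def comm_scalar_prod[of _ q])
  have "(transpose_mat A *\<^sub>v u) $ k = bil A u (unit_vec q k)" if "k < q" for k
    using eq[of "unit_vec q k"] that A u by (simp add: scalar_prod_right_unit del: index_mult_mat_vec)
  then show ?thesis
    unfolding eq[OF v] using A u v e by (intro scalar_prod_unit_expand) (auto simp del: index_mult_mat_vec)
qed

lemma bil_le_l1_left:
  assumes A: "A \<in> carrier_mat p q" and u: "u \<in> carrier_vec p" and v: "v \<in> carrier_vec q"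
    and e: "\<And>k. k < p \<Longrightarrow> \<bar>bil A (unit_vec p k) v\<bar> \<le> e"
  shows "\<bar>bil A u v\<bar> \<le> e * l1_norm u"
  using bil_le_l1_right[of "transpose_mat A" q p v u e] assms bil_transpose[OF A _ v] by simp

lemma bil_le_l1_l1:
  assumes A: "A \<in> carrier_mat p q" and u: "u \<in> carrier_vec p" and v: "v \<in> carrier_vec q"
    and e: "\<And>j k. j < p \<Longrightarrow> k < q \<Longrightarrow> \<bar>bil A (unit_vec p j) (unit_vec q k)\<bar> \<le> e"
  shows "\<bar>bil A u v\<bar> \<le> e * l1_norm u * l1_norm v"
proof -
  have "\<bar>bil A u (unit_vec q k)\<bar> \<le> e * l1_norm u" if "k < q" for k
    using bil_le_l1_left[OF A u, of "unit_vec q k" e] e that by simp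
  then show ?thesis using bil_le_l1_right[OF A u v] by simp
qed

section \<open>Semidefinite forms and extremal eigenvalues\<close>

lemma mat_inverse_exists:
  fixes A :: "real mat"
  assumes A: "A \<in> carrier_mat n n"
    and inj: "\<And>v. v \<in> carrier_vec n \<Longrightarrow> A *\<^sub>v v = 0\<^sub>v n \<Longrightarrow> v = 0\<^sub>v n"
  shows "\<exists>B. mat_inverse A = Some B \<and> A * B = 1\<^sub>m n \<and> B * A = 1\<^sub>m n \<and> B \<in> carrier_mat n n"
proof -
  have "det A \<noteq> 0"
    using inj unfolding det_0_iff_vec_prod_zero_field[OF A] by blast
  then have "A \<in> Units (ring_mat TYPE(real) n ())"
    by (rule det_non_zero_imp_unit[OF A])
  then obtain B where "mat_inverse A = Some B"
    using mat_inverse(1)[OF A, of "()"] by (cases "mat_inverse A") auto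
  then show ?thesis using mat_inverse(2)[OF A] by blast
qed

text \<open>Evaluate at the minimiser \<open>- b / c\<close>; for \<open>c = 0\<close> an affine
  function without sign change is constant. Stated for scalars so that it serves both a single
  symmetric matrix and the cross-covariance, where three different matrices supply the
  coefficients.\<close>

lemma quadratic_nonneg_discriminant:
  fixes a b c :: real
  assumes "\<And>s. 0 \<le> a + 2 * s * b + s\<^sup>2 * c" and c: "c \<ge> 0"
  shows "b\<^sup>2 \<le> a * c"
proof (cases "c = 0")
  case True
  have "b = 0"
  proof (rule ccontr)
    assume "b \<noteq> 0"
    \<comment> \<open>At this point the affine function takes the value -1.\<close>
    then show False using assms(1)[of "- (a + 1) / (2 * b)"] True by (simp add: field_simps)
  qed
  then show ?thesis using True by simp
next
  case False
  have "0 \<le> a + 2 * (- b / c) * b + (- b / c)\<^sup>2 * c" by (rule assms(1))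
  also have "\<dots> = (a * c - b\<^sup>2) / c" using False by (simp add: field_simps power2_eq_square)
  finally show ?thesis using c False by (simp add: zero_le_divide_iff)
qed

lemma bil_cauchy_schwarz:
  assumes A: "A \<in> carrier_mat n n" and sym: "transpose_mat A = A"
    and psd: "\<And>v. v \<in> carrier_vec n \<Longrightarrow> 0 \<le> bil A v v"
    and u: "u \<in> carrier_vec n" and v: "v \<in> carrier_vec n"
  shows "(bil A u v)\<^sup>2 \<le> bil A u u * bil A v v"
proof (rule quadratic_nonneg_discriminant)
  fix s :: real
  have "bil A v u = bil A u v" using bil_transpose[OF A u v] sym by simp
  moreover have "bil A (u + s \<cdot>\<^sub>v v) (u + s \<cdot>\<^sub>v v) = bil A u u + s * bil A u v + s * (bil A v u + s * bil A v v)"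
    using A u v by (simp add: bil_linear[where p = n and q = n] algebra_simps)
  ultimately show "0 \<le> bil A u u + 2 * s * bil A u v + s\<^sup>2 * bil A v v"
    using psd[of "u + s \<cdot>\<^sub>v v"] u v by (simp add: algebra_simps power2_eq_square)
qed (use psd v in auto)

text \<open>Crude, but it supplies the two finiteness facts of the Rayleigh argument: the quotients
  are bounded below, and the form of the inverse is bounded on the unit sphere.\<close>

lemma bil_self_bounded:
  assumes A: "A \<in> carrier_mat n n"
  shows "\<exists>C. \<forall>v. v \<in> carrier_vec n \<longrightarrow> v \<bullet> v = 1 \<longrightarrow> \<bar>bil A v v\<bar> \<le> C"
proof (intro exI allI impI)
  fix v :: "real vec" assume v: "v \<in> carrier_vec n" "v \<bullet> v = 1"
  have v1: "\<bar>v $ i\<bar> \<le> 1" if "i < n" for i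
    using abs_index_le_l2_norm[of i v] that v by (simp add: l2_norm_alt)
  have "\<bar>bil A v v\<bar> \<le> (\<Sum>i<n. \<Sum>j<n. \<bar>v $ i * A $$ (i, j) * v $ j\<bar>)"
    unfolding bil_sum[OF A v(1) v(1)] by (intro order_trans[OF sum_abs] sum_mono sum_abs)
  also have "\<dots> \<le> (\<Sum>i<n. \<Sum>j<n. 1 * \<bar>A $$ (i, j)\<bar> * 1)"
    unfolding abs_mult using v1 by (intro sum_mono mult_mono) auto
  finally show "\<bar>bil A v v\<bar> \<le> (\<Sum>i<n. \<Sum>j<n. 1 * \<bar>A $$ (i, j)\<bar> * 1)" .
qed

text \<open>The infimum \<open>t\<close> of the Rayleigh quotient is an eigenvalue: otherwise \<open>A - t\<close> would be positive
  semidefinite and invertible, and Cauchy-Schwarz for its form would bound it away from \<open>0\<close>.\<close>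

lemma eigenvalue_bound_imp_form_bound:
  assumes A: "A \<in> carrier_mat n n" and sym: "transpose_mat A = A"
    and eig: "\<And>e. eigenvalue A e \<Longrightarrow> m \<le> e" and v: "v \<in> carrier_vec n"
  shows "m * (v \<bullet> v) \<le> bil A v v"
proof (cases "v \<bullet> v = 0")
  case True
  then have "v = 0\<^sub>v n"
    using v by (auto simp: scalar_prod_self sum_nonneg_eq_0_iff)
  then show ?thesis using True A by (simp add: bil_def)
next
  case nz: False
  define R where "R = {bil A v v | v. v \<in> carrier_vec n \<and> v \<bullet> v = 1}"
  define t where "t = Inf R"
  have normalize: "\<exists>v'. v' \<in> carrier_vec n \<and> v' \<bullet> v' = 1 \<and> bil A v v = (v \<bullet> v) * bil A v' v'"
    if "v \<in> carrier_vec n" "v \<bullet> v \<noteq> 0" for v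
  proof (intro exI conjI)
    let ?k = "1 / sqrt (v \<bullet> v)"
    have k: "?k * ?k = 1 / (v \<bullet> v)" by (simp add: power2_eq_square[symmetric] power_divide)
    show "?k \<cdot>\<^sub>v v \<in> carrier_vec n" using that by simp
    show "(?k \<cdot>\<^sub>v v) \<bullet> (?k \<cdot>\<^sub>v v) = 1"
      using that k by (simp add: mult.assoc[symmetric])
    show "bil A v v = (v \<bullet> v) * bil A (?k \<cdot>\<^sub>v v) (?k \<cdot>\<^sub>v v)"
      using that A k by (simp add: bil_linear[where p = n and q = n] mult.assoc[symmetric])
  qed
  obtain C where C: "\<And>v. v \<in> carrier_vec n \<Longrightarrow> v \<bullet> v = 1 \<Longrightarrow> \<bar>bil A v v\<bar> \<le> C"
    using bil_self_bounded[OF A] by blast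
  have bdd: "bdd_below R"
    unfolding R_def by (rule bdd_belowI[of _ "- C"]) (use C in \<open>auto simp: abs_le_iff\<close>, force)
  have ne: "R \<noteq> {}" using normalize[OF v nz] by (auto simp: R_def)
  have t_le: "t * (v \<bullet> v) \<le> bil A v v" if v: "v \<in> carrier_vec n" for v
  proof (cases "v \<bullet> v = 0")
    case True
    then have "v = 0\<^sub>v n"
      using v by (auto simp: scalar_prod_self sum_nonneg_eq_0_iff)
    then show ?thesis using True A by (simp add: bil_def)
  next
    case False
    obtain v' where v': "v' \<in> carrier_vec n" "v' \<bullet> v' = 1" "bil A v v = (v \<bullet> v) * bil A v' v'"
      using normalize[OF v False] by blast
    have "t \<le> bil A v' v'"
      unfolding t_def using bdd v' by (intro cInf_lower) (auto simp: R_def)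
    then show ?thesis using mult_left_mono[of t "bil A v' v'" "v \<bullet> v"] v' by (simp add: mult.commute)
  qed
  have "eigenvalue A t"
  proof (rule ccontr)
    assume no: "\<not> eigenvalue A t"
    define B where "B = A + (- t) \<cdot>\<^sub>m 1\<^sub>m n"
    have B: "B \<in> carrier_mat n n" using A by (simp add: B_def)
    have Bv: "B *\<^sub>v v = A *\<^sub>v v + (- t) \<cdot>\<^sub>v v" if "v \<in> carrier_vec n" for v
      unfolding B_def using A that
      by (subst add_mult_distrib_mat_vec[of _ n n]) (auto intro!: eq_vecI)
    have Bform: "bil B u v = bil A u v - t * (u \<bullet> v)" if "u \<in> carrier_vec n" "v \<in> carrier_vec n" for u v
      using that A by (simp add: B_def bil_add_mat[of _ n n] bil_smult_mat[of _ n n] bil_one_mat)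
    have "B *\<^sub>v v = 0\<^sub>v n \<Longrightarrow> v = 0\<^sub>v n" if v: "v \<in> carrier_vec n" for v
    proof (rule ccontr)
      assume 0: "B *\<^sub>v v = 0\<^sub>v n" "v \<noteq> 0\<^sub>v n"
      have "A *\<^sub>v v = t \<cdot>\<^sub>v v"
      proof (rule eq_vecI)
        fix i assume i: "i < dim_vec (t \<cdot>\<^sub>v v)"
        have "(A *\<^sub>v v + (- t) \<cdot>\<^sub>v v) $ i = 0"
          using 0 Bv[OF v] i v by simp
        then show "(A *\<^sub>v v) $ i = (t \<cdot>\<^sub>v v) $ i"
          using i v A by simp
      qed (use A v in auto)
      then have "eigenvalue A t"
        using 0 v A unfolding eigenvalue_def eigenvector_def by auto
      then show False using no by simp
    qed
    from mat_inverse_exists[OF B this] obtain G where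
      G: "B * G = 1\<^sub>m n" "G \<in> carrier_mat n n" by blast
    obtain D where D: "\<And>v. v \<in> carrier_vec n \<Longrightarrow> v \<bullet> v = 1 \<Longrightarrow> \<bar>bil G v v\<bar> \<le> D"
      using bil_self_bounded[OF G(2)] by blast
    \<comment> \<open>The maximum with 1 makes \<open>1 / D'\<close> a positive amount.\<close>
    define D' where "D' = max D 1"
    have symB: "transpose_mat B = B"
    proof (rule eq_matI)
      fix i j assume "i < dim_row B" "j < dim_col B"
      moreover have "A $$ (j, i) = A $$ (i, j)" if "i < n" "j < n"
        using arg_cong[OF sym, of "\<lambda>A. A $$ (i, j)"] that A by simp
      ultimately show "transpose_mat B $$ (i, j) = B $$ (i, j)"
        using A by (auto simp: B_def)
    qed (use B in auto)
    have "t + 1 / D' \<le> Inf R"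
    proof (rule cInf_greatest[OF ne])
      fix x assume "x \<in> R"
      then obtain v where v: "v \<in> carrier_vec n" "v \<bullet> v = 1" and x: "x = bil A v v"
        by (auto simp: R_def)
      have BGv: "B *\<^sub>v (G *\<^sub>v v) = v"
        using B G v by (simp flip: assoc_mult_mat_vec)
      \<comment> \<open>Cauchy-Schwarz for the form of \<open>B\<close> between \<open>v\<close> and
        \<open>G v\<close>: as \<open>B\<close> maps \<open>G v\<close> to \<open>v\<close>, the
        left side is 1 and the second factor is the form of \<open>G\<close> at \<open>v\<close>.
        This bounds the form of \<open>B\<close> at \<open>v\<close> from below by
        \<open>1 / D'\<close>.\<close>
      have "1 = (bil B v (G *\<^sub>v v))\<^sup>2"
        using BGv v by (simp add: bil_def)
      also have "\<dots> \<le> bil B v v * bil B (G *\<^sub>v v) (G *\<^sub>v v)"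
        using t_le Bform by (intro bil_cauchy_schwarz[OF B symB] v) (use G v in auto)
      also have "bil B (G *\<^sub>v v) (G *\<^sub>v v) = bil G v v"
        using BGv v G by (simp add: bil_def comm_scalar_prod[of _ n])
      also have "bil B v v = x - t" using Bform[OF v(1) v(1)] v x by simp
      also have "(x - t) * bil G v v \<le> (x - t) * D'"
        using D[OF v] t_le[OF v(1)] v x by (intro mult_left_mono) (auto simp: D'_def)
      finally have "1 \<le> (x - t) * D'" .
      then have "1 / D' \<le> x - t" by (simp add: D'_def field_simps)
      then show "t + 1 / D' \<le> x" by simp
    qed
    then show False by (simp add: t_def[symmetric] D'_def)
  qed
  then have "m \<le> t" by (rule eig)
  then have "m * (v \<bullet> v) \<le> t * (v \<bullet> v)" by (intro mult_right_mono) auto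
  then show ?thesis using t_le[OF v] by simp
qed

text \<open>The lower bound applied to the negative of \<open>A\<close>, whose eigenvalues are the
  negatives of those of \<open>A\<close>.\<close>

lemma eigenvalue_bound_imp_form_bound_upper:
  assumes A: "A \<in> carrier_mat n n" and sym: "transpose_mat A = A"
    and eig: "\<And>e. eigenvalue A e \<Longrightarrow> e \<le> m" and v: "v \<in> carrier_vec n"
  shows "bil A v v \<le> m * (v \<bullet> v)"
proof -
  have "- m \<le> e" if e: "eigenvalue (- 1 \<cdot>\<^sub>m A) e" for e
  proof -
    obtain w where w: "w \<in> carrier_vec n" "w \<noteq> 0\<^sub>v n" "(- 1 \<cdot>\<^sub>m A) *\<^sub>v w = e \<cdot>\<^sub>v w"
      using e A unfolding eigenvalue_def eigenvector_def by auto
    have "A *\<^sub>v w = (- e) \<cdot>\<^sub>v w"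
    proof (rule eq_vecI)
      fix i assume i: "i < dim_vec ((- e) \<cdot>\<^sub>v w)"
      have "((- 1 \<cdot>\<^sub>m A) *\<^sub>v w) $ i = - ((A *\<^sub>v w) $ i)"
        using i w(1) A by (simp add: scalar_prod_def sum_negf)
      then show "(A *\<^sub>v w) $ i = ((- e) \<cdot>\<^sub>v w) $ i"
        using i w A by simp
    qed (use A w in auto)
    then have "eigenvalue A (- e)"
      using w A unfolding eigenvalue_def eigenvector_def by auto
    then show ?thesis using eig by fastforce
  qed
  moreover have "transpose_mat (- 1 \<cdot>\<^sub>m A) = - 1 \<cdot>\<^sub>m A"
  proof (rule eq_matI)
    fix i j assume "i < dim_row (- 1 \<cdot>\<^sub>m A)" "j < dim_col (- 1 \<cdot>\<^sub>m A)"
    moreover have "A $$ (j, i) = A $$ (i, j)" if "i < n" "j < n"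
      using arg_cong[OF sym, of "\<lambda>A. A $$ (i, j)"] that A by simp
    ultimately show "transpose_mat (- 1 \<cdot>\<^sub>m A) $$ (i, j) = (- 1 \<cdot>\<^sub>m A) $$ (i, j)"
      using A by auto
  qed (use A in auto)
  ultimately have "- m * (v \<bullet> v) \<le> bil (- 1 \<cdot>\<^sub>m A) v v"
    using A v by (intro eigenvalue_bound_imp_form_bound[where n = n]) auto
  then show ?thesis using A v by (simp add: bil_smult_mat[of _ n n])
qed

section \<open>Population covariance forms\<close>

lemma bil_outer:
  assumes "A \<in> carrier_mat p q" "B \<in> carrier_mat q' p'" "a \<in> carrier_vec q" "b \<in> carrier_vec q'"
    and "u \<in> carrier_vec p" "v \<in> carrier_vec p'"
  shows "bil (A * outer a b * B) u v = bil A u a * bil B b v"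
proof -
  have o: "outer a b \<in> carrier_mat q q'" using assms by (auto simp: outer_def)
  have 1: "outer a b *\<^sub>v w = (b \<bullet> w) \<cdot>\<^sub>v a" if "w \<in> carrier_vec q'" for w
    using assms that
    by (intro eq_vecI) (auto simp: outer_def scalar_prod_def row_def sum_distrib_left sum_distrib_right mult_ac intro!: sum.cong)
  have "bil (A * outer a b * B) u v = bil A u (outer a b *\<^sub>v (B *\<^sub>v v))"
    by (simp only: bil_def assoc_mult_mat_vec[OF mult_carrier_mat[OF assms(1) o] assms(2,6)]
        assoc_mult_mat_vec[OF assms(1) o mult_mat_vec_carrier[OF assms(2,6)]])
  also have "\<dots> = bil A u ((b \<bullet> (B *\<^sub>v v)) \<cdot>\<^sub>v a)"
    using 1[OF mult_mat_vec_carrier[OF assms(2,6)]] by simp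
  also have "\<dots> = (b \<bullet> (B *\<^sub>v v)) * bil A u a"
    by (rule bil_smult_right[OF assms(1,5,5,3,3)])
  also have "\<dots> = bil A u a * bil B b v"
    by (simp add: bil_def)
  finally show ?thesis .
qed

text \<open>Forms of an empirical covariance are sample means of products of linear functionals, the
  shape to which the concentration bound applies.\<close>

lemma bil_emp_cov:
  assumes "\<And>l. l < n \<Longrightarrow> x l \<in> carrier_vec p" "\<And>l. l < n \<Longrightarrow> y l \<in> carrier_vec q"
    and u: "u \<in> carrier_vec p" and v: "v \<in> carrier_vec q"
  shows "bil (emp_cov n p q x y) u v = (\<Sum>l<n. (u \<bullet> x l) * (v \<bullet> y l)) / real n"
proof -
  have "bil (emp_cov n p q x y) u v = (\<Sum>j<p. \<Sum>k<q. u $ j * ((\<Sum>l<n. x l $ j * y l $ k) / real n) * v $ k)"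
    by (subst bil_sum[OF _ u v]) (auto simp: emp_cov_def)
  also have "\<dots> = (\<Sum>j<p. \<Sum>k<q. \<Sum>l<n. (u $ j * x l $ j) * (v $ k * y l $ k) / real n)"
    by (intro sum.cong refl) (simp add: sum_distrib_left sum_distrib_right sum_divide_distrib mult_ac)
  also have "\<dots> = (\<Sum>j<p. \<Sum>l<n. \<Sum>k<q. (u $ j * x l $ j) * (v $ k * y l $ k) / real n)"
    by (intro sum.cong refl sum.swap)
  also have "\<dots> = (\<Sum>l<n. \<Sum>j<p. \<Sum>k<q. (u $ j * x l $ j) * (v $ k * y l $ k) / real n)"
    by (rule sum.swap)
  also have "\<dots> = (\<Sum>l<n. (\<Sum>j<p. u $ j * x l $ j) * (\<Sum>k<q. v $ k * y l $ k) / real n)"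
    by (simp add: sum_product sum_divide_distrib)
  also have "\<dots> = (\<Sum>l<n. (u \<bullet> x l) * (v \<bullet> y l) / real n)"
    using assms(1,2)[THEN carrier_vecD] by (intro sum.cong) (auto simp: scalar_prod_def atLeast0LessThan)
  finally show ?thesis by (simp add: sum_divide_distrib)
qed

lemma bil_cov_mat:
  assumes X: "X \<in> measurable M (borel_vec p)" and Y: "Y \<in> measurable M (borel_vec q)"
    and X0: "\<And>j. j < p \<Longrightarrow> integral\<^sup>L M (\<lambda>\<omega>. X \<omega> $ j) = 0" and Y0: "\<And>k. k < q \<Longrightarrow> integral\<^sup>L M (\<lambda>\<omega>. Y \<omega> $ k) = 0"
    and int: "\<And>j k. j < p \<Longrightarrow> k < q \<Longrightarrow> integrable M (\<lambda>\<omega>. X \<omega> $ j * Y \<omega> $ k)"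
    and u: "u \<in> carrier_vec p" and v: "v \<in> carrier_vec q"
  shows "bil (cov_mat M p q X Y) u v = integral\<^sup>L M (\<lambda>\<omega>. (u \<bullet> X \<omega>) * (v \<bullet> Y \<omega>))"
proof -
  have "bil (cov_mat M p q X Y) u v
      = (\<Sum>j<p. \<Sum>k<q. u $ j * integral\<^sup>L M (\<lambda>\<omega>. X \<omega> $ j * Y \<omega> $ k) * v $ k)"
    by (subst bil_sum[OF _ u v]) (auto simp: cov_mat_def X0 Y0)
  also have "\<dots> = (\<Sum>j<p. \<Sum>k<q. integral\<^sup>L M (\<lambda>\<omega>. u $ j * (X \<omega> $ j * Y \<omega> $ k) * v $ k))"
    by simp
  also have "\<dots> = integral\<^sup>L M (\<lambda>\<omega>. \<Sum>j<p. \<Sum>k<q. u $ j * (X \<omega> $ j * Y \<omega> $ k) * v $ k)"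
    using int by (subst Bochner_Integration.integral_sum, force)+ (auto intro!: sum.cong)
  also have "\<dots> = integral\<^sup>L M (\<lambda>\<omega>. (u \<bullet> X \<omega>) * (v \<bullet> Y \<omega>))"
  proof (rule Bochner_Integration.integral_cong[OF refl])
    fix \<omega> assume "\<omega> \<in> space M"
    then have "X \<omega> \<in> carrier_vec p" "Y \<omega> \<in> carrier_vec q"
      using X Y unfolding measurable_borel_vec_iff by auto
    then show "(\<Sum>j<p. \<Sum>k<q. u $ j * (X \<omega> $ j * Y \<omega> $ k) * v $ k) = (u \<bullet> X \<omega>) * (v \<bullet> Y \<omega>)"
      by (auto simp: scalar_prod_def atLeast0LessThan sum_product mult_ac intro!: sum.cong)
  qed
  finally show ?thesis .
qed

lemma measurable_scalar_prod_vec: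
  assumes "X \<in> measurable M (borel_vec p)"
  shows "(\<lambda>\<omega>. u \<bullet> X \<omega>) \<in> borel_measurable M"
proof -
  have "(\<lambda>\<omega>. u \<bullet> X \<omega>) \<in> borel_measurable M \<longleftrightarrow> (\<lambda>\<omega>. \<Sum>j<p. u $ j * X \<omega> $ j) \<in> borel_measurable M"
    using assms by (intro measurable_cong) (auto simp: measurable_borel_vec_iff scalar_prod_def atLeast0LessThan Pi_def)
  moreover have "(\<lambda>\<omega>. \<Sum>j<p. u $ j * X \<omega> $ j) \<in> borel_measurable M"
    using assms by (intro borel_measurable_sum borel_measurable_times) (auto simp: measurable_borel_vec_iff)
  ultimately show ?thesis by simp
qed

section \<open>Sub-Gaussian scale of linear functionals\<close>

lemma subgaussian_mono:
  assumes M: "prob_space M" and f: "subgaussian M c f" and c: "0 < c" and g: "g \<in> borel_measurable M"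
    and le: "\<And>\<omega>. \<omega> \<in> space M \<Longrightarrow> (g \<omega>)\<^sup>2 / c' \<le> (f \<omega>)\<^sup>2 / c"
  shows "subgaussian M c' g"
proof -
  have int: "integrable M (\<lambda>\<omega>. exp ((f \<omega>)\<^sup>2 / c))" using f by (simp add: subgaussian_def)
  have i: "integrable M (\<lambda>\<omega>. exp ((g \<omega>)\<^sup>2 / c'))"
    by (rule Bochner_Integration.integrable_bound[OF int]) (use g le in auto)
  then have "integral\<^sup>L M (\<lambda>\<omega>. exp ((g \<omega>)\<^sup>2 / c')) \<le> integral\<^sup>L M (\<lambda>\<omega>. exp ((f \<omega>)\<^sup>2 / c))"
    using int le by (intro integral_mono) auto
  then show ?thesis using f g i by (simp add: subgaussian_def)
qed

text \<open>The norm is an infimum over admissible \<open>t\<close>, so a level strictly above it is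
  needed to find one. The summand 1 provides the room, and \<open>max K 0\<close> covers a negative
  \<open>K\<close>.\<close>

lemma subgaussian_psi2:
  assumes M: "prob_space M" and Z: "Z \<in> borel_measurable M" and psi: "psi2_norm M Z \<le> ennreal K"
  shows "subgaussian M ((max K 0 + 1)\<^sup>2) Z"
proof -
  interpret prob_space M by fact
  have "psi2_norm M Z < ennreal (max K 0 + 1)"
    by (rule le_less_trans[OF psi]) (auto simp: ennreal_less_iff max_def intro: ennreal_lessI)
  then obtain t where t: "t > 0" "ennreal t < ennreal (max K 0 + 1)"
     "(\<integral>\<^sup>+ \<omega>. ennreal (exp ((Z \<omega>)\<^sup>2 / t\<^sup>2)) \<partial>M) \<le> 2"
    unfolding psi2_norm_def Inf_less_iff by auto
  have tK: "t < max K 0 + 1" using t(2) unfolding ennreal_less_iff[OF less_imp_le[OF t(1)]] .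
  have int: "integrable M (\<lambda>\<omega>. exp ((Z \<omega>)\<^sup>2 / t\<^sup>2))"
    using t(3) Z by (intro integrableI_nonneg) (auto simp: ennreal_numeral[symmetric] intro: le_less_trans simp del: ennreal_numeral)
  have "ennreal (expectation (\<lambda>\<omega>. exp ((Z \<omega>)\<^sup>2 / t\<^sup>2))) \<le> ennreal 2"
    using t(3) nn_integral_eq_integral[OF int] by simp
  then have "expectation (\<lambda>\<omega>. exp ((Z \<omega>)\<^sup>2 / t\<^sup>2)) \<le> 2"
    by (subst (asm) ennreal_le_iff) auto
  then have "subgaussian M (t\<^sup>2) Z"
    using int Z by (simp add: subgaussian_def)
  then show ?thesis
  proof (rule subgaussian_mono[OF M _ _ Z])
    show "(Z \<omega>)\<^sup>2 / (max K 0 + 1)\<^sup>2 \<le> (Z \<omega>)\<^sup>2 / t\<^sup>2" for \<omega>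
      using t tK by (intro divide_left_mono power_mono mult_pos_pos) auto
  qed (use t in auto)
qed

text \<open>The vector norm is a supremum over unit vectors. Other directions are rescaled, with
  \<open>L\<close> bounding the squared length; the zero direction is treated apart because it
  cannot be normalised.\<close>

lemma subgaussian_psi2_vec:
  assumes M: "prob_space M" and X: "X \<in> measurable M (borel_vec p)" and psi: "psi2_norm_vec M p X \<le> ennreal K"
    and u: "u \<in> carrier_vec p" "u \<bullet> u \<le> L" and L: "L > 0"
  shows "subgaussian M ((max K 0 + 1)\<^sup>2 * L) (\<lambda>\<omega>. u \<bullet> X \<omega>)"
proof (cases "u \<bullet> u = 0")
  case True
  interpret prob_space M by fact
  have "u = 0\<^sub>v p" using True u by (auto simp: scalar_prod_self sum_nonneg_eq_0_iff)
  then have "u \<bullet> X \<omega> = 0" if "\<omega> \<in> space M" for \<omega>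
    using X that by (auto simp: measurable_borel_vec_iff Pi_def)
  then have "subgaussian M ((max K 0 + 1)\<^sup>2 * L) (\<lambda>\<omega>. u \<bullet> X \<omega>) \<longleftrightarrow> subgaussian M ((max K 0 + 1)\<^sup>2 * L) (\<lambda>\<omega>. 0)"
    unfolding subgaussian_def
    by (intro arg_cong2[of _ _ _ _ "(\<and>)"] arg_cong2[of _ _ _ _ "(\<le>)"] measurable_cong Bochner_Integration.integrable_cong Bochner_Integration.integral_cong refl) auto
  then show ?thesis by (simp add: subgaussian_def prob_space)
next
  case False
  let ?k = "1 / sqrt (u \<bullet> u)"
  let ?u = "?k \<cdot>\<^sub>v u"
  have pos: "u \<bullet> u > 0" using False scalar_prod_self_nonneg[of u] by linarith
  have "l2_norm ?u = 1" using pos by (simp add: l2_norm_smult) (simp add: l2_norm_alt)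
  then have "psi2_norm M (\<lambda>\<omega>. ?u \<bullet> X \<omega>) \<le> psi2_norm_vec M p X"
    unfolding psi2_norm_vec_def using u by (intro SUP_upper) auto
  then have "subgaussian M ((max K 0 + 1)\<^sup>2) (\<lambda>\<omega>. ?u \<bullet> X \<omega>)"
    using psi by (intro subgaussian_psi2 M measurable_scalar_prod_vec[OF X]) auto
  then show ?thesis
  proof (rule subgaussian_mono[OF M])
    fix \<omega> assume "\<omega> \<in> space M"
    then have "X \<omega> \<in> carrier_vec p" using X by (auto simp: measurable_borel_vec_iff)
    then have "(?u \<bullet> X \<omega>)\<^sup>2 = (u \<bullet> X \<omega>)\<^sup>2 / (u \<bullet> u)"
      using u pos by (simp add: power_mult_distrib power_divide)
    then have "(?u \<bullet> X \<omega>)\<^sup>2 / (max K 0 + 1)\<^sup>2 = (u \<bullet> X \<omega>)\<^sup>2 / ((max K 0 + 1)\<^sup>2 * (u \<bullet> u))"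
      by simp
    moreover have "(u \<bullet> X \<omega>)\<^sup>2 / ((max K 0 + 1)\<^sup>2 * L) \<le> (u \<bullet> X \<omega>)\<^sup>2 / ((max K 0 + 1)\<^sup>2 * (u \<bullet> u))"
      using u pos L by (intro divide_left_mono mult_left_mono mult_pos_pos) auto
    ultimately show "(u \<bullet> X \<omega>)\<^sup>2 / ((max K 0 + 1)\<^sup>2 * L) \<le> (?u \<bullet> X \<omega>)\<^sup>2 / (max K 0 + 1)\<^sup>2" by simp
  qed (auto intro: measurable_scalar_prod_vec[OF X])
qed

lemma scalar_prod_zero_imp_zero:
  fixes v :: "real vec"
  assumes "v \<in> carrier_vec n" "v \<bullet> v \<le> 0"
  shows "v = 0\<^sub>v n"
proof -
  have "v \<bullet> v = 0" using assms(2) scalar_prod_self_nonneg[of v] by linarith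
  then show ?thesis using assms(1) by (auto simp: scalar_prod_self sum_nonneg_eq_0_iff)
qed

text \<open>\<open>a\<close> collects the products of \<open>h\<close> with the columns of
  \<open>U\<close> in the inner product of \<open>A\<close>, so \<open>U a\<close> is the projection
  of \<open>h\<close> onto their span, and the form at \<open>h - U a\<close> equals the form at
  \<open>h\<close> minus the squared length of \<open>a\<close>.\<close>

lemma bil_bessel:
  assumes A: "A \<in> carrier_mat p p" and sym: "transpose_mat A = A"
    and psd: "\<And>v. v \<in> carrier_vec p \<Longrightarrow> 0 \<le> bil A v v"
    and U: "U \<in> carrier_mat p r" and orth: "transpose_mat U * A * U = 1\<^sub>m r"
    and h: "h \<in> carrier_vec p"
  shows "(\<Sum>j<r. (bil A h (col U j))\<^sup>2) \<le> bil A h h"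
proof -
  define a where "a = transpose_mat (A * U) *\<^sub>v h"
  have AU: "A * U \<in> carrier_mat p r" using A U by simp
  have a: "a \<in> carrier_vec r" unfolding a_def using AU h by (intro mult_mat_vec_carrier[of _ r p]) auto
  have aj: "a $ j = bil A h (col U j)" if "j < r" for j
  proof -
    have "a $ j = col (A * U) j \<bullet> h" using that AU U by (simp add: a_def)
    also have "col (A * U) j = A *\<^sub>v col U j" by (rule col_mult2[OF A U that])
    finally show ?thesis using h A U that by (simp add: bil_def comm_scalar_prod[of _ p])
  qed
  let ?w = "U *\<^sub>v a"
  have w: "?w \<in> carrier_vec p" using U a by simp
  have 1: "bil A h ?w = a \<bullet> a"
  proof -
    have "bil A h ?w = bil (A * U) h a" using bil_mult_right[OF A U h a] by simp
    also have "\<dots> = bil (transpose_mat (A * U)) a h" using bil_transpose[OF AU h a] by simp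
    finally show ?thesis by (simp add: bil_def a_def)
  qed
  have 2: "bil A ?w h = a \<bullet> a" using 1 bil_transpose[OF A h w] sym by simp
  have 3: "bil A ?w ?w = a \<bullet> a"
  proof -
    have "bil A ?w ?w = bil (A * U) ?w a" using bil_mult_right[OF A U w a] by simp
    also have "\<dots> = bil (transpose_mat (A * U)) a ?w" using bil_transpose[OF AU w a] by simp
    also have "transpose_mat (A * U) = transpose_mat U * A" using A U sym by (simp add: transpose_mult[of _ p p])
    also have "bil (transpose_mat U * A) a ?w = bil (transpose_mat U * A * U) a a"
      using A U by (intro bil_mult_right[OF _ U a a, symmetric]) auto
    finally show ?thesis using orth a by (simp add: bil_one_mat)
  qed
  have "0 \<le> bil A (h + (- 1) \<cdot>\<^sub>v ?w) (h + (- 1) \<cdot>\<^sub>v ?w)" using h w by (intro psd) auto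
  also have "\<dots> = bil A h h - a \<bullet> a"
  proof -
    have "bil A (h + (- 1) \<cdot>\<^sub>v ?w) (h + (- 1) \<cdot>\<^sub>v ?w)
        = bil A h h + - 1 * bil A h ?w + (- 1 * bil A ?w h + - 1 * (- 1 * bil A ?w ?w))"
      using A h w by (simp only: bil_linear[of A p p] smult_carrier_vec add_carrier_vec)
        (simp add: bil_linear[of A p p])
    then show ?thesis by (simp add: 1 2 3)
  qed
  finally have "a \<bullet> a \<le> bil A h h" by simp
  also have "a \<bullet> a = (\<Sum>j<r. (bil A h (col U j))\<^sup>2)"
    using a aj by (simp add: scalar_prod_self)
  finally show ?thesis .
qed

section \<open>Covariance forms of the model and the canonical decomposition\<close>

context cca_model begin

lemma X_carrier: "\<omega> \<in> space (prob_sp C) \<Longrightarrow> pop_X C \<omega> \<in> carrier_vec (dim_x C)"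
  and Y_carrier: "\<omega> \<in> space (prob_sp C) \<Longrightarrow> pop_Y C \<omega> \<in> carrier_vec (dim_y C)"
  using meas_X meas_Y by (auto simp: measurable_borel_vec_iff)

lemma subgaussian_scalar_X:
  "u \<in> carrier_vec (dim_x C) \<Longrightarrow> u \<bullet> u \<le> L \<Longrightarrow> L > 0 \<Longrightarrow>
     subgaussian (prob_sp C) ((max K 0 + 1)\<^sup>2 * L) (\<lambda>\<omega>. u \<bullet> pop_X C \<omega>)"
  by (rule subgaussian_psi2_vec[OF prob_space_axioms meas_X subgaussian_X])

lemma subgaussian_scalar_Y:
  "u \<in> carrier_vec (dim_y C) \<Longrightarrow> u \<bullet> u \<le> L \<Longrightarrow> L > 0 \<Longrightarrow>
     subgaussian (prob_sp C) ((max K 0 + 1)\<^sup>2 * L) (\<lambda>\<omega>. u \<bullet> pop_Y C \<omega>)"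
  by (rule subgaussian_psi2_vec[OF prob_space_axioms meas_Y subgaussian_Y])

text \<open>\<open>subgaussian_product\<close> wants one scale for both factors, hence the maximum
  with the squared length \<open>L\<close> of the other direction; the summand 1 keeps it positive.
  The y-version has the maximum in the opposite order so that the scales of a mixed product coincide
  literally.\<close>

lemma subgaussian_scalar_X': "u \<in> carrier_vec (dim_x C) \<Longrightarrow>
     subgaussian (prob_sp C) ((max K 0 + 1)\<^sup>2 * (max (u \<bullet> u) L + 1)) (\<lambda>\<omega>. u \<bullet> pop_X C \<omega>)"
  using scalar_prod_self_nonneg[of u] max.cobounded1[of "u \<bullet> u" L]
  by (intro subgaussian_scalar_X, simp, linarith, linarith)

lemma subgaussian_scalar_Y': "u \<in> carrier_vec (dim_y C) \<Longrightarrow>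
     subgaussian (prob_sp C) ((max K 0 + 1)\<^sup>2 * (max L (u \<bullet> u) + 1)) (\<lambda>\<omega>. u \<bullet> pop_Y C \<omega>)"
  using scalar_prod_self_nonneg[of u] max.cobounded2[of "u \<bullet> u" L]
  by (intro subgaussian_scalar_Y, simp, linarith, linarith)

lemma scalar_const_pos: "0 < (max K 0 + 1)\<^sup>2 * (max (a :: real) b + 1)" if "a \<ge> 0"
  using that by (intro mult_pos_pos zero_less_power) auto

lemma integrable_scalar_XX:
  assumes u: "u \<in> carrier_vec (dim_x C)" and v: "v \<in> carrier_vec (dim_x C)"
  shows "integrable (prob_sp C) (\<lambda>\<omega>. (u \<bullet> pop_X C \<omega>) * (v \<bullet> pop_X C \<omega>))"
proof (rule subgaussian_product(1)[OF prob_space_axioms scalar_const_pos[of "u \<bullet> u" "v \<bullet> v"]])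
  show "subgaussian (prob_sp C) ((max K 0 + 1)\<^sup>2 * (max (u \<bullet> u) (v \<bullet> v) + 1)) (\<lambda>\<omega>. v \<bullet> pop_X C \<omega>)"
    using subgaussian_scalar_X'[OF v, of "u \<bullet> u"] by (simp add: max.commute)
qed (use subgaussian_scalar_X'[OF u] in auto)

lemma integrable_scalar_YY:
  assumes u: "u \<in> carrier_vec (dim_y C)" and v: "v \<in> carrier_vec (dim_y C)"
  shows "integrable (prob_sp C) (\<lambda>\<omega>. (u \<bullet> pop_Y C \<omega>) * (v \<bullet> pop_Y C \<omega>))"
proof (rule subgaussian_product(1)[OF prob_space_axioms scalar_const_pos[of "v \<bullet> v" "u \<bullet> u"]])
  show "subgaussian (prob_sp C) ((max K 0 + 1)\<^sup>2 * (max (v \<bullet> v) (u \<bullet> u) + 1)) (\<lambda>\<omega>. v \<bullet> pop_Y C \<omega>)"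
    using subgaussian_scalar_Y'[OF v, of "u \<bullet> u"] by (simp add: max.commute)
qed (use subgaussian_scalar_Y'[OF u] in auto)

lemma integrable_scalar_XY:
  assumes u: "u \<in> carrier_vec (dim_x C)" and v: "v \<in> carrier_vec (dim_y C)"
  shows "integrable (prob_sp C) (\<lambda>\<omega>. (u \<bullet> pop_X C \<omega>) * (v \<bullet> pop_Y C \<omega>))"
  by (rule subgaussian_product(1)[OF prob_space_axioms scalar_const_pos[of "u \<bullet> u" "v \<bullet> v"]])
     (use subgaussian_scalar_X'[OF u] subgaussian_scalar_Y'[OF v] in auto)

lemma Sigma_x_carrier [simp]: "Sigma_x C \<in> carrier_mat (dim_x C) (dim_x C)"
  and Sigma_y_carrier [simp]: "Sigma_y C \<in> carrier_mat (dim_y C) (dim_y C)"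
  and Sigma_xy_carrier [simp]: "Sigma_xy C \<in> carrier_mat (dim_x C) (dim_y C)"
  by (auto simp: Sigma_x_def Sigma_y_def Sigma_xy_def cov_mat_def)

lemma Sigma_x_form:
  assumes "u \<in> carrier_vec (dim_x C)" "v \<in> carrier_vec (dim_x C)"
  shows "bil (Sigma_x C) u v = expectation (\<lambda>\<omega>. (u \<bullet> pop_X C \<omega>) * (v \<bullet> pop_X C \<omega>))"
  unfolding Sigma_x_def
proof (rule bil_cov_mat[OF meas_X meas_X centered_X centered_X _ assms])
  fix j k assume jk: "j < dim_x C" "k < dim_x C"
  have "integrable (prob_sp C) (\<lambda>\<omega>. pop_X C \<omega> $ j * pop_X C \<omega> $ k) \<longleftrightarrow>
      integrable (prob_sp C) (\<lambda>\<omega>. (unit_vec (dim_x C) j \<bullet> pop_X C \<omega>) * (unit_vec (dim_x C) k \<bullet> pop_X C \<omega>))"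
    using jk X_carrier by (intro Bochner_Integration.integrable_cong) (auto simp: scalar_prod_left_unit)
  then show "integrable (prob_sp C) (\<lambda>\<omega>. pop_X C \<omega> $ j * pop_X C \<omega> $ k)"
    using integrable_scalar_XX by simp
qed auto

lemma Sigma_y_form:
  assumes "u \<in> carrier_vec (dim_y C)" "v \<in> carrier_vec (dim_y C)"
  shows "bil (Sigma_y C) u v = expectation (\<lambda>\<omega>. (u \<bullet> pop_Y C \<omega>) * (v \<bullet> pop_Y C \<omega>))"
  unfolding Sigma_y_def
proof (rule bil_cov_mat[OF meas_Y meas_Y centered_Y centered_Y _ assms])
  fix j k assume jk: "j < dim_y C" "k < dim_y C"
  have "integrable (prob_sp C) (\<lambda>\<omega>. pop_Y C \<omega> $ j * pop_Y C \<omega> $ k) \<longleftrightarrow>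
      integrable (prob_sp C) (\<lambda>\<omega>. (unit_vec (dim_y C) j \<bullet> pop_Y C \<omega>) * (unit_vec (dim_y C) k \<bullet> pop_Y C \<omega>))"
    using jk Y_carrier by (intro Bochner_Integration.integrable_cong) (auto simp: scalar_prod_left_unit)
  then show "integrable (prob_sp C) (\<lambda>\<omega>. pop_Y C \<omega> $ j * pop_Y C \<omega> $ k)"
    using integrable_scalar_YY by simp
qed auto

lemma Sigma_xy_form:
  assumes "u \<in> carrier_vec (dim_x C)" "v \<in> carrier_vec (dim_y C)"
  shows "bil (Sigma_xy C) u v = expectation (\<lambda>\<omega>. (u \<bullet> pop_X C \<omega>) * (v \<bullet> pop_Y C \<omega>))"
  unfolding Sigma_xy_def
proof (rule bil_cov_mat[OF meas_X meas_Y centered_X centered_Y _ assms])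
  fix j k assume jk: "j < dim_x C" "k < dim_y C"
  have "integrable (prob_sp C) (\<lambda>\<omega>. pop_X C \<omega> $ j * pop_Y C \<omega> $ k) \<longleftrightarrow>
      integrable (prob_sp C) (\<lambda>\<omega>. (unit_vec (dim_x C) j \<bullet> pop_X C \<omega>) * (unit_vec (dim_y C) k \<bullet> pop_Y C \<omega>))"
    using jk X_carrier Y_carrier by (intro Bochner_Integration.integrable_cong) (auto simp: scalar_prod_left_unit)
  then show "integrable (prob_sp C) (\<lambda>\<omega>. pop_X C \<omega> $ j * pop_Y C \<omega> $ k)"
    using integrable_scalar_XY by simp
qed auto

lemma Sigma_x_sym: "transpose_mat (Sigma_x C) = Sigma_x C"
  and Sigma_y_sym: "transpose_mat (Sigma_y C) = Sigma_y C"
  by (auto simp: Sigma_x_def Sigma_y_def cov_mat_def mult.commute intro!: eq_matI)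

lemma Sigma_x_comm:
  assumes "u \<in> carrier_vec (dim_x C)" "v \<in> carrier_vec (dim_x C)"
  shows "bil (Sigma_x C) u v = bil (Sigma_x C) v u"
  using bil_transpose[OF Sigma_x_carrier assms] by (simp add: Sigma_x_sym)

lemma Sigma_y_comm:
  assumes "u \<in> carrier_vec (dim_y C)" "v \<in> carrier_vec (dim_y C)"
  shows "bil (Sigma_y C) u v = bil (Sigma_y C) v u"
  using bil_transpose[OF Sigma_y_carrier assms] by (simp add: Sigma_y_sym)

lemma Sigma_x_psd: "u \<in> carrier_vec (dim_x C) \<Longrightarrow> 0 \<le> bil (Sigma_x C) u u"
  by (simp add: Sigma_x_form)

lemma Sigma_y_psd: "u \<in> carrier_vec (dim_y C) \<Longrightarrow> 0 \<le> bil (Sigma_y C) u u"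
  by (simp add: Sigma_y_form)

text \<open>The second moment of \<open>u \<bullet> X + s * (v \<bullet> Y)\<close> is a nonnegative
  quadratic polynomial in \<open>s\<close> whose coefficients are the three forms.\<close>

lemma Sigma_xy_cauchy_schwarz:
  assumes u: "u \<in> carrier_vec (dim_x C)" and v: "v \<in> carrier_vec (dim_y C)"
  shows "(bil (Sigma_xy C) u v)\<^sup>2 \<le> bil (Sigma_x C) u u * bil (Sigma_y C) v v"
proof (rule quadratic_nonneg_discriminant[OF _ Sigma_y_psd[OF v]])
  fix s :: real
  let ?f = "\<lambda>\<omega>. u \<bullet> pop_X C \<omega>" and ?g = "\<lambda>\<omega>. v \<bullet> pop_Y C \<omega>"
  note int = integrable_scalar_XX[OF u u] integrable_scalar_XY[OF u v] integrable_scalar_YY[OF v v]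
  have "0 \<le> expectation (\<lambda>\<omega>. (?f \<omega> + s * ?g \<omega>)\<^sup>2)" by simp
  also have "(\<lambda>\<omega>. (?f \<omega> + s * ?g \<omega>)\<^sup>2) = (\<lambda>\<omega>. ?f \<omega> * ?f \<omega> + (2 * s) * (?f \<omega> * ?g \<omega>) + s\<^sup>2 * (?g \<omega> * ?g \<omega>))"
    by (simp add: power2_eq_square algebra_simps)
  also have "expectation \<dots> = bil (Sigma_x C) u u + 2 * s * bil (Sigma_xy C) u v + s\<^sup>2 * bil (Sigma_y C) v v"
    unfolding Sigma_x_form[OF u u] Sigma_y_form[OF v v] Sigma_xy_form[OF u v]
    using int by (subst Bochner_Integration.integral_add, force, force)+ simp
  finally show "0 \<le> bil (Sigma_x C) u u + 2 * s * bil (Sigma_xy C) u v + s\<^sup>2 * bil (Sigma_y C) v v" .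
qed

lemma U_orth: "j < r \<Longrightarrow> k < r \<Longrightarrow> bil (Sigma_x C) (col (mat_U C) j) (col (mat_U C) k) = (if j = k then 1 else 0)"
proof -
  assume jk: "j < r" "k < r"
  have "(transpose_mat (mat_U C) * Sigma_x C * mat_U C) $$ (j, k)
      = (transpose_mat (mat_U C) * (Sigma_x C * mat_U C)) $$ (j, k)"
    using carrier_U by (subst assoc_mult_mat[OF _ Sigma_x_carrier carrier_U]) auto
  also have "\<dots> = col (mat_U C) j \<bullet> col (Sigma_x C * mat_U C) k"
    using carrier_U jk by simp
  also have "col (Sigma_x C * mat_U C) k = Sigma_x C *\<^sub>v col (mat_U C) k"
    by (rule col_mult2[OF Sigma_x_carrier carrier_U jk(2)])
  finally show ?thesis using orthonormal_U jk by (simp add: bil_def)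
qed

lemma V_orth: "j < r \<Longrightarrow> k < r \<Longrightarrow> bil (Sigma_y C) (col (mat_V C) j) (col (mat_V C) k) = (if j = k then 1 else 0)"
proof -
  assume jk: "j < r" "k < r"
  have "(transpose_mat (mat_V C) * Sigma_y C * mat_V C) $$ (j, k)
      = (transpose_mat (mat_V C) * (Sigma_y C * mat_V C)) $$ (j, k)"
    using carrier_V by (subst assoc_mult_mat[OF _ Sigma_y_carrier carrier_V]) auto
  also have "\<dots> = col (mat_V C) j \<bullet> col (Sigma_y C * mat_V C) k"
    using carrier_V jk by simp
  also have "col (Sigma_y C * mat_V C) k = Sigma_y C *\<^sub>v col (mat_V C) k"
    by (rule col_mult2[OF Sigma_y_carrier carrier_V jk(2)])
  finally show ?thesis using orthonormal_V jk by (simp add: bil_def)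
qed

text \<open>Turns the matrix factorisation into a sum over canonical pairs, on which orthonormality
  and the ordering of the correlations act term by term.\<close>

lemma Sigma_xy_decomp_form:
  assumes u: "u \<in> carrier_vec (dim_x C)" and v: "v \<in> carrier_vec (dim_y C)"
  shows "bil (Sigma_xy C) u v =
    (\<Sum>j<r. Lam C j * bil (Sigma_x C) u (col (mat_U C) j) * bil (Sigma_y C) (col (mat_V C) j) v)"
proof -
  let ?D = "mat_diag r (Lam C)" and ?U = "mat_U C" and ?V = "mat_V C"
  have D: "?D \<in> carrier_mat r r" by (simp add: mat_diag_def)
  have SU: "Sigma_x C * ?U \<in> carrier_mat (dim_x C) r"
    using carrier_U by (auto intro!: mult_carrier_mat[OF Sigma_x_carrier])
  have SUD: "Sigma_x C * ?U * ?D \<in> carrier_mat (dim_x C) r"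
    using SU D by (auto intro!: mult_carrier_mat)
  have VT: "transpose_mat ?V \<in> carrier_mat r (dim_y C)" using carrier_V by simp
  have SUDV: "Sigma_x C * ?U * ?D * transpose_mat ?V \<in> carrier_mat (dim_x C) (dim_y C)"
    using mult_carrier_mat[OF SUD VT] .
  define z where "z = transpose_mat ?V *\<^sub>v (Sigma_y C *\<^sub>v v)"
  define a where "a = transpose_mat (Sigma_x C * ?U) *\<^sub>v u"
  have Sv: "Sigma_y C *\<^sub>v v \<in> carrier_vec (dim_y C)" using v by (auto intro!: mult_mat_vec_carrier[OF Sigma_y_carrier])
  have z: "z \<in> carrier_vec r" using mult_mat_vec_carrier[OF VT Sv] by (simp add: z_def)
  have a: "a \<in> carrier_vec r" unfolding a_def using SU u by (intro mult_mat_vec_carrier[of _ r "dim_x C"]) auto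
  have aj: "a $ j = bil (Sigma_x C) u (col ?U j)" if "j < r" for j
  proof -
    have "a $ j = col (Sigma_x C * ?U) j \<bullet> u" using that SU carrier_U by (simp add: a_def)
    also have "col (Sigma_x C * ?U) j = Sigma_x C *\<^sub>v col ?U j" by (rule col_mult2[OF Sigma_x_carrier carrier_U that])
    finally show ?thesis using u that carrier_U
      by (simp add: bil_def comm_scalar_prod[of u "dim_x C"] mult_mat_vec_carrier[OF Sigma_x_carrier])
  qed
  have zj: "z $ j = bil (Sigma_y C) (col ?V j) v" if "j < r" for j
    using that carrier_V by (simp add: z_def bil_def)
  have "bil (Sigma_xy C) u v = bil (Sigma_x C * ?U * ?D * transpose_mat ?V) u (Sigma_y C *\<^sub>v v)"
    unfolding Sigma_xy_decomp using bil_mult_right[OF SUDV Sigma_y_carrier u v] .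
  also have "\<dots> = bil (Sigma_x C * ?U * ?D) u z"
    unfolding z_def using bil_mult_right[OF SUD VT u Sv] .
  also have "\<dots> = bil (Sigma_x C * ?U) u (?D *\<^sub>v z)"
    using bil_mult_right[OF SU D u z] .
  also have "\<dots> = bil (transpose_mat (Sigma_x C * ?U)) (?D *\<^sub>v z) u"
    using bil_transpose[OF SU u, of "?D *\<^sub>v z"] D z by (auto simp: mult_mat_vec_carrier)
  also have "\<dots> = (?D *\<^sub>v z) \<bullet> a" by (simp add: bil_def a_def)
  also have "\<dots> = (\<Sum>j<r. (?D *\<^sub>v z) $ j * a $ j)" using a by (simp add: scalar_prod_def atLeast0LessThan)
  also have "\<dots> = (\<Sum>j<r. Lam C j * z $ j * a $ j)"
  proof (rule sum.cong[OF refl])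
    fix j assume "j \<in> {..<r}"
    then have "(?D *\<^sub>v z) $ j = (\<Sum>k\<in>{0..<r}. (if j = k then Lam C k else 0) * z $ k)"
      using z D by (simp add: scalar_prod_def mat_diag_def)
    also have "\<dots> = (\<Sum>k\<in>{0..<r}. if j = k then Lam C k * z $ k else 0)" by (intro sum.cong) auto
    also have "\<dots> = Lam C j * z $ j" using \<open>j \<in> {..<r}\<close> by simp
    finally show "(?D *\<^sub>v z) $ j * a $ j = Lam C j * z $ j * a $ j" by simp
  qed
  finally show ?thesis by (simp add: aj zj mult_ac)
qed

end

section \<open>Hessian at the canonical direction\<close>

lemma bil_four_block:
  assumes "A \<in> carrier_mat p p'" "B \<in> carrier_mat p q'" "C \<in> carrier_mat q p'" "D \<in> carrier_mat q q'"
    and "g1 \<in> carrier_vec p" "g2 \<in> carrier_vec q" "h1 \<in> carrier_vec p'" "h2 \<in> carrier_vec q'"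
  shows "bil (four_block_mat A B C D) (g1 @\<^sub>v g2) (h1 @\<^sub>v h2) = bil A g1 h1 + bil B g1 h2 + bil C g2 h1 + bil D g2 h2"
proof -
  have c: "A *\<^sub>v h1 \<in> carrier_vec p" "B *\<^sub>v h2 \<in> carrier_vec p" "C *\<^sub>v h1 \<in> carrier_vec q" "D *\<^sub>v h2 \<in> carrier_vec q"
    using assms by (auto intro: mult_mat_vec_carrier)
  have "bil (four_block_mat A B C D) (g1 @\<^sub>v g2) (h1 @\<^sub>v h2)
      = g1 \<bullet> (A *\<^sub>v h1 + B *\<^sub>v h2) + g2 \<bullet> (C *\<^sub>v h1 + D *\<^sub>v h2)"
    unfolding bil_def four_block_mat_mult_vec[OF assms(1-4,7,8)]
    using assms c by (intro scalar_prod_append) auto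
  also have "\<dots> = bil A g1 h1 + bil B g1 h2 + (bil C g2 h1 + bil D g2 h2)"
    unfolding bil_def scalar_prod_add_distrib[OF assms(5) c(1,2)] scalar_prod_add_distrib[OF assms(6) c(3,4)] ..
  finally show ?thesis by simp
qed

text \<open>One sample size. The coercivity constant and the l2 bounds derived here involve only
  \<epsilon>0 and \<open>M\<close>, hence hold along the whole sequence of models.\<close>

locale cca_regular = cca_model C n r K for C :: "'w cca" and n r :: nat and K :: real +
  fixes \<epsilon>0 M :: real
  assumes r_pos: "r \<ge> 1"
    and eps_pos: "0 < \<epsilon>0"
    and gap: "rho0 C - Lambda2 r C > \<epsilon>0"
    and M_pos: "M > 0"
    and eig_x: "\<And>e. eigenvalue (Sigma_x C) e \<Longrightarrow> e \<in> {1 / M..M}"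
    and eig_y: "\<And>e. eigenvalue (Sigma_y C) e \<Longrightarrow> e \<in> {1 / M..M}"
begin

lemma alpha0_carrier [simp]: "alpha0 C \<in> carrier_vec (dim_x C)"
  and beta0_carrier [simp]: "beta0 C \<in> carrier_vec (dim_y C)"
  using col_dim[of "mat_U C" 0] col_dim[of "mat_V C" 0] carrier_matD(1)[OF carrier_U] carrier_matD(1)[OF carrier_V]
  by (auto simp: alpha0_def beta0_def)

lemma x0_carrier [simp]: "x0 C \<in> carrier_vec (dim_x C)"
  and y0_carrier [simp]: "y0 C \<in> carrier_vec (dim_y C)"
  by (auto simp: x0_def y0_def)

lemma alpha0_normalized: "bil (Sigma_x C) (alpha0 C) (alpha0 C) = 1"
  and beta0_normalized: "bil (Sigma_y C) (beta0 C) (beta0 C) = 1"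
  using U_orth[of 0 0] V_orth[of 0 0] r_pos by (auto simp: alpha0_def beta0_def)

lemma Sigma_x_lower: "u \<in> carrier_vec (dim_x C) \<Longrightarrow> 1 / M * (u \<bullet> u) \<le> bil (Sigma_x C) u u"
  using eig_x by (intro eigenvalue_bound_imp_form_bound[OF Sigma_x_carrier Sigma_x_sym]) auto

lemma Sigma_y_lower: "u \<in> carrier_vec (dim_y C) \<Longrightarrow> 1 / M * (u \<bullet> u) \<le> bil (Sigma_y C) u u"
  using eig_y by (intro eigenvalue_bound_imp_form_bound[OF Sigma_y_carrier Sigma_y_sym]) auto

lemma Sigma_x_upper: "u \<in> carrier_vec (dim_x C) \<Longrightarrow> bil (Sigma_x C) u u \<le> M * (u \<bullet> u)"
  using eig_x by (intro eigenvalue_bound_imp_form_bound_upper[OF Sigma_x_carrier Sigma_x_sym]) auto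

lemma Sigma_y_upper: "u \<in> carrier_vec (dim_y C) \<Longrightarrow> bil (Sigma_y C) u u \<le> M * (u \<bullet> u)"
  using eig_y by (intro eigenvalue_bound_imp_form_bound_upper[OF Sigma_y_carrier Sigma_y_sym]) auto

lemma abs_le_of_sq_le_prod:
  fixes b x y :: real
  assumes "b\<^sup>2 \<le> (M * x\<^sup>2) * (M * y\<^sup>2)" "0 \<le> x" "0 \<le> y"
  shows "\<bar>b\<bar> \<le> M * x * y"
proof -
  have "b\<^sup>2 \<le> (M * x * y)\<^sup>2" using assms(1) by (simp add: power2_eq_square mult_ac)
  then have "\<bar>b\<bar> \<le> \<bar>M * x * y\<bar>" by (simp only: abs_le_square_iff)
  then show ?thesis using assms M_pos by simp
qed

lemma Sigma_x_bound:
  assumes u: "u \<in> carrier_vec (dim_x C)" and v: "v \<in> carrier_vec (dim_x C)"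
  shows "\<bar>bil (Sigma_x C) u v\<bar> \<le> M * l2_norm u * l2_norm v"
proof (rule abs_le_of_sq_le_prod)
  show "(bil (Sigma_x C) u v)\<^sup>2 \<le> (M * (l2_norm u)\<^sup>2) * (M * (l2_norm v)\<^sup>2)"
    unfolding l2_norm_sq
    using bil_cauchy_schwarz[OF Sigma_x_carrier Sigma_x_sym Sigma_x_psd u v]
      mult_mono[OF Sigma_x_upper[OF u] Sigma_x_upper[OF v] _ Sigma_x_psd[OF v]] M_pos
    by (auto intro: order_trans)
qed auto

lemma Sigma_y_bound:
  assumes u: "u \<in> carrier_vec (dim_y C)" and v: "v \<in> carrier_vec (dim_y C)"
  shows "\<bar>bil (Sigma_y C) u v\<bar> \<le> M * l2_norm u * l2_norm v"
proof (rule abs_le_of_sq_le_prod)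
  show "(bil (Sigma_y C) u v)\<^sup>2 \<le> (M * (l2_norm u)\<^sup>2) * (M * (l2_norm v)\<^sup>2)"
    unfolding l2_norm_sq
    using bil_cauchy_schwarz[OF Sigma_y_carrier Sigma_y_sym Sigma_y_psd u v]
      mult_mono[OF Sigma_y_upper[OF u] Sigma_y_upper[OF v] _ Sigma_y_psd[OF v]] M_pos
    by (auto intro: order_trans)
qed auto

lemma Sigma_xy_bound:
  assumes u: "u \<in> carrier_vec (dim_x C)" and v: "v \<in> carrier_vec (dim_y C)"
  shows "\<bar>bil (Sigma_xy C) u v\<bar> \<le> M * l2_norm u * l2_norm v"
proof (rule abs_le_of_sq_le_prod)
  show "(bil (Sigma_xy C) u v)\<^sup>2 \<le> (M * (l2_norm u)\<^sup>2) * (M * (l2_norm v)\<^sup>2)"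
    unfolding l2_norm_sq
    using Sigma_xy_cauchy_schwarz[OF u v]
      mult_mono[OF Sigma_x_upper[OF u] Sigma_y_upper[OF v] _ Sigma_y_psd[OF v]] M_pos
    by (auto intro: order_trans)
qed auto

lemma Lam_le_Lambda2: "1 \<le> j \<Longrightarrow> j < r \<Longrightarrow> Lam C j \<le> Lambda2 r C"
  using Lam_decreasing[of 1 j] by (auto simp: Lambda2_def)

lemma Lambda2_nonneg: "0 \<le> Lambda2 r C"
  using Lam_pos[of 1] r_pos by (auto simp: Lambda2_def)

lemma rho0_gt: "\<epsilon>0 < rho0 C"
  using gap Lambda2_nonneg by linarith

lemma rho0_pos: "0 < rho0 C"
  using rho0_gt eps_pos by linarith

text \<open>By orthonormality every term of the canonical decomposition but the leading one vanishes
  at \<open>beta0\<close>.\<close>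

lemma Sigma_xy_beta0:
  assumes u: "u \<in> carrier_vec (dim_x C)"
  shows "bil (Sigma_xy C) u (beta0 C) = rho0 C * bil (Sigma_x C) u (alpha0 C)"
proof -
  have "bil (Sigma_xy C) u (beta0 C)
      = (\<Sum>j<r. if j = 0 then rho0 C * bil (Sigma_x C) u (alpha0 C) else 0)"
    unfolding Sigma_xy_decomp_form[OF u beta0_carrier]
    using r_pos by (intro sum.cong) (auto simp: V_orth rho0_def alpha0_def beta0_def)
  also have "\<dots> = rho0 C * bil (Sigma_x C) u (alpha0 C)"
    using r_pos by auto
  finally show ?thesis .
qed

lemma Sigma_xy_alpha0:
  assumes v: "v \<in> carrier_vec (dim_y C)"
  shows "bil (Sigma_xy C) (alpha0 C) v = rho0 C * bil (Sigma_y C) (beta0 C) v"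
proof -
  have "bil (Sigma_xy C) (alpha0 C) v
      = (\<Sum>j<r. if j = 0 then rho0 C * bil (Sigma_y C) (beta0 C) v else 0)"
    unfolding Sigma_xy_decomp_form[OF alpha0_carrier v]
    using r_pos by (intro sum.cong) (auto simp: U_orth rho0_def alpha0_def beta0_def)
  also have "\<dots> = rho0 C * bil (Sigma_y C) (beta0 C) v"
    using r_pos by auto
  finally show ?thesis .
qed

text \<open>The leading canonical correlation is the covariance of two variables of unit
  variance.\<close>

lemma rho0_le_1: "rho0 C \<le> 1"
proof -
  have "(rho0 C)\<^sup>2 \<le> 1"
    using Sigma_xy_cauchy_schwarz[of "alpha0 C" "beta0 C"] Sigma_xy_beta0[of "alpha0 C"]
    by (simp add: alpha0_normalized beta0_normalized)
  then show ?thesis using abs_le_square_iff[of "rho0 C" 1] by simp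
qed

text \<open>The leading pair is kept exactly, to be completed to a square in
  \<open>H0_coercive\<close>. Every other correlation is at most \<open>Lambda2\<close>, and a
  product of coefficients is at most half the sum of their squares, which Bessel's inequality sums
  to the full forms.\<close>

lemma Sigma_xy_le_canonical:
  assumes h1: "h1 \<in> carrier_vec (dim_x C)" and h2: "h2 \<in> carrier_vec (dim_y C)"
  shows "bil (Sigma_xy C) h1 h2 \<le> rho0 C * bil (Sigma_x C) h1 (alpha0 C) * bil (Sigma_y C) (beta0 C) h2
    + Lambda2 r C * (bil (Sigma_x C) h1 h1 + bil (Sigma_y C) h2 h2) / 2"
proof -
  let ?a = "\<lambda>j. bil (Sigma_x C) h1 (col (mat_U C) j)" and ?b = "\<lambda>j. bil (Sigma_y C) (col (mat_V C) j) h2"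
  have b: "?b j = bil (Sigma_y C) h2 (col (mat_V C) j)" if "j < r" for j
    using that carrier_V h2 by (intro Sigma_y_comm) auto
  have split: "{..<r} = insert 0 {1..<r}" using r_pos by auto
  have "bil (Sigma_xy C) h1 h2 = Lam C 0 * ?a 0 * ?b 0 + (\<Sum>j\<in>{1..<r}. Lam C j * ?a j * ?b j)"
    unfolding Sigma_xy_decomp_form[OF h1 h2] split by simp
  also have "(\<Sum>j\<in>{1..<r}. Lam C j * ?a j * ?b j) \<le> (\<Sum>j\<in>{1..<r}. Lambda2 r C * (((?a j)\<^sup>2 + (?b j)\<^sup>2) / 2))"
  proof (rule sum_mono)
    fix j assume j: "j \<in> {1..<r}"
    have "Lam C j * ?a j * ?b j \<le> Lam C j * (((?a j)\<^sup>2 + (?b j)\<^sup>2) / 2)"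
      unfolding mult.assoc using j Lam_pos[of j] sum_squares_bound[of "?a j" "?b j"] by (intro mult_left_mono) auto
    also have "\<dots> \<le> Lambda2 r C * (((?a j)\<^sup>2 + (?b j)\<^sup>2) / 2)"
      using j Lam_le_Lambda2[of j] by (intro mult_right_mono) auto
    finally show "Lam C j * ?a j * ?b j \<le> Lambda2 r C * (((?a j)\<^sup>2 + (?b j)\<^sup>2) / 2)" .
  qed
  also have "\<dots> = Lambda2 r C / 2 * ((\<Sum>j\<in>{1..<r}. (?a j)\<^sup>2) + (\<Sum>j\<in>{1..<r}. (?b j)\<^sup>2))"
    by (simp add: sum_distrib_left sum.distrib distrib_left add_divide_distrib)
  also have "\<dots> \<le> Lambda2 r C / 2 * (bil (Sigma_x C) h1 h1 + bil (Sigma_y C) h2 h2)"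
  proof (intro mult_left_mono add_mono)
    have "(\<Sum>j\<in>{1..<r}. (?a j)\<^sup>2) \<le> (\<Sum>j<r. (?a j)\<^sup>2)" by (intro sum_mono2) auto
    also have "\<dots> \<le> bil (Sigma_x C) h1 h1"
      by (rule bil_bessel[OF Sigma_x_carrier Sigma_x_sym Sigma_x_psd carrier_U orthonormal_U h1])
    finally show "(\<Sum>j\<in>{1..<r}. (?a j)\<^sup>2) \<le> bil (Sigma_x C) h1 h1" .
    have "(\<Sum>j\<in>{1..<r}. (?b j)\<^sup>2) \<le> (\<Sum>j<r. (?b j)\<^sup>2)" by (intro sum_mono2) auto
    also have "\<dots> = (\<Sum>j<r. (bil (Sigma_y C) h2 (col (mat_V C) j))\<^sup>2)" by (simp add: b)
    also have "\<dots> \<le> bil (Sigma_y C) h2 h2"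
      by (rule bil_bessel[OF Sigma_y_carrier Sigma_y_sym Sigma_y_psd carrier_V orthonormal_V h2])
    finally show "(\<Sum>j\<in>{1..<r}. (?b j)\<^sup>2) \<le> bil (Sigma_y C) h2 h2" .
  qed (use Lambda2_nonneg in auto)
  finally show ?thesis by (simp add: rho0_def alpha0_def beta0_def mult_ac)
qed

lemma H0_carrier: "H0 C \<in> carrier_mat (dim_x C + dim_y C) (dim_x C + dim_y C)"
  unfolding H0_def by (intro smult_carrier_mat four_block_carrier_mat add_carrier_mat smult_carrier_mat
      mult_carrier_mat[OF mult_carrier_mat[OF Sigma_x_carrier] Sigma_x_carrier]
      mult_carrier_mat[OF mult_carrier_mat[OF Sigma_y_carrier] Sigma_y_carrier])
    (use alpha0_carrier beta0_carrier in \<open>auto simp: outer_def\<close>)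

lemma H0_form:
  assumes g1: "g1 \<in> carrier_vec (dim_x C)" and g2: "g2 \<in> carrier_vec (dim_y C)"
    and h1: "h1 \<in> carrier_vec (dim_x C)" and h2: "h2 \<in> carrier_vec (dim_y C)"
  shows "bil (H0 C) (g1 @\<^sub>v g2) (h1 @\<^sub>v h2) =
    2 * rho0 C * bil (Sigma_x C) g1 h1 + 4 * rho0 C * bil (Sigma_x C) g1 (alpha0 C) * bil (Sigma_x C) (alpha0 C) h1
    - 2 * bil (Sigma_xy C) g1 h2 - 2 * bil (Sigma_xy C) h1 g2
    + 2 * rho0 C * bil (Sigma_y C) g2 h2 + 4 * rho0 C * bil (Sigma_y C) g2 (beta0 C) * bil (Sigma_y C) (beta0 C) h2"
proof -
  let ?p = "dim_x C" and ?q = "dim_y C"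
  let ?Ox = "Sigma_x C * outer (alpha0 C) (alpha0 C) * Sigma_x C"
  let ?Oy = "Sigma_y C * outer (beta0 C) (beta0 C) * Sigma_y C"
  have O: "?Ox \<in> carrier_mat ?p ?p" "?Oy \<in> carrier_mat ?q ?q"
    by (rule mult_carrier_mat[OF mult_carrier_mat[OF Sigma_x_carrier] Sigma_x_carrier]
             mult_carrier_mat[OF mult_carrier_mat[OF Sigma_y_carrier] Sigma_y_carrier],
        use alpha0_carrier beta0_carrier in \<open>auto simp: outer_def\<close>)+
  let ?A = "Sigma_x C + 2 \<cdot>\<^sub>m ?Ox" and ?B = "(- 1 / rho0 C) \<cdot>\<^sub>m Sigma_xy C"
  let ?C = "(- 1 / rho0 C) \<cdot>\<^sub>m transpose_mat (Sigma_xy C)" and ?D = "Sigma_y C + 2 \<cdot>\<^sub>m ?Oy"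
  have T: "transpose_mat (Sigma_xy C) \<in> carrier_mat ?q ?p" using Sigma_xy_carrier by simp
  have c: "?A \<in> carrier_mat ?p ?p" "?B \<in> carrier_mat ?p ?q" "?C \<in> carrier_mat ?q ?p" "?D \<in> carrier_mat ?q ?q"
    using O T by (auto intro!: add_carrier_mat)
  have gh: "g1 @\<^sub>v g2 \<in> carrier_vec (?p + ?q)" "h1 @\<^sub>v h2 \<in> carrier_vec (?p + ?q)"
    using assms by auto
  have "bil (H0 C) (g1 @\<^sub>v g2) (h1 @\<^sub>v h2)
      = 2 * rho0 C * bil (four_block_mat ?A ?B ?C ?D) (g1 @\<^sub>v g2) (h1 @\<^sub>v h2)"
    unfolding H0_def by (rule bil_smult_mat[OF four_block_carrier_mat[OF c(1,4)] gh])
  also have "bil (four_block_mat ?A ?B ?C ?D) (g1 @\<^sub>v g2) (h1 @\<^sub>v h2)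
      = bil ?A g1 h1 + bil ?B g1 h2 + bil ?C g2 h1 + bil ?D g2 h2"
    by (rule bil_four_block[OF c assms])
  also have "bil ?A g1 h1 = bil (Sigma_x C) g1 h1 + 2 * (bil (Sigma_x C) g1 (alpha0 C) * bil (Sigma_x C) (alpha0 C) h1)"
    unfolding bil_add_mat[OF Sigma_x_carrier smult_carrier_mat[OF O(1)] g1 h1] bil_smult_mat[OF O(1) g1 h1]
      bil_outer[OF Sigma_x_carrier Sigma_x_carrier alpha0_carrier alpha0_carrier g1 h1] ..
  also have "bil ?D g2 h2 = bil (Sigma_y C) g2 h2 + 2 * (bil (Sigma_y C) g2 (beta0 C) * bil (Sigma_y C) (beta0 C) h2)"
    unfolding bil_add_mat[OF Sigma_y_carrier smult_carrier_mat[OF O(2)] g2 h2] bil_smult_mat[OF O(2) g2 h2]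
      bil_outer[OF Sigma_y_carrier Sigma_y_carrier beta0_carrier beta0_carrier g2 h2] ..
  also have "bil ?B g1 h2 = - 1 / rho0 C * bil (Sigma_xy C) g1 h2"
    by (rule bil_smult_mat[OF Sigma_xy_carrier g1 h2])
  also have "bil ?C g2 h1 = - 1 / rho0 C * bil (Sigma_xy C) h1 g2"
    unfolding bil_smult_mat[OF T g2 h1] bil_transpose[OF Sigma_xy_carrier h1 g2] ..
  also have "2 * rho0 C * (a + - 1 / rho0 C * s + - 1 / rho0 C * t + d)
      = 2 * rho0 C * a - 2 * s - 2 * t + 2 * rho0 C * d" for a s t d
    using rho0_pos by (simp add: field_simps)
  finally show ?thesis
    by (simp add: distrib_left)
qed

text \<open>The cross form costs at most \<open>Lambda2\<close> on the diagonal blocks apart from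
  its leading pair, and the leading pair is absorbed by the rank-one terms of the Hessian, so the
  gap survives. Division by \<open>M\<close> passes from covariance forms to Euclidean
  norms.\<close>

lemma H0_coercive:
  assumes h1: "h1 \<in> carrier_vec (dim_x C)" and h2: "h2 \<in> carrier_vec (dim_y C)"
  shows "2 * \<epsilon>0 / M * (h1 \<bullet> h1 + h2 \<bullet> h2) \<le> bil (H0 C) (h1 @\<^sub>v h2) (h1 @\<^sub>v h2)"
proof -
  define a b P Q where "a = bil (Sigma_x C) h1 (alpha0 C)" and "b = bil (Sigma_y C) (beta0 C) h2"
    and "P = bil (Sigma_x C) h1 h1" and "Q = bil (Sigma_y C) h2 h2"
  have P: "1 / M * (h1 \<bullet> h1) \<le> P" "1 / M * (h2 \<bullet> h2) \<le> Q" "0 \<le> P" "0 \<le> Q"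
    using Sigma_x_lower[OF h1] Sigma_y_lower[OF h2] Sigma_x_psd[OF h1] Sigma_y_psd[OF h2] by (auto simp: P_def Q_def)
  have a: "bil (Sigma_x C) (alpha0 C) h1 = a" and b: "bil (Sigma_y C) h2 (beta0 C) = b"
    using Sigma_x_comm[OF h1 alpha0_carrier] Sigma_y_comm[OF h2 beta0_carrier] by (auto simp: a_def b_def)
  have "2 * \<epsilon>0 / M * (h1 \<bullet> h1 + h2 \<bullet> h2) = 2 * \<epsilon>0 * (1 / M * (h1 \<bullet> h1) + 1 / M * (h2 \<bullet> h2))"
    using M_pos by (simp add: field_simps)
  also have "\<dots> \<le> 2 * \<epsilon>0 * (P + Q)"
    using P eps_pos by (intro mult_left_mono) auto
  also have "\<dots> \<le> 2 * (rho0 C - Lambda2 r C) * (P + Q)"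
    using gap P by (intro mult_right_mono) auto
  \<comment> \<open>The added nonnegative term expands to
    \<open>4 * rho0 * (a\<^sup>2 + b\<^sup>2 - a * b)\<close>, exactly what the rank-one terms leave
    after the leading cross term has been subtracted.\<close>
  also have "\<dots> \<le> 2 * (rho0 C - Lambda2 r C) * (P + Q) + 2 * rho0 C * ((a - b)\<^sup>2 + (a\<^sup>2 + b\<^sup>2))"
    using rho0_pos by simp
  also have "\<dots> \<le> 2 * rho0 C * P + 4 * rho0 C * a * a - 4 * bil (Sigma_xy C) h1 h2 + 2 * rho0 C * Q + 4 * rho0 C * b * b"
  proof -
    have "4 * bil (Sigma_xy C) h1 h2 \<le> 4 * (rho0 C * a * b) + 2 * (Lambda2 r C * (P + Q))"
      using Sigma_xy_le_canonical[OF h1 h2] unfolding a_def[symmetric] b_def[symmetric] P_def[symmetric] Q_def[symmetric]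
      by linarith
    then show ?thesis by (simp add: algebra_simps power2_eq_square)
  qed
  also have "\<dots> = bil (H0 C) (h1 @\<^sub>v h2) (h1 @\<^sub>v h2)"
    unfolding H0_form[OF h1 h2 h1 h2] a b by (simp add: a_def b_def P_def Q_def)
  finally show ?thesis .
qed

text \<open>Coercivity makes \<open>H0\<close> injective, so the \<open>the\<close> in
  \<open>Phi0\<close> selects a genuine inverse.\<close>

lemma H0_inverse: "H0 C * Phi0 C = 1\<^sub>m (dim_x C + dim_y C)"
  and Phi0_carrier: "Phi0 C \<in> carrier_mat (dim_x C + dim_y C) (dim_x C + dim_y C)"
proof -
  let ?d = "dim_x C + dim_y C"
  have "v = 0\<^sub>v ?d" if v: "v \<in> carrier_vec ?d" "H0 C *\<^sub>v v = 0\<^sub>v ?d" for v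
  proof -
    let ?h1 = "vec_first v (dim_x C)" and ?h2 = "vec_last v (dim_y C)"
    have eq: "?h1 @\<^sub>v ?h2 = v" using v by simp
    have c: "?h1 \<in> carrier_vec (dim_x C)" "?h2 \<in> carrier_vec (dim_y C)" by auto
    have "2 * \<epsilon>0 / M * (?h1 \<bullet> ?h1 + ?h2 \<bullet> ?h2) \<le> 0"
      using H0_coercive[OF c] v unfolding eq by (simp add: bil_def)
    then have "v \<bullet> v \<le> 0"
      using eps_pos M_pos scalar_prod_append[OF c c] unfolding eq
      by (simp add: mult_le_0_iff divide_le_0_iff)
    then show ?thesis by (rule scalar_prod_zero_imp_zero[OF v(1)])
  qed
  from mat_inverse_exists[OF H0_carrier this]
  show "H0 C * Phi0 C = 1\<^sub>m ?d" "Phi0 C \<in> carrier_mat ?d ?d" by (auto simp: Phi0_def)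
qed

lemma phi_carrier [simp]: "phi1 C i \<in> carrier_vec (dim_x C)" "phi2 C i \<in> carrier_vec (dim_y C)"
  by (auto simp: phi1_def phi2_def)

lemma phi_append: "i < dim_x C + dim_y C \<Longrightarrow> phi1 C i @\<^sub>v phi2 C i = col (Phi0 C) i"
  using Phi0_carrier by (simp add: phi1_def phi2_def)

text \<open>By symmetry of \<open>H0\<close>, column \<open>i\<close> of its inverse represents the
  evaluation of coordinate \<open>i\<close> in the form of \<open>H0\<close>.\<close>

lemma H0_phi:
  assumes i: "i < dim_x C" and h1: "h1 \<in> carrier_vec (dim_x C)" and h2: "h2 \<in> carrier_vec (dim_y C)"
  shows "bil (H0 C) (phi1 C i @\<^sub>v phi2 C i) (h1 @\<^sub>v h2) = h1 $ i"
proof -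
  let ?d = "dim_x C + dim_y C"
  have id: "i < ?d" using i by simp
  have "bil (H0 C) (phi1 C i @\<^sub>v phi2 C i) (h1 @\<^sub>v h2) = bil (H0 C) (h1 @\<^sub>v h2) (phi1 C i @\<^sub>v phi2 C i)"
    unfolding H0_form[OF phi_carrier h1 h2] H0_form[OF h1 h2 phi_carrier]
    using h1 h2 by (simp add: Sigma_x_comm[OF phi_carrier(1) h1] Sigma_x_comm[OF phi_carrier(1) alpha0_carrier]
        Sigma_x_comm[OF alpha0_carrier h1] Sigma_y_comm[OF phi_carrier(2) h2] Sigma_y_comm[OF phi_carrier(2) beta0_carrier]
        Sigma_y_comm[OF beta0_carrier h2])
  also have "\<dots> = (h1 @\<^sub>v h2) \<bullet> (H0 C *\<^sub>v col (Phi0 C) i)"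
    using id by (simp add: bil_def phi_append)
  also have "H0 C *\<^sub>v col (Phi0 C) i = unit_vec ?d i"
    using col_mult2[OF H0_carrier Phi0_carrier id] id by (simp add: H0_inverse)
  also have "(h1 @\<^sub>v h2) \<bullet> unit_vec ?d i = (h1 @\<^sub>v h2) $ i"
    using h1 h2 id by (intro scalar_prod_right_unit) auto
  finally show ?thesis using h1 i by simp
qed

text \<open>Coercivity at the column itself: the form there equals the column's own coordinate
  \<open>i\<close>, which is at most its norm \<open>N\<close>, so
  \<open>2 * \<epsilon>0 / M\<close> times the square of \<open>N\<close> is at most
  \<open>N\<close>.\<close>

lemma phi_norm:
  assumes i: "i < dim_x C"
  shows "l2_norm (phi1 C i) \<le> M / (2 * \<epsilon>0)" "l2_norm (phi2 C i) \<le> M / (2 * \<epsilon>0)"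
proof -
  let ?p1 = "phi1 C i" and ?p2 = "phi2 C i"
  define N where "N = sqrt (?p1 \<bullet> ?p1 + ?p2 \<bullet> ?p2)"
  have N2: "N\<^sup>2 = ?p1 \<bullet> ?p1 + ?p2 \<bullet> ?p2" by (simp add: N_def)
  have N: "l2_norm ?p1 \<le> N" "l2_norm ?p2 \<le> N" "0 \<le> N"
    by (auto simp: N_def l2_norm_alt)
  have "2 * \<epsilon>0 / M * N\<^sup>2 \<le> ?p1 $ i"
    using H0_coercive[OF phi_carrier, of i i] H0_phi[OF i phi_carrier, of i] by (simp add: N2)
  also have "\<dots> \<le> l2_norm ?p1"
    using abs_index_le_l2_norm[of i ?p1] i phi_carrier(1)[of i] by (simp add: abs_le_iff)
  also have "\<dots> \<le> N" by (rule N)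
  finally have "2 * \<epsilon>0 / M * N * N \<le> 1 * N" by (simp add: power2_eq_square)
  then have "N \<le> M / (2 * \<epsilon>0)"
    using eps_pos M_pos N(3) by (cases "N = 0") (auto simp: field_simps)
  then show "l2_norm ?p1 \<le> M / (2 * \<epsilon>0)" "l2_norm ?p2 \<le> M / (2 * \<epsilon>0)" using N by auto
qed

lemma alpha0_l2: "l2_norm (alpha0 C) \<le> sqrt M"
  and beta0_l2: "l2_norm (beta0 C) \<le> sqrt M"
  using Sigma_x_lower[OF alpha0_carrier] Sigma_y_lower[OF beta0_carrier] M_pos
  by (auto simp: alpha0_normalized beta0_normalized l2_norm_alt field_simps)

text \<open>Keeps the canonical directions away from the origin, so that a small estimation error
  determines the sign of the estimate.\<close>

lemma alpha0_l2_lower: "1 / sqrt M \<le> l2_norm (alpha0 C)"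
  and beta0_l2_lower: "1 / sqrt M \<le> l2_norm (beta0 C)"
  using Sigma_x_upper[OF alpha0_carrier] Sigma_y_upper[OF beta0_carrier] M_pos
  by (auto simp: alpha0_normalized beta0_normalized l2_norm_alt field_simps simp flip: real_sqrt_mult)

lemma x0_l2: "l2_norm (x0 C) \<le> sqrt M"
  and y0_l2: "l2_norm (y0 C) \<le> sqrt M"
proof -
  have s: "sqrt (rho0 C) \<le> 1" "0 \<le> sqrt (rho0 C)" using rho0_le_1 rho0_pos by auto
  show "l2_norm (x0 C) \<le> sqrt M"
    using mult_mono[OF s(1) alpha0_l2] s by (simp add: x0_def l2_norm_smult)
  show "l2_norm (y0 C) \<le> sqrt M"
    using mult_mono[OF s(1) beta0_l2] s by (simp add: y0_def l2_norm_smult)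
qed

lemma alpha0_support: "card {j. j < dim_x C \<and> alpha0 C $ j \<noteq> 0} \<le> nonzero_rows (mat_U C)"
  unfolding nonzero_rows_def
proof (rule card_mono)
  show "{j. j < dim_x C \<and> alpha0 C $ j \<noteq> 0} \<subseteq> {j. j < dim_row (mat_U C) \<and> row (mat_U C) j \<noteq> 0\<^sub>v (dim_col (mat_U C))}"
  proof (intro subsetI CollectI conjI; elim CollectE conjE)
    fix j assume j: "j < dim_x C" "alpha0 C $ j \<noteq> 0"
    show "j < dim_row (mat_U C)" using j carrier_U by simp
    show "row (mat_U C) j \<noteq> 0\<^sub>v (dim_col (mat_U C))"
    proof
      assume "row (mat_U C) j = 0\<^sub>v (dim_col (mat_U C))"
      then have "row (mat_U C) j $ 0 = 0\<^sub>v (dim_col (mat_U C)) $ 0" by simp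
      then show False using j carrier_U r_pos by (simp add: alpha0_def)
    qed
  qed
qed auto

lemma beta0_support: "card {j. j < dim_y C \<and> beta0 C $ j \<noteq> 0} \<le> nonzero_rows (mat_V C)"
  unfolding nonzero_rows_def
proof (rule card_mono)
  show "{j. j < dim_y C \<and> beta0 C $ j \<noteq> 0} \<subseteq> {j. j < dim_row (mat_V C) \<and> row (mat_V C) j \<noteq> 0\<^sub>v (dim_col (mat_V C))}"
  proof (intro subsetI CollectI conjI; elim CollectE conjE)
    fix j assume j: "j < dim_y C" "beta0 C $ j \<noteq> 0"
    show "j < dim_row (mat_V C)" using j carrier_V by simp
    show "row (mat_V C) j \<noteq> 0\<^sub>v (dim_col (mat_V C))"
    proof
      assume "row (mat_V C) j = 0\<^sub>v (dim_col (mat_V C))"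
      then have "row (mat_V C) j $ 0 = 0\<^sub>v (dim_col (mat_V C)) $ 0" by simp
      then show False using j carrier_V r_pos by (simp add: beta0_def)
    qed
  qed
qed auto

lemma alpha0_l1: "l1_norm (alpha0 C) \<le> sqrt (real (sparsity C)) * sqrt M"
  and beta0_l1: "l1_norm (beta0 C) \<le> sqrt (real (sparsity C)) * sqrt M"
proof -
  have "l1_norm (alpha0 C) \<le> sqrt (real (sparsity C)) * l2_norm (alpha0 C)"
    using alpha0_support by (intro l1_norm_sparse_le[OF alpha0_carrier]) (simp add: sparsity_def)
  also have "\<dots> \<le> sqrt (real (sparsity C)) * sqrt M"
    using alpha0_l2 by (intro mult_left_mono) auto
  finally show "l1_norm (alpha0 C) \<le> sqrt (real (sparsity C)) * sqrt M" .
  have "l1_norm (beta0 C) \<le> sqrt (real (sparsity C)) * l2_norm (beta0 C)"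
    using beta0_support by (intro l1_norm_sparse_le[OF beta0_carrier]) (simp add: sparsity_def)
  also have "\<dots> \<le> sqrt (real (sparsity C)) * sqrt M"
    using beta0_l2 by (intro mult_left_mono) auto
  finally show "l1_norm (beta0 C) \<le> sqrt (real (sparsity C)) * sqrt M" .
qed

text \<open>A direction normalised by \<open>Sigma_x\<close> or \<open>Sigma_y\<close> cannot be
  zero. Hence the sparsity is at least 1, which the comparison of rates uses, and
  \<open>s_U = o(p)\<close> forces \<open>p\<close> to grow.\<close>

lemma nonzero_rows_pos: "1 \<le> nonzero_rows (mat_U C)" "1 \<le> nonzero_rows (mat_V C)"
proof -
  have pos: "0 < 1 / sqrt M" using M_pos by simp
  have "nonzero_rows (mat_U C) \<noteq> 0"
  proof
    assume "nonzero_rows (mat_U C) = 0"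
    then have "l1_norm (alpha0 C) \<le> 0"
      using l1_norm_sparse_le[OF alpha0_carrier alpha0_support] by simp
    then show False using alpha0_l2_lower pos l2_norm_le_l1_norm[of "alpha0 C"] by linarith
  qed
  then show "1 \<le> nonzero_rows (mat_U C)" by simp
  have "nonzero_rows (mat_V C) \<noteq> 0"
  proof
    assume "nonzero_rows (mat_V C) = 0"
    then have "l1_norm (beta0 C) \<le> 0"
      using l1_norm_sparse_le[OF beta0_carrier beta0_support] by simp
    then show False using beta0_l2_lower pos l2_norm_le_l1_norm[of "beta0 C"] by linarith
  qed
  then show "1 \<le> nonzero_rows (mat_V C)" by simp
qed

end

section \<open>Perturbation estimates\<close>

text \<open>Of the eight terms of the expanded form, the three of first order are kept and the four
  of second order are bounded, hence the factors 3 and 4. \<open>B\<close> bounds the fixed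
  directions and matrices, \<open>b\<close> the errors; they are separate because the errors of the
  rescaled estimates carry the larger constant \<open>58 * B ^ 5\<close>. \<eta> is the ratio of the
  l1 rate to the l2 rate.\<close>

lemma form_expand:
  fixes B b lam \<tau> \<eta> :: real
  assumes S: "S \<in> carrier_mat p q" and D: "D \<in> carrier_mat p q"
    and c: "u0 \<in> carrier_vec p" "du \<in> carrier_vec p" "v0 \<in> carrier_vec q" "dv \<in> carrier_vec q"
    and H: "\<And>u v. u \<in> carrier_vec p \<Longrightarrow> v \<in> carrier_vec q \<Longrightarrow> bil H u v = bil S u v + bil D u v"
    and Sb: "\<And>u v. u \<in> carrier_vec p \<Longrightarrow> v \<in> carrier_vec q \<Longrightarrow> \<bar>bil S u v\<bar> \<le> B * l2_norm u * l2_norm v"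
    and D0: "\<bar>bil D u0 v0\<bar> \<le> B * lam"
    and D1: "\<And>k. k < q \<Longrightarrow> \<bar>bil D u0 (unit_vec q k)\<bar> \<le> B * lam"
    and D2: "\<And>k. k < p \<Longrightarrow> \<bar>bil D (unit_vec p k) v0\<bar> \<le> B * lam"
    and D3: "\<And>j k. j < p \<Longrightarrow> k < q \<Longrightarrow> \<bar>bil D (unit_vec p j) (unit_vec q k)\<bar> \<le> B * lam"
    and n0: "l2_norm u0 \<le> B" "l2_norm v0 \<le> B"
    and nd: "l2_norm du \<le> b * \<tau>" "l2_norm dv \<le> b * \<tau>" "l1_norm du \<le> b * (\<eta> * \<tau>)" "l1_norm dv \<le> b * (\<eta> * \<tau>)"
    and B: "1 \<le> B" "1 \<le> b" and rates: "0 \<le> lam" "0 \<le> \<tau>" "\<tau> \<le> 1" "0 \<le> \<eta>" "lam \<le> \<tau>" "lam * \<eta> \<le> \<tau>" "lam * \<eta>\<^sup>2 \<le> 1"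
  shows "\<bar>bil S u0 dv + bil S du v0 + bil D u0 v0\<bar> \<le> 3 * B\<^sup>2 * b * \<tau>"
    and "\<bar>bil H (u0 + du) (v0 + dv) - (bil S u0 v0 + (bil S u0 dv + bil S du v0 + bil D u0 v0))\<bar> \<le> 4 * B * b\<^sup>2 * \<tau>\<^sup>2"
proof -
  have b1: "b \<le> b\<^sup>2" using B(2) by (simp add: power2_eq_square)
  have "\<bar>bil S u0 dv\<bar> \<le> B * l2_norm u0 * l2_norm dv" by (rule Sb) (use c in auto)
  also have "\<dots> \<le> B * B * (b * \<tau>)" using n0 nd B by (intro mult_mono) auto
  finally have s1: "\<bar>bil S u0 dv\<bar> \<le> B\<^sup>2 * b * \<tau>" by (simp add: power2_eq_square mult_ac)
  have "\<bar>bil S du v0\<bar> \<le> B * l2_norm du * l2_norm v0" by (rule Sb) (use c in auto)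
  also have "\<dots> \<le> B * (b * \<tau>) * B" using n0 nd B rates by (intro mult_mono) auto
  finally have s2: "\<bar>bil S du v0\<bar> \<le> B\<^sup>2 * b * \<tau>" by (simp add: power2_eq_square mult_ac)
  have "\<bar>bil S du dv\<bar> \<le> B * l2_norm du * l2_norm dv" by (rule Sb) (use c in auto)
  also have "\<dots> \<le> B * (b * \<tau>) * (b * \<tau>)" using nd B rates by (intro mult_mono) auto
  finally have s3: "\<bar>bil S du dv\<bar> \<le> B * b\<^sup>2 * \<tau>\<^sup>2" by (simp add: power2_eq_square mult_ac)
  have "B * lam \<le> B * \<tau>" using B rates by (intro mult_left_mono) auto
  also have "\<dots> \<le> B\<^sup>2 * b * \<tau>"
    using B rates mult_mono[of B "B\<^sup>2" 1 b] by (intro mult_right_mono) (auto simp: power2_eq_square)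
  finally have d0: "\<bar>bil D u0 v0\<bar> \<le> B\<^sup>2 * b * \<tau>" using D0 by linarith
  have l\<tau>: "B * lam * (b * (\<eta> * \<tau>)) \<le> B * b\<^sup>2 * \<tau>\<^sup>2"
  proof -
    have "B * lam * (b * (\<eta> * \<tau>)) = B * b * \<tau> * (lam * \<eta>)" by (simp add: mult_ac)
    also have "\<dots> \<le> B * b * \<tau> * \<tau>" using B rates by (intro mult_left_mono) auto
    also have "\<dots> = b * (B * \<tau>\<^sup>2)" by (simp add: power2_eq_square mult_ac)
    also have "\<dots> \<le> b\<^sup>2 * (B * \<tau>\<^sup>2)" using B b1 by (intro mult_right_mono) auto
    finally show ?thesis by (simp add: mult_ac)
  qed
  have "\<bar>bil D u0 dv\<bar> \<le> B * lam * l1_norm dv" by (rule bil_le_l1_right[OF D c(1,4) D1])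
  also have "\<dots> \<le> B * lam * (b * (\<eta> * \<tau>))" using nd B rates by (intro mult_left_mono) auto
  finally have d1: "\<bar>bil D u0 dv\<bar> \<le> B * b\<^sup>2 * \<tau>\<^sup>2" using l\<tau> by linarith
  have "\<bar>bil D du v0\<bar> \<le> B * lam * l1_norm du" by (rule bil_le_l1_left[OF D c(2,3) D2])
  also have "\<dots> \<le> B * lam * (b * (\<eta> * \<tau>))" using nd B rates by (intro mult_left_mono) auto
  finally have d2: "\<bar>bil D du v0\<bar> \<le> B * b\<^sup>2 * \<tau>\<^sup>2" using l\<tau> by linarith
  have "\<bar>bil D du dv\<bar> \<le> B * lam * l1_norm du * l1_norm dv" by (rule bil_le_l1_l1[OF D c(2,4) D3])
  also have "\<dots> \<le> B * lam * (b * (\<eta> * \<tau>)) * (b * (\<eta> * \<tau>))" using nd B rates by (intro mult_mono) auto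
  also have "\<dots> = B * b\<^sup>2 * \<tau>\<^sup>2 * (lam * \<eta>\<^sup>2)" by (simp add: power2_eq_square mult_ac)
  also have "\<dots> \<le> B * b\<^sup>2 * \<tau>\<^sup>2 * 1" using B rates by (intro mult_left_mono) auto
  finally have d3: "\<bar>bil D du dv\<bar> \<le> B * b\<^sup>2 * \<tau>\<^sup>2" by simp
  show "\<bar>bil S u0 dv + bil S du v0 + bil D u0 v0\<bar> \<le> 3 * B\<^sup>2 * b * \<tau>"
    using s1 s2 d0 by linarith
  have "bil H (u0 + du) (v0 + dv) = bil S u0 v0 + bil S u0 dv + bil S du v0 + bil S du dv
      + bil D u0 v0 + bil D u0 dv + bil D du v0 + bil D du dv"
    using c by (simp add: H bil_add_left[OF S c(1,2) _ c(3)] bil_add_left[OF D c(1,2) _ c(3)]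
      bil_add_right[OF S c(1,1,3,4)] bil_add_right[OF S c(2,2,3,4)]
      bil_add_right[OF D c(1,1,3,4)] bil_add_right[OF D c(2,2,3,4)])
  then show "\<bar>bil H (u0 + du) (v0 + dv) - (bil S u0 v0 + (bil S u0 dv + bil S du v0 + bil D u0 v0))\<bar> \<le> 4 * B * b\<^sup>2 * \<tau>\<^sup>2"
    using s3 d1 d2 d3 by linarith
qed

text \<open>Forgets the structure of the first-order part where only its size matters:
  \<open>7 = 3 + 4\<close>, with one constant \<open>B\<close> for fixed directions and errors
  alike.\<close>

lemma form_near:
  fixes x y z B \<tau> :: real
  assumes "\<bar>y\<bar> \<le> 3 * B\<^sup>2 * B * \<tau>" "\<bar>x - (z + y)\<bar> \<le> 4 * B * B\<^sup>2 * \<tau>\<^sup>2" "0 \<le> \<tau>" "\<tau> \<le> 1" "1 \<le> B"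
  shows "\<bar>x - z\<bar> \<le> 7 * B ^ 3 * \<tau>"
proof -
  have "\<tau>\<^sup>2 \<le> \<tau>" using assms by (simp add: power2_eq_square mult_left_le)
  then have "4 * B * B\<^sup>2 * \<tau>\<^sup>2 \<le> 4 * B * B\<^sup>2 * \<tau>" using assms by (intro mult_left_mono) auto
  moreover have "3 * B\<^sup>2 * B * \<tau> + 4 * B * B\<^sup>2 * \<tau> = 7 * B ^ 3 * \<tau>" by (simp add: power2_eq_square power3_eq_cube)
  ultimately show ?thesis using assms by linarith
qed

text \<open>What is kept is the product rule. Each of the other six products contains two
  first-order factors or a remainder, whence the 6.\<close>

lemma product_expand:
  fixes k \<tau> :: real
  assumes "\<bar>A1\<bar> \<le> k * \<tau>" "\<bar>P1\<bar> \<le> k * \<tau>" "\<bar>S1 - (\<rho> + A1)\<bar> \<le> k * \<tau>\<^sup>2" "\<bar>S2 - (P + P1)\<bar> \<le> k * \<tau>\<^sup>2"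
    and "\<bar>\<rho>\<bar> \<le> k" "\<bar>P\<bar> \<le> k" "0 \<le> \<tau>" "\<tau> \<le> 1" "1 \<le> k"
  shows "\<bar>S1 * S2 - (\<rho> * P + \<rho> * P1 + A1 * P)\<bar> \<le> 6 * k\<^sup>2 * \<tau>\<^sup>2"
proof -
  define R1 R2 where "R1 = S1 - (\<rho> + A1)" and "R2 = S2 - (P + P1)"
  have R: "\<bar>R1\<bar> \<le> k * \<tau>\<^sup>2" "\<bar>R2\<bar> \<le> k * \<tau>\<^sup>2" using assms by (auto simp: R1_def R2_def)
  have t2: "\<tau>\<^sup>2 \<le> \<tau>" "\<tau>\<^sup>2 \<le> 1" using assms by (auto simp: power2_eq_square mult_left_le mult_le_one)
  have kt: "k * \<tau>\<^sup>2 \<le> k * \<tau>" "k * \<tau>\<^sup>2 \<le> k" "k * \<tau> \<le> k" using t2 assms by (auto simp: mult_left_le)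
  have m: "\<bar>x * y\<bar> \<le> k\<^sup>2 * \<tau>\<^sup>2" if "\<bar>x\<bar> \<le> k" "\<bar>y\<bar> \<le> k * \<tau>\<^sup>2" for x y :: real
    using mult_mono[OF that] assms by (simp add: abs_mult power2_eq_square mult_ac)
  have "\<bar>A1 * P1\<bar> \<le> (k * \<tau>) * (k * \<tau>)"
    unfolding abs_mult using assms by (intro mult_mono) auto
  then have 1: "\<bar>A1 * P1\<bar> \<le> k\<^sup>2 * \<tau>\<^sup>2" by (simp add: power2_eq_square mult_ac)
  have ak: "\<bar>A1\<bar> \<le> k" "\<bar>P1\<bar> \<le> k" "\<bar>R1\<bar> \<le> k"
    using assms(1,2) R kt by linarith+
  have 2: "\<bar>\<rho> * R2\<bar> \<le> k\<^sup>2 * \<tau>\<^sup>2" "\<bar>A1 * R2\<bar> \<le> k\<^sup>2 * \<tau>\<^sup>2" "\<bar>P * R1\<bar> \<le> k\<^sup>2 * \<tau>\<^sup>2" "\<bar>P1 * R1\<bar> \<le> k\<^sup>2 * \<tau>\<^sup>2"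
    "\<bar>R1 * R2\<bar> \<le> k\<^sup>2 * \<tau>\<^sup>2"
    using assms(5,6) ak R by (auto intro: m)
  have "S1 * S2 - (\<rho> * P + \<rho> * P1 + A1 * P) = \<rho> * R2 + A1 * P1 + A1 * R2 + P * R1 + P1 * R1 + R1 * R2"
    by (simp add: R1_def R2_def algebra_simps)
  then show ?thesis using 1 2 by linarith
qed

text \<open>By smallness \<open>A\<close>, \<open>B\<close> and \<open>N\<close> stay away from 0.
  The ratio costs a factor 8, its numerator being at most \<open>4 * (k * \<tau>)\<close> and its
  denominator at least 1/2; the square root costs a factor \<open>1 / \<epsilon>\<close>, as
  \<open>\<epsilon> \<le> sqrt \<rho>\<close>.\<close>

lemma ratio_expand:
  fixes A B N \<rho> k \<tau> \<epsilon> :: real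
  assumes A: "\<bar>A - 1\<bar> \<le> k * \<tau>" and B: "\<bar>B - 1\<bar> \<le> k * \<tau>" and N: "\<bar>N - \<rho>\<bar> \<le> k * \<tau>"
    and small: "k * \<tau> \<le> \<epsilon> / 2" and \<epsilon>: "0 < \<epsilon>" "\<epsilon> < 1" and \<rho>: "\<epsilon> \<le> \<rho>" "\<rho> \<le> 1"
  shows "0 < N / (sqrt A * sqrt B)" and "sqrt (N / (sqrt A * sqrt B)) \<le> 2"
    and "\<bar>sqrt (N / (sqrt A * sqrt B)) - sqrt \<rho>\<bar> \<le> 8 * (k * \<tau>) / \<epsilon>"
proof -
  have bA: "1 / 2 \<le> A" "A \<le> 3 / 2" and bB: "1 / 2 \<le> B" "B \<le> 3 / 2" and bN: "\<epsilon> / 2 \<le> N" "N \<le> 3 / 2"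
    using A B N small \<epsilon> \<rho> by (auto simp: abs_le_iff)
  define d where "d = sqrt A * sqrt B"
  have d2: "d = sqrt (A * B)" by (simp add: d_def real_sqrt_mult)
  have "1 / 4 \<le> A * B" using mult_mono[OF bA(1) bB(1)] bA by simp
  then have "sqrt (1 / 4) \<le> d" unfolding d2 by (intro real_sqrt_le_mono)
  moreover have "sqrt (1 / 4) = (1 / 2 :: real)" by (simp add: real_sqrt_divide)
  ultimately have d: "1 / 2 \<le> d" by simp
  define z where "z = N / d"
  show pos: "0 < N / (sqrt A * sqrt B)"
    using bN d \<epsilon> unfolding d_def[symmetric] by (intro divide_pos_pos) auto
  have "z \<le> (3 / 2) / (1 / 2)" unfolding z_def using bN d \<epsilon> by (intro frac_le) auto
  then have "sqrt z \<le> sqrt 4" by (intro real_sqrt_le_mono) simp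
  then show "sqrt (N / (sqrt A * sqrt B)) \<le> 2" by (simp add: z_def d_def)
  have "\<bar>A * B - 1\<bar> = \<bar>(A - 1) * B + (B - 1)\<bar>" by (simp add: algebra_simps)
  also have "\<dots> \<le> \<bar>A - 1\<bar> * \<bar>B\<bar> + \<bar>B - 1\<bar>" using abs_triangle_ineq[of "(A - 1) * B" "B - 1"] by (simp add: abs_mult)
  also have "\<bar>A - 1\<bar> * \<bar>B\<bar> \<le> (k * \<tau>) * 2" using A bB by (intro mult_mono) auto
  finally have AB: "\<bar>A * B - 1\<bar> \<le> 3 * (k * \<tau>)" using B by linarith
  \<comment> \<open>Rationalisation: \<open>d\<close> is the square root of \<open>A * B\<close>,
    and multiplying by \<open>d + 1 \<ge> 1\<close> only enlarges.\<close>
  have "\<bar>d - 1\<bar> \<le> \<bar>(d - 1) * (d + 1)\<bar>"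
    using d mult_left_mono[of 1 "d + 1" "\<bar>d - 1\<bar>"] by (simp add: abs_mult)
  also have "(d - 1) * (d + 1) = A * B - 1"
    using bA bB by (simp add: algebra_simps d2)
  finally have d1: "\<bar>d - 1\<bar> \<le> 3 * (k * \<tau>)" using AB by linarith
  have "z - \<rho> = ((N - \<rho>) - \<rho> * (d - 1)) / d" using d by (simp add: z_def field_simps)
  then have "\<bar>z - \<rho>\<bar> = \<bar>(N - \<rho>) - \<rho> * (d - 1)\<bar> / d" using d by simp
  also have "\<bar>(N - \<rho>) - \<rho> * (d - 1)\<bar> \<le> \<bar>N - \<rho>\<bar> + \<bar>\<rho>\<bar> * \<bar>d - 1\<bar>"
    using abs_triangle_ineq4[of "N - \<rho>" "\<rho> * (d - 1)"] by (simp add: abs_mult)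
  also have "\<bar>\<rho>\<bar> * \<bar>d - 1\<bar> \<le> 1 * (3 * (k * \<tau>))" using \<rho> \<epsilon> d1 by (intro mult_mono) auto
  also have "(\<bar>N - \<rho>\<bar> + 1 * (3 * (k * \<tau>))) / d \<le> (4 * (k * \<tau>)) / (1 / 2)"
    using N d by (intro frac_le) (auto simp: mult.commute)
  finally have z\<rho>: "\<bar>z - \<rho>\<bar> \<le> 8 * (k * \<tau>)" using d by (simp add: divide_right_mono)
  have z0: "0 \<le> z" using pos by (simp add: z_def d_def)
  have "\<epsilon> * \<epsilon> \<le> \<epsilon>" using \<epsilon> by (simp add: mult_left_le)
  then have "\<epsilon> \<le> sqrt \<rho>"
    using \<rho> by (intro real_le_rsqrt) (simp add: power2_eq_square)
  then have "\<epsilon> * \<bar>sqrt z - sqrt \<rho>\<bar> \<le> (sqrt z + sqrt \<rho>) * \<bar>sqrt z - sqrt \<rho>\<bar>"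
    using z0 by (intro mult_right_mono) (auto intro: add_increasing)
  also have "\<dots> = \<bar>(sqrt z + sqrt \<rho>) * (sqrt z - sqrt \<rho>)\<bar>"
    using z0 \<rho> \<epsilon> by (simp add: abs_mult)
  also have "(sqrt z + sqrt \<rho>) * (sqrt z - sqrt \<rho>) = z - \<rho>"
    using z0 \<rho> \<epsilon> by (simp add: algebra_simps)
  also note z\<rho>
  finally have "\<bar>sqrt z - sqrt \<rho>\<bar> \<le> 8 * (k * \<tau>) / \<epsilon>" using \<epsilon> by (simp add: field_simps)
  then show "\<bar>sqrt (N / (sqrt A * sqrt B)) - sqrt \<rho>\<bar> \<le> 8 * (k * \<tau>) / \<epsilon>" by (simp add: z_def d_def)
qed

section \<open>Alignment of signs\<close>

lemma pm_dist_witness: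
  assumes "pm_dist N a a0 \<le> c"
  obtains w where "w \<in> {- 1, 1 :: real}" "N (w \<cdot>\<^sub>v a - a0) \<le> c"
proof -
  have "pm_dist N a a0 = Min ((\<lambda>w. N (w \<cdot>\<^sub>v a - a0)) ` {- 1, 1 :: real})"
    unfolding pm_dist_def by (intro cInf_eq_Min) auto
  also have "\<dots> \<in> (\<lambda>w. N (w \<cdot>\<^sub>v a - a0)) ` {- 1, 1 :: real}"
    by (intro Min_in) auto
  finally obtain w where w: "w \<in> {- 1, 1 :: real}" "pm_dist N a a0 = N (w \<cdot>\<^sub>v a - a0)"
    by (elim imageE)
  show ?thesis by (rule that[OF w(1)]) (use assms w(2) in simp)
qed

lemma pm_dist_nonneg:
  assumes "\<And>v. 0 \<le> N v"
  shows "0 \<le> pm_dist N a a0"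
  unfolding pm_dist_def by (intro cINF_greatest) (use assms in auto)

text \<open>The signs realising the two minima agree as soon as the \<open>l1\<close> distance is small compared with
  the norm of the target.\<close>

lemma common_sign:
  fixes a0 :: "real vec"
  assumes a: "a \<in> carrier_vec p" and a0: "a0 \<in> carrier_vec p"
    and l2: "pm_dist l2_norm a a0 \<le> c2" and l1: "pm_dist l1_norm a a0 \<le> c1"
    and small: "c1 + c2 < 2 * l2_norm a0"
  obtains w d where "w \<in> {- 1, 1 :: real}" "d \<in> carrier_vec p" "w \<cdot>\<^sub>v a = a0 + d" "l2_norm d \<le> c2" "l1_norm d \<le> c1"
proof -
  obtain w where w: "w \<in> {- 1, 1 :: real}" "l2_norm (w \<cdot>\<^sub>v a - a0) \<le> c2" by (rule pm_dist_witness[OF l2])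
  obtain w' where w': "w' \<in> {- 1, 1 :: real}" "l1_norm (w' \<cdot>\<^sub>v a - a0) \<le> c1" by (rule pm_dist_witness[OF l1])
  have "w = w'"
  proof (rule ccontr)
    assume "w \<noteq> w'"
    then have "w' = - w" using w w' by auto
    let ?u = "w \<cdot>\<^sub>v a - a0" and ?v = "w' \<cdot>\<^sub>v a - a0"
    have uv: "?u \<in> carrier_vec p" "?v \<in> carrier_vec p" using a a0 by auto
    \<comment> \<open>With opposite signs the two copies of \<open>a\<close> cancel, and twice the
      target would have to be small.\<close>
    have "?u + ?v = (- 2) \<cdot>\<^sub>v a0"
      using a a0 by (intro eq_vecI) (auto simp: \<open>w' = - w\<close>)
    then have "2 * l2_norm a0 = l2_norm (?u + ?v)" by (simp add: l2_norm_smult)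
    also have "\<dots> \<le> l2_norm ?u + l2_norm ?v" by (rule l2_norm_add_le[OF uv])
    also have "\<dots> \<le> c2 + c1" using w w' l2_norm_le_l1_norm[of ?v] by linarith
    finally show False using small by linarith
  qed
  show thesis
  proof (rule that[of w "w \<cdot>\<^sub>v a - a0"])
    show "w \<cdot>\<^sub>v a = a0 + (w \<cdot>\<^sub>v a - a0)" using a a0 by (intro eq_vecI) auto
  qed (use w w' a a0 \<open>w = w'\<close> in auto)
qed

section \<open>Linearization of the de-biased estimator\<close>

lemma hat_Sigma_carrier [simp]:
  "hat_Sigma_x n C \<omega> \<in> carrier_mat (dim_x C) (dim_x C)"
  "hat_Sigma_y n C \<omega> \<in> carrier_mat (dim_y C) (dim_y C)"
  "hat_Sigma_xy n C \<omega> \<in> carrier_mat (dim_x C) (dim_y C)"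
  by (auto simp: hat_Sigma_x_def hat_Sigma_y_def hat_Sigma_xy_def emp_cov_def)

text \<open>Written as a sum with a negative multiple so that the linearity of \<open>bil\<close> in
  its matrix argument applies directly.\<close>

definition dev_x :: "nat \<Rightarrow> 'w cca \<Rightarrow> 'w \<Rightarrow> real mat" where
  "dev_x n C \<omega> = hat_Sigma_x n C \<omega> + (- 1) \<cdot>\<^sub>m Sigma_x C"

definition dev_y :: "nat \<Rightarrow> 'w cca \<Rightarrow> 'w \<Rightarrow> real mat" where
  "dev_y n C \<omega> = hat_Sigma_y n C \<omega> + (- 1) \<cdot>\<^sub>m Sigma_y C"

definition dev_xy :: "nat \<Rightarrow> 'w cca \<Rightarrow> 'w \<Rightarrow> real mat" where
  "dev_xy n C \<omega> = hat_Sigma_xy n C \<omega> + (- 1) \<cdot>\<^sub>m Sigma_xy C"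

text \<open>The directions in which deviations must be controlled: unit vectors for the l1 duality,
  \<open>alpha0\<close> for the estimated correlation, \<open>x0\<close> and \<open>phi1\<close> for
  the de-biasing step. There are at most \<open>dim_x C + 3\<close> of them, so a union bound is
  affordable.\<close>

definition test_x :: "'w cca \<Rightarrow> nat \<Rightarrow> real vec set" where
  "test_x C i = unit_vec (dim_x C) ` {..<dim_x C} \<union> {alpha0 C, x0 C, phi1 C i}"

definition test_y :: "'w cca \<Rightarrow> nat \<Rightarrow> real vec set" where
  "test_y C i = unit_vec (dim_y C) ` {..<dim_y C} \<union> {beta0 C, y0 C, phi2 C i}"

definition cov_close :: "nat \<Rightarrow> 'w cca \<Rightarrow> nat \<Rightarrow> real \<Rightarrow> 'w \<Rightarrow> bool" where
  "cov_close n C i e \<omega> \<longleftrightarrow>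
     (\<forall>u\<in>test_x C i. \<forall>v\<in>test_x C i. \<bar>bil (dev_x n C \<omega>) u v\<bar> \<le> e) \<and>
     (\<forall>u\<in>test_x C i. \<forall>v\<in>test_y C i. \<bar>bil (dev_xy n C \<omega>) u v\<bar> \<le> e) \<and>
     (\<forall>u\<in>test_y C i. \<forall>v\<in>test_y C i. \<bar>bil (dev_y n C \<omega>) u v\<bar> \<le> e)"

text \<open>First variation, in the deviation matrices, of minus the gradient at the true pair,
  contracted with column \<open>i\<close> of \<open>Phi0\<close>. The factor 2 is that of the
  gradient, and the product rule for form times form gives the first two terms of each diagonal
  block.\<close>

definition lin_term :: "nat \<Rightarrow> 'w cca \<Rightarrow> nat \<Rightarrow> 'w \<Rightarrow> real" where
  "lin_term n C i \<omega> = - 2 *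
     (rho0 C * bil (dev_x n C \<omega>) (phi1 C i) (x0 C) + bil (Sigma_x C) (phi1 C i) (x0 C) * bil (dev_x n C \<omega>) (x0 C) (x0 C)
    + rho0 C * bil (dev_y n C \<omega>) (phi2 C i) (y0 C) + bil (Sigma_y C) (phi2 C i) (y0 C) * bil (dev_y n C \<omega>) (y0 C) (y0 C)
    - bil (dev_xy n C \<omega>) (phi1 C i) (y0 C) - bil (dev_xy n C \<omega>) (x0 C) (phi2 C i))"

lemma l2_norm_append_ge:
  "l2_norm u \<le> l2_norm (u @\<^sub>v v)" "l2_norm v \<le> l2_norm (u @\<^sub>v v)"
proof -
  have "(u @\<^sub>v v) \<bullet> (u @\<^sub>v v) = u \<bullet> u + v \<bullet> v"
    by (rule scalar_prod_append[of u "dim_vec u" v "dim_vec v"]) auto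
  then show "l2_norm u \<le> l2_norm (u @\<^sub>v v)" "l2_norm v \<le> l2_norm (u @\<^sub>v v)"
    by (auto simp: l2_norm_alt)
qed

lemma l1_norm_append: "l1_norm (u @\<^sub>v v) = l1_norm u + l1_norm v"
proof -
  have "{..<dim_vec u + dim_vec v} = {..<dim_vec u} \<union> (\<lambda>j. dim_vec u + j) ` {..<dim_vec v}"
  proof (intro equalityI subsetI)
    fix j assume "j \<in> {..<dim_vec u + dim_vec v}"
    then show "j \<in> {..<dim_vec u} \<union> (\<lambda>j. dim_vec u + j) ` {..<dim_vec v}"
      by (cases "j < dim_vec u") (auto intro: image_eqI[of _ _ "j - dim_vec u"])
  qed auto
  then have "l1_norm (u @\<^sub>v v) = (\<Sum>j<dim_vec u. \<bar>(u @\<^sub>v v) $ j\<bar>) + (\<Sum>j\<in>(\<lambda>j. dim_vec u + j) ` {..<dim_vec v}. \<bar>(u @\<^sub>v v) $ j\<bar>)"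
    unfolding l1_norm_def by (subst sum.union_disjoint[symmetric]) auto
  then show ?thesis by (simp add: l1_norm_def sum.reindex)
qed

lemma l1_norm_append_ge: "l1_norm u \<le> l1_norm (u @\<^sub>v v)" "l1_norm v \<le> l1_norm (u @\<^sub>v v)"
  by (simp_all add: l1_norm_append)

lemma max_col_dist_ge:
  assumes "j < dim_col B"
  shows "N (col A j - col B j) \<le> max_col_dist N A B"
  unfolding max_col_dist_def using assms by (intro Max_ge) auto

text \<open>Coordinate \<open>i\<close> of a product with a transpose is a scalar product with
  column \<open>i\<close>. Splitting that column into its two blocks turns the whole correction into
  covariance forms.\<close>

lemma x_db_index:
  assumes i: "i < dim_x C" and a: "a \<omega> \<in> carrier_vec (dim_x C)" and b: "b \<omega> \<in> carrier_vec (dim_y C)"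
    and F: "F \<omega> \<in> carrier_mat (dim_x C + dim_y C) (dim_x C + dim_y C)"
    and x: "x = sqrt \<bar>hat_rho n C a b \<omega>\<bar> \<cdot>\<^sub>v a \<omega>" and y: "y = sqrt \<bar>hat_rho n C a b \<omega>\<bar> \<cdot>\<^sub>v b \<omega>"
    and f: "col (F \<omega>) i = f1 @\<^sub>v f2" "f1 \<in> carrier_vec (dim_x C)" "f2 \<in> carrier_vec (dim_y C)"
  shows "x_db n C a b F \<omega> $ i = x $ i -
      (2 * bil (hat_Sigma_x n C \<omega>) x x * bil (hat_Sigma_x n C \<omega>) f1 x - 2 * bil (hat_Sigma_xy n C \<omega>) f1 y
     + 2 * bil (hat_Sigma_y n C \<omega>) y y * bil (hat_Sigma_y n C \<omega>) f2 y - 2 * bil (hat_Sigma_xy n C \<omega>) x f2)"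
proof -
  let ?Sx = "hat_Sigma_x n C \<omega>" and ?Sy = "hat_Sigma_y n C \<omega>" and ?Sxy = "hat_Sigma_xy n C \<omega>"
  let ?p = "dim_x C" and ?q = "dim_y C"
  have xy: "x \<in> carrier_vec ?p" "y \<in> carrier_vec ?q" using a b x y by auto
  have T: "transpose_mat ?Sxy \<in> carrier_mat ?q ?p" using hat_Sigma_carrier(3) by simp
  have v: "?Sx *\<^sub>v x \<in> carrier_vec ?p" "?Sy *\<^sub>v y \<in> carrier_vec ?q" "?Sxy *\<^sub>v y \<in> carrier_vec ?p"
    "transpose_mat ?Sxy *\<^sub>v x \<in> carrier_vec ?q"
    using mult_mat_vec_carrier[OF hat_Sigma_carrier(1) xy(1)] mult_mat_vec_carrier[OF hat_Sigma_carrier(2) xy(2)]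
      mult_mat_vec_carrier[OF hat_Sigma_carrier(3) xy(2)] mult_mat_vec_carrier[OF T xy(1)] by auto
  define gx where "gx = (2 * (x \<bullet> (?Sx *\<^sub>v x))) \<cdot>\<^sub>v (?Sx *\<^sub>v x) - 2 \<cdot>\<^sub>v (?Sxy *\<^sub>v y)"
  define gy where "gy = (2 * (y \<bullet> (?Sy *\<^sub>v y))) \<cdot>\<^sub>v (?Sy *\<^sub>v y) - 2 \<cdot>\<^sub>v (transpose_mat ?Sxy *\<^sub>v x)"
  have g: "gx \<in> carrier_vec ?p" "gy \<in> carrier_vec ?q" using v by (auto simp: gx_def gy_def)
  have "debiased n C a b F \<omega> = (x @\<^sub>v y) - transpose_mat (F \<omega>) *\<^sub>v (gx @\<^sub>v gy)"
    by (simp add: debiased_def Let_def x y gx_def gy_def)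
  then have "x_db n C a b F \<omega> $ i = ((x @\<^sub>v y) - transpose_mat (F \<omega>) *\<^sub>v (gx @\<^sub>v gy)) $ i"
    using i by (simp add: x_db_def vec_first_def)
  also have "\<dots> = x $ i - col (F \<omega>) i \<bullet> (gx @\<^sub>v gy)"
    using i F xy by simp
  also have "col (F \<omega>) i \<bullet> (gx @\<^sub>v gy) = f1 \<bullet> gx + f2 \<bullet> gy"
    unfolding f(1) by (rule scalar_prod_append[OF f(2,3) g])
  also have "f1 \<bullet> gx = 2 * bil ?Sx x x * bil ?Sx f1 x - 2 * bil ?Sxy f1 y"
    unfolding gx_def using f v by (subst scalar_prod_minus_distrib[of _ ?p]) (auto simp: bil_def)
  also have "f2 \<bullet> gy = 2 * bil ?Sy y y * bil ?Sy f2 y - 2 * bil (transpose_mat ?Sxy) f2 x"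
    unfolding gy_def using f v by (subst scalar_prod_minus_distrib[of _ ?q]) (auto simp: bil_def)
  also have "bil (transpose_mat ?Sxy) f2 x = bil ?Sxy x f2"
    by (rule bil_transpose[OF hat_Sigma_carrier(3) xy(1) f(3)])
  finally show ?thesis by simp
qed

section \<open>Deterministic expansion at a single outcome\<close>

context cca_regular begin

lemma dev_carrier [simp]:
  "dev_x n C \<omega> \<in> carrier_mat (dim_x C) (dim_x C)"
  "dev_y n C \<omega> \<in> carrier_mat (dim_y C) (dim_y C)"
  "dev_xy n C \<omega> \<in> carrier_mat (dim_x C) (dim_y C)"
  using Sigma_x_carrier Sigma_y_carrier Sigma_xy_carrier
  by (auto simp: dev_x_def dev_y_def dev_xy_def intro!: add_carrier_mat)

lemma dev_x_form:
  "u \<in> carrier_vec (dim_x C) \<Longrightarrow> v \<in> carrier_vec (dim_x C) \<Longrightarrow>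
     bil (hat_Sigma_x n C \<omega>) u v = bil (Sigma_x C) u v + bil (dev_x n C \<omega>) u v"
  unfolding dev_x_def
  by (simp add: bil_add_mat[of _ "dim_x C" "dim_x C"] bil_smult_mat[OF Sigma_x_carrier])

lemma dev_y_form:
  "u \<in> carrier_vec (dim_y C) \<Longrightarrow> v \<in> carrier_vec (dim_y C) \<Longrightarrow>
     bil (hat_Sigma_y n C \<omega>) u v = bil (Sigma_y C) u v + bil (dev_y n C \<omega>) u v"
  unfolding dev_y_def
  by (simp add: bil_add_mat[of _ "dim_y C" "dim_y C"] bil_smult_mat[OF Sigma_y_carrier])

lemma dev_xy_form:
  "u \<in> carrier_vec (dim_x C) \<Longrightarrow> v \<in> carrier_vec (dim_y C) \<Longrightarrow>
     bil (hat_Sigma_xy n C \<omega>) u v = bil (Sigma_xy C) u v + bil (dev_xy n C \<omega>) u v"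
  unfolding dev_xy_def
  by (simp add: bil_add_mat[of _ "dim_x C" "dim_y C"] bil_smult_mat[OF Sigma_xy_carrier])

lemma test_carrier: "u \<in> test_x C i \<Longrightarrow> u \<in> carrier_vec (dim_x C)" "v \<in> test_y C i \<Longrightarrow> v \<in> carrier_vec (dim_y C)"
  by (auto simp: test_x_def test_y_def)

lemma test_members [simp]:
  "k < dim_x C \<Longrightarrow> unit_vec (dim_x C) k \<in> test_x C i" "alpha0 C \<in> test_x C i" "x0 C \<in> test_x C i" "phi1 C i \<in> test_x C i"
  "k < dim_y C \<Longrightarrow> unit_vec (dim_y C) k \<in> test_y C i" "beta0 C \<in> test_y C i" "y0 C \<in> test_y C i" "phi2 C i \<in> test_y C i"
  by (auto simp: test_x_def test_y_def)

end

text \<open>One outcome \<open>\<omega>\<close> off all exceptional sets, so nothing in this locale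
  is random. \<eta> stands for the square root of the sparsity, \<open>lam\<close> for the entrywise
  rate and \<tau> for the l2 rate; \<open>B\<close> dominates every constant in play, and the
  smallness conditions hold for large n.\<close>

locale cca_expansion = cca_regular C n r K \<epsilon>0 M
  for C :: "'w cca" and n r :: nat and K \<epsilon>0 M :: real +
  fixes i :: nat and B lam \<tau> \<eta> :: real and a b :: "'w \<Rightarrow> real vec" and F :: "'w \<Rightarrow> real mat" and \<omega> :: 'w
  assumes i: "i < dim_x C"
    and eps_less_1: "\<epsilon>0 < 1"
    and B: "1 \<le> B" "M \<le> B" "1 / \<epsilon>0 \<le> B" "sqrt M \<le> B" "M / (2 * \<epsilon>0) \<le> B"
    and rates: "0 \<le> lam" "0 \<le> \<tau>" "\<tau> \<le> 1" "0 \<le> \<eta>" "lam \<le> \<tau>" "lam * \<eta> \<le> \<tau>" "lam * \<eta>\<^sup>2 \<le> 1"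
    and sparse: "sqrt (real (sparsity C)) \<le> \<eta>"
    and small: "7 * B ^ 3 * \<tau> \<le> \<epsilon>0 / 2" "B * (\<eta> * \<tau>) + B * \<tau> < 2 / sqrt M"
    and a: "a \<omega> \<in> carrier_vec (dim_x C)" and b: "b \<omega> \<in> carrier_vec (dim_y C)"
    and F: "F \<omega> \<in> carrier_mat (dim_x C + dim_y C) (dim_x C + dim_y C)"
    and prelim2: "pm_dist l2_norm (a \<omega>) (alpha0 C) + pm_dist l2_norm (b \<omega>) (beta0 C) \<le> B * \<tau>"
    and prelim1: "pm_dist l1_norm (a \<omega>) (alpha0 C) + pm_dist l1_norm (b \<omega>) (beta0 C) \<le> B * (\<eta> * \<tau>)"
    and hess2: "max_col_dist l2_norm (F \<omega>) (Phi0 C) \<le> B * \<tau>"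
    and hess1: "max_col_dist l1_norm (F \<omega>) (Phi0 C) \<le> B * (\<eta> * \<tau>)"
    and close: "cov_close n C i (B * lam) \<omega>"
    and signs: "0 \<le> hat_rho n C a b \<omega>"
begin

lemma Sigma_B:
  "u \<in> carrier_vec (dim_x C) \<Longrightarrow> u' \<in> carrier_vec (dim_x C) \<Longrightarrow> \<bar>bil (Sigma_x C) u u'\<bar> \<le> B * l2_norm u * l2_norm u'"
  "v \<in> carrier_vec (dim_y C) \<Longrightarrow> v' \<in> carrier_vec (dim_y C) \<Longrightarrow> \<bar>bil (Sigma_y C) v v'\<bar> \<le> B * l2_norm v * l2_norm v'"
  "u \<in> carrier_vec (dim_x C) \<Longrightarrow> v \<in> carrier_vec (dim_y C) \<Longrightarrow> \<bar>bil (Sigma_xy C) u v\<bar> \<le> B * l2_norm u * l2_norm v"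
  by (rule order_trans[OF Sigma_x_bound] order_trans[OF Sigma_y_bound] order_trans[OF Sigma_xy_bound],
      (assumption | intro mult_right_mono B(2) l2_norm_nonneg)+)+

lemma expand_x:
  assumes "u0 \<in> test_x C i" "v0 \<in> test_x C i" "du \<in> carrier_vec (dim_x C)" "dv \<in> carrier_vec (dim_x C)"
    and n0: "l2_norm u0 \<le> B" "l2_norm v0 \<le> B" and b: "1 \<le> c"
    and nd: "l2_norm du \<le> c * \<tau>" "l2_norm dv \<le> c * \<tau>" "l1_norm du \<le> c * (\<eta> * \<tau>)" "l1_norm dv \<le> c * (\<eta> * \<tau>)"
  shows "\<bar>bil (Sigma_x C) u0 dv + bil (Sigma_x C) du v0 + bil (dev_x n C \<omega>) u0 v0\<bar> \<le> 3 * B\<^sup>2 * c * \<tau>"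
    and "\<bar>bil (hat_Sigma_x n C \<omega>) (u0 + du) (v0 + dv) - (bil (Sigma_x C) u0 v0 + (bil (Sigma_x C) u0 dv + bil (Sigma_x C) du v0 + bil (dev_x n C \<omega>) u0 v0))\<bar> \<le> 4 * B * c\<^sup>2 * \<tau>\<^sup>2"
  by (rule form_expand[OF Sigma_x_carrier dev_carrier(1) test_carrier(1)[OF assms(1)] assms(3) test_carrier(1)[OF assms(2)] assms(4)
        dev_x_form Sigma_B(1) _ _ _ _ n0 nd B(1) b rates];
      use close assms(1,2) in \<open>auto simp: cov_close_def\<close>)+

lemma expand_y:
  assumes "u0 \<in> test_y C i" "v0 \<in> test_y C i" "du \<in> carrier_vec (dim_y C)" "dv \<in> carrier_vec (dim_y C)"
    and n0: "l2_norm u0 \<le> B" "l2_norm v0 \<le> B" and b: "1 \<le> c"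
    and nd: "l2_norm du \<le> c * \<tau>" "l2_norm dv \<le> c * \<tau>" "l1_norm du \<le> c * (\<eta> * \<tau>)" "l1_norm dv \<le> c * (\<eta> * \<tau>)"
  shows "\<bar>bil (Sigma_y C) u0 dv + bil (Sigma_y C) du v0 + bil (dev_y n C \<omega>) u0 v0\<bar> \<le> 3 * B\<^sup>2 * c * \<tau>"
    and "\<bar>bil (hat_Sigma_y n C \<omega>) (u0 + du) (v0 + dv) - (bil (Sigma_y C) u0 v0 + (bil (Sigma_y C) u0 dv + bil (Sigma_y C) du v0 + bil (dev_y n C \<omega>) u0 v0))\<bar> \<le> 4 * B * c\<^sup>2 * \<tau>\<^sup>2"
  by (rule form_expand[OF Sigma_y_carrier dev_carrier(2) test_carrier(2)[OF assms(1)] assms(3) test_carrier(2)[OF assms(2)] assms(4)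
        dev_y_form Sigma_B(2) _ _ _ _ n0 nd B(1) b rates];
      use close assms(1,2) in \<open>auto simp: cov_close_def\<close>)+

lemma expand_xy:
  assumes "u0 \<in> test_x C i" "v0 \<in> test_y C i" "du \<in> carrier_vec (dim_x C)" "dv \<in> carrier_vec (dim_y C)"
    and n0: "l2_norm u0 \<le> B" "l2_norm v0 \<le> B" and b: "1 \<le> c"
    and nd: "l2_norm du \<le> c * \<tau>" "l2_norm dv \<le> c * \<tau>" "l1_norm du \<le> c * (\<eta> * \<tau>)" "l1_norm dv \<le> c * (\<eta> * \<tau>)"
  shows "\<bar>bil (Sigma_xy C) u0 dv + bil (Sigma_xy C) du v0 + bil (dev_xy n C \<omega>) u0 v0\<bar> \<le> 3 * B\<^sup>2 * c * \<tau>"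
    and "\<bar>bil (hat_Sigma_xy n C \<omega>) (u0 + du) (v0 + dv) - (bil (Sigma_xy C) u0 v0 + (bil (Sigma_xy C) u0 dv + bil (Sigma_xy C) du v0 + bil (dev_xy n C \<omega>) u0 v0))\<bar> \<le> 4 * B * c\<^sup>2 * \<tau>\<^sup>2"
  by (rule form_expand[OF Sigma_xy_carrier dev_carrier(3) test_carrier(1)[OF assms(1)] assms(3) test_carrier(2)[OF assms(2)] assms(4)
        dev_xy_form Sigma_B(3) _ _ _ _ n0 nd B(1) b rates];
      use close assms(1,2) in \<open>auto simp: cov_close_def\<close>)+

lemma norms_le_B: "l2_norm (alpha0 C) \<le> B" "l2_norm (beta0 C) \<le> B" "l2_norm (x0 C) \<le> B" "l2_norm (y0 C) \<le> B"
  "l2_norm (phi1 C i) \<le> B" "l2_norm (phi2 C i) \<le> B"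
  using alpha0_l2 beta0_l2 x0_l2 y0_l2 phi_norm[OF i] B by linarith+

lemma alpha0_l1_B: "l1_norm (alpha0 C) \<le> B * \<eta>" and beta0_l1_B: "l1_norm (beta0 C) \<le> B * \<eta>"
proof -
  have "sqrt (real (sparsity C)) * sqrt M \<le> \<eta> * B"
    using sparse B rates M_pos by (intro mult_mono) auto
  then show "l1_norm (alpha0 C) \<le> B * \<eta>" "l1_norm (beta0 C) \<le> B * \<eta>"
    using alpha0_l1 beta0_l1 by (auto simp: mult.commute)
qed

text \<open>The vector is the difference of \<open>t (v0 + dv)\<close> and \<open>s v0\<close>. The
  bound \<open>56 * B ^ 4 * \<tau>\<close> on the scalar times \<open>B\<close> contributes 56, and
  the factor \<open>t \<le> 2\<close> on the error contributes 2.\<close>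

lemma scaled_difference_norms:
  fixes v0 dv :: "real vec" and t s :: real
  assumes v: "v0 \<in> carrier_vec p" "dv \<in> carrier_vec p" and t: "0 \<le> t" "t \<le> 2" "\<bar>t - s\<bar> \<le> 56 * B ^ 4 * \<tau>"
    and n0: "l2_norm v0 \<le> B" "l1_norm v0 \<le> B * \<eta>" and nd: "l2_norm dv \<le> B * \<tau>" "l1_norm dv \<le> B * (\<eta> * \<tau>)"
  shows "l2_norm ((t - s) \<cdot>\<^sub>v v0 + t \<cdot>\<^sub>v dv) \<le> 58 * B ^ 5 * \<tau>"
    and "l1_norm ((t - s) \<cdot>\<^sub>v v0 + t \<cdot>\<^sub>v dv) \<le> 58 * B ^ 5 * (\<eta> * \<tau>)"
proof -
  have B5: "B \<le> B ^ 5" using B(1) power_increasing[of 1 5 B] by simp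
  have e: "56 * B ^ 4 * \<tau> * B = 56 * B ^ 5 * \<tau>" by (simp add: eval_nat_numeral)
  have "l2_norm ((t - s) \<cdot>\<^sub>v v0 + t \<cdot>\<^sub>v dv) \<le> \<bar>t - s\<bar> * l2_norm v0 + t * l2_norm dv"
    using l2_norm_add_le[of "(t - s) \<cdot>\<^sub>v v0" p "t \<cdot>\<^sub>v dv"] v t by (simp add: l2_norm_smult)
  also have "\<dots> \<le> 56 * B ^ 4 * \<tau> * B + 2 * (B * \<tau>)"
    using t n0 nd B rates by (intro add_mono mult_mono) auto
  also have "\<dots> \<le> 56 * B ^ 5 * \<tau> + 2 * (B ^ 5 * \<tau>)"
    unfolding e using B5 rates by (intro add_mono mult_left_mono mult_right_mono) auto
  finally show "l2_norm ((t - s) \<cdot>\<^sub>v v0 + t \<cdot>\<^sub>v dv) \<le> 58 * B ^ 5 * \<tau>" by (simp add: mult_ac)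
  have "l1_norm ((t - s) \<cdot>\<^sub>v v0 + t \<cdot>\<^sub>v dv) \<le> \<bar>t - s\<bar> * l1_norm v0 + t * l1_norm dv"
    using l1_norm_add_le[of "(t - s) \<cdot>\<^sub>v v0" p "t \<cdot>\<^sub>v dv"] v t by (simp add: l1_norm_smult)
  also have "\<dots> \<le> 56 * B ^ 4 * \<tau> * (B * \<eta>) + 2 * (B * (\<eta> * \<tau>))"
    using t n0 nd B rates by (intro add_mono mult_mono) auto
  also have "56 * B ^ 4 * \<tau> * (B * \<eta>) = 56 * B ^ 5 * (\<eta> * \<tau>)" using e by (simp add: mult_ac)
  also have "2 * (B * (\<eta> * \<tau>)) \<le> 2 * (B ^ 5 * (\<eta> * \<tau>))"
    using B5 rates by (intro mult_left_mono mult_right_mono) auto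
  finally show "l1_norm ((t - s) \<cdot>\<^sub>v v0 + t \<cdot>\<^sub>v dv) \<le> 58 * B ^ 5 * (\<eta> * \<tau>)" by (simp add: mult_ac)
qed

text \<open>\<open>common_sign\<close> yields one sign per vector, \<open>wa\<close> and
  \<open>wb\<close>; the estimated correlation of the aligned vectors is a positive \<open>z\<close>
  near \<open>rho0\<close>. The constants chain as \<open>7 * B ^ 3\<close> for the normalised
  forms, \<open>8 * 7 * B ^ 3 / \<epsilon>0 \<le> 56 * B ^ 4\<close> for the square root of the
  correlation, and 58 after \<open>scaled_difference_norms\<close>.\<close>

lemma scaled_estimators:
  obtains w dx dy where "w \<in> {- 1, 1 :: real}" "dx \<in> carrier_vec (dim_x C)" "dy \<in> carrier_vec (dim_y C)"
    "sqrt \<bar>hat_rho n C a b \<omega>\<bar> \<cdot>\<^sub>v a \<omega> = w \<cdot>\<^sub>v (x0 C + dx)" "sqrt \<bar>hat_rho n C a b \<omega>\<bar> \<cdot>\<^sub>v b \<omega> = w \<cdot>\<^sub>v (y0 C + dy)"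
    "l2_norm dx \<le> 58 * B ^ 5 * \<tau>" "l2_norm dy \<le> 58 * B ^ 5 * \<tau>"
    "l1_norm dx \<le> 58 * B ^ 5 * (\<eta> * \<tau>)" "l1_norm dy \<le> 58 * B ^ 5 * (\<eta> * \<tau>)"
proof -
  have nn: "0 \<le> pm_dist l2_norm (a \<omega>) (alpha0 C)" "0 \<le> pm_dist l2_norm (b \<omega>) (beta0 C)"
    "0 \<le> pm_dist l1_norm (a \<omega>) (alpha0 C)" "0 \<le> pm_dist l1_norm (b \<omega>) (beta0 C)"
    by (auto intro: pm_dist_nonneg)
  have 1: "pm_dist l2_norm (a \<omega>) (alpha0 C) \<le> B * \<tau>" "pm_dist l2_norm (b \<omega>) (beta0 C) \<le> B * \<tau>"
    "pm_dist l1_norm (a \<omega>) (alpha0 C) \<le> B * (\<eta> * \<tau>)" "pm_dist l1_norm (b \<omega>) (beta0 C) \<le> B * (\<eta> * \<tau>)"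
    using nn prelim1 prelim2 by linarith+
  have sm: "B * (\<eta> * \<tau>) + B * \<tau> < 2 * l2_norm (alpha0 C)" "B * (\<eta> * \<tau>) + B * \<tau> < 2 * l2_norm (beta0 C)"
    using small(2) alpha0_l2_lower beta0_l2_lower by linarith+
  obtain wa da where wa: "wa \<in> {- 1, 1 :: real}" "da \<in> carrier_vec (dim_x C)" "wa \<cdot>\<^sub>v a \<omega> = alpha0 C + da"
      "l2_norm da \<le> B * \<tau>" "l1_norm da \<le> B * (\<eta> * \<tau>)"
    by (rule common_sign[OF a alpha0_carrier 1(1,3) sm(1)])
  obtain wb db where wb: "wb \<in> {- 1, 1 :: real}" "db \<in> carrier_vec (dim_y C)" "wb \<cdot>\<^sub>v b \<omega> = beta0 C + db"
      "l2_norm db \<le> B * \<tau>" "l1_norm db \<le> B * (\<eta> * \<tau>)"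
    by (rule common_sign[OF b beta0_carrier 1(2,4) sm(2)])
  have a_eq: "a \<omega> = wa \<cdot>\<^sub>v (alpha0 C + da)"
    unfolding wa(3)[symmetric] using wa(1) a by (auto simp: smult_smult_assoc)
  have b_eq: "b \<omega> = wb \<cdot>\<^sub>v (beta0 C + db)"
    unfolding wb(3)[symmetric] using wb(1) b by (auto simp: smult_smult_assoc)
  have w2: "wa * wa = 1" "wb * wb = 1" using wa wb by auto
  let ?u = "alpha0 C + da" and ?v = "beta0 C + db"
  have uv: "?u \<in> carrier_vec (dim_x C)" "?v \<in> carrier_vec (dim_y C)" using wa wb by auto
  define A Bq N where "A = bil (hat_Sigma_x n C \<omega>) ?u ?u" and "Bq = bil (hat_Sigma_y n C \<omega>) ?v ?v"
    and "N = bil (hat_Sigma_xy n C \<omega>) ?u ?v"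
  have A: "\<bar>A - 1\<bar> \<le> 7 * B ^ 3 * \<tau>"
    unfolding A_def alpha0_normalized[symmetric]
    using expand_x[OF test_members(2,2) wa(2,2) norms_le_B(1,1) B(1) wa(4,4,5,5)] rates B(1)
    by (intro form_near) auto
  have Bq: "\<bar>Bq - 1\<bar> \<le> 7 * B ^ 3 * \<tau>"
    unfolding Bq_def beta0_normalized[symmetric]
    using expand_y[OF test_members(6,6) wb(2,2) norms_le_B(2,2) B(1) wb(4,4,5,5)] rates B(1)
    by (intro form_near) auto
  have "bil (Sigma_xy C) (alpha0 C) (beta0 C) = rho0 C"
    using Sigma_xy_beta0[OF alpha0_carrier] by (simp add: alpha0_normalized)
  then have N: "\<bar>N - rho0 C\<bar> \<le> 7 * B ^ 3 * \<tau>"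
    unfolding N_def
    using expand_xy[OF test_members(2,6) wa(2) wb(2) norms_le_B(1,2) B(1) wa(4) wb(4) wa(5) wb(5)] rates B(1)
    by (intro form_near) auto
  define z where "z = N / (sqrt A * sqrt Bq)"
  have ratio: "0 < z" "sqrt z \<le> 2" "\<bar>sqrt z - sqrt (rho0 C)\<bar> \<le> 8 * (7 * B ^ 3 * \<tau>) / \<epsilon>0"
    unfolding z_def using ratio_expand[OF A Bq N small(1) eps_pos eps_less_1] rho0_gt rho0_le_1 by auto
  have "8 * (7 * B ^ 3 * \<tau>) / \<epsilon>0 = 56 * B ^ 3 * \<tau> * (1 / \<epsilon>0)" by simp
  also have "\<dots> \<le> 56 * B ^ 3 * \<tau> * B" using B rates by (intro mult_left_mono) auto
  also have "\<dots> = 56 * B ^ 4 * \<tau>" by (simp add: eval_nat_numeral)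
  finally have sq: "\<bar>sqrt z - sqrt (rho0 C)\<bar> \<le> 56 * B ^ 4 * \<tau>" using ratio by linarith
  have rho: "hat_rho n C a b \<omega> = wa * wb * z"
  proof -
    have "bil (hat_Sigma_x n C \<omega>) (a \<omega>) (a \<omega>) = wa * wa * A"
      unfolding a_eq A_def using uv
      by (simp add: bil_smult_left[OF hat_Sigma_carrier(1) _ uv(1) _ uv(1)] bil_smult_right[OF hat_Sigma_carrier(1) uv(1,1,1,1)])
    moreover have "bil (hat_Sigma_y n C \<omega>) (b \<omega>) (b \<omega>) = wb * wb * Bq"
      unfolding b_eq Bq_def using uv
      by (simp add: bil_smult_left[OF hat_Sigma_carrier(2) _ uv(2) _ uv(2)] bil_smult_right[OF hat_Sigma_carrier(2) uv(2,2,2,2)])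
    moreover have "bil (hat_Sigma_xy n C \<omega>) (a \<omega>) (b \<omega>) = wa * wb * N"
      unfolding a_eq b_eq N_def using uv
      by (simp add: bil_smult_left[OF hat_Sigma_carrier(3) _ uv(1) _ uv(2)] bil_smult_right[OF hat_Sigma_carrier(3) uv(1,1,2,2)])
    ultimately show ?thesis by (simp add: hat_rho_def z_def w2 flip: bil_def)
  qed
  \<comment> \<open>\<open>hat_rho\<close> is \<open>wa * wb * z\<close> with \<open>z > 0\<close>,
    so its nonnegativity rules out opposite signs.\<close>
  have "wa = wb" using wa(1) wb(1) signs ratio(1) unfolding rho by auto
  then have rho': "hat_rho n C a b \<omega> = z" using rho w2 by simp
  define dx where "dx = (sqrt z - sqrt (rho0 C)) \<cdot>\<^sub>v alpha0 C + sqrt z \<cdot>\<^sub>v da"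
  define dy where "dy = (sqrt z - sqrt (rho0 C)) \<cdot>\<^sub>v beta0 C + sqrt z \<cdot>\<^sub>v db"
  have z0: "0 \<le> sqrt z" using ratio by simp
  show thesis
  proof (rule that[of wa dx dy])
    show "sqrt \<bar>hat_rho n C a b \<omega>\<bar> \<cdot>\<^sub>v a \<omega> = wa \<cdot>\<^sub>v (x0 C + dx)"
      unfolding rho' a_eq x0_def dx_def using ratio(1) wa(2)
      by (intro eq_vecI) (auto simp: algebra_simps carrier_vecD[OF alpha0_carrier])
    show "sqrt \<bar>hat_rho n C a b \<omega>\<bar> \<cdot>\<^sub>v b \<omega> = wa \<cdot>\<^sub>v (y0 C + dy)"
      unfolding rho' b_eq y0_def dy_def \<open>wa = wb\<close> using ratio(1) wb(2)
      by (intro eq_vecI) (auto simp: algebra_simps carrier_vecD[OF beta0_carrier])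
    show "l2_norm dx \<le> 58 * B ^ 5 * \<tau>" "l1_norm dx \<le> 58 * B ^ 5 * (\<eta> * \<tau>)"
      unfolding dx_def
      by (rule scaled_difference_norms[OF alpha0_carrier wa(2) z0 ratio(2) sq norms_le_B(1) alpha0_l1_B wa(4,5)])+
    show "l2_norm dy \<le> 58 * B ^ 5 * \<tau>" "l1_norm dy \<le> 58 * B ^ 5 * (\<eta> * \<tau>)"
      unfolding dy_def
      by (rule scaled_difference_norms[OF beta0_carrier wb(2) z0 ratio(2) sq norms_le_B(2) beta0_l1_B wb(4,5)])+
  qed (use wa wb in \<open>auto simp: dx_def dy_def\<close>)
qed

text \<open>The canonical equations after rescaling. Together with \<open>x0_y0_normalized\<close>
  they say that the population gradient vanishes at \<open>(x0, y0)\<close>.\<close>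

lemma stationary:
  "u \<in> carrier_vec (dim_x C) \<Longrightarrow> bil (Sigma_xy C) u (y0 C) = rho0 C * bil (Sigma_x C) u (x0 C)"
  "v \<in> carrier_vec (dim_y C) \<Longrightarrow> bil (Sigma_xy C) (x0 C) v = rho0 C * bil (Sigma_y C) (y0 C) v"
  unfolding x0_def y0_def
  using bil_smult_right[OF Sigma_xy_carrier _ _ beta0_carrier beta0_carrier] bil_smult_right[OF Sigma_x_carrier _ _ alpha0_carrier alpha0_carrier]
    bil_smult_left[OF Sigma_xy_carrier alpha0_carrier alpha0_carrier] bil_smult_left[OF Sigma_y_carrier beta0_carrier beta0_carrier]
  by (simp_all add: Sigma_xy_beta0 Sigma_xy_alpha0)

lemma x0_y0_scale:
  "u \<in> carrier_vec (dim_x C) \<Longrightarrow> u' \<in> carrier_vec (dim_x C) \<Longrightarrow>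
     bil (Sigma_x C) u (x0 C) * bil (Sigma_x C) (x0 C) u' = rho0 C * bil (Sigma_x C) u (alpha0 C) * bil (Sigma_x C) (alpha0 C) u'"
  "v \<in> carrier_vec (dim_y C) \<Longrightarrow> v' \<in> carrier_vec (dim_y C) \<Longrightarrow>
     bil (Sigma_y C) v (y0 C) * bil (Sigma_y C) (y0 C) v' = rho0 C * bil (Sigma_y C) v (beta0 C) * bil (Sigma_y C) (beta0 C) v'"
proof -
  have s: "sqrt (rho0 C) * (sqrt (rho0 C) * t) = rho0 C * t" for t
    using rho0_pos by (simp flip: mult.assoc)
  show "bil (Sigma_x C) u (x0 C) * bil (Sigma_x C) (x0 C) u' = rho0 C * bil (Sigma_x C) u (alpha0 C) * bil (Sigma_x C) (alpha0 C) u'"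
    if u: "u \<in> carrier_vec (dim_x C)" "u' \<in> carrier_vec (dim_x C)"
    unfolding x0_def bil_smult_right[OF Sigma_x_carrier u(1,1) alpha0_carrier alpha0_carrier]
      bil_smult_left[OF Sigma_x_carrier alpha0_carrier alpha0_carrier u(2,2)]
    using s[of "bil (Sigma_x C) u (alpha0 C) * bil (Sigma_x C) (alpha0 C) u'"] by (simp add: mult_ac)
  show "bil (Sigma_y C) v (y0 C) * bil (Sigma_y C) (y0 C) v' = rho0 C * bil (Sigma_y C) v (beta0 C) * bil (Sigma_y C) (beta0 C) v'"
    if v: "v \<in> carrier_vec (dim_y C)" "v' \<in> carrier_vec (dim_y C)"
    unfolding y0_def bil_smult_right[OF Sigma_y_carrier v(1,1) beta0_carrier beta0_carrier]
      bil_smult_left[OF Sigma_y_carrier beta0_carrier beta0_carrier v(2,2)]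
    using s[of "bil (Sigma_y C) v (beta0 C) * bil (Sigma_y C) (beta0 C) v'"] by (simp add: mult_ac)
qed

lemma x0_y0_normalized: "bil (Sigma_x C) (x0 C) (x0 C) = rho0 C" "bil (Sigma_y C) (y0 C) (y0 C) = rho0 C"
  unfolding x0_def y0_def bil_smult_right[OF Sigma_x_carrier x0_carrier[unfolded x0_def] x0_carrier alpha0_carrier alpha0_carrier]
    bil_smult_left[OF Sigma_x_carrier alpha0_carrier x0_carrier alpha0_carrier x0_carrier]
    bil_smult_right[OF Sigma_y_carrier y0_carrier[unfolded y0_def] y0_carrier beta0_carrier beta0_carrier]
    bil_smult_left[OF Sigma_y_carrier beta0_carrier y0_carrier beta0_carrier y0_carrier]
  using rho0_pos by (simp_all add: alpha0_normalized beta0_normalized)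

text \<open>\<open>H0_phi\<close> with both \<open>alpha0\<close> of the rank-one term replaced by
  \<open>x0\<close>, which absorbs a factor \<open>rho0\<close>, and likewise for
  \<open>beta0\<close>. This is the shape that the product rule produces.\<close>

lemma hessian_column:
  assumes h: "h1 \<in> carrier_vec (dim_x C)" "h2 \<in> carrier_vec (dim_y C)"
  shows "2 * rho0 C * bil (Sigma_x C) (phi1 C i) h1 + 4 * (bil (Sigma_x C) (phi1 C i) (x0 C) * bil (Sigma_x C) (x0 C) h1)
    - 2 * bil (Sigma_xy C) (phi1 C i) h2 - 2 * bil (Sigma_xy C) h1 (phi2 C i)
    + 2 * rho0 C * bil (Sigma_y C) (phi2 C i) h2 + 4 * (bil (Sigma_y C) (phi2 C i) (y0 C) * bil (Sigma_y C) (y0 C) h2) = h1 $ i"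
  using H0_phi[OF i h] unfolding H0_form[OF phi_carrier h] x0_y0_scale(1)[OF phi_carrier(1) h(1)] x0_y0_scale(2)[OF phi_carrier(2) h(2)]
  by simp

lemma hat_Phi_column:
  obtains df1 df2 where "df1 \<in> carrier_vec (dim_x C)" "df2 \<in> carrier_vec (dim_y C)"
    "col (F \<omega>) i = (phi1 C i + df1) @\<^sub>v (phi2 C i + df2)"
    "l2_norm df1 \<le> B * \<tau>" "l2_norm df2 \<le> B * \<tau>" "l1_norm df1 \<le> B * (\<eta> * \<tau>)" "l1_norm df2 \<le> B * (\<eta> * \<tau>)"
proof -
  let ?p = "dim_x C" and ?q = "dim_y C"
  have id: "i < ?p + ?q" "i < dim_col (Phi0 C)" using i Phi0_carrier by auto
  define df where "df = col (F \<omega>) i - col (Phi0 C) i"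
  have c: "col (F \<omega>) i \<in> carrier_vec (?p + ?q)" "col (Phi0 C) i \<in> carrier_vec (?p + ?q)"
    using col_dim[of "F \<omega>" i] col_dim[of "Phi0 C" i] F Phi0_carrier by auto
  have df: "df \<in> carrier_vec (?p + ?q)" using c by (simp add: df_def)
  let ?d1 = "vec_first df ?p" and ?d2 = "vec_last df ?q"
  have eq: "?d1 @\<^sub>v ?d2 = df" using df by simp
  have "col (F \<omega>) i = col (Phi0 C) i + df" using c F Phi0_carrier by (intro eq_vecI) (auto simp: df_def)
  also have "\<dots> = (phi1 C i @\<^sub>v phi2 C i) + (?d1 @\<^sub>v ?d2)" unfolding eq phi_append[OF id(1)] ..
  also have "\<dots> = (phi1 C i + ?d1) @\<^sub>v (phi2 C i + ?d2)"
    by (rule append_vec_add[of _ "dim_x C" _ _ "dim_y C"]) auto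
  finally have F_eq: "col (F \<omega>) i = (phi1 C i + ?d1) @\<^sub>v (phi2 C i + ?d2)" .
  have n: "l2_norm df \<le> B * \<tau>" "l1_norm df \<le> B * (\<eta> * \<tau>)"
    using max_col_dist_ge[OF id(2), of l2_norm "F \<omega>"] max_col_dist_ge[OF id(2), of l1_norm "F \<omega>"] hess1 hess2
    by (auto simp: df_def)
  show thesis
    by (rule that[of ?d1 ?d2])
       (use F_eq n l2_norm_append_ge[of ?d1 ?d2] l2_norm_append_ge(2)[of ?d2 ?d1] l1_norm_append_ge(1)[of ?d1 ?d2] l1_norm_append_ge(2)[of ?d2 ?d1] in
         \<open>auto simp: eq\<close>)
qed

text \<open>The correction has only terms of degree one and three in the pair of scaled estimates,
  so the common sign factors out and disappears after multiplication by \<open>w\<close>. The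
  constant 28 adds two products with remainder 6 and two single forms with remainder 1, each doubled
  by the gradient.\<close>

theorem debiased_expansion:
  obtains w where "w \<in> {- 1, 1 :: real}"
    "\<bar>w * x_db n C a b F \<omega> $ i - x0 C $ i - lin_term n C i \<omega>\<bar> \<le> 28 * (4 * B\<^sup>2 * (58 * B ^ 5)\<^sup>2)\<^sup>2 * \<tau>\<^sup>2"
proof -
  let ?p = "dim_x C" and ?q = "dim_y C"
  obtain w dx dy where w: "w \<in> {- 1, 1 :: real}" and d: "dx \<in> carrier_vec ?p" "dy \<in> carrier_vec ?q"
    and eqs: "sqrt \<bar>hat_rho n C a b \<omega>\<bar> \<cdot>\<^sub>v a \<omega> = w \<cdot>\<^sub>v (x0 C + dx)" "sqrt \<bar>hat_rho n C a b \<omega>\<bar> \<cdot>\<^sub>v b \<omega> = w \<cdot>\<^sub>v (y0 C + dy)"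
    and d2: "l2_norm dx \<le> 58 * B ^ 5 * \<tau>" "l2_norm dy \<le> 58 * B ^ 5 * \<tau>"
    and d1: "l1_norm dx \<le> 58 * B ^ 5 * (\<eta> * \<tau>)" "l1_norm dy \<le> 58 * B ^ 5 * (\<eta> * \<tau>)"
    by (rule scaled_estimators)
  obtain df1 df2 where f: "df1 \<in> carrier_vec ?p" "df2 \<in> carrier_vec ?q"
    and F_eq: "col (F \<omega>) i = (phi1 C i + df1) @\<^sub>v (phi2 C i + df2)"
    and f2: "l2_norm df1 \<le> B * \<tau>" "l2_norm df2 \<le> B * \<tau>" and f1: "l1_norm df1 \<le> B * (\<eta> * \<tau>)" "l1_norm df2 \<le> B * (\<eta> * \<tau>)"
    by (rule hat_Phi_column)
  define c where "c = 58 * B ^ 5"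
  \<comment> \<open>\<open>k\<close> dominates the first-order constant
    \<open>3 * B\<^sup>2 * c\<close>, the second-order constant \<open>4 * B * c\<^sup>2\<close> and
    the bound \<open>B * B * B\<close> on the population forms, so \<open>product_expand\<close>
    runs with a single constant.\<close>
  define k where "k = 4 * B\<^sup>2 * c\<^sup>2"
  have B5: "B \<le> B ^ 5" using B(1) power_increasing[of 1 5 B] by simp
  then have c: "B \<le> c" "1 \<le> c" using B(1) by (auto simp: c_def)
  note d2 = d2[folded c_def] and d1 = d1[folded c_def]
  have "B * \<tau> \<le> c * \<tau>" "B * (\<eta> * \<tau>) \<le> c * (\<eta> * \<tau>)" using c rates by (auto intro!: mult_right_mono)
  then have f2: "l2_norm df1 \<le> c * \<tau>" "l2_norm df2 \<le> c * \<tau>" and f1: "l1_norm df1 \<le> c * (\<eta> * \<tau>)" "l1_norm df2 \<le> c * (\<eta> * \<tau>)"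
    using f1 f2 by auto
  have B2: "1 \<le> B\<^sup>2" "B \<le> B\<^sup>2" and c2: "1 \<le> c\<^sup>2" "c \<le> c\<^sup>2" "B \<le> c\<^sup>2"
    using B(1) c by (auto simp: power2_eq_square intro: order_trans[OF _ mult_left_mono[of 1 _ c, simplified]] order_trans[OF _ mult_left_mono[of 1 _ B, simplified]])
  have k: "3 * B\<^sup>2 * c * \<tau> \<le> k * \<tau>" "4 * B * c\<^sup>2 * \<tau>\<^sup>2 \<le> k * \<tau>\<^sup>2" "1 \<le> k" "B * B * B \<le> k"
  proof -
    have "3 * B\<^sup>2 * c \<le> 4 * B\<^sup>2 * c\<^sup>2" using B2 c c2 by (intro mult_mono) auto
    then show "3 * B\<^sup>2 * c * \<tau> \<le> k * \<tau>" using rates by (auto simp: k_def intro: mult_right_mono)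
    have "4 * B * c\<^sup>2 \<le> 4 * B\<^sup>2 * c\<^sup>2" using B(1) B2 c2 by (intro mult_mono) auto
    then show "4 * B * c\<^sup>2 * \<tau>\<^sup>2 \<le> k * \<tau>\<^sup>2" unfolding k_def by (rule mult_right_mono) simp
    have "1 * 1 * 1 \<le> 4 * B\<^sup>2 * c\<^sup>2" using B(1) B2 c2 by (intro mult_mono) auto
    then show "1 \<le> k" by (simp add: k_def)
    have "B\<^sup>2 * B \<le> 4 * B\<^sup>2 * c\<^sup>2" using B2 c2 B by (intro mult_mono) auto
    then show "B * B * B \<le> k" by (simp add: k_def power2_eq_square)
  qed
  note [simp] = phi_carrier x0_carrier y0_carrier
  let ?Sx = "bil (Sigma_x C)" and ?Sy = "bil (Sigma_y C)" and ?Sxy = "bil (Sigma_xy C)"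
  let ?Dx = "bil (dev_x n C \<omega>)" and ?Dy = "bil (dev_y n C \<omega>)" and ?Dxy = "bil (dev_xy n C \<omega>)"
  let ?Hx = "bil (hat_Sigma_x n C \<omega>)" and ?Hy = "bil (hat_Sigma_y n C \<omega>)" and ?Hxy = "bil (hat_Sigma_xy n C \<omega>)"
  let ?x = "x0 C" and ?y = "y0 C" and ?f = "phi1 C i" and ?g = "phi2 C i"
  let ?X = "?x + dx" and ?Y = "?y + dy" and ?F = "?f + df1" and ?G = "?g + df2"
  have XY: "?X \<in> carrier_vec ?p" "?Y \<in> carrier_vec ?q" "?F \<in> carrier_vec ?p" "?G \<in> carrier_vec ?q"
    using d f by auto
  note XX = expand_x[OF test_members(3,3) d(1,1) norms_le_B(3,3) c(2) d2(1,1) d1(1,1)]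
  note FX = expand_x[OF test_members(4,3) f(1) d(1) norms_le_B(5,3) c(2) f2(1) d2(1) f1(1) d1(1)]
  note YY = expand_y[OF test_members(7,7) d(2,2) norms_le_B(4,4) c(2) d2(2,2) d1(2,2)]
  note GY = expand_y[OF test_members(8,7) f(2) d(2) norms_le_B(6,4) c(2) f2(2) d2(2) f1(2) d1(2)]
  note FY = expand_xy[OF test_members(4,7) f(1) d(2) norms_le_B(5,4) c(2) f2(1) d2(2) f1(1) d1(2)]
  note XG = expand_xy[OF test_members(3,8) d(1) f(2) norms_le_B(3,6) c(2) d2(1) f2(2) d1(1) f1(2)]
  define P Q where "P = ?Sx ?f ?x" and "Q = ?Sy ?g ?y"
  have PQ: "\<bar>P\<bar> \<le> k" "\<bar>Q\<bar> \<le> k"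
  proof -
    have "B * l2_norm ?f * l2_norm ?x \<le> B * B * B" "B * l2_norm ?g * l2_norm ?y \<le> B * B * B"
      using norms_le_B B by (auto intro!: mult_mono)
    then show "\<bar>P\<bar> \<le> k" "\<bar>Q\<bar> \<le> k"
      using Sigma_B(1)[of ?f ?x] Sigma_B(2)[of ?g ?y] k(4) by (auto simp: P_def Q_def)
  qed
  have rk: "\<bar>rho0 C\<bar> \<le> k" using rho0_pos rho0_le_1 k(3) by simp
  define A1 P1 A2 Q2 where "A1 = ?Sx ?x dx + ?Sx dx ?x + ?Dx ?x ?x" and "P1 = ?Sx ?f dx + ?Sx df1 ?x + ?Dx ?f ?x"
    and "A2 = ?Sy ?y dy + ?Sy dy ?y + ?Dy ?y ?y" and "Q2 = ?Sy ?g dy + ?Sy df2 ?y + ?Dy ?g ?y"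
  define T1 T2 where "T1 = ?Sxy ?f dy + ?Sxy df1 ?y + ?Dxy ?f ?y" and "T2 = ?Sxy ?x df2 + ?Sxy dx ?g + ?Dxy ?x ?g"
  have e1: "\<bar>?Hx ?X ?X * ?Hx ?F ?X - (rho0 C * P + rho0 C * P1 + A1 * P)\<bar> \<le> 6 * k\<^sup>2 * \<tau>\<^sup>2"
  proof (rule product_expand[OF _ _ _ _ rk PQ(1) rates(2,3) k(3)])
    show "\<bar>A1\<bar> \<le> k * \<tau>" "\<bar>P1\<bar> \<le> k * \<tau>"
      using XX(1) FX(1) k(1) unfolding A1_def P1_def by linarith+
    show "\<bar>?Hx ?X ?X - (rho0 C + A1)\<bar> \<le> k * \<tau>\<^sup>2" "\<bar>?Hx ?F ?X - (P + P1)\<bar> \<le> k * \<tau>\<^sup>2"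
      using XX(2) FX(2) k(2) unfolding A1_def P1_def P_def x0_y0_normalized by linarith+
  qed
  have e2: "\<bar>?Hy ?Y ?Y * ?Hy ?G ?Y - (rho0 C * Q + rho0 C * Q2 + A2 * Q)\<bar> \<le> 6 * k\<^sup>2 * \<tau>\<^sup>2"
  proof (rule product_expand[OF _ _ _ _ rk PQ(2) rates(2,3) k(3)])
    show "\<bar>A2\<bar> \<le> k * \<tau>" "\<bar>Q2\<bar> \<le> k * \<tau>"
      using YY(1) GY(1) k(1) unfolding A2_def Q2_def by linarith+
    show "\<bar>?Hy ?Y ?Y - (rho0 C + A2)\<bar> \<le> k * \<tau>\<^sup>2" "\<bar>?Hy ?G ?Y - (Q + Q2)\<bar> \<le> k * \<tau>\<^sup>2"
      using YY(2) GY(2) k(2) unfolding A2_def Q2_def Q_def x0_y0_normalized by linarith+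
  qed
  have e3: "\<bar>?Hxy ?F ?Y - (rho0 C * P + T1)\<bar> \<le> k * \<tau>\<^sup>2"
    using FY(2) k(2) by (simp add: T1_def P_def stationary(1))
  have gy: "?Sy ?y ?g = Q" using Sigma_y_comm[of ?y ?g] by (simp add: Q_def)
  have e4: "\<bar>?Hxy ?X ?G - (rho0 C * Q + T2)\<bar> \<le> k * \<tau>\<^sup>2"
    using XG(2) k(2) by (simp add: T2_def gy stationary(2))
  have "w * x_db n C a b F \<omega> $ i = w * ((w \<cdot>\<^sub>v ?X) $ i -
      (2 * ?Hx (w \<cdot>\<^sub>v ?X) (w \<cdot>\<^sub>v ?X) * ?Hx ?F (w \<cdot>\<^sub>v ?X) - 2 * ?Hxy ?F (w \<cdot>\<^sub>v ?Y)
     + 2 * ?Hy (w \<cdot>\<^sub>v ?Y) (w \<cdot>\<^sub>v ?Y) * ?Hy ?G (w \<cdot>\<^sub>v ?Y) - 2 * ?Hxy (w \<cdot>\<^sub>v ?X) ?G))"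
    by (subst x_db_index[where a = a and b = b and F = F and n = n and C = C and \<omega> = \<omega> and i = i and x = "w \<cdot>\<^sub>v ?X" and y = "w \<cdot>\<^sub>v ?Y", OF i a b F eqs(1)[symmetric] eqs(2)[symmetric] F_eq XY(3,4)]) simp
  also have "\<dots> = w * (w * ?X $ i -
      (2 * (w * (w * ?Hx ?X ?X)) * (w * ?Hx ?F ?X) - 2 * (w * ?Hxy ?F ?Y)
     + 2 * (w * (w * ?Hy ?Y ?Y)) * (w * ?Hy ?G ?Y) - 2 * (w * ?Hxy ?X ?G)))"
    using XY i d
    by (simp add: bil_smult_left[OF hat_Sigma_carrier(1) XY(1,1) _ XY(1)] bil_smult_right[OF hat_Sigma_carrier(1) _ XY(1,1,1)]
        bil_smult_left[OF hat_Sigma_carrier(2) XY(2,2) _ XY(2)] bil_smult_right[OF hat_Sigma_carrier(2) _ XY(2,2,2)]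
        bil_smult_left[OF hat_Sigma_carrier(3) XY(1,1,4,4)] bil_smult_right[OF hat_Sigma_carrier(3) XY(3,3,2,2)])
  also have "\<dots> = ?X $ i - (2 * (?Hx ?X ?X * ?Hx ?F ?X) - 2 * ?Hxy ?F ?Y + 2 * (?Hy ?Y ?Y * ?Hy ?G ?Y) - 2 * ?Hxy ?X ?G)"
    using w by auto
  also have "?X $ i = ?x $ i + dx $ i" using i d by simp
  finally have db: "w * x_db n C a b F \<omega> $ i = ?x $ i + dx $ i
      - (2 * (?Hx ?X ?X * ?Hx ?F ?X) - 2 * ?Hxy ?F ?Y + 2 * (?Hy ?Y ?Y * ?Hy ?G ?Y) - 2 * ?Hxy ?X ?G)" .
  \<comment> \<open>The error of the column of \<open>F\<close> drops out by stationarity. The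
    errors \<open>dx\<close> and \<open>dy\<close> assemble to the left side of
    \<open>hessian_column\<close>, that is to \<open>dx $ i\<close>, which then cancels against the
    error of the estimate itself.\<close>
  have main: "2 * (rho0 C * P + rho0 C * P1 + A1 * P) - 2 * (rho0 C * P + T1)
      + 2 * (rho0 C * Q + rho0 C * Q2 + A2 * Q) - 2 * (rho0 C * Q + T2) = dx $ i - lin_term n C i \<omega>"
  proof -
    have "?Sx dx ?x = ?Sx ?x dx" "?Sy dy ?y = ?Sy ?y dy" "?Sy df2 ?y = ?Sy ?y df2"
      using Sigma_x_comm[OF d(1) x0_carrier] Sigma_y_comm[OF d(2) y0_carrier] Sigma_y_comm[OF f(2) y0_carrier] by auto
    then show ?thesis
      unfolding hessian_column[OF d, symmetric] lin_term_def A1_def A2_def P1_def Q2_def T1_def T2_def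
        stationary(1)[OF f(1)] stationary(2)[OF f(2)] P_def[symmetric] Q_def[symmetric]
      by (simp add: algebra_simps)
  qed
  have kk: "k * \<tau>\<^sup>2 \<le> k\<^sup>2 * \<tau>\<^sup>2"
    using k(3) by (intro mult_right_mono) (auto simp: power2_eq_square)
  have "\<bar>w * x_db n C a b F \<omega> $ i - ?x $ i - lin_term n C i \<omega>\<bar> \<le> 28 * (k\<^sup>2 * \<tau>\<^sup>2)"
  proof -
    have combine: "\<bar>z - x - l\<bar> \<le> 28 * e"
      if "z = x + h - (2 * u1 - 2 * u3 + 2 * u2 - 2 * u4)" "2 * m1 - 2 * m3 + 2 * m2 - 2 * m4 = h - l"
        "\<bar>u1 - m1\<bar> \<le> 6 * e" "\<bar>u2 - m2\<bar> \<le> 6 * e" "\<bar>u3 - m3\<bar> \<le> e'" "\<bar>u4 - m4\<bar> \<le> e'" "e' \<le> e"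
      for z x h l u1 u2 u3 u4 m1 m2 m3 m4 e e' :: real
      using that by linarith
    show ?thesis
      by (rule combine[OF db main e1[unfolded mult.assoc[of 6]] e2[unfolded mult.assoc[of 6]] e3 e4 kk])
  qed
  then show thesis
    using that[OF w] by (simp add: k_def c_def mult.assoc)
qed

end

section \<open>Influence function and moments\<close>

lemma exp_mean_le: "exp ((x + y) / 2) \<le> (exp x + exp y) / 2" for x y :: real
proof -
  have "2 * (exp (x / 2) * exp (y / 2)) \<le> (exp (x / 2))\<^sup>2 + (exp (y / 2))\<^sup>2"
    using sum_squares_bound[of "exp (x / 2)" "exp (y / 2)"] by simp
  then show ?thesis by (simp add: add_divide_distrib exp_add flip: exp_double)
qed

text \<open>\<open>u \<le> exp u\<close> at \<open>u = \<bar>z\<bar> / (k * c)\<close>, raised to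
  the power \<open>k\<close>, dominates the k-th moment. The constants 4 and 27 are the square of 2
  and the cube of 3.\<close>

lemma subexponential_moments:
  fixes \<zeta> :: "'a \<Rightarrow> real" and c D :: real
  assumes M: "prob_space M" and c: "c > 0" and [measurable]: "\<zeta> \<in> borel_measurable M"
    and int: "integrable M (\<lambda>\<omega>. exp (\<bar>\<zeta> \<omega>\<bar> / c))" and D: "integral\<^sup>L M (\<lambda>\<omega>. exp (\<bar>\<zeta> \<omega>\<bar> / c)) \<le> D"
  shows "integrable M \<zeta>" "integrable M (\<lambda>\<omega>. (\<zeta> \<omega>)\<^sup>2)" "integrable M (\<lambda>\<omega>. \<bar>\<zeta> \<omega>\<bar> ^ 3)"
    and "integral\<^sup>L M (\<lambda>\<omega>. \<bar>\<zeta> \<omega>\<bar>) \<le> c * D" "integral\<^sup>L M (\<lambda>\<omega>. (\<zeta> \<omega>)\<^sup>2) \<le> 4 * c\<^sup>2 * D"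
      "integral\<^sup>L M (\<lambda>\<omega>. \<bar>\<zeta> \<omega>\<bar> ^ 3) \<le> 27 * c ^ 3 * D"
proof -
  have p: "\<bar>z\<bar> ^ k \<le> (real k * c) ^ k * exp (\<bar>z\<bar> / c)" if "k \<ge> 1" for z k
  proof -
    let ?u = "\<bar>z\<bar> / (real k * c)"
    have "?u \<le> exp ?u" using exp_ge_add_one_self[of ?u] by linarith
    then have "?u ^ k \<le> exp ?u ^ k" using c by (intro power_mono) auto
    also have "exp ?u ^ k = exp (\<bar>z\<bar> / c)"
      using that by (simp flip: exp_of_nat_mult)
    finally show ?thesis using c that by (simp add: power_divide field_simps)
  qed
  have p1: "\<bar>\<zeta> \<omega>\<bar> \<le> c * exp (\<bar>\<zeta> \<omega>\<bar> / c)" and p2: "(\<zeta> \<omega>)\<^sup>2 \<le> 4 * c\<^sup>2 * exp (\<bar>\<zeta> \<omega>\<bar> / c)"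
    and p3: "\<bar>\<zeta> \<omega>\<bar> ^ 3 \<le> 27 * c ^ 3 * exp (\<bar>\<zeta> \<omega>\<bar> / c)" for \<omega>
    using p[of 1 "\<zeta> \<omega>"] p[of 2 "\<zeta> \<omega>"] p[of 3 "\<zeta> \<omega>"] by (auto simp: power_mult_distrib)
  have pos: "0 \<le> c * exp t" "0 \<le> 4 * c\<^sup>2 * exp t" "0 \<le> 27 * c ^ 3 * exp t" for t using c by auto
  show i1: "integrable M \<zeta>"
    by (rule Bochner_Integration.integrable_bound[OF integrable_mult_right[OF int, of c]])
       (use p1 pos in \<open>auto\<close>)
  show i2: "integrable M (\<lambda>\<omega>. (\<zeta> \<omega>)\<^sup>2)"
    by (rule Bochner_Integration.integrable_bound[OF integrable_mult_right[OF int, of "4 * c\<^sup>2"]])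
       (use p2 pos in \<open>auto\<close>)
  show i3: "integrable M (\<lambda>\<omega>. \<bar>\<zeta> \<omega>\<bar> ^ 3)"
    by (rule Bochner_Integration.integrable_bound[OF integrable_mult_right[OF int, of "27 * c ^ 3"]])
       (use p3 pos c in \<open>auto\<close>)
  have "integral\<^sup>L M (\<lambda>\<omega>. \<bar>\<zeta> \<omega>\<bar>) \<le> integral\<^sup>L M (\<lambda>\<omega>. c * exp (\<bar>\<zeta> \<omega>\<bar> / c))"
    using i1 p1 int by (intro integral_mono) auto
  also have "\<dots> \<le> c * D" using D c by simp
  finally show "integral\<^sup>L M (\<lambda>\<omega>. \<bar>\<zeta> \<omega>\<bar>) \<le> c * D" .
  have "integral\<^sup>L M (\<lambda>\<omega>. (\<zeta> \<omega>)\<^sup>2) \<le> integral\<^sup>L M (\<lambda>\<omega>. 4 * c\<^sup>2 * exp (\<bar>\<zeta> \<omega>\<bar> / c))"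
    using i2 p2 int by (intro integral_mono) auto
  also have "\<dots> \<le> 4 * c\<^sup>2 * D" using D c by simp
  finally show "integral\<^sup>L M (\<lambda>\<omega>. (\<zeta> \<omega>)\<^sup>2) \<le> 4 * c\<^sup>2 * D" .
  have "integral\<^sup>L M (\<lambda>\<omega>. \<bar>\<zeta> \<omega>\<bar> ^ 3) \<le> integral\<^sup>L M (\<lambda>\<omega>. 27 * c ^ 3 * exp (\<bar>\<zeta> \<omega>\<bar> / c))"
    using i3 p3 int by (intro integral_mono) auto
  also have "\<dots> \<le> 27 * c ^ 3 * D" using D c by simp
  finally show "integral\<^sup>L M (\<lambda>\<omega>. \<bar>\<zeta> \<omega>\<bar> ^ 3) \<le> 27 * c ^ 3 * D" .
qed

text \<open>\<open>Z_influence\<close> as a function of the pair of values, with outer products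
  collapsed to scalar products. It can be composed with every observation as well as with the
  population pair, which transfers independence and equality of laws.\<close>

definition influence :: "'w cca \<Rightarrow> nat \<Rightarrow> real vec \<times> real vec \<Rightarrow> real" where
  "influence C i w =
     rho0 C * ((phi1 C i \<bullet> fst w) * (x0 C \<bullet> fst w)) + bil (Sigma_x C) (phi1 C i) (x0 C) * ((x0 C \<bullet> fst w) * (x0 C \<bullet> fst w))
   + rho0 C * ((phi2 C i \<bullet> snd w) * (y0 C \<bullet> snd w)) + bil (Sigma_y C) (phi2 C i) (y0 C) * ((y0 C \<bullet> snd w) * (y0 C \<bullet> snd w))
   - (phi1 C i \<bullet> fst w) * (y0 C \<bullet> snd w) - (x0 C \<bullet> fst w) * (phi2 C i \<bullet> snd w)"

text \<open>The last factor bounds the squared norms of all vectors in \<open>test_x\<close> and \<open>test_y\<close>.\<close>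

definition sg_scale :: "real \<Rightarrow> real \<Rightarrow> real \<Rightarrow> real" where
  "sg_scale K \<epsilon>0 M = (max K 0 + 1)\<^sup>2 * (1 + M + (M / (2 * \<epsilon>0))\<^sup>2)"

section \<open>Moments of the influence function and concentration of the test forms\<close>

context cca_regular begin

abbreviation "sg \<equiv> sg_scale K \<epsilon>0 M"

abbreviation "pop \<omega> \<equiv> (pop_X C \<omega>, pop_Y C \<omega>)"
abbreviation "obs l \<omega> \<equiv> (obs_X C l \<omega>, obs_Y C l \<omega>)"
abbreviation "pair_space \<equiv> borel_vec (dim_x C) \<Otimes>\<^sub>M borel_vec (dim_y C)"

lemma pop_measurable: "pop \<in> measurable (prob_sp C) pair_space"
  using meas_X meas_Y by (rule measurable_Pair)

lemma obs_measurable: "l < n \<Longrightarrow> obs l \<in> measurable (prob_sp C) pair_space"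
  using indep_obs unfolding indep_vars_def2 by simp

lemma obs_X_measurable: "l < n \<Longrightarrow> obs_X C l \<in> measurable (prob_sp C) (borel_vec (dim_x C))"
  and obs_Y_measurable: "l < n \<Longrightarrow> obs_Y C l \<in> measurable (prob_sp C) (borel_vec (dim_y C))"
  using measurable_compose[OF obs_measurable measurable_fst] measurable_compose[OF obs_measurable measurable_snd] by auto

lemma obs_carrier:
  assumes "\<omega> \<in> space (prob_sp C)" "l < n"
  shows "obs_X C l \<omega> \<in> carrier_vec (dim_x C)" "obs_Y C l \<omega> \<in> carrier_vec (dim_y C)"
  using obs_X_measurable[OF assms(2)] obs_Y_measurable[OF assms(2)] assms(1) by (auto simp: measurable_borel_vec_iff)

lemma measurable_functional [measurable]:
  "(\<lambda>w. u \<bullet> fst w) \<in> borel_measurable pair_space" "(\<lambda>w. v \<bullet> snd w) \<in> borel_measurable pair_space"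
  by (rule measurable_scalar_prod_vec[OF measurable_fst] measurable_scalar_prod_vec[OF measurable_snd])+

lemma influence_measurable [measurable]: "influence C i \<in> borel_measurable pair_space"
  unfolding influence_def[abs_def] by measurable

lemma hat_forms:
  assumes \<omega>: "\<omega> \<in> space (prob_sp C)"
  shows "u \<in> carrier_vec (dim_x C) \<Longrightarrow> u' \<in> carrier_vec (dim_x C) \<Longrightarrow>
      bil (hat_Sigma_x n C \<omega>) u u' = (\<Sum>l<n. (u \<bullet> obs_X C l \<omega>) * (u' \<bullet> obs_X C l \<omega>)) / real n"
    and "v \<in> carrier_vec (dim_y C) \<Longrightarrow> v' \<in> carrier_vec (dim_y C) \<Longrightarrow>
      bil (hat_Sigma_y n C \<omega>) v v' = (\<Sum>l<n. (v \<bullet> obs_Y C l \<omega>) * (v' \<bullet> obs_Y C l \<omega>)) / real n"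
    and "u \<in> carrier_vec (dim_x C) \<Longrightarrow> v \<in> carrier_vec (dim_y C) \<Longrightarrow>
      bil (hat_Sigma_xy n C \<omega>) u v = (\<Sum>l<n. (u \<bullet> obs_X C l \<omega>) * (v \<bullet> obs_Y C l \<omega>)) / real n"
  unfolding hat_Sigma_x_def hat_Sigma_y_def hat_Sigma_xy_def
  using obs_carrier[OF \<omega>] by (auto intro!: bil_emp_cov)

lemma dev_forms:
  assumes \<omega>: "\<omega> \<in> space (prob_sp C)"
  shows "u \<in> carrier_vec (dim_x C) \<Longrightarrow> u' \<in> carrier_vec (dim_x C) \<Longrightarrow>
      bil (dev_x n C \<omega>) u u' = (\<Sum>l<n. (u \<bullet> obs_X C l \<omega>) * (u' \<bullet> obs_X C l \<omega>)) / real n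
        - expectation (\<lambda>\<omega>. (u \<bullet> pop_X C \<omega>) * (u' \<bullet> pop_X C \<omega>))"
    and "v \<in> carrier_vec (dim_y C) \<Longrightarrow> v' \<in> carrier_vec (dim_y C) \<Longrightarrow>
      bil (dev_y n C \<omega>) v v' = (\<Sum>l<n. (v \<bullet> obs_Y C l \<omega>) * (v' \<bullet> obs_Y C l \<omega>)) / real n
        - expectation (\<lambda>\<omega>. (v \<bullet> pop_Y C \<omega>) * (v' \<bullet> pop_Y C \<omega>))"
    and "u \<in> carrier_vec (dim_x C) \<Longrightarrow> v \<in> carrier_vec (dim_y C) \<Longrightarrow>
      bil (dev_xy n C \<omega>) u v = (\<Sum>l<n. (u \<bullet> obs_X C l \<omega>) * (v \<bullet> obs_Y C l \<omega>)) / real n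
        - expectation (\<lambda>\<omega>. (u \<bullet> pop_X C \<omega>) * (v \<bullet> pop_Y C \<omega>))"
  using hat_forms(1)[OF \<omega>, of u u'] dev_x_form[of u u' \<omega>] Sigma_x_form[of u u']
    hat_forms(2)[OF \<omega>, of v v'] dev_y_form[of v v' \<omega>] Sigma_y_form[of v v']
    hat_forms(3)[OF \<omega>, of u v] dev_xy_form[of u v \<omega>] Sigma_xy_form[of u v] by auto

lemma influence_integrable: "integrable (prob_sp C) (\<lambda>\<omega>. influence C i (pop \<omega>))"
  unfolding influence_def fst_conv snd_conv
  by (intro Bochner_Integration.integrable_add Bochner_Integration.integrable_diff integrable_mult_right
      integrable_scalar_XX integrable_scalar_YY integrable_scalar_XY phi_carrier x0_carrier y0_carrier)

lemma expectation_influence: "expectation (\<lambda>\<omega>. influence C i (pop \<omega>)) =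
     rho0 C * expectation (\<lambda>\<omega>. (phi1 C i \<bullet> pop_X C \<omega>) * (x0 C \<bullet> pop_X C \<omega>))
   + bil (Sigma_x C) (phi1 C i) (x0 C) * expectation (\<lambda>\<omega>. (x0 C \<bullet> pop_X C \<omega>) * (x0 C \<bullet> pop_X C \<omega>))
   + rho0 C * expectation (\<lambda>\<omega>. (phi2 C i \<bullet> pop_Y C \<omega>) * (y0 C \<bullet> pop_Y C \<omega>))
   + bil (Sigma_y C) (phi2 C i) (y0 C) * expectation (\<lambda>\<omega>. (y0 C \<bullet> pop_Y C \<omega>) * (y0 C \<bullet> pop_Y C \<omega>))
   - expectation (\<lambda>\<omega>. (phi1 C i \<bullet> pop_X C \<omega>) * (y0 C \<bullet> pop_Y C \<omega>))
   - expectation (\<lambda>\<omega>. (x0 C \<bullet> pop_X C \<omega>) * (phi2 C i \<bullet> pop_Y C \<omega>))"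
  unfolding influence_def fst_conv snd_conv
  by (simp add: integrable_scalar_XX integrable_scalar_YY integrable_scalar_XY)

text \<open>Each deviation form is a sample mean minus the expectation of a product of functionals,
  and \<open>lin_term\<close> is linear in these forms with population coefficients.\<close>

lemma lin_term_eq:
  assumes \<omega>: "\<omega> \<in> space (prob_sp C)"
  shows "lin_term n C i \<omega> = - 2 * ((\<Sum>l<n. influence C i (obs l \<omega>)) / real n - expectation (\<lambda>\<omega>. influence C i (pop \<omega>)))"
proof -
  have eq: "(\<Sum>l<n. influence C i (obs l \<omega>)) / real n =
     rho0 C * ((\<Sum>l<n. (phi1 C i \<bullet> obs_X C l \<omega>) * (x0 C \<bullet> obs_X C l \<omega>)) / real n)
   + bil (Sigma_x C) (phi1 C i) (x0 C) * ((\<Sum>l<n. (x0 C \<bullet> obs_X C l \<omega>) * (x0 C \<bullet> obs_X C l \<omega>)) / real n)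
   + rho0 C * ((\<Sum>l<n. (phi2 C i \<bullet> obs_Y C l \<omega>) * (y0 C \<bullet> obs_Y C l \<omega>)) / real n)
   + bil (Sigma_y C) (phi2 C i) (y0 C) * ((\<Sum>l<n. (y0 C \<bullet> obs_Y C l \<omega>) * (y0 C \<bullet> obs_Y C l \<omega>)) / real n)
   - (\<Sum>l<n. (phi1 C i \<bullet> obs_X C l \<omega>) * (y0 C \<bullet> obs_Y C l \<omega>)) / real n
   - (\<Sum>l<n. (x0 C \<bullet> obs_X C l \<omega>) * (phi2 C i \<bullet> obs_Y C l \<omega>)) / real n"
    by (simp add: influence_def sum.distrib sum_subtractf sum_distrib_left add_divide_distrib diff_divide_distrib)
  show ?thesis
    unfolding lin_term_def expectation_influence eq dev_forms(1)[OF \<omega> phi_carrier(1) x0_carrier]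
      dev_forms(1)[OF \<omega> x0_carrier x0_carrier] dev_forms(2)[OF \<omega> phi_carrier(2) y0_carrier]
      dev_forms(2)[OF \<omega> y0_carrier y0_carrier] dev_forms(3)[OF \<omega> phi_carrier(1) y0_carrier]
      dev_forms(3)[OF \<omega> x0_carrier phi_carrier(2)]
    by (simp add: algebra_simps)
qed

lemma Z_influence_eq:
  assumes \<omega>: "\<omega> \<in> space (prob_sp C)"
  shows "Z_influence C i \<omega> = influence C i (pop \<omega>)"
proof -
  note c = X_carrier[OF \<omega>] Y_carrier[OF \<omega>]
  have o: "outer u v *\<^sub>v z = (v \<bullet> z) \<cdot>\<^sub>v u" if "dim_vec v = dim_vec z" for u v z
    using that by (intro eq_vecI) (auto simp: outer_def scalar_prod_def row_def sum_distrib_left sum_distrib_right mult_ac intro!: sum.cong)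
  have comm: "pop_X C \<omega> \<bullet> x0 C = x0 C \<bullet> pop_X C \<omega>" "pop_Y C \<omega> \<bullet> y0 C = y0 C \<bullet> pop_Y C \<omega>"
    "pop_Y C \<omega> \<bullet> phi2 C i = phi2 C i \<bullet> pop_Y C \<omega>"
    using comm_scalar_prod[OF c(1) x0_carrier] comm_scalar_prod[OF c(2) y0_carrier] comm_scalar_prod[OF c(2) phi_carrier(2)] by auto
  have "(rho0 C \<cdot>\<^sub>v phi1 C i + t \<cdot>\<^sub>v x0 C) \<bullet> (s \<cdot>\<^sub>v pop_X C \<omega>) = s * (rho0 C * (phi1 C i \<bullet> pop_X C \<omega>) + t * (x0 C \<bullet> pop_X C \<omega>))" for s t
    using c by (subst scalar_prod_smult_distrib[of _ "dim_x C"]) (auto simp: add_scalar_prod_distrib[of _ "dim_x C"])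
  moreover have "(rho0 C \<cdot>\<^sub>v phi2 C i + t \<cdot>\<^sub>v y0 C) \<bullet> (s \<cdot>\<^sub>v pop_Y C \<omega>) = s * (rho0 C * (phi2 C i \<bullet> pop_Y C \<omega>) + t * (y0 C \<bullet> pop_Y C \<omega>))" for s t
    using c by (subst scalar_prod_smult_distrib[of _ "dim_y C"]) (auto simp: add_scalar_prod_distrib[of _ "dim_y C"])
  moreover have "phi1 C i \<bullet> (s \<cdot>\<^sub>v pop_X C \<omega>) = s * (phi1 C i \<bullet> pop_X C \<omega>)" "x0 C \<bullet> (s \<cdot>\<^sub>v pop_X C \<omega>) = s * (x0 C \<bullet> pop_X C \<omega>)" for s
    using c by (auto intro!: scalar_prod_smult_distrib[of _ "dim_x C"])
  ultimately show ?thesis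
    using carrier_vecD[OF c(1)] carrier_vecD[OF c(2)]
    unfolding Z_influence_def Let_def influence_def fst_conv snd_conv bil_def
    by (subst o, simp add: carrier_vecD[OF x0_carrier] carrier_vecD[OF y0_carrier] carrier_vecD[OF phi_carrier(2)])+
       (simp add: comm algebra_simps)
qed

lemma sigma_sq_eq: "sigma_sq C i = variance (\<lambda>\<omega>. influence C i (pop \<omega>))"
proof -
  have "expectation (Z_influence C i) = expectation (\<lambda>\<omega>. influence C i (pop \<omega>))"
    by (rule Bochner_Integration.integral_cong) (auto simp: Z_influence_eq)
  then show ?thesis
    unfolding sigma_sq_def by (intro Bochner_Integration.integral_cong) (auto simp: Z_influence_eq)
qed

lemma sg_scale_pos: "0 < sg"
proof -
  have "0 < max K 0 + 1" by (simp add: max_def)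
  moreover have "0 < 1 + M + (M / (2 * \<epsilon>0))\<^sup>2" using M_pos by (intro add_pos_nonneg) auto
  ultimately show ?thesis unfolding sg_scale_def by (intro mult_pos_pos zero_less_power)
qed

lemma test_norm:
  assumes i: "i < dim_x C"
  shows "u \<in> test_x C i \<Longrightarrow> u \<bullet> u \<le> 1 + M + (M / (2 * \<epsilon>0))\<^sup>2" "v \<in> test_y C i \<Longrightarrow> v \<bullet> v \<le> 1 + M + (M / (2 * \<epsilon>0))\<^sup>2"
proof -
  have s: "z \<bullet> z \<le> M" if "l2_norm z \<le> sqrt M" for z
    using power_mono[OF that l2_norm_nonneg, of 2] M_pos by (simp add: l2_norm_sq)
  have t: "z \<bullet> z \<le> (M / (2 * \<epsilon>0))\<^sup>2" if "l2_norm z \<le> M / (2 * \<epsilon>0)" for z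
    using power_mono[OF that l2_norm_nonneg, of 2] by (simp add: l2_norm_sq)
  define R where "R = (M / (2 * \<epsilon>0))\<^sup>2"
  have R: "0 \<le> R" by (simp add: R_def)
  show "u \<bullet> u \<le> 1 + M + (M / (2 * \<epsilon>0))\<^sup>2" if "u \<in> test_x C i"
    using that s[OF alpha0_l2] s[OF x0_l2] t[OF phi_norm(1)[OF i]] M_pos R
    unfolding test_x_def R_def[symmetric] by (elim UnE imageE insertE emptyE) auto
  show "v \<bullet> v \<le> 1 + M + (M / (2 * \<epsilon>0))\<^sup>2" if "v \<in> test_y C i"
    using that s[OF beta0_l2] s[OF y0_l2] t[OF phi_norm(2)[OF i]] M_pos R
    unfolding test_y_def R_def[symmetric] by (elim UnE imageE insertE emptyE) auto
qed

lemma test_subgaussian: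
  assumes i: "i < dim_x C"
  shows "u \<in> test_x C i \<Longrightarrow> subgaussian (prob_sp C) sg (\<lambda>\<omega>. u \<bullet> pop_X C \<omega>)"
    "v \<in> test_y C i \<Longrightarrow> subgaussian (prob_sp C) sg (\<lambda>\<omega>. v \<bullet> pop_Y C \<omega>)"
proof -
  have L: "0 < 1 + M + (M / (2 * \<epsilon>0))\<^sup>2" using M_pos by (intro add_pos_nonneg) auto
  show "subgaussian (prob_sp C) sg (\<lambda>\<omega>. u \<bullet> pop_X C \<omega>)" if "u \<in> test_x C i"
    unfolding sg_scale_def by (rule subgaussian_scalar_X[OF test_carrier(1)[OF that] test_norm(1)[OF i that] L])
  show "subgaussian (prob_sp C) sg (\<lambda>\<omega>. v \<bullet> pop_Y C \<omega>)" if "v \<in> test_y C i"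
    unfolding sg_scale_def by (rule subgaussian_scalar_Y[OF test_carrier(2)[OF that] test_norm(2)[OF i that] L])
qed

text \<open>Test vectors of both blocks are read as functionals on the pair space and merged into
  one family of at most \<open>dim_x C + dim_y C + 6\<close> members, so a single concentration
  bound covers all three deviation matrices.\<close>

lemma cov_close_prob:
  fixes s t :: real
  assumes n: "n \<ge> 1" and i: "i < dim_x C" and s: "0 < s" "s \<le> 1 / (2 * sg)"
  shows "\<exists>A\<in>events. prob A \<le> 2 * (real (dim_x C + dim_y C + 6))\<^sup>2 * exp (- s * real n * t + 64 * sg\<^sup>2 * s\<^sup>2 * real n)
     \<and> (\<forall>\<omega>\<in>space (prob_sp C) - A. cov_close n C i t \<omega>)"
proof -
  define fx fy :: "real vec \<Rightarrow> real vec \<times> real vec \<Rightarrow> real" where "fx u w = u \<bullet> fst w" and "fy u w = u \<bullet> snd w" for u w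
  define J where "J = fx ` test_x C i \<union> fy ` test_y C i"
  define A where "A = {\<omega> \<in> space (prob_sp C). \<exists>j\<in>J. \<exists>k\<in>J. \<bar>(\<Sum>l<n. j (obs l \<omega>) * k (obs l \<omega>)) / real n
                  - expectation (\<lambda>\<omega>. j (pop \<omega>) * k (pop \<omega>))\<bar> > t}"
  have fin: "finite (test_x C i)" "finite (test_y C i)" by (auto simp: test_x_def test_y_def)
  have card: "card (test_x C i) \<le> dim_x C + 3" "card (test_y C i) \<le> dim_y C + 3"
    unfolding test_x_def test_y_def
    by (rule order_trans[OF card_Un_le] add_mono order_trans[OF card_image_le] | simp add: card_insert_if)+
  have "card J \<le> card (fx ` test_x C i) + card (fy ` test_y C i)" unfolding J_def by (rule card_Un_le)
  also have "\<dots> \<le> card (test_x C i) + card (test_y C i)" using fin by (intro add_mono card_image_le)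
  also have "\<dots> \<le> dim_x C + dim_y C + 6" using card by simp
  finally have cJ: "card J \<le> dim_x C + dim_y C + 6" .
  have J: "finite J" using fin by (simp add: J_def)
  have g: "j \<in> borel_measurable pair_space" if "j \<in> J" for j
    using that measurable_functional by (auto simp: J_def fx_def[abs_def] fy_def[abs_def])
  have sub: "subgaussian (prob_sp C) sg (\<lambda>\<omega>. j (pop \<omega>))" if "j \<in> J" for j
    using that test_subgaussian[OF i] by (auto simp: J_def fx_def fy_def)
  note conc = empirical_product_concentration[where g = "\<lambda>j. j", OF n sg_scale_pos s indep_obs pop_measurable ident_obs J g sub, of t, folded A_def]
  have A: "A \<in> events" using conc(1) .
  have "prob A \<le> 2 * (real (card J))\<^sup>2 * exp (- s * real n * t + 64 * sg\<^sup>2 * s\<^sup>2 * real n)"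
    using conc(2) .
  also have "\<dots> \<le> 2 * (real (dim_x C + dim_y C + 6))\<^sup>2 * exp (- s * real n * t + 64 * sg\<^sup>2 * s\<^sup>2 * real n)"
    using cJ by (intro mult_right_mono mult_left_mono power_mono) auto
  finally have pA: "prob A \<le> 2 * (real (dim_x C + dim_y C + 6))\<^sup>2 * exp (- s * real n * t + 64 * sg\<^sup>2 * s\<^sup>2 * real n)" .
  have "cov_close n C i t \<omega>" if \<omega>: "\<omega> \<in> space (prob_sp C) - A" for \<omega>
  proof -
    have sp: "\<omega> \<in> space (prob_sp C)" using \<omega> by simp
    have *: "\<bar>(\<Sum>l<n. j (obs l \<omega>) * k (obs l \<omega>)) / real n - expectation (\<lambda>\<omega>. j (pop \<omega>) * k (pop \<omega>))\<bar> \<le> t"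
      if "j \<in> J" "k \<in> J" for j k
      using that \<omega> unfolding A_def by (auto simp: not_less)
    have Jx: "fx u \<in> J" if "u \<in> test_x C i" for u using that by (simp add: J_def)
    have Jy: "fy u \<in> J" if "u \<in> test_y C i" for u using that by (simp add: J_def)
    show ?thesis
      unfolding cov_close_def
      using *[OF Jx Jx] *[OF Jx Jy] *[OF Jy Jy] test_carrier
      by (auto simp: dev_forms[OF sp] fx_def fy_def)
  qed
  then show ?thesis using A pA by blast
qed

text \<open>Products are at most half the sum of squares, so the influence is at most a constant
  times the sum of four squares of sub-Gaussian functionals. The factor 4 in \<open>c\<close> turns
  that sum into a mean, to which convexity of the exponential applies; the bracket bounds the
  coefficients.\<close>

lemma influence_subexponential:
  assumes i: "i < dim_x C"
  defines "c \<equiv> 4 * sg * (2 + M * (M / (2 * \<epsilon>0)) * sqrt M)"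
  shows "0 < c" and "integrable (prob_sp C) (\<lambda>\<omega>. exp (\<bar>influence C i (pop \<omega>)\<bar> / c))"
    and "expectation (\<lambda>\<omega>. exp (\<bar>influence C i (pop \<omega>)\<bar> / c)) \<le> 2"
proof -
  define k where "k = 2 + M * (M / (2 * \<epsilon>0)) * sqrt M"
  have k: "2 \<le> k" using M_pos eps_pos by (simp add: k_def)
  show c: "0 < c" unfolding c_def k_def[symmetric] using k sg_scale_pos by simp
  let ?g1 = "\<lambda>\<omega>. x0 C \<bullet> pop_X C \<omega>" and ?g2 = "\<lambda>\<omega>. phi1 C i \<bullet> pop_X C \<omega>" and ?g3 = "\<lambda>\<omega>. y0 C \<bullet> pop_Y C \<omega>"
    and ?g4 = "\<lambda>\<omega>. phi2 C i \<bullet> pop_Y C \<omega>"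
  let ?e = "\<lambda>g \<omega>. exp ((g \<omega>)\<^sup>2 / sg)"
  let ?h = "\<lambda>\<omega>. (?e ?g1 \<omega> + ?e ?g2 \<omega> + ?e ?g3 \<omega> + ?e ?g4 \<omega>) / 4"
  have sub: "subgaussian (prob_sp C) sg ?g1" "subgaussian (prob_sp C) sg ?g2"
    "subgaussian (prob_sp C) sg ?g3" "subgaussian (prob_sp C) sg ?g4"
    by (intro test_subgaussian[OF i] test_members)+
  have h: "integrable (prob_sp C) ?h" using sub by (auto simp: subgaussian_def)
  have h2: "expectation ?h \<le> 2" using sub by (simp add: subgaussian_def)
  have "M * l2_norm (phi1 C i) * l2_norm (x0 C) \<le> M * (M / (2 * \<epsilon>0)) * sqrt M"
    "M * l2_norm (phi2 C i) * l2_norm (y0 C) \<le> M * (M / (2 * \<epsilon>0)) * sqrt M"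
    by (intro mult_mono; use phi_norm[OF i] x0_l2 y0_l2 M_pos eps_pos in simp)+
  then have PQ: "\<bar>bil (Sigma_x C) (phi1 C i) (x0 C)\<bar> \<le> k - 2" "\<bar>bil (Sigma_y C) (phi2 C i) (y0 C)\<bar> \<le> k - 2"
    using Sigma_x_bound[OF phi_carrier(1) x0_carrier, of i] Sigma_y_bound[OF phi_carrier(2) y0_carrier, of i] by (auto simp: k_def)
  have prod: "\<bar>x * y\<bar> \<le> (x\<^sup>2 + y\<^sup>2) / 2" for x y :: real
    using sum_squares_bound[of "\<bar>x\<bar>" "\<bar>y\<bar>"] by (simp add: abs_mult)
  have bound: "\<bar>influence C i (pop \<omega>)\<bar> \<le> k * ((?g1 \<omega>)\<^sup>2 + (?g2 \<omega>)\<^sup>2 + (?g3 \<omega>)\<^sup>2 + (?g4 \<omega>)\<^sup>2)" for \<omega>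
  proof -
    define x1 x2 x3 x4 where "x1 = ?g1 \<omega>" and "x2 = ?g2 \<omega>" and "x3 = ?g3 \<omega>" and "x4 = ?g4 \<omega>"
    let ?P = "bil (Sigma_x C) (phi1 C i) (x0 C)" and ?Q = "bil (Sigma_y C) (phi2 C i) (y0 C)"
    have r: "\<bar>rho0 C * t\<bar> \<le> \<bar>t\<bar>" for t
      using rho0_pos rho0_le_1 mult_right_mono[of "rho0 C" 1 "\<bar>t\<bar>"] by (simp add: abs_mult)
    have a: "\<bar>rho0 C * (x2 * x1)\<bar> \<le> (x2\<^sup>2 + x1\<^sup>2) / 2" "\<bar>rho0 C * (x4 * x3)\<bar> \<le> (x4\<^sup>2 + x3\<^sup>2) / 2"
      using r prod order_trans by blast+
    have b: "\<bar>?P * (x1 * x1)\<bar> \<le> (k - 2) * x1\<^sup>2" "\<bar>?Q * (x3 * x3)\<bar> \<le> (k - 2) * x3\<^sup>2"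
      using PQ by (auto simp: abs_mult power2_eq_square intro!: mult_right_mono)
    have "\<bar>influence C i (pop \<omega>)\<bar> \<le> \<bar>rho0 C * (x2 * x1)\<bar> + \<bar>?P * (x1 * x1)\<bar> + \<bar>rho0 C * (x4 * x3)\<bar> + \<bar>?Q * (x3 * x3)\<bar> + \<bar>x2 * x3\<bar> + \<bar>x1 * x4\<bar>"
      unfolding influence_def fst_conv snd_conv x1_def[symmetric] x2_def[symmetric] x3_def[symmetric] x4_def[symmetric] by linarith
    also have "\<dots> \<le> (x2\<^sup>2 + x1\<^sup>2) / 2 + (k - 2) * x1\<^sup>2 + (x4\<^sup>2 + x3\<^sup>2) / 2 + (k - 2) * x3\<^sup>2 + (x2\<^sup>2 + x3\<^sup>2) / 2 + (x1\<^sup>2 + x4\<^sup>2) / 2"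
      by (intro add_mono a b prod)
    also have "\<dots> \<le> k * (x1\<^sup>2 + x2\<^sup>2 + x3\<^sup>2 + x4\<^sup>2)"
    proof -
      have k2: "x2\<^sup>2 \<le> k * x2\<^sup>2" "x4\<^sup>2 \<le> k * x4\<^sup>2"
        using k mult_right_mono[of 1 k "x2\<^sup>2"] mult_right_mono[of 1 k "x4\<^sup>2"] by auto
      have "(a2 + a1) / 2 + (b1 - 2 * a1) + (a4 + a3) / 2 + (b3 - 2 * a3) + (a2 + a3) / 2 + (a1 + a4) / 2 \<le> b1 + b2 + b3 + b4"
        if "a2 \<le> b2" "a4 \<le> b4" "0 \<le> a1" "0 \<le> a3" for a1 a2 a3 a4 b1 b2 b3 b4 :: real
        using that by (simp add: field_simps)
      from this[OF k2 zero_le_power2 zero_le_power2] show ?thesis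
        unfolding distrib_left left_diff_distrib .
    qed
    finally show ?thesis by (simp add: x1_def x2_def x3_def x4_def)
  qed
  have le: "exp (\<bar>influence C i (pop \<omega>)\<bar> / c) \<le> ?h \<omega>" for \<omega>
  proof -
    let ?a = "\<lambda>g. (g \<omega>)\<^sup>2 / sg"
    have "\<bar>influence C i (pop \<omega>)\<bar> / c \<le> (k * ((?g1 \<omega>)\<^sup>2 + (?g2 \<omega>)\<^sup>2 + (?g3 \<omega>)\<^sup>2 + (?g4 \<omega>)\<^sup>2)) / c"
      using bound c by (intro divide_right_mono) auto
    also have "\<dots> = ((?a ?g1 + ?a ?g2) / 2 + (?a ?g3 + ?a ?g4) / 2) / 2"
      using k sg_scale_pos unfolding c_def k_def[symmetric] by (simp add: field_simps)
    finally have "exp (\<bar>influence C i (pop \<omega>)\<bar> / c) \<le> exp (((?a ?g1 + ?a ?g2) / 2 + (?a ?g3 + ?a ?g4) / 2) / 2)"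
      by simp
    also have "\<dots> \<le> (exp ((?a ?g1 + ?a ?g2) / 2) + exp ((?a ?g3 + ?a ?g4) / 2)) / 2" by (rule exp_mean_le)
    also have "\<dots> \<le> ((exp (?a ?g1) + exp (?a ?g2)) / 2 + (exp (?a ?g3) + exp (?a ?g4)) / 2) / 2"
      by (intro divide_right_mono add_mono exp_mean_le) auto
    finally show ?thesis by (simp add: add_divide_distrib)
  qed
  show int: "integrable (prob_sp C) (\<lambda>\<omega>. exp (\<bar>influence C i (pop \<omega>)\<bar> / c))"
    by (rule Bochner_Integration.integrable_bound[OF h])
       (use le measurable_compose[OF pop_measurable influence_measurable] in \<open>auto intro: order_trans[OF _ abs_ge_self]\<close>)
  show "expectation (\<lambda>\<omega>. exp (\<bar>influence C i (pop \<omega>)\<bar> / c)) \<le> 2"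
    using integral_mono[OF int h le] h2 by linarith
qed

end

section \<open>Measurability and rates\<close>

lemma bil_measurable:
  assumes A: "\<And>\<omega>. \<omega> \<in> space N \<Longrightarrow> A \<omega> \<in> carrier_mat p q"
    and entries: "\<And>j k. j < p \<Longrightarrow> k < q \<Longrightarrow> (\<lambda>\<omega>. A \<omega> $$ (j, k)) \<in> borel_measurable N"
    and u: "u \<in> measurable N (borel_vec p)" and v: "v \<in> measurable N (borel_vec q)"
  shows "(\<lambda>\<omega>. bil (A \<omega>) (u \<omega>) (v \<omega>)) \<in> borel_measurable N"
proof -
  have "(\<lambda>\<omega>. bil (A \<omega>) (u \<omega>) (v \<omega>)) \<in> borel_measurable N \<longleftrightarrow>
    (\<lambda>\<omega>. \<Sum>j<p. \<Sum>k<q. u \<omega> $ j * A \<omega> $$ (j, k) * v \<omega> $ k) \<in> borel_measurable N"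
    using u v A by (intro measurable_cong bil_sum) (auto simp: measurable_borel_vec_iff)
  moreover have "(\<lambda>\<omega>. \<Sum>j<p. \<Sum>k<q. u \<omega> $ j * A \<omega> $$ (j, k) * v \<omega> $ k) \<in> borel_measurable N"
    using u v entries by (intro borel_measurable_sum borel_measurable_times) (auto simp: measurable_borel_vec_iff)
  ultimately show ?thesis by simp
qed

lemma l2_dist_measurable:
  assumes X: "X \<in> measurable N (borel_vec p)" and v: "v \<in> carrier_vec p"
  shows "(\<lambda>\<omega>. l2_norm (w \<cdot>\<^sub>v X \<omega> - v)) \<in> borel_measurable N"
proof -
  have "(\<lambda>\<omega>. l2_norm (w \<cdot>\<^sub>v X \<omega> - v)) \<in> borel_measurable N \<longleftrightarrow>
    (\<lambda>\<omega>. sqrt (\<Sum>j<p. (w * X \<omega> $ j - v $ j)\<^sup>2)) \<in> borel_measurable N"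
    using X v by (intro measurable_cong) (auto simp: measurable_borel_vec_iff l2_norm_def Pi_def)
  moreover have "(\<lambda>\<omega>. sqrt (\<Sum>j<p. (w * X \<omega> $ j - v $ j)\<^sup>2)) \<in> borel_measurable N"
    using X
    by (intro measurable_compose[OF _ borel_measurable_sqrt] borel_measurable_sum borel_measurable_power
        borel_measurable_diff borel_measurable_times)
      (auto simp: measurable_borel_vec_iff)
  ultimately show ?thesis by simp
qed

lemma l1_dist_measurable:
  assumes X: "X \<in> measurable N (borel_vec p)" and v: "v \<in> carrier_vec p"
  shows "(\<lambda>\<omega>. l1_norm (w \<cdot>\<^sub>v X \<omega> - v)) \<in> borel_measurable N"
proof -
  have "(\<lambda>\<omega>. l1_norm (w \<cdot>\<^sub>v X \<omega> - v)) \<in> borel_measurable N \<longleftrightarrow>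
    (\<lambda>\<omega>. \<Sum>j<p. \<bar>w * X \<omega> $ j - v $ j\<bar>) \<in> borel_measurable N"
    using X v by (intro measurable_cong) (auto simp: measurable_borel_vec_iff l1_norm_def Pi_def)
  moreover have "(\<lambda>\<omega>. \<Sum>j<p. \<bar>w * X \<omega> $ j - v $ j\<bar>) \<in> borel_measurable N"
    using X by (intro borel_measurable_abs borel_measurable_sum borel_measurable_diff borel_measurable_times)
      (auto simp: measurable_borel_vec_iff)
  ultimately show ?thesis by simp
qed

lemma pm_dist_measurable:
  assumes "\<And>w. (\<lambda>\<omega>. N' (w \<cdot>\<^sub>v X \<omega> - v)) \<in> borel_measurable N"
  shows "(\<lambda>\<omega>. pm_dist N' (X \<omega>) v) \<in> borel_measurable N"
proof -
  have "pm_dist N' x v = min (N' ((- 1) \<cdot>\<^sub>v x - v)) (N' (1 \<cdot>\<^sub>v x - v))" for x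
    unfolding pm_dist_def by (subst cInf_eq_Min) auto
  then show ?thesis by (simp only:) (intro borel_measurable_min assms)
qed

lemma max_col_dist_measurable:
  assumes "\<And>j. j < dim_col B \<Longrightarrow> (\<lambda>\<omega>. N' (1 \<cdot>\<^sub>v col (A \<omega>) j - col B j)) \<in> borel_measurable N"
  shows "(\<lambda>\<omega>. max_col_dist N' (A \<omega>) B) \<in> borel_measurable N"
  unfolding max_col_dist_def using assms by (intro borel_measurable_Max) auto

section \<open>Measurability of the estimators\<close>

context cca_regular begin

lemma hat_Sigma_entries:
  "j < dim_x C \<Longrightarrow> k < dim_x C \<Longrightarrow> (\<lambda>\<omega>. hat_Sigma_x n C \<omega> $$ (j, k)) \<in> borel_measurable (prob_sp C)"
  "j < dim_y C \<Longrightarrow> k < dim_y C \<Longrightarrow> (\<lambda>\<omega>. hat_Sigma_y n C \<omega> $$ (j, k)) \<in> borel_measurable (prob_sp C)"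
  "j < dim_x C \<Longrightarrow> k < dim_y C \<Longrightarrow> (\<lambda>\<omega>. hat_Sigma_xy n C \<omega> $$ (j, k)) \<in> borel_measurable (prob_sp C)"
  using obs_X_measurable obs_Y_measurable
  by (auto simp: hat_Sigma_x_def hat_Sigma_y_def hat_Sigma_xy_def emp_cov_def measurable_borel_vec_iff
      intro!: borel_measurable_divide borel_measurable_sum borel_measurable_times)

lemma hat_forms_measurable:
  "u \<in> measurable (prob_sp C) (borel_vec (dim_x C)) \<Longrightarrow> u' \<in> measurable (prob_sp C) (borel_vec (dim_x C)) \<Longrightarrow>
    (\<lambda>\<omega>. bil (hat_Sigma_x n C \<omega>) (u \<omega>) (u' \<omega>)) \<in> borel_measurable (prob_sp C)"
  "v \<in> measurable (prob_sp C) (borel_vec (dim_y C)) \<Longrightarrow> v' \<in> measurable (prob_sp C) (borel_vec (dim_y C)) \<Longrightarrow>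
    (\<lambda>\<omega>. bil (hat_Sigma_y n C \<omega>) (v \<omega>) (v' \<omega>)) \<in> borel_measurable (prob_sp C)"
  "u \<in> measurable (prob_sp C) (borel_vec (dim_x C)) \<Longrightarrow> v \<in> measurable (prob_sp C) (borel_vec (dim_y C)) \<Longrightarrow>
    (\<lambda>\<omega>. bil (hat_Sigma_xy n C \<omega>) (u \<omega>) (v \<omega>)) \<in> borel_measurable (prob_sp C)"
  by (rule bil_measurable[OF hat_Sigma_carrier(1) hat_Sigma_entries(1)] bil_measurable[OF hat_Sigma_carrier(2) hat_Sigma_entries(2)]
      bil_measurable[OF hat_Sigma_carrier(3) hat_Sigma_entries(3)]; assumption)+

lemma hat_rho_measurable:
  assumes "a \<in> measurable (prob_sp C) (borel_vec (dim_x C))" "b \<in> measurable (prob_sp C) (borel_vec (dim_y C))"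
  shows "hat_rho n C a b \<in> borel_measurable (prob_sp C)"
  unfolding hat_rho_def[abs_def] bil_def[symmetric]
  using hat_forms_measurable(1)[OF assms(1,1)] hat_forms_measurable(2)[OF assms(2,2)] hat_forms_measurable(3)[OF assms]
  by (intro borel_measurable_divide borel_measurable_times measurable_compose[OF _ borel_measurable_sqrt])

text \<open>Through \<open>x_db_index\<close> the coordinate is a polynomial in covariance forms of
  vectors with measurable entries.\<close>

lemma x_db_measurable:
  assumes i: "i < dim_x C"
    and a: "a \<in> measurable (prob_sp C) (borel_vec (dim_x C))" and b: "b \<in> measurable (prob_sp C) (borel_vec (dim_y C))"
    and F: "\<And>\<omega>. \<omega> \<in> space (prob_sp C) \<Longrightarrow> F \<omega> \<in> carrier_mat (dim_x C + dim_y C) (dim_x C + dim_y C)"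
      "(\<lambda>\<omega>. col (F \<omega>) i) \<in> measurable (prob_sp C) (borel_vec (dim_x C + dim_y C))"
  shows "(\<lambda>\<omega>. x_db n C a b F \<omega> $ i) \<in> borel_measurable (prob_sp C)"
proof -
  let ?p = "dim_x C" and ?q = "dim_y C"
  define t where "t \<omega> = sqrt \<bar>hat_rho n C a b \<omega>\<bar>" for \<omega>
  have t: "t \<in> borel_measurable (prob_sp C)"
    unfolding t_def[abs_def] using hat_rho_measurable[OF a b] by simp
  define x y f1 f2 where "x \<omega> = t \<omega> \<cdot>\<^sub>v a \<omega>" and "y \<omega> = t \<omega> \<cdot>\<^sub>v b \<omega>"
    and "f1 \<omega> = vec_first (col (F \<omega>) i) ?p" and "f2 \<omega> = vec_last (col (F \<omega>) i) ?q" for \<omega>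
  have Fc: "col (F \<omega>) i \<in> carrier_vec (?p + ?q)" if "\<omega> \<in> space (prob_sp C)" for \<omega>
    using F(1)[OF that] col_dim[of "F \<omega>" i] by auto
  have x: "x \<in> measurable (prob_sp C) (borel_vec ?p)" and y: "y \<in> measurable (prob_sp C) (borel_vec ?q)"
  proof -
    have "(\<lambda>\<omega>. x \<omega> $ j) \<in> borel_measurable (prob_sp C)" if j: "j < ?p" for j
    proof -
      have "(\<lambda>\<omega>. x \<omega> $ j) \<in> borel_measurable (prob_sp C) \<longleftrightarrow> (\<lambda>\<omega>. t \<omega> * a \<omega> $ j) \<in> borel_measurable (prob_sp C)"
        using a j by (intro measurable_cong) (auto simp: x_def measurable_borel_vec_iff Pi_def)
      then show ?thesis using borel_measurable_times[OF t, of "\<lambda>\<omega>. a \<omega> $ j"] a j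
        by (auto simp: measurable_borel_vec_iff)
    qed
    then show "x \<in> measurable (prob_sp C) (borel_vec ?p)"
      using a unfolding measurable_borel_vec_iff by (auto simp: x_def)
    have "(\<lambda>\<omega>. y \<omega> $ j) \<in> borel_measurable (prob_sp C)" if j: "j < ?q" for j
    proof -
      have "(\<lambda>\<omega>. y \<omega> $ j) \<in> borel_measurable (prob_sp C) \<longleftrightarrow> (\<lambda>\<omega>. t \<omega> * b \<omega> $ j) \<in> borel_measurable (prob_sp C)"
        using b j by (intro measurable_cong) (auto simp: y_def measurable_borel_vec_iff Pi_def)
      then show ?thesis using borel_measurable_times[OF t, of "\<lambda>\<omega>. b \<omega> $ j"] b j
        by (auto simp: measurable_borel_vec_iff)
    qed
    then show "y \<in> measurable (prob_sp C) (borel_vec ?q)"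
      using b unfolding measurable_borel_vec_iff by (auto simp: y_def)
  qed
  have f1: "f1 \<in> measurable (prob_sp C) (borel_vec ?p)" and f2: "f2 \<in> measurable (prob_sp C) (borel_vec ?q)"
  proof -
    have "(\<lambda>\<omega>. f1 \<omega> $ j) \<in> borel_measurable (prob_sp C)" if j: "j < ?p" for j
    proof -
      have "(\<lambda>\<omega>. f1 \<omega> $ j) = (\<lambda>\<omega>. col (F \<omega>) i $ j)" using j by (simp add: f1_def vec_first_def)
      moreover have "(\<lambda>\<omega>. col (F \<omega>) i $ j) \<in> borel_measurable (prob_sp C)"
        using F(2) j unfolding measurable_borel_vec_iff by auto
      ultimately show ?thesis by simp
    qed
    then show "f1 \<in> measurable (prob_sp C) (borel_vec ?p)"
      unfolding measurable_borel_vec_iff by (auto simp: f1_def)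
    have "(\<lambda>\<omega>. f2 \<omega> $ j) \<in> borel_measurable (prob_sp C)" if j: "j < ?q" for j
    proof -
      have "(\<lambda>\<omega>. f2 \<omega> $ j) \<in> borel_measurable (prob_sp C) \<longleftrightarrow> (\<lambda>\<omega>. col (F \<omega>) i $ (?p + j)) \<in> borel_measurable (prob_sp C)"
      proof (rule measurable_cong)
        fix \<omega> assume "\<omega> \<in> space (prob_sp C)"
        from carrier_vecD[OF Fc[OF this]] show "f2 \<omega> $ j = col (F \<omega>) i $ (?p + j)"
          using j by (simp add: f2_def vec_last_def add.commute del: index_col dim_col)
      qed
      moreover have "(\<lambda>\<omega>. col (F \<omega>) i $ (?p + j)) \<in> borel_measurable (prob_sp C)"
        using F(2) j unfolding measurable_borel_vec_iff by auto
      ultimately show ?thesis by blast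
    qed
    then show "f2 \<in> measurable (prob_sp C) (borel_vec ?q)"
      unfolding measurable_borel_vec_iff by (auto simp: f2_def)
  qed
  have eq: "x_db n C a b F \<omega> $ i = x \<omega> $ i -
      (2 * bil (hat_Sigma_x n C \<omega>) (x \<omega>) (x \<omega>) * bil (hat_Sigma_x n C \<omega>) (f1 \<omega>) (x \<omega>) - 2 * bil (hat_Sigma_xy n C \<omega>) (f1 \<omega>) (y \<omega>)
     + 2 * bil (hat_Sigma_y n C \<omega>) (y \<omega>) (y \<omega>) * bil (hat_Sigma_y n C \<omega>) (f2 \<omega>) (y \<omega>) - 2 * bil (hat_Sigma_xy n C \<omega>) (x \<omega>) (f2 \<omega>))"
    if \<omega>: "\<omega> \<in> space (prob_sp C)" for \<omega>
  proof (rule x_db_index[where a = a and b = b and F = F and \<omega> = \<omega>, OF i])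
    show "F \<omega> \<in> carrier_mat (?p + ?q) (?p + ?q)" by (rule F(1)[OF \<omega>])
    show "a \<omega> \<in> carrier_vec ?p" "b \<omega> \<in> carrier_vec ?q" using a b \<omega> by (auto simp: measurable_borel_vec_iff)
    show "col (F \<omega>) i = f1 \<omega> @\<^sub>v f2 \<omega>" using Fc[OF \<omega>] by (simp add: f1_def f2_def)
  qed (auto simp: x_def y_def t_def f1_def f2_def)
  have xi: "(\<lambda>\<omega>. x \<omega> $ i) \<in> borel_measurable (prob_sp C)" using x i by (simp add: measurable_borel_vec_iff)
  have "(\<lambda>\<omega>. x \<omega> $ i -
      (2 * bil (hat_Sigma_x n C \<omega>) (x \<omega>) (x \<omega>) * bil (hat_Sigma_x n C \<omega>) (f1 \<omega>) (x \<omega>) - 2 * bil (hat_Sigma_xy n C \<omega>) (f1 \<omega>) (y \<omega>)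
     + 2 * bil (hat_Sigma_y n C \<omega>) (y \<omega>) (y \<omega>) * bil (hat_Sigma_y n C \<omega>) (f2 \<omega>) (y \<omega>) - 2 * bil (hat_Sigma_xy n C \<omega>) (x \<omega>) (f2 \<omega>)))
     \<in> borel_measurable (prob_sp C)"
    by (intro borel_measurable_diff borel_measurable_add borel_measurable_times borel_measurable_const xi hat_forms_measurable x y f1 f2)
  then show ?thesis by (subst measurable_cong[OF eq])
qed

lemma lin_term_measurable: "lin_term n C i \<in> borel_measurable (prob_sp C)"
proof -
  have "lin_term n C i \<in> borel_measurable (prob_sp C) \<longleftrightarrow>
    (\<lambda>\<omega>. - 2 * ((\<Sum>l<n. influence C i (obs l \<omega>)) / real n - expectation (\<lambda>\<omega>. influence C i (pop \<omega>)))) \<in> borel_measurable (prob_sp C)"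
    by (rule measurable_cong) (rule lin_term_eq)
  also have "\<dots>"
    using measurable_compose[OF obs_measurable influence_measurable]
    by (intro borel_measurable_diff borel_measurable_times borel_measurable_divide borel_measurable_sum borel_measurable_const) auto
  finally show ?thesis .
qed

end

text \<open>The bounds on \<open>lam * s\<close> and \<open>sqrt s * \<tau>\<close> use that \<open>lam\<close> is at least of order \<open>n powr (- 1/2)\<close>.\<close>

lemma rate_bounds:
  fixes s n lam \<kappa> :: real
  assumes s: "1 \<le> s" and \<kappa>: "1 / 2 \<le> \<kappa>" and n: "1 \<le> n" and lam: "0 \<le> lam" "1 \<le> n * lam\<^sup>2"
  defines "\<tau> \<equiv> s powr \<kappa> * lam"
  defines "\<delta> \<equiv> sqrt n * \<tau>\<^sup>2"
  shows "lam \<le> \<tau>" "lam * sqrt s \<le> \<tau>" "lam * s \<le> \<delta>" "sqrt s * \<tau> \<le> \<delta>" "\<tau>\<^sup>2 \<le> \<delta>" "0 \<le> \<tau>"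
proof -
  have ss: "sqrt s \<le> s powr \<kappa>"
    using s \<kappa> by (simp add: powr_half_sqrt[symmetric] powr_mono)
  have s1: "1 \<le> sqrt s" using s by simp
  show \<tau>0: "0 \<le> \<tau>" unfolding \<tau>_def using lam by simp
  show ls: "lam * sqrt s \<le> \<tau>" unfolding \<tau>_def using mult_left_mono[OF ss lam(1)] by (simp add: mult.commute)
  have "lam * 1 \<le> lam * sqrt s" using s1 lam by (intro mult_left_mono)
  then show "lam \<le> \<tau>" using ls by simp
  have "sqrt 1 \<le> sqrt (n * lam\<^sup>2)" using lam(2) by (intro real_sqrt_le_mono)
  then have ln: "1 \<le> sqrt n * lam" using lam(1) by (simp add: real_sqrt_mult)
  have "(lam * sqrt s)\<^sup>2 \<le> \<tau>\<^sup>2" using ls lam s by (intro power_mono) auto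
  then have ls2: "lam\<^sup>2 * s \<le> \<tau>\<^sup>2" using s by (simp add: power_mult_distrib)
  have "lam * s * 1 \<le> lam * s * (sqrt n * lam)" using ln lam s by (intro mult_left_mono) auto
  also have "\<dots> = sqrt n * (lam\<^sup>2 * s)" by (simp add: power2_eq_square mult_ac)
  also have "\<dots> \<le> \<delta>" unfolding \<delta>_def using ls2 n by (intro mult_left_mono) auto
  finally show lsd: "lam * s \<le> \<delta>" by simp
  have \<delta>0: "0 \<le> \<delta>" using n by (simp add: \<delta>_def)
  \<comment> \<open>The lower bound on the rate is used a second time: it turns the factor
    \<open>s\<close> in the square of \<open>sqrt s * \<tau>\<close> into
    \<open>sqrt n * \<delta>\<close>, and \<open>sqrt n * \<tau>\<^sup>2 = \<delta>\<close>
    completes the square.\<close>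
  have "s * 1 \<le> s * (sqrt n * lam)" using ln s by (intro mult_left_mono) auto
  also have "\<dots> = sqrt n * (lam * s)" by (simp add: mult_ac)
  also have "\<dots> \<le> sqrt n * \<delta>" using lsd n by (intro mult_left_mono) auto
  finally have "s * \<tau>\<^sup>2 \<le> sqrt n * \<delta> * \<tau>\<^sup>2" by (simp add: mult_right_mono)
  also have "\<dots> = \<delta>\<^sup>2" by (simp add: \<delta>_def power2_eq_square mult_ac)
  finally have "(sqrt s * \<tau>)\<^sup>2 \<le> \<delta>\<^sup>2" using s by (simp add: power_mult_distrib)
  then show "sqrt s * \<tau> \<le> \<delta>" using \<delta>0 by (rule power2_le_imp_le)
  have "1 * \<tau>\<^sup>2 \<le> sqrt n * \<tau>\<^sup>2" using n by (intro mult_right_mono) auto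
  then show "\<tau>\<^sup>2 \<le> \<delta>" by (simp add: \<delta>_def)
qed

section \<open>Rates along the sequence of models\<close>

locale cca_sequence =
  fixes C :: "nat \<Rightarrow> 'w cca" and r :: nat and K \<epsilon>0 M \<kappa> :: real
    and a b :: "nat \<Rightarrow> 'w \<Rightarrow> real vec" and F :: "nat \<Rightarrow> 'w \<Rightarrow> real mat" and i :: "nat \<Rightarrow> nat"
  assumes regular: "\<And>n. n \<ge> 1 \<Longrightarrow> cca_regular (C n) n r K \<epsilon>0 M"
    and eps: "0 < \<epsilon>0" "\<epsilon>0 < 1" and M: "0 < M"
    and kappa: "1 / 2 \<le> \<kappa>"
    and sparse:
      "(\<lambda>n. real (nonzero_rows (mat_U (C n)))) \<in> o(\<lambda>n. real (dim_x (C n)))"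
      "(\<lambda>n. real (sparsity (C n)) powr (2 * \<kappa>) * (lambda_rate n (C n))\<^sup>2)
         \<in> o(\<lambda>n. real n powr (- 1/2))"
    and estimators: "random_vectors C dim_x a" "random_vectors C dim_y b"
      "random_square_matrices C (\<lambda>c. dim_x c + dim_y c) F"
    and preliminary: "preliminary_estimator_condition C \<kappa> a b"
    and signs: "signs_matched C a b"
    and inverse_Hessian: "inverse_Hessian_condition C \<kappa> F"
    and index: "\<And>n. n \<ge> 1 \<Longrightarrow> i n < dim_x (C n)"
begin

definition lam :: "nat \<Rightarrow> real" where "lam n = lambda_rate n (C n)"
definition s :: "nat \<Rightarrow> real" where "s n = real (sparsity (C n))"
definition \<tau> :: "nat \<Rightarrow> real" where "\<tau> n = s n powr \<kappa> * lam n"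
text \<open>The quadratic remainder after multiplication by \<open>sqrt n\<close>. That it vanishes
  is the content of the condition relating sparsity and \<lambda>.\<close>

definition \<delta> :: "nat \<Rightarrow> real" where "\<delta> n = sqrt (real n) * (\<tau> n)\<^sup>2"
definition m :: "nat \<Rightarrow> real" where "m n = real (max (dim_x (C n)) (dim_y (C n)))"

lemma s_ge_1: "n \<ge> 1 \<Longrightarrow> 1 \<le> s n"
  using cca_regular.nonzero_rows_pos[OF regular, of n] by (simp add: s_def sparsity_def)

text \<open>Growth of the dimension is forced: \<open>U\<close> has at least one nonzero row, and
  the number of such rows is negligible against \<open>dim_x\<close>. This makes the failure
  probability of the union bound, of order \<open>1 / m\<close>, vanish.\<close>

lemma m_at_top: "filterlim m at_top sequentially"
  unfolding filterlim_at_top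
proof
  fix Z :: real
  define c where "c = 1 / max Z 1"
  have c: "0 < c" by (simp add: c_def)
  have "\<forall>\<^sub>F n in sequentially. norm (real (nonzero_rows (mat_U (C n)))) \<le> c * norm (real (dim_x (C n)))"
    by (rule landau_o.smallD[OF sparse(1) c])
  then show "\<forall>\<^sub>F n in sequentially. Z \<le> m n"
    using eventually_ge_at_top[of 1]
  proof eventually_elim
    case (elim n)
    have "1 \<le> real (nonzero_rows (mat_U (C n)))"
      using cca_regular.nonzero_rows_pos(1)[OF regular[OF elim(2)]] by simp
    also have "\<dots> \<le> c * real (dim_x (C n))" using elim by simp
    finally have "max Z 1 \<le> real (dim_x (C n))" by (simp add: c_def field_simps)
    then show ?case by (auto simp: m_def)
  qed
qed

text \<open>Through \<open>lam_sq\<close> this is the lower bound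
  \<open>1 \<le> n * lam\<^sup>2\<close> that \<open>rate_bounds\<close> asks for.\<close>

lemma eventually_ln_m: "\<forall>\<^sub>F n in sequentially. 1 \<le> ln (m n)"
proof -
  have "\<forall>\<^sub>F n in sequentially. exp 1 \<le> m n"
    using m_at_top by (simp add: filterlim_at_top)
  then show ?thesis
  proof eventually_elim
    case (elim n)
    have "ln (exp 1) \<le> ln (m n)" using elim by (intro ln_mono) auto
    then show ?case by simp
  qed
qed

lemma lam_sq: "n \<ge> 1 \<Longrightarrow> 1 \<le> ln (m n) \<Longrightarrow> real n * (lam n)\<^sup>2 = ln (m n)"
  by (simp add: lam_def lambda_rate_def m_def)

lemma lam_nonneg: "1 \<le> ln (m n) \<Longrightarrow> 0 \<le> lam n"
  by (simp add: lam_def lambda_rate_def m_def)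

lemma \<delta>_tendsto: "\<delta> \<longlonglongrightarrow> 0"
proof -
  have "(\<lambda>n. real (sparsity (C n)) powr (2 * \<kappa>) * (lambda_rate n (C n))\<^sup>2 / (real n powr (- 1/2))) \<longlonglongrightarrow> 0"
    by (rule smalloD_tendsto[OF sparse(2)])
  moreover have "\<forall>\<^sub>F n in sequentially.
      real (sparsity (C n)) powr (2 * \<kappa>) * (lambda_rate n (C n))\<^sup>2 / (real n powr (- 1/2)) = \<delta> n"
    using eventually_ge_at_top[of 1]
  proof eventually_elim
    case (elim n)
    have "(real (sparsity (C n)) powr \<kappa>)\<^sup>2 = real (sparsity (C n)) powr (2 * \<kappa>)"
      by (simp add: power2_eq_square powr_add[symmetric])
    moreover have "real n powr (- 1/2) = 1 / sqrt (real n)"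
      using elim by (simp add: powr_minus_divide powr_half_sqrt)
    ultimately show ?case
      by (simp add: \<delta>_def \<tau>_def s_def lam_def power_mult_distrib)
  qed
  ultimately show ?thesis by (rule Lim_transform_eventually)
qed

lemma rates:
  assumes "n \<ge> 1" "1 \<le> ln (m n)"
  shows "lam n \<le> \<tau> n" "lam n * sqrt (s n) \<le> \<tau> n" "lam n * s n \<le> \<delta> n" "sqrt (s n) * \<tau> n \<le> \<delta> n" "(\<tau> n)\<^sup>2 \<le> \<delta> n" "0 \<le> \<tau> n"
  using rate_bounds[OF s_ge_1[OF assms(1)] kappa, of "real n" "lam n"] assms lam_sq[OF assms] lam_nonneg[OF assms(2)]
  unfolding \<delta>_def \<tau>_def by auto

lemma \<tau>_tendsto: "\<tau> \<longlonglongrightarrow> 0"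
proof (rule Lim_null_comparison)
  show "(\<lambda>n. sqrt (\<delta> n)) \<longlonglongrightarrow> 0" using tendsto_real_sqrt[OF \<delta>_tendsto] by simp
  show "\<forall>\<^sub>F n in sequentially. norm (\<tau> n) \<le> sqrt (\<delta> n)"
    using eventually_ln_m eventually_ge_at_top[of 1]
  proof eventually_elim
    case (elim n)
    then show ?case using rates[of n] by (auto intro: real_le_rsqrt)
  qed
qed

lemma \<eta>\<tau>_tendsto: "(\<lambda>n. sqrt (s n) * \<tau> n) \<longlonglongrightarrow> 0"
proof (rule Lim_null_comparison[OF _ \<delta>_tendsto])
  show "\<forall>\<^sub>F n in sequentially. norm (sqrt (s n) * \<tau> n) \<le> \<delta> n"
    using eventually_ln_m eventually_ge_at_top[of 1]
  proof eventually_elim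
    case (elim n)
    then show ?case using rates[of n] s_ge_1[of n] by (simp add: abs_mult)
  qed
qed

lemma l2_rate: "real (sparsity (C n)) powr \<kappa> * lambda_rate n (C n) = \<tau> n"
  by (simp add: \<tau>_def s_def lam_def)

lemma l1_rate: "real (sparsity (C n)) powr (\<kappa> + 1/2) * lambda_rate n (C n) = sqrt (s n) * \<tau> n"
  by (simp add: \<tau>_def s_def lam_def powr_add powr_half_sqrt)

end

section \<open>Events of high probability\<close>

lemma bigO_in_prob_event:
  assumes O: "bigO_in_prob P Z g" and e: "e > 0" and Z: "\<And>n. n \<ge> 1 \<Longrightarrow> Z n \<in> borel_measurable (P n)"
  shows "\<exists>B>0. \<forall>\<^sub>F n in sequentially. likely (P n) e (\<lambda>\<omega>. \<bar>Z n \<omega>\<bar> \<le> B * g n)"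
proof -
  obtain B where B: "B > 0" "\<forall>\<^sub>F n in sequentially. measure (P n) {\<omega> \<in> space (P n). \<bar>Z n \<omega>\<bar> > B * g n} \<le> e"
    using O e unfolding bigO_in_prob_def by blast
  have "\<forall>\<^sub>F n in sequentially. likely (P n) e (\<lambda>\<omega>. \<bar>Z n \<omega>\<bar> \<le> B * g n)"
    using B(2) eventually_ge_at_top[of 1]
  proof eventually_elim
    case (elim n)
    have [measurable]: "Z n \<in> borel_measurable (P n)" using Z elim by simp
    show ?case
      by (rule bexI[of _ "{\<omega> \<in> space (P n). \<bar>Z n \<omega>\<bar> > B * g n}"]) (use elim in \<open>auto simp: not_less\<close>)
  qed
  then show ?thesis using B(1) by blast
qed

text \<open>The test function \<open>f\<close> is a continuous ramp, 0 up to \<open>R\<close> and 1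
  beyond \<open>R + 1\<close>, and lies below \<open>x\<^sup>2 / R\<^sup>2\<close>. Chebyshev's
  inequality under the Gaussian gives \<open>e / 2\<close>, and merging contributes at most another
  \<open>e / 2\<close>.\<close>

lemma centered_gaussian_tight:
  fixes P :: "nat \<Rightarrow> 'w measure" and T :: "nat \<Rightarrow> 'w \<Rightarrow> real"
  assumes P: "\<And>n. n \<ge> 1 \<Longrightarrow> prob_space (P n)"
    and T: "\<And>n. n \<ge> 1 \<Longrightarrow> T n \<in> borel_measurable (P n)"
    and v: "\<And>n. n \<ge> 1 \<Longrightarrow> 0 \<le> v n" "\<And>n. n \<ge> 1 \<Longrightarrow> v n \<le> B"
    and merge: "weakly_merging (\<lambda>n. distr (P n) borel (T n)) (\<lambda>n. centered_gaussian (v n))"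
    and e: "e > 0"
  shows "\<exists>R>0. \<forall>\<^sub>F n in sequentially. likely (P n) e (\<lambda>\<omega>. \<bar>T n \<omega>\<bar> \<le> R)"
proof -
  have B0: "0 \<le> B" using v[of 1] by simp
  \<comment> \<open>Adding 1 keeps the radius \<open>R\<close> positive when
    \<open>B = 0\<close>.\<close>
  define c where "c = B + 1"
  have c: "0 < c" "B \<le> c" using B0 by (auto simp: c_def)
  define R where "R = sqrt (2 * c / e)"
  have R: "R > 0" "R\<^sup>2 = 2 * c / e" using c e by (auto simp: R_def)
  define f :: "real \<Rightarrow> real" where "f x = min 1 (max 0 (\<bar>x\<bar> - R))" for x
  have f: "continuous_on UNIV f" "bounded (range f)" "\<And>x. 0 \<le> f x" "\<And>x. f x \<le> 1"
    by (auto simp: f_def[abs_def] bounded_iff intro!: continuous_intros exI[of _ 1])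
  have [measurable]: "f \<in> borel_measurable borel"
    using f by (auto intro: borel_measurable_continuous_onI)
  have f_sq: "f x \<le> x\<^sup>2 / R\<^sup>2" for x
  proof (cases "\<bar>x\<bar> \<le> R")
    case False
    then have "R\<^sup>2 \<le> x\<^sup>2" using R(1) by (simp add: abs_le_square_iff[symmetric])
    then have "1 \<le> x\<^sup>2 / R\<^sup>2" using R(1) by simp
    then show ?thesis using f(4)[of x] by linarith
  qed (simp add: f_def)
  have gauss: "integral\<^sup>L (centered_gaussian t) f \<le> e / 2" if t: "0 \<le> t" "t \<le> B" for t
  proof -
    interpret N: real_distribution std_normal_distribution by (rule real_dist_normal_dist)
    have int: "integrable std_normal_distribution (\<lambda>z. z\<^sup>2)"
      by (rule integrable_std_normal_distribution_moment)
    have "integral\<^sup>L (centered_gaussian t) f = integral\<^sup>L std_normal_distribution (\<lambda>z. f (sqrt t * z))"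
      unfolding centered_gaussian_def by (subst integral_distr) auto
    also have "\<dots> \<le> integral\<^sup>L std_normal_distribution (\<lambda>z. (t / R\<^sup>2) * z\<^sup>2)"
    proof (rule integral_mono)
      show "integrable std_normal_distribution (\<lambda>z. f (sqrt t * z))"
        using f by (intro N.integrable_const_bound[where B = 1]) auto
      show "f (sqrt t * z) \<le> (t / R\<^sup>2) * z\<^sup>2" for z
        using f_sq[of "sqrt t * z"] t by (simp add: power_mult_distrib)
    qed (use int in auto)
    also have "\<dots> = t / R\<^sup>2"
      using std_normal_distribution_even_moments[of 1] by (simp add: fact_numeral)
    also have "\<dots> \<le> c / R\<^sup>2" using t c by (intro divide_right_mono zero_le_power2) simp
    also have "\<dots> = e / 2" using c e by (simp add: R(2))
    finally show ?thesis .
  qed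
  have "(\<lambda>n. integral\<^sup>L (distr (P n) borel (T n)) f - integral\<^sup>L (centered_gaussian (v n)) f) \<longlonglongrightarrow> 0"
    using merge f unfolding weakly_merging_def by blast
  then have "\<forall>\<^sub>F n in sequentially. integral\<^sup>L (distr (P n) borel (T n)) f - integral\<^sup>L (centered_gaussian (v n)) f < e / 2"
    by (rule order_tendstoD) (use e in simp)
  then have "\<forall>\<^sub>F n in sequentially. likely (P n) e (\<lambda>\<omega>. \<bar>T n \<omega>\<bar> \<le> R + 1)"
    using eventually_ge_at_top[of 1]
  proof eventually_elim
    case (elim n)
    interpret prob_space "P n" using P elim by auto
    have [measurable]: "T n \<in> borel_measurable (P n)" using T elim by simp
    let ?A = "{\<omega> \<in> space (P n). R + 1 < \<bar>T n \<omega>\<bar>}"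
    have "prob ?A = expectation (indicator ?A)" by simp
    also have "\<dots> \<le> expectation (\<lambda>\<omega>. f (T n \<omega>))"
    proof (rule integral_mono)
      show "integrable (P n) (\<lambda>\<omega>. f (T n \<omega>))"
        using f by (intro integrable_const_bound[where B = 1]) auto
      show "indicator ?A \<omega> \<le> f (T n \<omega>)" if "\<omega> \<in> space (P n)" for \<omega>
        using f(3)[of "T n \<omega>"] by (auto split: split_indicator simp: f_def)
    qed (auto simp: emeasure_eq_measure)
    also have "\<dots> = integral\<^sup>L (distr (P n) borel (T n)) f" by (simp add: integral_distr)
    also have "\<dots> \<le> e" using elim gauss[OF v(1)[OF elim(2)] v(2)[OF elim(2)]] by linarith
    finally have "prob ?A \<le> e" .
    then show ?case by (intro bexI[of _ ?A]) (auto simp: not_less)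
  qed
  then show ?thesis using R(1) by (intro exI[of _ "R + 1"]) auto
qed

text \<open>\<open>q\<close> is \<open>sqrt n\<close>, \<open>l\<close> the linear term and
  \<open>D\<close> the remainder. In the first bound the square of \<open>l + D\<close> survives
  only with a factor \<open>1 / q\<close>; the second bound serves a vanishing coordinate, where
  that square is the leading term.\<close>

lemma square_difference_expand:
  fixes q x l D e R X :: real
  assumes q: "0 < q" and D: "\<bar>D\<bar> \<le> e" and l: "\<bar>q * l\<bar> \<le> R" and x: "\<bar>x\<bar> \<le> X"
  shows "\<bar>q * ((x + l + D)\<^sup>2 - x\<^sup>2) - 2 * x * (q * l)\<bar> \<le> 2 * X * (q * e) + (R + q * e)\<^sup>2 / q"
    and "\<bar>q\<^sup>2 * (l + D)\<^sup>2 - (q * l)\<^sup>2\<bar> \<le> 2 * R * (q * e) + (q * e)\<^sup>2"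
proof -
  have qD: "\<bar>q * D\<bar> \<le> q * e" using D q by (simp add: abs_mult)
  have "(q * l + q * D)\<^sup>2 / q = q * (l + D)\<^sup>2"
    using q by (simp add: power2_eq_square distrib_left[symmetric])
  then have 1: "q * ((x + l + D)\<^sup>2 - x\<^sup>2) - 2 * x * (q * l) = 2 * (x * (q * D)) + (q * l + q * D)\<^sup>2 / q"
    by (simp add: algebra_simps power2_eq_square)
  have a: "\<bar>x * (q * D)\<bar> \<le> X * (q * e)" unfolding abs_mult[of x] using x qD by (intro mult_mono) auto
  have b: "(q * l + q * D)\<^sup>2 / q \<le> (R + q * e)\<^sup>2 / q"
  proof (rule divide_right_mono)
    have "\<bar>q * l + q * D\<bar> \<le> \<bar>R + q * e\<bar>" using l qD by linarith
    then show "(q * l + q * D)\<^sup>2 \<le> (R + q * e)\<^sup>2" by (simp only: abs_le_square_iff)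
  qed (use q in simp)
  have c: "0 \<le> (q * l + q * D)\<^sup>2 / q" using q by simp
  have comb: "\<bar>2 * u + v\<bar> \<le> 2 * X * (q * e) + v'" if "\<bar>u\<bar> \<le> X * (q * e)" "v \<le> v'" "0 \<le> v" for u v v'
    using that by (simp add: abs_le_iff)
  show "\<bar>q * ((x + l + D)\<^sup>2 - x\<^sup>2) - 2 * x * (q * l)\<bar> \<le> 2 * X * (q * e) + (R + q * e)\<^sup>2 / q"
    unfolding 1 by (rule comb[OF a b c])
  have 2: "q\<^sup>2 * (l + D)\<^sup>2 - (q * l)\<^sup>2 = 2 * ((q * l) * (q * D)) + (q * D)\<^sup>2"
    by (simp add: algebra_simps power2_eq_square)
  have a: "\<bar>(q * l) * (q * D)\<bar> \<le> R * (q * e)" unfolding abs_mult[of "q * l"] using l qD by (intro mult_mono) auto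
  have b: "(q * D)\<^sup>2 \<le> (q * e)\<^sup>2" using power_mono[OF qD abs_ge_zero, of 2] by (simp only: power2_abs)
  have comb: "\<bar>2 * u + v\<bar> \<le> 2 * R * (q * e) + v'" if "\<bar>u\<bar> \<le> R * (q * e)" "v \<le> v'" "0 \<le> v" for u v v'
    using that by (simp add: abs_le_iff)
  show "\<bar>q\<^sup>2 * (l + D)\<^sup>2 - (q * l)\<^sup>2\<bar> \<le> 2 * R * (q * e) + (q * e)\<^sup>2"
    unfolding 2 by (rule comb[OF a b zero_le_power2])
qed

section \<open>Exceptional sets of small probability\<close>

context cca_sequence begin

abbreviation "P n \<equiv> prob_sp (C n)"

lemma prob_space_P: "n \<ge> 1 \<Longrightarrow> prob_space (P n)"
  using regular[of n] by (auto simp: cca_regular_def cca_model_def)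

lemma a_measurable: "n \<ge> 1 \<Longrightarrow> a n \<in> measurable (P n) (borel_vec (dim_x (C n)))"
  and b_measurable: "n \<ge> 1 \<Longrightarrow> b n \<in> measurable (P n) (borel_vec (dim_y (C n)))"
  using estimators(1,2) by (auto simp: random_vectors_def)

lemma F_carrier: "n \<ge> 1 \<Longrightarrow> \<omega> \<in> space (P n) \<Longrightarrow> F n \<omega> \<in> carrier_mat (dim_x (C n) + dim_y (C n)) (dim_x (C n) + dim_y (C n))"
  and F_col_measurable: "n \<ge> 1 \<Longrightarrow> j < dim_x (C n) + dim_y (C n) \<Longrightarrow>
      (\<lambda>\<omega>. col (F n \<omega>) j) \<in> measurable (P n) (borel_vec (dim_x (C n) + dim_y (C n)))"
  using estimators(3) by (auto simp: random_square_matrices_def)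

lemma distances_measurable:
  assumes n: "n \<ge> 1"
  shows "(\<lambda>\<omega>. pm_dist l2_norm (a n \<omega>) (alpha0 (C n)) + pm_dist l2_norm (b n \<omega>) (beta0 (C n))) \<in> borel_measurable (P n)"
    "(\<lambda>\<omega>. pm_dist l1_norm (a n \<omega>) (alpha0 (C n)) + pm_dist l1_norm (b n \<omega>) (beta0 (C n))) \<in> borel_measurable (P n)"
    "(\<lambda>\<omega>. max_col_dist l1_norm (F n \<omega>) (Phi0 (C n))) \<in> borel_measurable (P n)"
    "(\<lambda>\<omega>. max_col_dist l2_norm (F n \<omega>) (Phi0 (C n))) \<in> borel_measurable (P n)"
proof -
  interpret cca_regular "C n" n r K \<epsilon>0 M by (rule regular[OF n])
  have c: "col (Phi0 (C n)) j \<in> carrier_vec (dim_x (C n) + dim_y (C n))" for j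
    using col_dim[of "Phi0 (C n)" j] Phi0_carrier by auto
  have d: "dim_col (Phi0 (C n)) = dim_x (C n) + dim_y (C n)" using Phi0_carrier by auto
  show "(\<lambda>\<omega>. pm_dist l2_norm (a n \<omega>) (alpha0 (C n)) + pm_dist l2_norm (b n \<omega>) (beta0 (C n))) \<in> borel_measurable (P n)"
    "(\<lambda>\<omega>. pm_dist l1_norm (a n \<omega>) (alpha0 (C n)) + pm_dist l1_norm (b n \<omega>) (beta0 (C n))) \<in> borel_measurable (P n)"
    by (intro borel_measurable_add pm_dist_measurable l2_dist_measurable[OF a_measurable[OF n] alpha0_carrier]
        l2_dist_measurable[OF b_measurable[OF n] beta0_carrier] l1_dist_measurable[OF a_measurable[OF n] alpha0_carrier]
        l1_dist_measurable[OF b_measurable[OF n] beta0_carrier])+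
  show "(\<lambda>\<omega>. max_col_dist l1_norm (F n \<omega>) (Phi0 (C n))) \<in> borel_measurable (P n)"
    by (rule max_col_dist_measurable, rule l1_dist_measurable[OF F_col_measurable[OF n] c]) (simp add: d)
  show "(\<lambda>\<omega>. max_col_dist l2_norm (F n \<omega>) (Phi0 (C n))) \<in> borel_measurable (P n)"
    by (rule max_col_dist_measurable, rule l2_dist_measurable[OF F_col_measurable[OF n] c]) (simp add: d)
qed

text \<open>With Chernoff parameter \<open>lam n\<close> and threshold
  \<open>conc_const * lam n\<close> the exponent of the concentration bound is
  \<open>- 3 * n * lam\<^sup>2 = - 3 * ln m\<close>. The resulting \<open>m^(-3)\<close> beats a
  union bound over order \<open>m^2\<close> pairs.\<close>

abbreviation "conc_const \<equiv> 64 * (sg_scale K \<epsilon>0 M)\<^sup>2 + 3"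

lemma cov_close_event:
  assumes e: "e > 0"
  shows "\<forall>\<^sub>F n in sequentially. likely (P n) e (\<lambda>\<omega>. cov_close n (C n) (i n) (conc_const * lam n) \<omega>)"
proof -
  let ?c = "sg_scale K \<epsilon>0 M"
  have c: "0 < ?c" by (rule cca_regular.sg_scale_pos[OF regular[of 1]]) simp
  have "\<forall>\<^sub>F n in sequentially. \<tau> n < 1 / (2 * ?c)"
    by (rule order_tendstoD(2)[OF \<tau>_tendsto]) (use c in simp)
  moreover have "\<forall>\<^sub>F n in sequentially. max 1 (128 / e) \<le> m n"
    using m_at_top unfolding filterlim_at_top by blast
  ultimately show ?thesis
    using eventually_ln_m eventually_ge_at_top[of 1]
  proof eventually_elim
    case (elim n)
    interpret cca_regular "C n" n r K \<epsilon>0 M by (rule regular[OF elim(4)])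
    have nl: "real n * (lam n)\<^sup>2 = ln (m n)" by (rule lam_sq[OF elim(4,3)])
    have l0: "0 < lam n"
    proof -
      have "lam n \<noteq> 0" using nl elim(3) by auto
      then show ?thesis using lam_nonneg[OF elim(3)] by simp
    qed
    have ls: "lam n \<le> 1 / (2 * ?c)" using rates(1)[OF elim(4,3)] elim(1) by linarith
    \<comment> \<open>The Chernoff parameter is the rate itself, admissible because
      \<open>lam n \<le> \<tau> n\<close> and \<tau> tends to 0.\<close>
    obtain A where A: "A \<in> events" "\<forall>\<omega>\<in>space (P n) - A. cov_close n (C n) (i n) (conc_const * lam n) \<omega>"
      and pA: "prob A \<le> 2 * (real (dim_x (C n) + dim_y (C n) + 6))\<^sup>2 *
          exp (- lam n * real n * (conc_const * lam n) + 64 * ?c\<^sup>2 * (lam n)\<^sup>2 * real n)"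
      using cov_close_prob[OF elim(4) index[OF elim(4)] l0 ls, of "conc_const * lam n"] by blast
    have m1: "1 \<le> m n" "128 / e \<le> m n" using elim(2) by auto
    have "- lam n * real n * (conc_const * lam n) + 64 * ?c\<^sup>2 * (lam n)\<^sup>2 * real n = - (3 * (real n * (lam n)\<^sup>2))"
      by (simp add: algebra_simps power2_eq_square)
    also have "exp \<dots> = 1 / m n ^ 3"
      using m1 exp_of_nat_mult[of 3 "ln (m n)"] by (simp add: nl exp_minus field_simps)
    finally have "prob A \<le> 2 * (real (dim_x (C n) + dim_y (C n) + 6))\<^sup>2 * (1 / m n ^ 3)" using pA by simp
    \<comment> \<open>Each of the two dimensions is at most \<open>m n\<close>, and 6 is at most
      \<open>6 * m n\<close>, whence the factor 8.\<close>
    also have "\<dots> \<le> 2 * (8 * m n)\<^sup>2 * (1 / m n ^ 3)"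
    proof (intro mult_right_mono mult_left_mono power_mono)
      have "real (dim_x (C n)) \<le> m n" "real (dim_y (C n)) \<le> m n" by (auto simp: m_def)
      then show "real (dim_x (C n) + dim_y (C n) + 6) \<le> 8 * m n" using m1 by simp
    qed (use m1 in auto)
    also have "\<dots> = 128 / m n" using m1 by (simp add: power2_eq_square power3_eq_cube)
    also have "\<dots> \<le> e" using m1 e by (simp add: field_simps)
    finally show ?case using A by blast
  qed
qed

lemma signs_event:
  assumes e: "e > 0"
  shows "\<forall>\<^sub>F n in sequentially. likely (P n) e (\<lambda>\<omega>. 0 \<le> hat_rho n (C n) (a n) (b n) \<omega>)"
proof -
  have "\<forall>\<^sub>F n in sequentially. measure (P n) {\<omega> \<in> space (P n). hat_rho n (C n) (a n) (b n) \<omega> < 0} < e"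
    by (rule order_tendstoD(2)[OF signs[unfolded signs_matched_def] e])
  then show ?thesis using eventually_ge_at_top[of 1]
  proof eventually_elim
    case (elim n)
    interpret cca_regular "C n" n r K \<epsilon>0 M by (rule regular[OF elim(2)])
    note [measurable] = hat_rho_measurable[OF a_measurable[OF elim(2)] b_measurable[OF elim(2)]]
    show ?case
      by (rule bexI[of _ "{\<omega> \<in> space (P n). hat_rho n (C n) (a n) (b n) \<omega> < 0}"]) (use elim in \<open>auto simp: not_less\<close>)
  qed
qed

text \<open>Six exceptional sets share the probability \<open>e\<close>: four for the distances of
  the estimators, one for the covariance deviations and one for the sign. On the remaining outcomes
  the locale \<open>cca_expansion\<close> can be interpreted.\<close>

lemma expansion_event:
  assumes e: "e > 0"
  shows "\<exists>c. \<forall>\<^sub>F n in sequentially. likely (P n) e (\<lambda>\<omega>. \<exists>w\<in>{- 1, 1 :: real}.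
      \<bar>w * x_db n (C n) (a n) (b n) (F n) \<omega> $ i n - x0 (C n) $ i n - lin_term n (C n) (i n) \<omega>\<bar> \<le> c * (\<tau> n)\<^sup>2)"
proof -
  have e6: "e / 6 > 0" using e by simp
  have O: "bigO_in_prob P (\<lambda>n \<omega>. pm_dist l2_norm (a n \<omega>) (alpha0 (C n)) + pm_dist l2_norm (b n \<omega>) (beta0 (C n))) (\<lambda>n. \<tau> n)"
      "bigO_in_prob P (\<lambda>n \<omega>. pm_dist l1_norm (a n \<omega>) (alpha0 (C n)) + pm_dist l1_norm (b n \<omega>) (beta0 (C n))) (\<lambda>n. sqrt (s n) * \<tau> n)"
      "bigO_in_prob P (\<lambda>n \<omega>. max_col_dist l1_norm (F n \<omega>) (Phi0 (C n))) (\<lambda>n. sqrt (s n) * \<tau> n)"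
      "bigO_in_prob P (\<lambda>n \<omega>. max_col_dist l2_norm (F n \<omega>) (Phi0 (C n))) (\<lambda>n. \<tau> n)"
    using preliminary inverse_Hessian
    unfolding preliminary_estimator_condition_def inverse_Hessian_condition_def l1_rate l2_rate by simp_all
  obtain B1 where B1: "B1 > 0" "\<forall>\<^sub>F n in sequentially. likely (P n) (e / 6) (\<lambda>\<omega>.
      \<bar>pm_dist l2_norm (a n \<omega>) (alpha0 (C n)) + pm_dist l2_norm (b n \<omega>) (beta0 (C n))\<bar> \<le> B1 * \<tau> n)"
    using bigO_in_prob_event[OF O(1) e6 distances_measurable(1)] by blast
  obtain B2 where B2: "B2 > 0" "\<forall>\<^sub>F n in sequentially. likely (P n) (e / 6) (\<lambda>\<omega>.
      \<bar>pm_dist l1_norm (a n \<omega>) (alpha0 (C n)) + pm_dist l1_norm (b n \<omega>) (beta0 (C n))\<bar> \<le> B2 * (sqrt (s n) * \<tau> n))"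
    using bigO_in_prob_event[OF O(2) e6 distances_measurable(2)] by blast
  obtain B3 where B3: "B3 > 0" "\<forall>\<^sub>F n in sequentially. likely (P n) (e / 6) (\<lambda>\<omega>.
      \<bar>max_col_dist l1_norm (F n \<omega>) (Phi0 (C n))\<bar> \<le> B3 * (sqrt (s n) * \<tau> n))"
    using bigO_in_prob_event[OF O(3) e6 distances_measurable(3)] by blast
  obtain B4 where B4: "B4 > 0" "\<forall>\<^sub>F n in sequentially. likely (P n) (e / 6) (\<lambda>\<omega>.
      \<bar>max_col_dist l2_norm (F n \<omega>) (Phi0 (C n))\<bar> \<le> B4 * \<tau> n)"
    using bigO_in_prob_event[OF O(4) e6 distances_measurable(4)] by blast
  \<comment> \<open>A sum of positive quantities bounds each of them. It depends on \<open>e\<close>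
    through \<open>B1\<close> to \<open>B4\<close>, but not on n.\<close>
  define B where "B = 1 + M + 1 / \<epsilon>0 + sqrt M + M / (2 * \<epsilon>0) + conc_const + B1 + B2 + B3 + B4"
  have parts: "0 < M" "0 < 1 / \<epsilon>0" "0 < sqrt M" "0 < M / (2 * \<epsilon>0)" "0 < conc_const"
    using M eps by (auto intro: add_nonneg_pos)
  have B: "1 \<le> B" "M \<le> B" "1 / \<epsilon>0 \<le> B" "sqrt M \<le> B" "M / (2 * \<epsilon>0) \<le> B" "conc_const \<le> B"
    "B1 \<le> B" "B2 \<le> B" "B3 \<le> B" "B4 \<le> B"
    using parts B1(1) B2(1) B3(1) B4(1) unfolding B_def by linarith+
  have "(\<lambda>n. 7 * B ^ 3 * \<tau> n) \<longlonglongrightarrow> 7 * B ^ 3 * 0" by (intro tendsto_intros \<tau>_tendsto)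
  then have "\<forall>\<^sub>F n in sequentially. 7 * B ^ 3 * \<tau> n < \<epsilon>0 / 2"
    by (rule order_tendstoD) (use eps in simp)
  moreover have "(\<lambda>n. B * (sqrt (s n) * \<tau> n) + B * \<tau> n) \<longlonglongrightarrow> B * 0 + B * 0"
    by (intro tendsto_intros \<tau>_tendsto \<eta>\<tau>_tendsto)
  then have "\<forall>\<^sub>F n in sequentially. B * (sqrt (s n) * \<tau> n) + B * \<tau> n < 2 / sqrt M"
    by (rule order_tendstoD) (use M in simp)
  moreover have "\<forall>\<^sub>F n in sequentially. \<tau> n < 1" by (rule order_tendstoD[OF \<tau>_tendsto]) simp
  moreover have "\<forall>\<^sub>F n in sequentially. \<delta> n < 1" by (rule order_tendstoD[OF \<delta>_tendsto]) simp
  ultimately have "\<forall>\<^sub>F n in sequentially. likely (P n) e (\<lambda>\<omega>. \<exists>w\<in>{- 1, 1 :: real}.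
      \<bar>w * x_db n (C n) (a n) (b n) (F n) \<omega> $ i n - x0 (C n) $ i n - lin_term n (C n) (i n) \<omega>\<bar>
        \<le> 28 * (4 * B\<^sup>2 * (58 * B ^ 5)\<^sup>2)\<^sup>2 * (\<tau> n)\<^sup>2)"
    using B1(2) B2(2) B3(2) B4(2) cov_close_event[OF e6] signs_event[OF e6] eventually_ln_m eventually_ge_at_top[of 1]
  proof eventually_elim
    case (elim n)
    interpret cca_regular "C n" n r K \<epsilon>0 M by (rule regular[OF elim(12)])
    note n = elim(12) and lnm = elim(11)
    obtain A1 where A1: "A1 \<in> events" "prob A1 \<le> e / 6" "\<And>\<omega>. \<omega> \<in> space (P n) - A1 \<Longrightarrow>
        \<bar>pm_dist l2_norm (a n \<omega>) (alpha0 (C n)) + pm_dist l2_norm (b n \<omega>) (beta0 (C n))\<bar> \<le> B1 * \<tau> n"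
      using elim(5) by blast
    obtain A2 where A2: "A2 \<in> events" "prob A2 \<le> e / 6" "\<And>\<omega>. \<omega> \<in> space (P n) - A2 \<Longrightarrow>
        \<bar>pm_dist l1_norm (a n \<omega>) (alpha0 (C n)) + pm_dist l1_norm (b n \<omega>) (beta0 (C n))\<bar> \<le> B2 * (sqrt (s n) * \<tau> n)"
      using elim(6) by blast
    obtain A3 where A3: "A3 \<in> events" "prob A3 \<le> e / 6" "\<And>\<omega>. \<omega> \<in> space (P n) - A3 \<Longrightarrow>
        \<bar>max_col_dist l1_norm (F n \<omega>) (Phi0 (C n))\<bar> \<le> B3 * (sqrt (s n) * \<tau> n)"
      using elim(7) by blast
    obtain A4 where A4: "A4 \<in> events" "prob A4 \<le> e / 6" "\<And>\<omega>. \<omega> \<in> space (P n) - A4 \<Longrightarrow>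
        \<bar>max_col_dist l2_norm (F n \<omega>) (Phi0 (C n))\<bar> \<le> B4 * \<tau> n"
      using elim(8) by blast
    obtain A5 where A5: "A5 \<in> events" "prob A5 \<le> e / 6" "\<And>\<omega>. \<omega> \<in> space (P n) - A5 \<Longrightarrow>
        cov_close n (C n) (i n) (conc_const * lam n) \<omega>"
      using elim(9) by blast
    obtain A6 where A6: "A6 \<in> events" "prob A6 \<le> e / 6" "\<And>\<omega>. \<omega> \<in> space (P n) - A6 \<Longrightarrow>
        0 \<le> hat_rho n (C n) (a n) (b n) \<omega>"
      using elim(10) by blast
    let ?A = "A1 \<union> A2 \<union> A3 \<union> A4 \<union> A5 \<union> A6"
    have A: "?A \<in> events" using A1 A2 A3 A4 A5 A6 by auto
    have "prob ?A \<le> prob A1 + prob A2 + prob A3 + prob A4 + prob A5 + prob A6"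
      using A1(1) A2(1) A3(1) A4(1) A5(1) A6(1)
      by (intro order_trans[OF measure_Un_le] add_mono order_refl) auto
    then have pA: "prob ?A \<le> e" using A1(2) A2(2) A3(2) A4(2) A5(2) A6(2) by linarith
    note rt = rates[OF n lnm]
    have l0: "0 \<le> lam n" by (rule lam_nonneg[OF lnm])
    have s0: "0 \<le> sqrt (s n)" using s_ge_1[OF n] by simp
    have "\<exists>w\<in>{- 1, 1 :: real}. \<bar>w * x_db n (C n) (a n) (b n) (F n) \<omega> $ i n - x0 (C n) $ i n - lin_term n (C n) (i n) \<omega>\<bar>
        \<le> 28 * (4 * B\<^sup>2 * (58 * B ^ 5)\<^sup>2)\<^sup>2 * (\<tau> n)\<^sup>2" if \<omega>: "\<omega> \<in> space (P n) - ?A" for \<omega>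
    proof -
      have sp: "\<omega> \<in> space (P n)" using \<omega> by simp
      have mB: "B1 * \<tau> n \<le> B * \<tau> n" "B4 * \<tau> n \<le> B * \<tau> n"
        "B2 * (sqrt (s n) * \<tau> n) \<le> B * (sqrt (s n) * \<tau> n)" "B3 * (sqrt (s n) * \<tau> n) \<le> B * (sqrt (s n) * \<tau> n)"
        "conc_const * lam n \<le> B * lam n"
        using B rt s0 l0 by (auto intro!: mult_right_mono)
      have cl: "cov_close n (C n) (i n) (B * lam n) \<omega>"
        using A5(3)[of \<omega>] \<omega> mB(5) unfolding cov_close_def by fastforce
      interpret cca_expansion "C n" n r K \<epsilon>0 M "i n" B "lam n" "\<tau> n" "sqrt (s n)" "a n" "b n" "F n" \<omega>
      proof unfold_locales
        show "i n < dim_x (C n)" by (rule index[OF n])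
        show "lam n * (sqrt (s n))\<^sup>2 \<le> 1" using rt(3) elim(4) s_ge_1[OF n] by simp
        show "a n \<omega> \<in> carrier_vec (dim_x (C n))" "b n \<omega> \<in> carrier_vec (dim_y (C n))"
          using a_measurable[OF n] b_measurable[OF n] sp by (auto simp: measurable_borel_vec_iff)
        show "F n \<omega> \<in> carrier_mat (dim_x (C n) + dim_y (C n)) (dim_x (C n) + dim_y (C n))" by (rule F_carrier[OF n sp])
        show "pm_dist l2_norm (a n \<omega>) (alpha0 (C n)) + pm_dist l2_norm (b n \<omega>) (beta0 (C n)) \<le> B * \<tau> n"
          using A1(3)[of \<omega>] \<omega> mB(1) by (simp add: abs_le_iff)
        show "pm_dist l1_norm (a n \<omega>) (alpha0 (C n)) + pm_dist l1_norm (b n \<omega>) (beta0 (C n)) \<le> B * (sqrt (s n) * \<tau> n)"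
          using A2(3)[of \<omega>] \<omega> mB(3) by (simp add: abs_le_iff)
        show "max_col_dist l2_norm (F n \<omega>) (Phi0 (C n)) \<le> B * \<tau> n"
          using A4(3)[of \<omega>] \<omega> mB(2) by (simp add: abs_le_iff)
        show "max_col_dist l1_norm (F n \<omega>) (Phi0 (C n)) \<le> B * (sqrt (s n) * \<tau> n)"
          using A3(3)[of \<omega>] \<omega> mB(4) by (simp add: abs_le_iff)
        show "0 \<le> hat_rho n (C n) (a n) (b n) \<omega>" using A6(3)[of \<omega>] \<omega> by simp
        show "7 * B ^ 3 * \<tau> n \<le> \<epsilon>0 / 2" using elim(1) by simp
        show "B * (sqrt (s n) * \<tau> n) + B * \<tau> n < 2 / sqrt M" using elim(2) .
        show "\<tau> n \<le> 1" using elim(3) by simp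
        show "sqrt (real (sparsity (C n))) \<le> sqrt (s n)" by (simp add: s_def)
      qed (use eps B rt s0 l0 cl in auto)
      show ?thesis by (rule debiased_expansion) blast
    qed
    then show ?case using A pA by blast
  qed
  then show ?thesis by (rule exI[of _ "28 * (4 * B\<^sup>2 * (58 * B ^ 5)\<^sup>2)\<^sup>2"])
qed

end

section \<open>Limit laws\<close>

lemma weakly_merging_cong:
  assumes "\<forall>\<^sub>F n in sequentially. \<mu> n = \<mu>' n" "\<forall>\<^sub>F n in sequentially. \<nu> n = \<nu>' n"
    and "weakly_merging \<mu> \<nu>"
  shows "weakly_merging \<mu>' \<nu>'"
  unfolding weakly_merging_def
proof (intro allI impI)
  fix f :: "real \<Rightarrow> real" assume "continuous_on UNIV f" "bounded (range f)"
  then have "(\<lambda>n. integral\<^sup>L (\<mu> n) f - integral\<^sup>L (\<nu> n) f) \<longlonglongrightarrow> 0"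
    using assms(3) unfolding weakly_merging_def by blast
  moreover have "\<forall>\<^sub>F n in sequentially. integral\<^sup>L (\<mu> n) f - integral\<^sup>L (\<nu> n) f = integral\<^sup>L (\<mu>' n) f - integral\<^sup>L (\<nu>' n) f"
    using assms(1,2) by eventually_elim simp
  ultimately show "(\<lambda>n. integral\<^sup>L (\<mu>' n) f - integral\<^sup>L (\<nu>' n) f) \<longlonglongrightarrow> 0"
    by (rule Lim_transform_eventually)
qed

lemma distr_cong_space:
  assumes "\<And>\<omega>. \<omega> \<in> space M \<Longrightarrow> f \<omega> = g \<omega>"
  shows "distr M N f = distr M N g"
  using assms by (intro distr_cong) auto

text \<open>The constant \<open>c\<close> of \<open>influence_subexponential\<close>, stated without
  reference to a model so that it is visibly the same at every sample size.\<close>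

definition influence_scale :: "real \<Rightarrow> real \<Rightarrow> real \<Rightarrow> real" where
  "influence_scale K \<epsilon>0 M = 4 * sg_scale K \<epsilon>0 M * (2 + M * (M / (2 * \<epsilon>0)) * sqrt M)"

context cca_regular begin

text \<open>The factor \<open>- 2 * h\<close> makes the normalised sum equal to
  \<open>h * sqrt n * lin_term\<close>. The multiplier \<open>h\<close> is deterministic: 1 for the
  chi-squared limit, twice the coordinate of \<open>x0\<close> for the Gaussian one.\<close>

definition centered_influence :: "nat \<Rightarrow> real \<Rightarrow> real vec \<times> real vec \<Rightarrow> real" where
  "centered_influence i h w = - 2 * h * (influence C i w - expectation (\<lambda>\<omega>. influence C i (pop \<omega>)))"

lemma centered_influence_measurable [measurable]: "centered_influence i h \<in> borel_measurable pair_space"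
  unfolding centered_influence_def[abs_def] by measurable

text \<open>Centering costs a factor \<open>exp 2\<close>, since the mean is at most twice the
  scale. \<open>H + 1\<close> in place of \<open>H\<close> keeps the scale positive when
  \<open>H = 0\<close>.\<close>

lemma centered_influence_subexponential:
  fixes h H :: real
  assumes i: "i < dim_x C" and h: "\<bar>h\<bar> \<le> H"
  defines "c \<equiv> 2 * (H + 1) * influence_scale K \<epsilon>0 M"
  shows "0 < c"
    and "integrable (prob_sp C) (\<lambda>\<omega>. exp (\<bar>centered_influence i h (pop \<omega>)\<bar> / c))"
    and "expectation (\<lambda>\<omega>. exp (\<bar>centered_influence i h (pop \<omega>)\<bar> / c)) \<le> 2 * exp 2"
proof -
  let ?c = "influence_scale K \<epsilon>0 M"
  let ?\<zeta> = "\<lambda>\<omega>. influence C i (pop \<omega>)"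
  note sub = influence_subexponential[OF i, folded influence_scale_def]
  have H: "0 \<le> H" using h by linarith
  show c: "0 < c" using sub(1) H by (simp add: c_def)
  have rv [measurable]: "?\<zeta> \<in> borel_measurable (prob_sp C)"
    by (rule measurable_compose[OF pop_measurable influence_measurable])
  have "\<bar>expectation ?\<zeta>\<bar> \<le> expectation (\<lambda>\<omega>. \<bar>?\<zeta> \<omega>\<bar>)" by (rule integral_abs_bound)
  also have "\<dots> \<le> ?c * 2" by (rule subexponential_moments(4)[OF prob_space_axioms sub(1) rv sub(2,3)])
  finally have m: "\<bar>expectation ?\<zeta>\<bar> \<le> ?c * 2" .
  have le: "exp (\<bar>centered_influence i h (pop \<omega>)\<bar> / c) \<le> exp 2 * exp (\<bar>?\<zeta> \<omega>\<bar> / ?c)" for \<omega>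
  proof -
    have "\<bar>centered_influence i h (pop \<omega>)\<bar> = 2 * \<bar>h\<bar> * \<bar>?\<zeta> \<omega> - expectation ?\<zeta>\<bar>"
      by (simp add: centered_influence_def abs_mult)
    also have "\<dots> \<le> 2 * (H + 1) * (\<bar>?\<zeta> \<omega>\<bar> + ?c * 2)"
      using h m by (intro mult_mono) auto
    finally have "\<bar>centered_influence i h (pop \<omega>)\<bar> / c \<le> 2 * (H + 1) * (\<bar>?\<zeta> \<omega>\<bar> + ?c * 2) / c"
      using c by (intro divide_right_mono) auto
    also have "\<dots> = 2 + \<bar>?\<zeta> \<omega>\<bar> / ?c"
    proof -
      have "2 * (H + 1) \<noteq> 0" using H by simp
      then have "2 * (H + 1) * (\<bar>?\<zeta> \<omega>\<bar> + ?c * 2) / c = (\<bar>?\<zeta> \<omega>\<bar> + ?c * 2) / ?c"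
        unfolding c_def by (rule mult_divide_mult_cancel_left)
      also have "\<dots> = 2 + \<bar>?\<zeta> \<omega>\<bar> / ?c" using sub(1) by (simp add: add_divide_distrib)
      finally show ?thesis .
    qed
    finally have "exp (\<bar>centered_influence i h (pop \<omega>)\<bar> / c) \<le> exp (2 + \<bar>?\<zeta> \<omega>\<bar> / ?c)" by simp
    then show ?thesis by (simp add: exp_add)
  qed
  have rv' [measurable]: "(\<lambda>\<omega>. centered_influence i h (pop \<omega>)) \<in> borel_measurable (prob_sp C)"
    by (rule measurable_compose[OF pop_measurable centered_influence_measurable])
  have bnd: "integrable (prob_sp C) (\<lambda>\<omega>. exp 2 * exp (\<bar>?\<zeta> \<omega>\<bar> / ?c))" using sub(2) by simp
  show int: "integrable (prob_sp C) (\<lambda>\<omega>. exp (\<bar>centered_influence i h (pop \<omega>)\<bar> / c))"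
    by (rule Bochner_Integration.integrable_bound[OF bnd]) (use le in auto)
  have "expectation (\<lambda>\<omega>. exp (\<bar>centered_influence i h (pop \<omega>)\<bar> / c)) \<le> expectation (\<lambda>\<omega>. exp 2 * exp (\<bar>?\<zeta> \<omega>\<bar> / ?c))"
    by (intro integral_mono int bnd le)
  also have "\<dots> \<le> 2 * exp 2" using sub(3) by simp
  finally show "expectation (\<lambda>\<omega>. exp (\<bar>centered_influence i h (pop \<omega>)\<bar> / c)) \<le> 2 * exp 2" .
qed

lemma centered_influence_mean: "expectation (\<lambda>\<omega>. centered_influence i h (pop \<omega>)) = 0"
  using influence_integrable[of i] by (simp add: centered_influence_def prob_space)

lemma centered_influence_variance:
  "expectation (\<lambda>\<omega>. (centered_influence i h (pop \<omega>))\<^sup>2) = 4 * h\<^sup>2 * sigma_sq C i"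
  by (simp add: centered_influence_def sigma_sq_eq power_mult_distrib)

lemma centered_influence_sum:
  assumes n: "n \<ge> 1" and \<omega>: "\<omega> \<in> space (prob_sp C)"
  shows "(\<Sum>l<n. centered_influence i h (obs l \<omega>)) / sqrt (real n) = h * (sqrt (real n) * lin_term n C i \<omega>)"
proof -
  let ?e = "expectation (\<lambda>\<omega>. influence C i (pop \<omega>))"
  have "(\<Sum>l<n. centered_influence i h (obs l \<omega>)) = - 2 * h * ((\<Sum>l<n. influence C i (obs l \<omega>)) - real n * ?e)"
    by (simp add: centered_influence_def sum_subtractf right_diff_distrib sum_distrib_left sum_negf)
  also have "\<dots> = real n * (h * lin_term n C i \<omega>)"
    using n unfolding lin_term_eq[OF \<omega>] by (simp add: field_simps)
  also have "\<dots> / sqrt (real n) = (real n / sqrt (real n)) * (h * lin_term n C i \<omega>)"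
    by simp
  also have "\<dots> = h * (sqrt (real n) * lin_term n C i \<omega>)"
    by (subst real_div_sqrt) simp_all
  finally show ?thesis .
qed

end

section \<open>Limit theorems for the linear term and for the squared coordinate\<close>

context cca_sequence begin

definition L :: "nat \<Rightarrow> 'w \<Rightarrow> real" where
  "L n \<omega> = sqrt (real n) * lin_term n (C n) (i n) \<omega>"

lemma L_measurable: "n \<ge> 1 \<Longrightarrow> L n \<in> borel_measurable (P n)"
  unfolding L_def[abs_def] using cca_regular.lin_term_measurable[OF regular] by simp

lemma sigma_sq_nonneg: "n \<ge> 1 \<Longrightarrow> 0 \<le> sigma_sq (C n) (i n)"
  by (simp add: sigma_sq_def)

text \<open>The multiplier sits inside the central limit theorem because
  \<open>weakly_merging_distr\<close> transports merging along one fixed continuous map, whereas the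
  coordinate of \<open>x0\<close> varies with n.\<close>

lemma scaled_L_clt:
  assumes h: "\<And>n. n \<ge> 1 \<Longrightarrow> \<bar>h n\<bar> \<le> H"
  shows "weakly_merging (\<lambda>n. distr (P n) borel (\<lambda>\<omega>. h n * L n \<omega>)) (\<lambda>n. centered_gaussian (4 * (h n)\<^sup>2 * sigma_sq (C n) (i n)))"
    and "\<exists>B. \<forall>n\<ge>1. 4 * (h n)\<^sup>2 * sigma_sq (C n) (i n) \<le> B"
proof -
  define c where "c = 2 * (H + 1) * influence_scale K \<epsilon>0 M"
  define B where "B = 27 * c ^ 3 * (2 * exp 2) + 4 * c\<^sup>2 * (2 * exp 2)"
  define \<xi> where "\<xi> n l \<omega> = cca_regular.centered_influence (C n) (i n) (h n) (obs_X (C n) l \<omega>, obs_Y (C n) l \<omega>)" for n l \<omega>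
  define \<mu> where "\<mu> n = distr (P n) borel (\<lambda>\<omega>. cca_regular.centered_influence (C n) (i n) (h n) (pop_X (C n) \<omega>, pop_Y (C n) \<omega>))" for n
  have moments: "integrable (\<mu> n) (\<lambda>x. x)" "integrable (\<mu> n) (\<lambda>x. x\<^sup>2)" "integrable (\<mu> n) (\<lambda>x. \<bar>x\<bar> ^ 3)"
      "integral\<^sup>L (\<mu> n) (\<lambda>x. x) = 0" "integral\<^sup>L (\<mu> n) (\<lambda>x. x\<^sup>2) = 4 * (h n)\<^sup>2 * sigma_sq (C n) (i n)"
      "integral\<^sup>L (\<mu> n) (\<lambda>x. \<bar>x\<bar> ^ 3) \<le> B" "4 * (h n)\<^sup>2 * sigma_sq (C n) (i n) \<le> B"
    if n: "n \<ge> 1" for n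
  proof -
    interpret cca_regular "C n" n r K \<epsilon>0 M by (rule regular[OF n])
    note sub = centered_influence_subexponential[OF index[OF n] h[OF n], folded c_def]
    have rv: "(\<lambda>\<omega>. centered_influence (i n) (h n) (pop \<omega>)) \<in> borel_measurable (P n)"
      by (rule measurable_compose[OF pop_measurable centered_influence_measurable])
    note mo = subexponential_moments[OF prob_space_axioms sub(1) rv sub(2,3)]
    show "integrable (\<mu> n) (\<lambda>x. x)" "integrable (\<mu> n) (\<lambda>x. x\<^sup>2)" "integrable (\<mu> n) (\<lambda>x. \<bar>x\<bar> ^ 3)"
      unfolding \<mu>_def using mo(1-3) rv by (simp_all add: integrable_distr_eq)
    show "integral\<^sup>L (\<mu> n) (\<lambda>x. x) = 0"
      unfolding \<mu>_def using rv centered_influence_mean by (simp add: integral_distr)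
    show v: "integral\<^sup>L (\<mu> n) (\<lambda>x. x\<^sup>2) = 4 * (h n)\<^sup>2 * sigma_sq (C n) (i n)"
      unfolding \<mu>_def using rv centered_influence_variance by (simp add: integral_distr)
    have c3: "0 \<le> 27 * c ^ 3 * (2 * exp 2)" "0 \<le> 4 * c\<^sup>2 * (2 * exp 2)" using sub(1) by auto
    show "integral\<^sup>L (\<mu> n) (\<lambda>x. \<bar>x\<bar> ^ 3) \<le> B"
    proof -
      have "integral\<^sup>L (\<mu> n) (\<lambda>x. \<bar>x\<bar> ^ 3) = expectation (\<lambda>\<omega>. \<bar>centered_influence (i n) (h n) (pop \<omega>)\<bar> ^ 3)"
        unfolding \<mu>_def using rv by (simp add: integral_distr)
      then show ?thesis using mo(6) c3 unfolding B_def by linarith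
    qed
    show "4 * (h n)\<^sup>2 * sigma_sq (C n) (i n) \<le> B"
      unfolding centered_influence_variance[symmetric] B_def using mo(5) c3 by linarith
  qed
  have "weakly_merging (\<lambda>n. distr (P n) borel (\<lambda>\<omega>. (\<Sum>l<n. \<xi> n l \<omega>) / sqrt (real n))) (\<lambda>n. centered_gaussian (4 * (h n)\<^sup>2 * sigma_sq (C n) (i n)))"
  proof (rule weakly_merging_normalized_sums[where \<mu> = \<mu>, OF prob_space_P])
    fix n :: nat assume n: "n \<ge> 1"
    interpret cca_regular "C n" n r K \<epsilon>0 M by (rule regular[OF n])
    show "indep_vars (\<lambda>_. borel) (\<xi> n) {..<n}"
      unfolding \<xi>_def[abs_def]
      by (rule indep_vars_compose2[OF indep_obs]) (rule centered_influence_measurable)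
    fix l assume l: "l < n"
    have "distr (P n) borel (\<xi> n l) = distr (distr (P n) pair_space (obs l)) borel (centered_influence (i n) (h n))"
      using obs_measurable[OF l] by (subst distr_distr) (auto simp: \<xi>_def[abs_def] o_def)
    also have "\<dots> = distr (distr (P n) pair_space pop) borel (centered_influence (i n) (h n))"
      by (simp only: ident_obs[OF l])
    also have "\<dots> = \<mu> n"
      using pop_measurable by (subst distr_distr) (auto simp: \<mu>_def o_def)
    finally show "distr (P n) borel (\<xi> n l) = \<mu> n" .
  qed (use moments in auto)
  then show "weakly_merging (\<lambda>n. distr (P n) borel (\<lambda>\<omega>. h n * L n \<omega>)) (\<lambda>n. centered_gaussian (4 * (h n)\<^sup>2 * sigma_sq (C n) (i n)))"
  proof (rule weakly_merging_cong[rotated 2])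
    show "\<forall>\<^sub>F n in sequentially. distr (P n) borel (\<lambda>\<omega>. (\<Sum>l<n. \<xi> n l \<omega>) / sqrt (real n)) = distr (P n) borel (\<lambda>\<omega>. h n * L n \<omega>)"
      using eventually_ge_at_top[of 1]
    proof eventually_elim
      case (elim n)
      show ?case
        by (rule distr_cong_space)
           (simp add: \<xi>_def L_def cca_regular.centered_influence_sum[OF regular[OF elim] elim])
    qed
  qed simp
  show "\<exists>B. \<forall>n\<ge>1. 4 * (h n)\<^sup>2 * sigma_sq (C n) (i n) \<le> B" using moments(7) by blast
qed

lemma L_clt: "weakly_merging (\<lambda>n. distr (P n) borel (L n)) (\<lambda>n. centered_gaussian (4 * sigma_sq (C n) (i n)))"
  using scaled_L_clt(1)[of "\<lambda>_. 1" 1] by simp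

lemma L_tight:
  assumes "e > 0"
  shows "\<exists>R>0. \<forall>\<^sub>F n in sequentially. likely (P n) e (\<lambda>\<omega>. \<bar>L n \<omega>\<bar> \<le> R)"
proof -
  obtain B where B: "\<forall>n\<ge>1. 4 * sigma_sq (C n) (i n) \<le> B"
    using scaled_L_clt(2)[of "\<lambda>_. 1" 1] by auto
  show ?thesis
    by (rule centered_gaussian_tight[OF prob_space_P L_measurable _ _ L_clt assms, of B])
       (use B sigma_sq_nonneg in auto)
qed

abbreviation "X_db n \<omega> \<equiv> x_db n (C n) (a n) (b n) (F n) \<omega> $ i n"
abbreviation "x\<^sub>0 n \<equiv> x0 (C n) $ i n"

lemma X_db_measurable: "n \<ge> 1 \<Longrightarrow> X_db n \<in> borel_measurable (P n)"
  using index[of n] by (intro cca_regular.x_db_measurable[OF regular] a_measurable b_measurable F_carrier F_col_measurable) auto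

lemma x0_le: "n \<ge> 1 \<Longrightarrow> \<bar>x\<^sub>0 n\<bar> \<le> sqrt M"
proof -
  assume n: "n \<ge> 1"
  interpret cca_regular "C n" n r K \<epsilon>0 M by (rule regular[OF n])
  show ?thesis
    using abs_index_le_l2_norm[of "i n" "x0 (C n)"] x0_l2 index[OF n] carrier_vecD[OF x0_carrier] by simp
qed

text \<open>Puts tightness of the linear term and the expansion on one exceptional set, with the
  remainder named; both limit laws start from this form.\<close>

lemma linearization_event:
  assumes e: "e > 0"
  shows "\<exists>c R. 0 < R \<and> (\<forall>\<^sub>F n in sequentially. likely (P n) e (\<lambda>\<omega>. \<bar>L n \<omega>\<bar> \<le> R \<and> (\<exists>w\<in>{- 1, 1 :: real}. \<exists>D. w * X_db n \<omega> = x\<^sub>0 n + lin_term n (C n) (i n) \<omega> + D \<and>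
        \<bar>D\<bar> \<le> c * (\<tau> n)\<^sup>2)))"
proof -
  have e2: "e / 2 > 0" using e by simp
  obtain c where c: "\<forall>\<^sub>F n in sequentially. likely (P n) (e / 2) (\<lambda>\<omega>. \<exists>w\<in>{- 1, 1 :: real}. \<bar>w * X_db n \<omega> - x\<^sub>0 n - lin_term n (C n) (i n) \<omega>\<bar> \<le> c * (\<tau> n)\<^sup>2)"
    using expansion_event[OF e2] by blast
  obtain R where R: "R > 0" "\<forall>\<^sub>F n in sequentially. likely (P n) (e / 2) (\<lambda>\<omega>. \<bar>L n \<omega>\<bar> \<le> R)"
    using L_tight[OF e2] by blast
  have "\<forall>\<^sub>F n in sequentially. likely (P n) e (\<lambda>\<omega>. \<bar>L n \<omega>\<bar> \<le> R \<and> (\<exists>w\<in>{- 1, 1 :: real}. \<exists>D. w * X_db n \<omega> = x\<^sub>0 n + lin_term n (C n) (i n) \<omega> + D \<and>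
        \<bar>D\<bar> \<le> c * (\<tau> n)\<^sup>2))"
    using c R(2)
  proof eventually_elim
    case (elim n)
    obtain A where A: "A \<in> sets (P n)" "measure (P n) A \<le> e / 2"
      "\<And>\<omega>. \<omega> \<in> space (P n) - A \<Longrightarrow> \<exists>w\<in>{- 1, 1 :: real}. \<bar>w * X_db n \<omega> - x\<^sub>0 n - lin_term n (C n) (i n) \<omega>\<bar> \<le> c * (\<tau> n)\<^sup>2"
      using elim(1) by blast
    obtain A' where A': "A' \<in> sets (P n)" "measure (P n) A' \<le> e / 2" "\<And>\<omega>. \<omega> \<in> space (P n) - A' \<Longrightarrow> \<bar>L n \<omega>\<bar> \<le> R"
      using elim(2) by blast
    have m: "measure (P n) (A \<union> A') \<le> e" using measure_Un_le[OF A(1) A'(1)] A(2) A'(2) by linarith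
    have "\<bar>L n \<omega>\<bar> \<le> R \<and> (\<exists>w\<in>{- 1, 1 :: real}. \<exists>D. w * X_db n \<omega> = x\<^sub>0 n + lin_term n (C n) (i n) \<omega> + D \<and> \<bar>D\<bar> \<le> c * (\<tau> n)\<^sup>2)"
      if \<omega>: "\<omega> \<in> space (P n) - (A \<union> A')" for \<omega>
    proof -
      obtain w where w: "w \<in> {- 1, 1 :: real}" "\<bar>w * X_db n \<omega> - x\<^sub>0 n - lin_term n (C n) (i n) \<omega>\<bar> \<le> c * (\<tau> n)\<^sup>2"
        using A(3)[of \<omega>] \<omega> by blast
      have "w * X_db n \<omega> = x\<^sub>0 n + lin_term n (C n) (i n) \<omega> + (w * X_db n \<omega> - x\<^sub>0 n - lin_term n (C n) (i n) \<omega>)" by simp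
      then show ?thesis using w A'(3)[of \<omega>] \<omega> by blast
    qed
    then show ?case using A(1) A'(1) m by blast
  qed
  then show ?thesis using R(1) by blast
qed

text \<open>The delta method at a moving point: the comparison variable is
  \<open>2 * x0 * L\<close>, of asymptotic variance \<open>4 * (2 * x0)\<^sup>2 * sigma_sq\<close>.
  The squared fluctuation is bounded by tightness and enters with \<open>1 / sqrt n\<close>; the
  remainder enters through \<delta>.\<close>

theorem squared_difference_clt:
  "weakly_merging (\<lambda>n. distr (P n) borel (\<lambda>\<omega>. sqrt (real n) * ((X_db n \<omega>)\<^sup>2 - (x\<^sub>0 n)\<^sup>2)))
     (\<lambda>n. centered_gaussian (16 * sigma_sq (C n) (i n) * (x\<^sub>0 n)\<^sup>2))"
proof (rule weakly_merging_slutsky[where T' = "\<lambda>n \<omega>. 2 * x\<^sub>0 n * L n \<omega>", OF prob_space_P])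
  have h: "\<bar>2 * x\<^sub>0 n\<bar> \<le> 2 * sqrt M" if "n \<ge> 1" for n using x0_le[OF that] by (simp add: abs_mult)
  have eq: "4 * (2 * x\<^sub>0 n)\<^sup>2 * sigma_sq (C n) (i n) = 16 * sigma_sq (C n) (i n) * (x\<^sub>0 n)\<^sup>2" for n
    by (simp add: power_mult_distrib)
  show "weakly_merging (\<lambda>n. distr (P n) borel (\<lambda>\<omega>. 2 * x\<^sub>0 n * L n \<omega>)) (\<lambda>n. centered_gaussian (16 * sigma_sq (C n) (i n) * (x\<^sub>0 n)\<^sup>2))"
    using scaled_L_clt(1)[of "\<lambda>n. 2 * x\<^sub>0 n", OF h] unfolding eq .
  show m1: "(\<lambda>\<omega>. sqrt (real n) * ((X_db n \<omega>)\<^sup>2 - (x\<^sub>0 n)\<^sup>2)) \<in> borel_measurable (P n)" if "n \<ge> 1" for n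
    using X_db_measurable[OF that] by simp
  show m2: "(\<lambda>\<omega>. 2 * x\<^sub>0 n * L n \<omega>) \<in> borel_measurable (P n)" if "n \<ge> 1" for n
    using L_measurable[OF that] by simp
  show "\<exists>R. \<forall>\<^sub>F n in sequentially. likely (P n) e (\<lambda>\<omega>. \<bar>2 * x\<^sub>0 n * L n \<omega>\<bar> \<le> R)"
    if e: "e > 0" for e
  proof -
    obtain R where R: "R > 0" "\<forall>\<^sub>F n in sequentially. likely (P n) e (\<lambda>\<omega>. \<bar>L n \<omega>\<bar> \<le> R)"
      using L_tight[OF e] by blast
    have "\<forall>\<^sub>F n in sequentially. likely (P n) e (\<lambda>\<omega>. \<bar>2 * x\<^sub>0 n * L n \<omega>\<bar> \<le> 2 * sqrt M * R)"
      using R(2) eventually_ge_at_top[of 1]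
    proof eventually_elim
      case (elim n)
      obtain A where A: "A \<in> sets (P n)" "measure (P n) A \<le> e" "\<And>\<omega>. \<omega> \<in> space (P n) - A \<Longrightarrow> \<bar>L n \<omega>\<bar> \<le> R"
        using elim(1) by blast
      have "\<bar>2 * x\<^sub>0 n * L n \<omega>\<bar> \<le> 2 * sqrt M * R" if "\<omega> \<in> space (P n) - A" for \<omega>
        unfolding abs_mult[of "2 * x\<^sub>0 n"] using h[OF elim(2)] A(3)[OF that] M by (intro mult_mono) auto
      then show ?case using A(1,2) by blast
    qed
    then show ?thesis by blast
  qed
  fix e d :: real assume e: "e > 0" and d: "d > 0"
  obtain c R where R: "0 < R" and ev: "\<forall>\<^sub>F n in sequentially. likely (P n) e (\<lambda>\<omega>. \<bar>L n \<omega>\<bar> \<le> R \<and> (\<exists>w\<in>{- 1, 1 :: real}. \<exists>D. w * X_db n \<omega> = x\<^sub>0 n + lin_term n (C n) (i n) \<omega> + D \<and>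
        \<bar>D\<bar> \<le> c * (\<tau> n)\<^sup>2))"
    using linearization_event[OF e] by blast
  have "(\<lambda>n. 1 / sqrt (real n)) \<longlonglongrightarrow> 0" by real_asymp
  then have "(\<lambda>n. 2 * sqrt M * (c * \<delta> n) + (R + c * \<delta> n)\<^sup>2 * (1 / sqrt (real n))) \<longlonglongrightarrow> 2 * sqrt M * (c * 0) + (R + c * 0)\<^sup>2 * 0"
    by (intro tendsto_intros \<delta>_tendsto)
  then have "\<forall>\<^sub>F n in sequentially. 2 * sqrt M * (c * \<delta> n) + (R + c * \<delta> n)\<^sup>2 * (1 / sqrt (real n)) < d"
    by (rule order_tendstoD) (use d in simp)
  then show "\<forall>\<^sub>F n in sequentially. likely (P n) e (\<lambda>\<omega>. \<bar>sqrt (real n) * ((X_db n \<omega>)\<^sup>2 - (x\<^sub>0 n)\<^sup>2) - 2 * x\<^sub>0 n * L n \<omega>\<bar> \<le> d)"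
    using ev eventually_ge_at_top[of 1]
  proof eventually_elim
    case (elim n)
    obtain A where A: "A \<in> sets (P n)" "measure (P n) A \<le> e"
      "\<And>\<omega>. \<omega> \<in> space (P n) - A \<Longrightarrow> \<bar>L n \<omega>\<bar> \<le> R \<and> (\<exists>w\<in>{- 1, 1 :: real}. \<exists>D. w * X_db n \<omega> = x\<^sub>0 n + lin_term n (C n) (i n) \<omega> + D \<and>
        \<bar>D\<bar> \<le> c * (\<tau> n)\<^sup>2)"
      using elim(2) by blast
    have "\<bar>sqrt (real n) * ((X_db n \<omega>)\<^sup>2 - (x\<^sub>0 n)\<^sup>2) - 2 * x\<^sub>0 n * L n \<omega>\<bar> \<le> d" if \<omega>: "\<omega> \<in> space (P n) - A" for \<omega>
    proof -
      obtain w D where w: "w \<in> {- 1, 1 :: real}" "w * X_db n \<omega> = x\<^sub>0 n + lin_term n (C n) (i n) \<omega> + D" "\<bar>D\<bar> \<le> c * (\<tau> n)\<^sup>2"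
        using A(3)[OF \<omega>] by blast
      have q: "0 < sqrt (real n)" using elim(3) by simp
      have "(X_db n \<omega>)\<^sup>2 = (w * X_db n \<omega>)\<^sup>2" using w(1) by auto
      then have sq: "(X_db n \<omega>)\<^sup>2 = (x\<^sub>0 n + lin_term n (C n) (i n) \<omega> + D)\<^sup>2" using w(2) by simp
      have Lb: "\<bar>sqrt (real n) * lin_term n (C n) (i n) \<omega>\<bar> \<le> R" using A(3)[OF \<omega>] by (simp add: L_def)
      have err: "sqrt (real n) * (c * (\<tau> n)\<^sup>2) = c * \<delta> n" by (simp add: \<delta>_def)
      show ?thesis
        using square_difference_expand(1)[OF q w(3) Lb x0_le[OF elim(3)], unfolded err] elim(1)
        unfolding sq L_def by simp
    qed
    then show ?case using A(1,2) by blast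
  qed
qed

text \<open>At a zero coordinate of \<open>alpha0\<close>, hence of its multiple \<open>x0\<close>,
  the linear part of the square vanishes and the quadratic part leads. The comparison variable is
  the square of \<open>L\<close>, whose law follows by continuous mapping.\<close>

theorem squared_coordinate_chi_squared:
  assumes zero: "\<forall>\<^sub>F n in sequentially. alpha0 (C n) $ i n = 0"
  shows "weakly_merging (\<lambda>n. distr (P n) borel (\<lambda>\<omega>. real n * (X_db n \<omega>)\<^sup>2)) (\<lambda>n. scaled_chi_squared_1 (4 * sigma_sq (C n) (i n)))"
proof (rule weakly_merging_slutsky[where T' = "\<lambda>n \<omega>. (L n \<omega>)\<^sup>2", OF prob_space_P])
  have sq: "continuous_on UNIV (\<lambda>x::real. x\<^sup>2)" by (intro continuous_intros)
  have "weakly_merging (\<lambda>n. distr (distr (P n) borel (L n)) borel (\<lambda>x. x\<^sup>2)) (\<lambda>n. distr (centered_gaussian (4 * sigma_sq (C n) (i n))) borel (\<lambda>x. x\<^sup>2))"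
    by (rule weakly_merging_distr[OF sq L_clt]) (auto simp: centered_gaussian_def)
  then show "weakly_merging (\<lambda>n. distr (P n) borel (\<lambda>\<omega>. (L n \<omega>)\<^sup>2)) (\<lambda>n. scaled_chi_squared_1 (4 * sigma_sq (C n) (i n)))"
  proof (rule weakly_merging_cong[rotated 2])
    show "\<forall>\<^sub>F n in sequentially. distr (distr (P n) borel (L n)) borel (\<lambda>x. x\<^sup>2) = distr (P n) borel (\<lambda>\<omega>. (L n \<omega>)\<^sup>2)"
      using eventually_ge_at_top[of 1]
    proof eventually_elim
      case (elim n)
      show ?case using L_measurable[OF elim] by (subst distr_distr) (auto simp: o_def)
    qed
    show "\<forall>\<^sub>F n in sequentially. distr (centered_gaussian (4 * sigma_sq (C n) (i n))) borel (\<lambda>x. x\<^sup>2) = scaled_chi_squared_1 (4 * sigma_sq (C n) (i n))"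
      using eventually_ge_at_top[of 1]
    proof eventually_elim
      case (elim n)
      then show ?case using sigma_sq_nonneg[OF elim]
        unfolding centered_gaussian_def scaled_chi_squared_1_def chi_squared_1_def
        by (subst (1 2) distr_distr) (auto simp: o_def power_mult_distrib)
    qed
  qed
  show "(\<lambda>\<omega>. real n * (X_db n \<omega>)\<^sup>2) \<in> borel_measurable (P n)" if "n \<ge> 1" for n
    using X_db_measurable[OF that] by simp
  show "(\<lambda>\<omega>. (L n \<omega>)\<^sup>2) \<in> borel_measurable (P n)" if "n \<ge> 1" for n
    using L_measurable[OF that] by simp
  show "\<exists>R. \<forall>\<^sub>F n in sequentially. likely (P n) e (\<lambda>\<omega>. \<bar>(L n \<omega>)\<^sup>2\<bar> \<le> R)"
    if e: "e > 0" for e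
  proof -
    obtain R where R: "R > 0" "\<forall>\<^sub>F n in sequentially. likely (P n) e (\<lambda>\<omega>. \<bar>L n \<omega>\<bar> \<le> R)"
      using L_tight[OF e] by blast
    have "\<forall>\<^sub>F n in sequentially. likely (P n) e (\<lambda>\<omega>. \<bar>(L n \<omega>)\<^sup>2\<bar> \<le> R\<^sup>2)"
      using R(2)
    proof eventually_elim
      case (elim n)
      have "\<bar>z\<^sup>2\<bar> \<le> R\<^sup>2" if "\<bar>z\<bar> \<le> R" for z :: real
        using power_mono[OF that abs_ge_zero, of 2] by simp
      then show ?case using elim by blast
    qed
    then show ?thesis by blast
  qed
  fix e d :: real assume e: "e > 0" and d: "d > 0"
  obtain c R where R: "0 < R" and ev: "\<forall>\<^sub>F n in sequentially. likely (P n) e (\<lambda>\<omega>. \<bar>L n \<omega>\<bar> \<le> R \<and> (\<exists>w\<in>{- 1, 1 :: real}. \<exists>D. w * X_db n \<omega> = x\<^sub>0 n + lin_term n (C n) (i n) \<omega> + D \<and>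
        \<bar>D\<bar> \<le> c * (\<tau> n)\<^sup>2))"
    using linearization_event[OF e] by blast
  have "(\<lambda>n. 2 * R * (c * \<delta> n) + (c * \<delta> n)\<^sup>2) \<longlonglongrightarrow> 2 * R * (c * 0) + (c * 0)\<^sup>2"
    by (intro tendsto_intros \<delta>_tendsto)
  then have "\<forall>\<^sub>F n in sequentially. 2 * R * (c * \<delta> n) + (c * \<delta> n)\<^sup>2 < d"
    by (rule order_tendstoD) (use d in simp)
  then show "\<forall>\<^sub>F n in sequentially. likely (P n) e (\<lambda>\<omega>. \<bar>real n * (X_db n \<omega>)\<^sup>2 - (L n \<omega>)\<^sup>2\<bar> \<le> d)"
    using ev zero eventually_ge_at_top[of 1]
  proof eventually_elim
    case (elim n)
    interpret cca_regular "C n" n r K \<epsilon>0 M by (rule regular[OF elim(4)])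
    have x: "x\<^sub>0 n = 0" using elim(3) index[OF elim(4)] by (simp add: x0_def carrier_vecD[OF alpha0_carrier])
    obtain A where A: "A \<in> sets (P n)" "measure (P n) A \<le> e"
      "\<And>\<omega>. \<omega> \<in> space (P n) - A \<Longrightarrow> \<bar>L n \<omega>\<bar> \<le> R \<and> (\<exists>w\<in>{- 1, 1 :: real}. \<exists>D. w * X_db n \<omega> = x\<^sub>0 n + lin_term n (C n) (i n) \<omega> + D \<and>
        \<bar>D\<bar> \<le> c * (\<tau> n)\<^sup>2)"
      using elim(2) by blast
    have "\<bar>real n * (X_db n \<omega>)\<^sup>2 - (L n \<omega>)\<^sup>2\<bar> \<le> d" if \<omega>: "\<omega> \<in> space (P n) - A" for \<omega>
    proof -
      obtain w D where w: "w \<in> {- 1, 1 :: real}" "w * X_db n \<omega> = x\<^sub>0 n + lin_term n (C n) (i n) \<omega> + D" "\<bar>D\<bar> \<le> c * (\<tau> n)\<^sup>2"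
        using A(3)[OF \<omega>] by blast
      have q: "0 < sqrt (real n)" using elim(4) by simp
      have "(X_db n \<omega>)\<^sup>2 = (w * X_db n \<omega>)\<^sup>2" using w(1) by auto
      then have sq: "(X_db n \<omega>)\<^sup>2 = (lin_term n (C n) (i n) \<omega> + D)\<^sup>2" using w(2) x by simp
      have Lb: "\<bar>sqrt (real n) * lin_term n (C n) (i n) \<omega>\<bar> \<le> R" using A(3)[OF \<omega>] by (simp add: L_def)
      have err: "sqrt (real n) * (c * (\<tau> n)\<^sup>2) = c * \<delta> n" by (simp add: \<delta>_def)
      show ?thesis
        using square_difference_expand(2)[OF q w(3) Lb x0_le[OF elim(4)], unfolded err] elim(1)
        unfolding sq L_def by simp
    qed
    then show ?case using A(1,2) by blast
  qed
qed

end

theorem corollary1: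
  fixes C :: "nat \<Rightarrow> 'w cca"
    and r :: nat and K \<epsilon>0 M \<kappa> :: real
    and a b :: "nat \<Rightarrow> 'w \<Rightarrow> real vec" and F :: "nat \<Rightarrow> 'w \<Rightarrow> real mat"
    and i :: "nat \<Rightarrow> nat"
  assumes r: "r \<ge> 1"
    and model: "\<And>n. n \<ge> 1 \<Longrightarrow> cca_model (C n) n r K"
    and eigengap: "0 < \<epsilon>0" "\<epsilon>0 < 1" "\<And>n. n \<ge> 1 \<Longrightarrow> rho0 (C n) - Lambda2 r (C n) > \<epsilon>0"
    and bounded_eigenvalues: "M > 0"
      "\<And>n e. n \<ge> 1 \<Longrightarrow> eigenvalue (Sigma_x (C n)) e \<Longrightarrow> e \<in> {1 / M..M}"
      "\<And>n e. n \<ge> 1 \<Longrightarrow> eigenvalue (Sigma_y (C n)) e \<Longrightarrow> e \<in> {1 / M..M}"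
    and kappa: "\<kappa> \<in> {1/2..1}"
    and sparse:
      "(\<lambda>n. real (nonzero_rows (mat_U (C n)))) \<in> o(\<lambda>n. real (dim_x (C n)))"
      "(\<lambda>n. real (nonzero_rows (mat_V (C n)))) \<in> o(\<lambda>n. real (dim_y (C n)))"
      "(\<lambda>n. real (sparsity (C n)) powr (2 * \<kappa>) * (lambda_rate n (C n))\<^sup>2)
         \<in> o(\<lambda>n. real n powr (- 1/2))"
    and estimators: "random_vectors C dim_x a" "random_vectors C dim_y b"
      "random_square_matrices C (\<lambda>c. dim_x c + dim_y c) F"
    and preliminary: "preliminary_estimator_condition C \<kappa> a b"
    and signs: "signs_matched C a b"
    and inverse_Hessian: "inverse_Hessian_condition C \<kappa> F"
    and index: "\<forall>\<^sub>F n in sequentially. i n < dim_x (C n)"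
  shows "((\<forall>\<^sub>F n in sequentially. alpha0 (C n) $ i n \<noteq> 0) \<longrightarrow>
      weakly_merging
        (\<lambda>n. distr (prob_sp (C n)) borel (\<lambda>\<omega>. sqrt (real n) *
           ((x_db n (C n) (a n) (b n) (F n) \<omega> $ i n)\<^sup>2 - (x0 (C n) $ i n)\<^sup>2)))
        (\<lambda>n. centered_gaussian (16 * sigma_sq (C n) (i n) * (x0 (C n) $ i n)\<^sup>2)))
    \<and> ((\<forall>\<^sub>F n in sequentially. alpha0 (C n) $ i n = 0) \<longrightarrow>
      weakly_merging
        (\<lambda>n. distr (prob_sp (C n)) borel (\<lambda>\<omega>. real n *
           (x_db n (C n) (a n) (b n) (F n) \<omega> $ i n)\<^sup>2))
        (\<lambda>n. scaled_chi_squared_1 (4 * sigma_sq (C n) (i n))))"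
proof -
  \<comment> \<open>The index is in range only from some n on. It is changed at finitely many n,
    which does not affect the limits, and 0 is a valid replacement because \<open>dim_x\<close> is
    positive.\<close>
  define i' where "i' n = (if i n < dim_x (C n) then i n else 0)" for n
  have i': "\<forall>\<^sub>F n in sequentially. i' n = i n"
    using index by eventually_elim (simp add: i'_def)
  have regular: "cca_regular (C n) n r K \<epsilon>0 M" if "n \<ge> 1" for n
    using model[OF that] r eigengap(1) eigengap(3)[OF that] bounded_eigenvalues(1)
      bounded_eigenvalues(2,3)[OF that]
    unfolding cca_regular_def cca_regular_axioms_def by blast
  \<comment> \<open>Without rows \<open>mat_U\<close> would have no nonzero row, against the
    normalisation of \<open>alpha0\<close>.\<close>
  have pos: "0 < dim_x (C n)" if "n \<ge> 1" for n
  proof (rule ccontr)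
    assume "\<not> 0 < dim_x (C n)"
    interpret cca_regular "C n" n r K \<epsilon>0 M by (rule regular[OF that])
    have "mat_U (C n) \<in> carrier_mat 0 r" using carrier_U \<open>\<not> 0 < dim_x (C n)\<close> by simp
    then have "nonzero_rows (mat_U (C n)) = 0" by (auto simp: nonzero_rows_def)
    then show False using nonzero_rows_pos(1) by simp
  qed
  interpret cca_sequence C r K \<epsilon>0 M \<kappa> a b F i'
  proof (rule cca_sequence.intro)
    show "1 / 2 \<le> \<kappa>" using kappa by simp
    show "i' n < dim_x (C n)" if "n \<ge> 1" for n using pos[OF that] by (simp add: i'_def)
  qed (fact regular eigengap bounded_eigenvalues sparse estimators preliminary signs inverse_Hessian)+
  show ?thesis
  proof (intro conjI impI)
    show "weakly_merging
        (\<lambda>n. distr (prob_sp (C n)) borel (\<lambda>\<omega>. sqrt (real n) *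
           ((x_db n (C n) (a n) (b n) (F n) \<omega> $ i n)\<^sup>2 - (x0 (C n) $ i n)\<^sup>2)))
        (\<lambda>n. centered_gaussian (16 * sigma_sq (C n) (i n) * (x0 (C n) $ i n)\<^sup>2))"
      by (rule weakly_merging_cong[OF _ _ squared_difference_clt]) (use i' in \<open>eventually_elim, simp\<close>)+
    assume "\<forall>\<^sub>F n in sequentially. alpha0 (C n) $ i n = 0"
    with i' have "\<forall>\<^sub>F n in sequentially. alpha0 (C n) $ i' n = 0" by eventually_elim simp
    from squared_coordinate_chi_squared[OF this] show "weakly_merging
        (\<lambda>n. distr (prob_sp (C n)) borel (\<lambda>\<omega>. real n *
           (x_db n (C n) (a n) (b n) (F n) \<omega> $ i n)\<^sup>2))
        (\<lambda>n. scaled_chi_squared_1 (4 * sigma_sq (C n) (i n)))"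
      by (rule weakly_merging_cong[rotated 2]) (use i' in \<open>eventually_elim, simp\<close>)+
  qed
qed

end
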